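(* Let $(\Lambda,d)$ be a row-finite source-free $k$-graph, let $v\in\Lambda^0$ be such that both $\Lambda^1v$ and $v\Lambda^1$ are complete edges and $v\neq w$, where $w:=r(\Lambda^1v)$, and let $(\Lambda_R,d_R)$ be the graph of $\Lambda$ reduced at $v$. Then $C^*(\Lambda)$ is Morita equivalent to $C^*(\Lambda_R)$.
   Context: Fix $k\ge1$; $0\in\mathbb{N}$; $e_1,\dots,e_k$ are the standard basis vectors of $\mathbb{N}^k$, and $\mathbb{N}^k$ is regarded as a category with one object, composition being addition. For $n=\sum n_ie_i$, $|n|=\sum n_i$. A $k$-graph is a countable category $\Lambda$ with a functor $d:\Lambda\to\mathbb{N}^k$ satisfying the factorization rule: for every morphism $\lambda$ and $n,m\in\mathbb{N}^k$ with $d(\lambda)=n+m$ there exist unique $\mu,\nu\in\Lambda$ with $d(\mu)=m$, $d(\nu)=n$, $\lambda=\mu\nu$. $\Lambda^n=d^{-1}(n)$; $\Lambda^0$ is the set of vertices (identified with objects); $\Lambda^1=\{\lambda:|d(\lambda)|=1\}$ is the set of edges, an edge in $\Lambda^{e_i}$ having color $e_i$. $r(\lambda),s(\lambda)\in\Lambda^0$ are the unique vertices with $r(\lambda)\lambda s(\lambda)=\lambda$. $v\Lambda^1=\{e\in\Lambda^1:r(e)=v\}$, $\Lambda^1v=\{e\in\Lambda^1:s(e)=v\}$. $\Lambda$ is row-finite if $|\{\lambda\in\Lambda^{e_i}:r(\lambda)=v\}|<\infty$ for all $v\in\Lambda^0$, $1\le i\le k$. A vertex $v$ is a source if $r^{-1}(v)\cap\Lambda^{e_i}=\emptyset$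 for some $i$; $\Lambda$ is source-free if it has no sources. The 1-skeleton of $\Lambda$ is the directed graph $G=(\Lambda^0,\Lambda^1,r,s)$ with edges colored by $d$. For any $k$-colored directed graph, the path category (denoted by $*$, e.g. $G^*$) consists of all finite paths $f_n\cdots f_1$ with $s(f_i)=r(f_{i-1})$, including vertices as paths of length $0$, with range, source and (additively extended) degree. On $G^*$, $\lambda\sim\mu$ means that $\lambda$ and $\mu$ compose to the same morphism of $\Lambda$; thus $\Lambda=G^*/\sim$. A set of edges $E\subseteq\Lambda^1$ is a complete edge if: (1) $E$ contains precisely one edge of each color; (2) $s(e)=s(f)$ and $r(e)=r(f)$ for all $e,f\in E$; (3) if $e\in E$ and $a,b,f\in\Lambda^1$ satisfy $ea\sim fb$ or $ae\sim bf$, then $f\in E$. For such $E$, $r(E)$ denotes the common range of its edges. Reduction at $v$: let $v\in\Lambda^0$ be such that $\Lambda^1v$ and $v\Lambda^1$ are complete edges and $v\ne w:=r(\Lambda^1v)$. Define the $k$-colored graph $G_R=(\Lambda_R^0,\Lambda_R^1,r_R,s_R)$ by $\Lambda_R^0=\Lambda^0\setminus\{v\}$, $\Lambda_R^1=\Lambda^1\setminus\Lambda^1v$, $s_R(e)=s(e)$, and $r_R(e)=r(e)$ if $r(e)\ne v$, $r_R(e)=w$ if $r(e)=v$. Let $\iota:\Lambda_R^0\cup\Lambda_R^1\to\Lambda^0\cup\Lambda^1$ be the inclusion. Fix an edge $f\in\Lambda^1v$ and define $par:G_R^*\to G^*$ by $par(x)=\iota(x)$ for $x\in\Lambda_R^0$;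 for $e\in\Lambda_R^1$, $par(e)=\iota(e)$ if $r(\iota(e))\ne v$ and $par(e)=f\,\iota(e)$ if $r(\iota(e))=v$; and $par(\lambda_n\cdots\lambda_1)=par(\lambda_n)\cdots par(\lambda_1)$. The degree map $d_R$ on $G_R^*$ is determined by $d_R(e)=d(\iota(e))$ for edges. Define $\mu\sim_R\lambda$ on $G_R^*$ if $par(\mu)\sim par(\lambda)$. Then $\Lambda_R=G_R^*/\sim_R$, with composition induced by concatenation and degree map induced by $d_R$, is the graph of $\Lambda$ reduced at $v$ (it is a row-finite source-free $k$-graph). For a row-finite source-free $k$-graph $\Lambda$, a Cuntz–Krieger $\Lambda$-family is a collection of projections $\{P_v:v\in\Lambda^0\}$ and partial isometries $\{T_f:f\in\Lambda^1\}$ such that: (CK1) the $P_v$ are mutually orthogonal; (CK2) if $a,b,f,g\in\Lambda^1$ satisfy $af\sim gb$, then $T_aT_f=T_gT_b$; (CK3) $T_f^*T_f=P_{s(f)}$ for all $f\in\Lambda^1$; (CK4) $P_v=\sum_{f:\,r(f)=v,\ d(f)=e_i}T_fT_f^*$ for all $v\in\Lambda^0$, $1\le i\le k$. $C^*(\Lambda)$ is the universal $C^*$-algebra generated by a Cuntz–Krieger $\Lambda$-family. *)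

theory Defs
  imports
    "HOL-Analysis.Analysis"
    "HOL-Algebra.Module"
begin

section \<open>C*-algebras\<close>

definition complex_ring :: "complex ring" where
  "complex_ring = \<lparr>carrier = UNIV, mult = (*), one = 1, zero = 0, add = (+)\<rparr>"

text \<open>C*-algebras here need not have a unit: the record field \<open>one\<close> inherited from \<open>ring\<close> (and, for
  the bimodules below, also the field \<open>mult\<close>) is unused, as it is for the additive groups of
  modules in HOL-Algebra.\<close>

record 'a cstar = "(complex, 'a) module" +
  star :: "'a \<Rightarrow> 'a"
  nrm :: "'a \<Rightarrow> real"

locale star_algebra = Module.module complex_ring A for A :: "('a, 'm) cstar_scheme" (structure) +
  assumes mult_closed: "\<lbrakk>a \<in> carrier A; b \<in> carrier A\<rbrakk> \<Longrightarrow> a \<otimes> b \<in> carrier A"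
    and mult_assoc: "\<lbrakk>a \<in> carrier A; b \<in> carrier A; c \<in> carrier A\<rbrakk> \<Longrightarrow> (a \<otimes> b) \<otimes> c = a \<otimes> (b \<otimes> c)"
    and add_mult: "\<lbrakk>a \<in> carrier A; b \<in> carrier A; c \<in> carrier A\<rbrakk> \<Longrightarrow> (a \<oplus> b) \<otimes> c = a \<otimes> c \<oplus> b \<otimes> c"
    and mult_add: "\<lbrakk>a \<in> carrier A; b \<in> carrier A; c \<in> carrier A\<rbrakk> \<Longrightarrow> a \<otimes> (b \<oplus> c) = a \<otimes> b \<oplus> a \<otimes> c"
    and smult_mult: "\<lbrakk>a \<in> carrier A; b \<in> carrier A\<rbrakk> \<Longrightarrow> (z \<odot> a) \<otimes> b = z \<odot> (a \<otimes> b)"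
    and mult_smult: "\<lbrakk>a \<in> carrier A; b \<in> carrier A\<rbrakk> \<Longrightarrow> a \<otimes> (z \<odot> b) = z \<odot> (a \<otimes> b)"
    and star_closed: "a \<in> carrier A \<Longrightarrow> star A a \<in> carrier A"
    and star_star: "a \<in> carrier A \<Longrightarrow> star A (star A a) = a"
    and star_add: "\<lbrakk>a \<in> carrier A; b \<in> carrier A\<rbrakk> \<Longrightarrow> star A (a \<oplus> b) = star A a \<oplus> star A b"
    and star_smult: "a \<in> carrier A \<Longrightarrow> star A (z \<odot> a) = cnj z \<odot> star A a"
    and star_mult: "\<lbrakk>a \<in> carrier A; b \<in> carrier A\<rbrakk> \<Longrightarrow> star A (a \<otimes> b) = star A b \<otimes> star A a"

definition is_cstar_seminorm :: "('a, 'm) cstar_scheme \<Rightarrow> ('a \<Rightarrow> real) \<Rightarrow> bool" where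
  "is_cstar_seminorm A p \<longleftrightarrow>
     (\<forall>a\<in>carrier A. \<forall>b\<in>carrier A. p (a \<oplus>\<^bsub>A\<^esub> b) \<le> p a + p b) \<and>
     (\<forall>z. \<forall>a\<in>carrier A. p (z \<odot>\<^bsub>A\<^esub> a) = cmod z * p a) \<and>
     (\<forall>a\<in>carrier A. \<forall>b\<in>carrier A. p (a \<otimes>\<^bsub>A\<^esub> b) \<le> p a * p b) \<and>
     (\<forall>a\<in>carrier A. p (star A a \<otimes>\<^bsub>A\<^esub> a) = (p a)\<^sup>2)"

definition cauchy_seqs :: "('a, 'm) ring_scheme \<Rightarrow> ('a \<Rightarrow> real) \<Rightarrow> (nat \<Rightarrow> 'a) set" where
  "cauchy_seqs V p = {x. (\<forall>n. x n \<in> carrier V) \<and>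
     (\<forall>e>0. \<exists>M. \<forall>m\<ge>M. \<forall>n\<ge>M. p (x m \<ominus>\<^bsub>V\<^esub> x n) < e)}"

definition is_complete :: "('a, 'm) ring_scheme \<Rightarrow> ('a \<Rightarrow> real) \<Rightarrow> bool" where
  "is_complete V p \<longleftrightarrow>
     (\<forall>x\<in>cauchy_seqs V p. \<exists>l\<in>carrier V. (\<lambda>n. p (x n \<ominus>\<^bsub>V\<^esub> l)) \<longlonglongrightarrow> 0)"

locale cstar_algebra = star_algebra A for A :: "('a, 'm) cstar_scheme" (structure) +
  assumes cstar_norm: "is_cstar_seminorm A (nrm A)"
    and norm_eq_zero: "\<lbrakk>a \<in> carrier A; nrm A a = 0\<rbrakk> \<Longrightarrow> a = \<zero>"
    and norm_complete: "is_complete A (nrm A)"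

definition cstar_positive :: "('a, 'm) cstar_scheme \<Rightarrow> 'a \<Rightarrow> bool" where
  "cstar_positive A a \<longleftrightarrow> (\<exists>b\<in>carrier A. a = star A b \<otimes>\<^bsub>A\<^esub> b)"

inductive_set lin_span :: "('a, 'm) cstar_scheme \<Rightarrow> 'a set \<Rightarrow> 'a set"
  for A :: "('a, 'm) cstar_scheme" and S :: "'a set" where
  zero: "\<zero>\<^bsub>A\<^esub> \<in> lin_span A S"
| base: "a \<in> S \<Longrightarrow> a \<in> lin_span A S"
| add: "\<lbrakk>a \<in> lin_span A S; b \<in> lin_span A S\<rbrakk> \<Longrightarrow> a \<oplus>\<^bsub>A\<^esub> b \<in> lin_span A S"
| smult: "a \<in> lin_span A S \<Longrightarrow> z \<odot>\<^bsub>A\<^esub> a \<in> lin_span A S"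

definition dense_span :: "('a, 'm) cstar_scheme \<Rightarrow> 'a set \<Rightarrow> bool" where
  "dense_span A S \<longleftrightarrow> (\<forall>a\<in>carrier A. \<forall>e>0. \<exists>b\<in>lin_span A S. nrm A (a \<ominus>\<^bsub>A\<^esub> b) < e)"


section \<open>Morita equivalence\<close>

record ('a, 'b, 'x) bimodule = "(complex, 'x) module" +
  lact :: "'a \<Rightarrow> 'x \<Rightarrow> 'x"
  ract :: "'x \<Rightarrow> 'b \<Rightarrow> 'x"
  lip :: "'x \<Rightarrow> 'x \<Rightarrow> 'a"
  rip :: "'x \<Rightarrow> 'x \<Rightarrow> 'b"

text \<open>Right inner products are linear in the second, left inner products in the first variable.\<close>

locale full_right_hilbert_module =
  B: cstar_algebra B + X: Module.module complex_ring X
  for B :: "('b, 'm) cstar_scheme" and X :: "('a, 'b, 'x, 'n) bimodule_scheme" +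
  assumes ract_closed: "\<lbrakk>x \<in> carrier X; b \<in> carrier B\<rbrakk> \<Longrightarrow> ract X x b \<in> carrier X"
    and ract_add_left: "\<lbrakk>x \<in> carrier X; y \<in> carrier X; b \<in> carrier B\<rbrakk> \<Longrightarrow>
      ract X (x \<oplus>\<^bsub>X\<^esub> y) b = ract X x b \<oplus>\<^bsub>X\<^esub> ract X y b"
    and ract_add_right: "\<lbrakk>x \<in> carrier X; b \<in> carrier B; c \<in> carrier B\<rbrakk> \<Longrightarrow>
      ract X x (b \<oplus>\<^bsub>B\<^esub> c) = ract X x b \<oplus>\<^bsub>X\<^esub> ract X x c"
    and ract_mult: "\<lbrakk>x \<in> carrier X; b \<in> carrier B; c \<in> carrier B\<rbrakk> \<Longrightarrow>
      ract X x (b \<otimes>\<^bsub>B\<^esub> c) = ract X (ract X x b) c"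
    and ract_smult_left: "\<lbrakk>x \<in> carrier X; b \<in> carrier B\<rbrakk> \<Longrightarrow>
      ract X (z \<odot>\<^bsub>X\<^esub> x) b = z \<odot>\<^bsub>X\<^esub> ract X x b"
    and ract_smult_right: "\<lbrakk>x \<in> carrier X; b \<in> carrier B\<rbrakk> \<Longrightarrow>
      ract X x (z \<odot>\<^bsub>B\<^esub> b) = z \<odot>\<^bsub>X\<^esub> ract X x b"
    and rip_closed: "\<lbrakk>x \<in> carrier X; y \<in> carrier X\<rbrakk> \<Longrightarrow> rip X x y \<in> carrier B"
    and rip_add: "\<lbrakk>x \<in> carrier X; y \<in> carrier X; y' \<in> carrier X\<rbrakk> \<Longrightarrow>
      rip X x (y \<oplus>\<^bsub>X\<^esub> y') = rip X x y \<oplus>\<^bsub>B\<^esub> rip X x y'"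
    and rip_smult: "\<lbrakk>x \<in> carrier X; y \<in> carrier X\<rbrakk> \<Longrightarrow> rip X x (z \<odot>\<^bsub>X\<^esub> y) = z \<odot>\<^bsub>B\<^esub> rip X x y"
    and rip_ract: "\<lbrakk>x \<in> carrier X; y \<in> carrier X; b \<in> carrier B\<rbrakk> \<Longrightarrow>
      rip X x (ract X y b) = rip X x y \<otimes>\<^bsub>B\<^esub> b"
    and rip_star: "\<lbrakk>x \<in> carrier X; y \<in> carrier X\<rbrakk> \<Longrightarrow> star B (rip X x y) = rip X y x"
    and rip_positive: "x \<in> carrier X \<Longrightarrow> cstar_positive B (rip X x x)"
    and rip_definite: "\<lbrakk>x \<in> carrier X; rip X x x = \<zero>\<^bsub>B\<^esub>\<rbrakk> \<Longrightarrow> x = \<zero>\<^bsub>X\<^esub>"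
    and rip_complete: "is_complete X (\<lambda>x. sqrt (nrm B (rip X x x)))"
    and rip_full: "dense_span B {rip X x y | x y. x \<in> carrier X \<and> y \<in> carrier X}"

locale full_left_hilbert_module =
  A: cstar_algebra A + X: Module.module complex_ring X
  for A :: "('a, 'm) cstar_scheme" and X :: "('a, 'b, 'x, 'n) bimodule_scheme" +
  assumes lact_closed: "\<lbrakk>x \<in> carrier X; a \<in> carrier A\<rbrakk> \<Longrightarrow> lact X a x \<in> carrier X"
    and lact_add_right: "\<lbrakk>x \<in> carrier X; y \<in> carrier X; a \<in> carrier A\<rbrakk> \<Longrightarrow>
      lact X a (x \<oplus>\<^bsub>X\<^esub> y) = lact X a x \<oplus>\<^bsub>X\<^esub> lact X a y"
    and lact_add_left: "\<lbrakk>x \<in> carrier X; a \<in> carrier A; c \<in> carrier A\<rbrakk> \<Longrightarrow>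
      lact X (a \<oplus>\<^bsub>A\<^esub> c) x = lact X a x \<oplus>\<^bsub>X\<^esub> lact X c x"
    and lact_mult: "\<lbrakk>x \<in> carrier X; a \<in> carrier A; c \<in> carrier A\<rbrakk> \<Longrightarrow>
      lact X (a \<otimes>\<^bsub>A\<^esub> c) x = lact X a (lact X c x)"
    and lact_smult_right: "\<lbrakk>x \<in> carrier X; a \<in> carrier A\<rbrakk> \<Longrightarrow>
      lact X a (z \<odot>\<^bsub>X\<^esub> x) = z \<odot>\<^bsub>X\<^esub> lact X a x"
    and lact_smult_left: "\<lbrakk>x \<in> carrier X; a \<in> carrier A\<rbrakk> \<Longrightarrow>
      lact X (z \<odot>\<^bsub>A\<^esub> a) x = z \<odot>\<^bsub>X\<^esub> lact X a x"
    and lip_closed: "\<lbrakk>x \<in> carrier X; y \<in> carrier X\<rbrakk> \<Longrightarrow> lip X x y \<in> carrier A"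
    and lip_add: "\<lbrakk>x \<in> carrier X; x' \<in> carrier X; y \<in> carrier X\<rbrakk> \<Longrightarrow>
      lip X (x \<oplus>\<^bsub>X\<^esub> x') y = lip X x y \<oplus>\<^bsub>A\<^esub> lip X x' y"
    and lip_smult: "\<lbrakk>x \<in> carrier X; y \<in> carrier X\<rbrakk> \<Longrightarrow> lip X (z \<odot>\<^bsub>X\<^esub> x) y = z \<odot>\<^bsub>A\<^esub> lip X x y"
    and lip_lact: "\<lbrakk>x \<in> carrier X; y \<in> carrier X; a \<in> carrier A\<rbrakk> \<Longrightarrow>
      lip X (lact X a x) y = a \<otimes>\<^bsub>A\<^esub> lip X x y"
    and lip_star: "\<lbrakk>x \<in> carrier X; y \<in> carrier X\<rbrakk> \<Longrightarrow> star A (lip X x y) = lip X y x"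
    and lip_positive: "x \<in> carrier X \<Longrightarrow> cstar_positive A (lip X x x)"
    and lip_definite: "\<lbrakk>x \<in> carrier X; lip X x x = \<zero>\<^bsub>A\<^esub>\<rbrakk> \<Longrightarrow> x = \<zero>\<^bsub>X\<^esub>"
    and lip_complete: "is_complete X (\<lambda>x. sqrt (nrm A (lip X x x)))"
    and lip_full: "dense_span A {lip X x y | x y. x \<in> carrier X \<and> y \<in> carrier X}"

locale imprimitivity_bimodule =
  full_left_hilbert_module A X + full_right_hilbert_module B X
  for A :: "('a, 'm) cstar_scheme" and B :: "('b, 'l) cstar_scheme"
    and X :: "('a, 'b, 'x, 'n) bimodule_scheme" +
  assumes lact_ract: "\<lbrakk>x \<in> carrier X; a \<in> carrier A; b \<in> carrier B\<rbrakk> \<Longrightarrow>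
      ract X (lact X a x) b = lact X a (ract X x b)"
    and rip_lact: "\<lbrakk>x \<in> carrier X; y \<in> carrier X; a \<in> carrier A\<rbrakk> \<Longrightarrow>
      rip X (lact X a x) y = rip X x (lact X (star A a) y)"
    and lip_ract: "\<lbrakk>x \<in> carrier X; y \<in> carrier X; b \<in> carrier B\<rbrakk> \<Longrightarrow>
      lip X (ract X x b) y = lip X x (ract X y (star B b))"
    and lip_rip: "\<lbrakk>x \<in> carrier X; y \<in> carrier X; z \<in> carrier X\<rbrakk> \<Longrightarrow>
      lact X (lip X x y) z = ract X x (rip X y z)"

text \<open>The underlying set of the bimodule is taken in the type \<open>'a \<times> 'b\<close>. This is no restriction:
  the cardinality of an imprimitivity bimodule is at most the maximum of those of the two
  algebras (its density character is bounded by theirs, and the cardinality of an infinite-dimensional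
  Banach space is determined by its density character).\<close>

definition morita_equivalent :: "'a cstar \<Rightarrow> 'b cstar \<Rightarrow> bool" where
  "morita_equivalent A B \<longleftrightarrow>
     (\<exists>X :: ('a, 'b, 'a \<times> 'b) bimodule. imprimitivity_bimodule A B X)"


section \<open>Higher-rank graphs\<close>

text \<open>A category is given by its morphisms, its objects being identified with the identity
  morphisms. The rank \<open>k \<ge> 1\<close> is the cardinality of the index type \<open>'k\<close>, and the \<open>i\<close>-th standard
  basis vector is \<open>axis i 1\<close>. Compositions are written as in \<open>\<mu>\<nu>\<close>, which requires the source of
  \<open>\<mu>\<close> to be the range of \<open>\<nu>\<close>.\<close>

record ('a, 'k) kgraph =
  Mor :: "'a set"
  rng :: "'a \<Rightarrow> 'a"
  src :: "'a \<Rightarrow> 'a"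
  cmp :: "'a \<Rightarrow> 'a \<Rightarrow> 'a"
  deg :: "'a \<Rightarrow> nat ^ 'k"

locale k_graph =
  fixes \<Lambda> :: "('a, 'k::finite) kgraph"
  assumes rng_closed: "x \<in> Mor \<Lambda> \<Longrightarrow> rng \<Lambda> x \<in> Mor \<Lambda>"
    and src_closed: "x \<in> Mor \<Lambda> \<Longrightarrow> src \<Lambda> x \<in> Mor \<Lambda>"
    and rng_rng: "x \<in> Mor \<Lambda> \<Longrightarrow> rng \<Lambda> (rng \<Lambda> x) = rng \<Lambda> x"
    and src_rng: "x \<in> Mor \<Lambda> \<Longrightarrow> src \<Lambda> (rng \<Lambda> x) = rng \<Lambda> x"
    and rng_src: "x \<in> Mor \<Lambda> \<Longrightarrow> rng \<Lambda> (src \<Lambda> x) = src \<Lambda> x"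
    and src_src: "x \<in> Mor \<Lambda> \<Longrightarrow> src \<Lambda> (src \<Lambda> x) = src \<Lambda> x"
    and cmp_closed: "\<lbrakk>x \<in> Mor \<Lambda>; y \<in> Mor \<Lambda>; src \<Lambda> x = rng \<Lambda> y\<rbrakk> \<Longrightarrow> cmp \<Lambda> x y \<in> Mor \<Lambda>"
    and rng_cmp: "\<lbrakk>x \<in> Mor \<Lambda>; y \<in> Mor \<Lambda>; src \<Lambda> x = rng \<Lambda> y\<rbrakk> \<Longrightarrow> rng \<Lambda> (cmp \<Lambda> x y) = rng \<Lambda> x"
    and src_cmp: "\<lbrakk>x \<in> Mor \<Lambda>; y \<in> Mor \<Lambda>; src \<Lambda> x = rng \<Lambda> y\<rbrakk> \<Longrightarrow> src \<Lambda> (cmp \<Lambda> x y) = src \<Lambda> y"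
    and cmp_rng: "x \<in> Mor \<Lambda> \<Longrightarrow> cmp \<Lambda> (rng \<Lambda> x) x = x"
    and cmp_src: "x \<in> Mor \<Lambda> \<Longrightarrow> cmp \<Lambda> x (src \<Lambda> x) = x"
    and cmp_assoc: "\<lbrakk>x \<in> Mor \<Lambda>; y \<in> Mor \<Lambda>; z \<in> Mor \<Lambda>; src \<Lambda> x = rng \<Lambda> y; src \<Lambda> y = rng \<Lambda> z\<rbrakk> \<Longrightarrow>
      cmp \<Lambda> (cmp \<Lambda> x y) z = cmp \<Lambda> x (cmp \<Lambda> y z)"
    and countable_Mor: "countable (Mor \<Lambda>)"
    and deg_rng: "x \<in> Mor \<Lambda> \<Longrightarrow> deg \<Lambda> (rng \<Lambda> x) = 0"
    and deg_src: "x \<in> Mor \<Lambda> \<Longrightarrow> deg \<Lambda> (src \<Lambda> x) = 0"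
    and deg_cmp: "\<lbrakk>x \<in> Mor \<Lambda>; y \<in> Mor \<Lambda>; src \<Lambda> x = rng \<Lambda> y\<rbrakk> \<Longrightarrow>
      deg \<Lambda> (cmp \<Lambda> x y) = deg \<Lambda> x + deg \<Lambda> y"
    and factorization: "\<lbrakk>x \<in> Mor \<Lambda>; deg \<Lambda> x = n + m\<rbrakk> \<Longrightarrow>
      \<exists>!(\<mu>, \<nu>). \<mu> \<in> Mor \<Lambda> \<and> \<nu> \<in> Mor \<Lambda> \<and> src \<Lambda> \<mu> = rng \<Lambda> \<nu> \<and>
        deg \<Lambda> \<mu> = m \<and> deg \<Lambda> \<nu> = n \<and> x = cmp \<Lambda> \<mu> \<nu>"

definition verts_of :: "('a, 'k::finite) kgraph \<Rightarrow> 'a set" where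
  "verts_of \<Lambda> = {x \<in> Mor \<Lambda>. deg \<Lambda> x = 0}"

definition edges_of :: "('a, 'k::finite) kgraph \<Rightarrow> 'a set" where
  "edges_of \<Lambda> = {x \<in> Mor \<Lambda>. (\<Sum>i\<in>UNIV. deg \<Lambda> x $ i) = 1}"

definition edges_from :: "('a, 'k::finite) kgraph \<Rightarrow> 'a \<Rightarrow> 'a set" where
  "edges_from \<Lambda> v = {e \<in> edges_of \<Lambda>. src \<Lambda> e = v}"

definition edges_into :: "('a, 'k::finite) kgraph \<Rightarrow> 'a \<Rightarrow> 'a set" where
  "edges_into \<Lambda> v = {e \<in> edges_of \<Lambda>. rng \<Lambda> e = v}"

definition edges_into_col :: "('a, 'k::finite) kgraph \<Rightarrow> 'a \<Rightarrow> 'k \<Rightarrow> 'a set" where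
  "edges_into_col \<Lambda> v i = {x \<in> Mor \<Lambda>. deg \<Lambda> x = axis i 1 \<and> rng \<Lambda> x = v}"

definition row_finite :: "('a, 'k::finite) kgraph \<Rightarrow> bool" where
  "row_finite \<Lambda> \<longleftrightarrow> (\<forall>v\<in>verts_of \<Lambda>. \<forall>i. finite (edges_into_col \<Lambda> v i))"

definition source_free :: "('a, 'k::finite) kgraph \<Rightarrow> bool" where
  "source_free \<Lambda> \<longleftrightarrow> (\<forall>v\<in>verts_of \<Lambda>. \<forall>i. edges_into_col \<Lambda> v i \<noteq> {})"


section \<open>Coloured graphs and path categories\<close>

record ('v, 'e, 'k) colored_graph =
  verts :: "'v set"
  edges :: "'e set"
  grng :: "'e \<Rightarrow> 'v"
  gsrc :: "'e \<Rightarrow> 'v"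
  color :: "'e \<Rightarrow> nat ^ 'k"

text \<open>The path \<open>f\<^sub>n \<dots> f\<^sub>1\<close> with range \<open>x\<close> is represented by \<open>(x, [f\<^sub>n, \<dots>, f\<^sub>1])\<close>, and the vertex \<open>x\<close> by
  \<open>(x, [])\<close>.\<close>

type_synonym ('v, 'e) path = "'v \<times> 'e list"

fun is_walk :: "('v, 'e, 'k::finite) colored_graph \<Rightarrow> 'v \<Rightarrow> 'e list \<Rightarrow> bool" where
  "is_walk G x [] \<longleftrightarrow> x \<in> verts G"
| "is_walk G x (f # fs) \<longleftrightarrow> x \<in> verts G \<and> f \<in> edges G \<and> grng G f = x \<and> is_walk G (gsrc G f) fs"

definition paths :: "('v, 'e, 'k::finite) colored_graph \<Rightarrow> ('v, 'e) path set" where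
  "paths G = {(x, fs). is_walk G x fs}"

definition path_rng :: "('v, 'e) path \<Rightarrow> 'v" where
  "path_rng p = fst p"

definition path_src :: "('v, 'e, 'k::finite) colored_graph \<Rightarrow> ('v, 'e) path \<Rightarrow> 'v" where
  "path_src G p = (if snd p = [] then fst p else gsrc G (last (snd p)))"

definition path_deg :: "('v, 'e, 'k::finite) colored_graph \<Rightarrow> ('v, 'e) path \<Rightarrow> nat ^ 'k" where
  "path_deg G p = sum_list (map (color G) (snd p))"

definition path_cat :: "('v, 'e) path \<Rightarrow> ('v, 'e) path \<Rightarrow> ('v, 'e) path" where
  "path_cat p q = (fst p, snd p @ snd q)"

definition skeleton :: "('a, 'k::finite) kgraph \<Rightarrow> ('a, 'a, 'k) colored_graph" where
  "skeleton \<Lambda> = \<lparr>verts = verts_of \<Lambda>, edges = edges_of \<Lambda>, grng = rng \<Lambda>, gsrc = src \<Lambda>,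
     color = deg \<Lambda>\<rparr>"

definition path_mor :: "('a, 'k::finite) kgraph \<Rightarrow> ('a, 'a) path \<Rightarrow> 'a" where
  "path_mor \<Lambda> p = (if snd p = [] then fst p else foldr (cmp \<Lambda>) (butlast (snd p)) (last (snd p)))"

definition path_equiv :: "('a, 'k::finite) kgraph \<Rightarrow> ('a, 'a) path \<Rightarrow> ('a, 'a) path \<Rightarrow> bool" where
  "path_equiv \<Lambda> p q \<longleftrightarrow>
     p \<in> paths (skeleton \<Lambda>) \<and> q \<in> paths (skeleton \<Lambda>) \<and> path_mor \<Lambda> p = path_mor \<Lambda> q"

text \<open>\<open>edges_commute \<Lambda> a f g b\<close> is the relation \<open>af \<sim> gb\<close> between paths of length 2.\<close>

definition edges_commute :: "('a, 'k::finite) kgraph \<Rightarrow> 'a \<Rightarrow> 'a \<Rightarrow> 'a \<Rightarrow> 'a \<Rightarrow> bool" where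
  "edges_commute \<Lambda> a f g b \<longleftrightarrow> path_equiv \<Lambda> (rng \<Lambda> a, [a, f]) (rng \<Lambda> g, [g, b])"


section \<open>Complete edges and reduction\<close>

definition complete_edge :: "('a, 'k::finite) kgraph \<Rightarrow> 'a set \<Rightarrow> bool" where
  "complete_edge \<Lambda> E \<longleftrightarrow> E \<subseteq> edges_of \<Lambda> \<and>
     (\<forall>i. \<exists>!e. e \<in> E \<and> deg \<Lambda> e = axis i 1) \<and>
     (\<forall>e\<in>E. \<forall>f\<in>E. src \<Lambda> e = src \<Lambda> f \<and> rng \<Lambda> e = rng \<Lambda> f) \<and>
     (\<forall>e\<in>E. \<forall>a\<in>edges_of \<Lambda>. \<forall>b\<in>edges_of \<Lambda>. \<forall>f\<in>edges_of \<Lambda>.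
        edges_commute \<Lambda> e a f b \<or> edges_commute \<Lambda> a e b f \<longrightarrow> f \<in> E)"

definition common_rng :: "('a, 'k::finite) kgraph \<Rightarrow> 'a set \<Rightarrow> 'a" where
  "common_rng \<Lambda> E = (THE x. \<forall>e\<in>E. rng \<Lambda> e = x)"

definition reduced_skeleton :: "('a, 'k::finite) kgraph \<Rightarrow> 'a \<Rightarrow> ('a, 'a, 'k) colored_graph" where
  "reduced_skeleton \<Lambda> v = \<lparr>verts = verts_of \<Lambda> - {v}, edges = edges_of \<Lambda> - edges_from \<Lambda> v,
     grng = (\<lambda>e. if rng \<Lambda> e = v then common_rng \<Lambda> (edges_from \<Lambda> v) else rng \<Lambda> e),
     gsrc = src \<Lambda>, color = deg \<Lambda>\<rparr>"

definition par :: "('a, 'k::finite) kgraph \<Rightarrow> 'a \<Rightarrow> 'a \<Rightarrow> ('a, 'a) path \<Rightarrow> ('a, 'a) path" where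
  "par \<Lambda> v f p = (fst p, concat (map (\<lambda>e. if rng \<Lambda> e = v then [f, e] else [e]) (snd p)))"

definition reduced_equiv ::
    "('a, 'k::finite) kgraph \<Rightarrow> 'a \<Rightarrow> 'a \<Rightarrow> (('a, 'a) path \<times> ('a, 'a) path) set" where
  "reduced_equiv \<Lambda> v f = {(p, q). p \<in> paths (reduced_skeleton \<Lambda> v) \<and>
     q \<in> paths (reduced_skeleton \<Lambda> v) \<and> path_equiv \<Lambda> (par \<Lambda> v f p) (par \<Lambda> v f q)}"

text \<open>The operations on equivalence classes are those induced by the operations on paths; an image
  of the form \<open>R `` S\<close> is the class of the elements of \<open>S\<close>.\<close>

definition reduction ::
    "('a, 'k::finite) kgraph \<Rightarrow> 'a \<Rightarrow> 'a \<Rightarrow> (('a, 'a) path set, 'k) kgraph" where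
  "reduction \<Lambda> v f = (let G = reduced_skeleton \<Lambda> v; R = reduced_equiv \<Lambda> v f in
     \<lparr>Mor = paths G // R,
      rng = (\<lambda>X. R `` {(path_rng p, []) | p. p \<in> X}),
      src = (\<lambda>X. R `` {(path_src G p, []) | p. p \<in> X}),
      cmp = (\<lambda>X Y. R `` {path_cat p q | p q. p \<in> X \<and> q \<in> Y}),
      deg = (\<lambda>X. THE n. \<forall>p\<in>X. path_deg G p = n)\<rparr>)"


section \<open>The C*-algebra of a higher-rank graph\<close>

locale ck_family =
  fixes \<Lambda> :: "('a, 'k::finite) kgraph" and A :: "('b, 'm) cstar_scheme" (structure)
    and P :: "'a \<Rightarrow> 'b" and T :: "'a \<Rightarrow> 'b"
  assumes P_closed: "v \<in> verts_of \<Lambda> \<Longrightarrow> P v \<in> carrier A"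
    and P_projection: "v \<in> verts_of \<Lambda> \<Longrightarrow> star A (P v) = P v \<and> P v \<otimes> P v = P v"
    and T_closed: "f \<in> edges_of \<Lambda> \<Longrightarrow> T f \<in> carrier A"
    and T_partial_isometry: "f \<in> edges_of \<Lambda> \<Longrightarrow> T f \<otimes> (star A (T f) \<otimes> T f) = T f"
    and CK1: "\<lbrakk>v \<in> verts_of \<Lambda>; w \<in> verts_of \<Lambda>; v \<noteq> w\<rbrakk> \<Longrightarrow> P v \<otimes> P w = \<zero>"
    and CK2: "\<lbrakk>a \<in> edges_of \<Lambda>; b \<in> edges_of \<Lambda>; f \<in> edges_of \<Lambda>; g \<in> edges_of \<Lambda>;
      edges_commute \<Lambda> a f g b\<rbrakk> \<Longrightarrow> T a \<otimes> T f = T g \<otimes> T b"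
    and CK3: "f \<in> edges_of \<Lambda> \<Longrightarrow> star A (T f) \<otimes> T f = P (src \<Lambda> f)"
    and CK4: "v \<in> verts_of \<Lambda> \<Longrightarrow> P v = (\<Oplus>f\<in>edges_into_col \<Lambda> v i. T f \<otimes> star A (T f))"

text \<open>The free *-algebra (without unit) on a set \<open>S\<close>, with a given seminorm: finitely supported
  complex functions on nonempty words in the letters \<open>(s, False)\<close>, standing for \<open>s\<close>, and
  \<open>(s, True)\<close>, standing for \<open>s\<^sup>*\<close>.\<close>

type_synonym 'g star_poly = "('g \<times> bool) list \<Rightarrow> complex"

definition free_star_algebra :: "'g set \<Rightarrow> ('g star_poly \<Rightarrow> real) \<Rightarrow> 'g star_poly cstar" where
  "free_star_algebra S p =
     \<lparr>carrier = {a. finite {w. a w \<noteq> 0} \<and> (\<forall>w. a w \<noteq> 0 \<longrightarrow> w \<noteq> [] \<and> fst ` set w \<subseteq> S)},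
      mult = (\<lambda>a b w. \<Sum>i\<le>length w. a (take i w) * b (drop i w)),
      one = undefined,
      zero = (\<lambda>w. 0),
      add = (\<lambda>a b w. a w + b w),
      smult = (\<lambda>z a w. z * a w),
      star = (\<lambda>a w. cnj (a (rev (map (\<lambda>(s, t). (s, \<not> t)) w)))),
      nrm = p\<rparr>"

definition gen :: "'g \<Rightarrow> 'g star_poly" where
  "gen s = (\<lambda>w. if w = [(s, False)] then 1 else 0)"

text \<open>The Hausdorff completion of a *-algebra with respect to a C*-seminorm, by classes of Cauchy
  sequences.\<close>

definition null_equiv :: "('a, 'm) cstar_scheme \<Rightarrow> ((nat \<Rightarrow> 'a) \<times> (nat \<Rightarrow> 'a)) set" where
  "null_equiv A = {(x, y). x \<in> cauchy_seqs A (nrm A) \<and> y \<in> cauchy_seqs A (nrm A) \<and>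
     (\<lambda>n. nrm A (x n \<ominus>\<^bsub>A\<^esub> y n)) \<longlonglongrightarrow> 0}"

definition completion :: "('a, 'm) cstar_scheme \<Rightarrow> (nat \<Rightarrow> 'a) set cstar" where
  "completion A = (let R = null_equiv A in
     \<lparr>carrier = cauchy_seqs A (nrm A) // R,
      mult = (\<lambda>X Y. R `` {\<lambda>n. x n \<otimes>\<^bsub>A\<^esub> y n | x y. x \<in> X \<and> y \<in> Y}),
      one = undefined,
      zero = R `` {\<lambda>n. \<zero>\<^bsub>A\<^esub>},
      add = (\<lambda>X Y. R `` {\<lambda>n. x n \<oplus>\<^bsub>A\<^esub> y n | x y. x \<in> X \<and> y \<in> Y}),
      smult = (\<lambda>z X. R `` {\<lambda>n. z \<odot>\<^bsub>A\<^esub> x n | x. x \<in> X}),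
      star = (\<lambda>X. R `` {\<lambda>n. star A (x n) | x. x \<in> X}),
      nrm = (\<lambda>X. THE r. \<forall>x\<in>X. (\<lambda>n. nrm A (x n)) \<longlonglongrightarrow> r)\<rparr>)"

definition to_completion :: "('a, 'm) cstar_scheme \<Rightarrow> 'a \<Rightarrow> (nat \<Rightarrow> 'a) set" where
  "to_completion A a = null_equiv A `` {\<lambda>n. a}"

datatype 'a ck_gen = Proj 'a | Iso 'a

definition ck_free :: "('a, 'k::finite) kgraph \<Rightarrow> ('a ck_gen star_poly \<Rightarrow> real) \<Rightarrow>
    'a ck_gen star_poly cstar" where
  "ck_free \<Lambda> p = free_star_algebra (Proj ` verts_of \<Lambda> \<union> Iso ` edges_of \<Lambda>) p"

text \<open>The seminorms \<open>a \<mapsto> \<parallel>\<pi>(a)\<parallel>\<close>, where \<open>\<pi>\<close> is the representation of the free *-algebra given by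
  a Cuntz--Krieger family in a C*-algebra, are exactly the C*-seminorms for which the generators
  become a Cuntz--Krieger family in the completion. The universal C*-algebra is the completion
  with respect to the supremum of all of them; using seminorms avoids a quantification over
  C*-algebras of arbitrary type.\<close>

definition ck_seminorm :: "('a, 'k::finite) kgraph \<Rightarrow> ('a ck_gen star_poly \<Rightarrow> real) \<Rightarrow> bool" where
  "ck_seminorm \<Lambda> p \<longleftrightarrow> is_cstar_seminorm (ck_free \<Lambda> p) p \<and>
     ck_family \<Lambda> (completion (ck_free \<Lambda> p))
       (\<lambda>v. to_completion (ck_free \<Lambda> p) (gen (Proj v)))
       (\<lambda>f. to_completion (ck_free \<Lambda> p) (gen (Iso f)))"

definition ck_universal_seminorm :: "('a, 'k::finite) kgraph \<Rightarrow> 'a ck_gen star_poly \<Rightarrow> real" where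
  "ck_universal_seminorm \<Lambda> a = (SUP p\<in>{p. ck_seminorm \<Lambda> p}. p a)"

definition ck_algebra ::
    "('a, 'k::finite) kgraph \<Rightarrow> (nat \<Rightarrow> 'a ck_gen star_poly) set cstar" where
  "ck_algebra \<Lambda> = completion (ck_free \<Lambda> (ck_universal_seminorm \<Lambda>))"

end

theory Submission
  imports Defs
begin

text \<open>Let \<open>q = P\<^sub>v\<close> in \<open>A = C\<^sup>*(\<Lambda>)\<close>. The elements \<open>x\<close> of \<open>A\<close> with \<open>xq = 0\<close> form an imprimitivity
  bimodule between \<open>A\<close> and the corner \<open>D = {a. qa = aq = 0}\<close>, with the products \<open>xy\<^sup>*\<close> and \<open>x\<^sup>*y\<close> as
  inner products. It is full because \<open>q\<close> is equivalent to a projection orthogonal to it: for an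
  edge \<open>h\<close> into \<open>v\<close> completeness gives \<open>T\<^sub>h T\<^sub>h\<^sup>* = q\<close>, and \<open>T\<^sub>h q = 0\<close> since the source \<open>u\<close> of \<open>h\<close> is not
  \<open>v\<close>, so that \<open>ab = (a - aq)(b - qb) + (aT\<^sub>h)(T\<^sub>h\<^sup>*b)\<close> (\<open>morita_corner\<close>).

  It remains to identify \<open>D\<close> with \<open>C\<^sup>*(\<Lambda>\<^sub>R)\<close>. Let \<open>\<phi>\<close> be the homomorphism of free *-algebras that sends
  \<open>P\<^sub>x\<close> to \<open>P\<^sub>x\<close>, and \<open>T\<^sub>e\<close> to \<open>T\<^sub>f T\<^sub>e\<close> if \<open>e\<close> has range \<open>v\<close> in \<open>\<Lambda>\<close> and to \<open>T\<^sub>e\<close> otherwise. It preserves the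
  universal seminorms, without any appeal to a uniqueness theorem, because families can be moved in
  both directions. The formulas for \<open>\<phi>\<close> turn a family for \<open>\<Lambda>\<close> into a family for
  \<open>\<Lambda>\<^sub>R\<close> (\<open>reduced_family\<close>). Conversely, in a family for \<open>\<Lambda>\<^sub>R\<close> the edges which had range \<open>v\<close> turn out to
  have one common range projection \<open>q\<close>; the 2 by 2 matrices with \<open>q\<close> in the second diagonal entry as
  the new projection at \<open>v\<close> give a family for \<open>\<Lambda>\<close> whose composition with \<open>\<phi>\<close> is the given one,
  in the first diagonal entry (\<open>M2_family\<close>). Hence \<open>\<phi>\<close> induces an isometric
  homomorphism from \<open>C\<^sup>*(\<Lambda>\<^sub>R)\<close> to \<open>A\<close>. Its image lies in \<open>D\<close>, and it is all of \<open>D\<close> since it is closed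
  and contains \<open>(1 - q)c(1 - q)\<close> for every polynomial \<open>c\<close> in the generators of \<open>A\<close>, as one sees by an
  induction on \<open>c\<close> that involves all four compressions of \<open>c\<close> by \<open>1 - q\<close> and \<open>T\<^sub>h\<close> (\<open>morita\<close>).

  Three facts about positivity enter: sums of elements \<open>b\<^sup>*b\<close> are again of this form (the inner product
  with values in \<open>C\<^sup>*(\<Lambda>\<^sub>R)\<close> is positive), the norm is monotone on positive elements (the operator
  norm on matrices is a C*-norm), and positive elements with sum 0 vanish (\<open>P\<^bsub>r(e)\<^esub> T\<^sub>e = T\<^sub>e\<close>).
  They are proved in a type class of unital C*-algebras; every C*-algebra given by a carrier set
  embeds isometrically into a type of this class (\<open>emb\<close>).\<close>

section \<open>C*-algebras as a type class\<close>

text \<open>Complex C*-algebras whose elements form a type, not necessarily with a unit. The class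
  \<open>cstar_alg_1\<close> adds a unit, of norm 1.\<close>

class cstar_alg = real_normed_algebra + banach +
  fixes scaleC :: "complex \<Rightarrow> 'a \<Rightarrow> 'a" (infixr "*\<^sub>C" 75)
    and adj :: "'a \<Rightarrow> 'a"
  assumes scaleC_add_right: "z *\<^sub>C (x + y) = z *\<^sub>C x + z *\<^sub>C y"
    and scaleC_add_left: "(z + z') *\<^sub>C x = z *\<^sub>C x + z' *\<^sub>C x"
    and scaleC_scaleC: "z *\<^sub>C (z' *\<^sub>C x) = (z * z') *\<^sub>C x"
    and scaleC_of_real: "of_real r *\<^sub>C x = r *\<^sub>R x"
    and scaleC_mult_left: "(z *\<^sub>C x) * y = z *\<^sub>C (x * y)"
    and scaleC_mult_right: "x * (z *\<^sub>C y) = z *\<^sub>C (x * y)"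
    and norm_scaleC: "norm (z *\<^sub>C x) = cmod z * norm x"
    and adj_adj [simp]: "adj (adj x) = x"
    and adj_add: "adj (x + y) = adj x + adj y"
    and adj_scaleC: "adj (z *\<^sub>C x) = cnj z *\<^sub>C adj x"
    and adj_mult: "adj (x * y) = adj y * adj x"
    and norm_adj_mult: "norm (adj x * x) = (norm x)\<^sup>2"

class cstar_alg_1 = cstar_alg + real_normed_algebra_1

lemma scaleC_one [simp]: "1 *\<^sub>C x = (x::'a::cstar_alg)"
  using scaleC_of_real[of 1 x] by simp

lemma scaleC_zero_left [simp]: "0 *\<^sub>C x = (0::'a::cstar_alg)"
  using scaleC_of_real[of 0 x] by simp

lemma scaleC_zero_right [simp]: "z *\<^sub>C 0 = (0::'a::cstar_alg)"
  using scaleC_add_right[of z 0 "0::'a"] by simp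

lemma scaleC_minus_one: "(-1) *\<^sub>C x = - (x::'a::cstar_alg)"
  using scaleC_of_real[of "-1" x] by simp

lemma scaleC_minus_right: "z *\<^sub>C (- x) = - (z *\<^sub>C (x::'a::cstar_alg))"
  using scaleC_add_right[of z x "-x"] by (simp add: eq_neg_iff_add_eq_0 add.commute)

lemma scaleC_minus_left: "(- z) *\<^sub>C x = - (z *\<^sub>C (x::'a::cstar_alg))"
  using scaleC_add_left[of z "-z" x] by (simp add: eq_neg_iff_add_eq_0 add.commute)

lemma scaleC_diff_right: "z *\<^sub>C (x - y) = z *\<^sub>C x - z *\<^sub>C (y::'a::cstar_alg)"
  using scaleC_add_right[of z x "-y"] by (simp add: scaleC_minus_right)

lemma adj_zero [simp]: "adj 0 = (0::'a::cstar_alg)"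
  using adj_add[of 0 "0::'a"] by simp

lemma adj_minus: "adj (- x) = - adj (x::'a::cstar_alg)"
  using adj_add[of x "-x"] by (simp add: eq_neg_iff_add_eq_0 add.commute)

lemma adj_diff: "adj (x - y) = adj x - adj (y::'a::cstar_alg)"
  using adj_add[of x "-y"] by (simp add: adj_minus)

lemma adj_scaleR: "adj (r *\<^sub>R x) = r *\<^sub>R adj (x::'a::cstar_alg)"
  using adj_scaleC[of "of_real r" x] by (simp add: scaleC_of_real)

lemma adj_one [simp]: "adj 1 = (1::'a::cstar_alg_1)"
  by (metis adj_adj adj_mult mult.left_neutral mult.right_neutral)

lemma adj_of_real [simp]: "adj (of_real r) = (of_real r::'a::cstar_alg_1)"
  by (simp add: of_real_def adj_scaleR)

lemma adj_power: "adj (x ^ n) = adj (x::'a::cstar_alg_1) ^ n"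
  by (induction n) (auto simp: adj_mult power_commutes)

lemma norm_adj [simp]: "norm (adj x) = norm (x::'a::cstar_alg)"
proof -
  have le: "norm y \<le> norm (adj y)" for y :: 'a
  proof (cases "y = 0")
    case False
    have "norm y * norm y \<le> norm (adj y) * norm y"
      using norm_mult_ineq[of "adj y" y] norm_adj_mult[of y] by (simp add: power2_eq_square)
    thus ?thesis using False by simp
  qed simp
  show ?thesis using le[of x] le[of "adj x"] by simp
qed

lemma bounded_linear_adj: "bounded_linear (adj :: 'a::cstar_alg \<Rightarrow> 'a)"
  by (rule bounded_linear_intro[where K = 1]) (auto simp: adj_add adj_scaleR)

lemma norm_selfadj_sq: "adj h = h \<Longrightarrow> norm (h * h) = (norm (h::'a::cstar_alg))\<^sup>2"
  using norm_adj_mult[of h] by simp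

lemma selfadj_sq_zero: "adj h = h \<Longrightarrow> h * h = 0 \<Longrightarrow> h = (0::'a::cstar_alg)"
  using norm_selfadj_sq[of h] by simp

lemma norm_selfadj_power:
  fixes h :: "'a::cstar_alg_1"
  assumes "adj h = h"
  shows "norm (h ^ (2 ^ m)) = norm h ^ (2 ^ m)"
proof (induction m)
  case (Suc m)
  have "adj (h ^ 2 ^ m) = h ^ 2 ^ m" by (simp add: adj_power assms)
  from norm_selfadj_sq[OF this] Suc show ?case
    by (simp add: power_mult power2_eq_square mult.commute[of 2])
qed simp

section \<open>Square roots\<close>

text \<open>The coefficients of the power series of \<open>\<surd>(1 - x)\<close> at 0.\<close>

definition sqrt_coeff :: "nat \<Rightarrow> real" where
  "sqrt_coeff n = (- 1) ^ n * ((1/2) gchoose n)"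

lemma sqrt_coeff_Suc: "sqrt_coeff (Suc n) = sqrt_coeff n * (real n - 1/2) / (real n + 1)"
proof -
  have "(1/2) gchoose Suc n = ((1/2) gchoose n) * (1/2 - real n) / (real n + 1)"
    using gbinomial_mult_1[of "1/2::real" n] by (simp add: field_simps)
  thus ?thesis unfolding sqrt_coeff_def by (simp only: power_Suc) (simp add: divide_simps mult_ac, simp add: algebra_simps)
qed

lemma sqrt_coeff_0: "sqrt_coeff 0 = 1"
  by (simp add: sqrt_coeff_def)

lemma sqrt_coeff_nonpos: "sqrt_coeff (Suc n) \<le> 0"
proof (induction n)
  case 0
  show ?case by (simp add: sqrt_coeff_Suc sqrt_coeff_0)
next
  case (Suc n)
  show ?case unfolding sqrt_coeff_Suc[of "Suc n"]
    using Suc by (auto intro!: divide_nonpos_pos mult_nonpos_nonneg)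
qed

lemma sqrt_coeff_sums:
  fixes x :: real
  assumes "\<bar>x\<bar> < 1"
  shows "(\<lambda>n. sqrt_coeff n * x ^ n) sums sqrt (1 - x)"
  using gen_binomial_real[of "- x" "1/2"] assms power_minus[of x]
  by (simp add: sqrt_coeff_def powr_half_sqrt mult_ac)

text \<open>The binomial series of the square root converges absolutely on the closed unit disc, since
  all its coefficients but the first are nonpositive and their partial sums are bounded.\<close>

lemma sum_sqrt_coeff_le: "(\<Sum>n<N. - sqrt_coeff (Suc n)) \<le> 1"
proof -
  have bound: "(\<Sum>n<N. - (sqrt_coeff (Suc n) * x ^ Suc n)) \<le> 1" if x: "0 < x" "x < 1" for x :: real
  proof -
    have "(\<lambda>n. sqrt_coeff (Suc n) * x ^ Suc n) sums (sqrt (1 - x) - 1)"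
      using sqrt_coeff_sums[of x] x by (subst sums_Suc_iff) (simp add: sqrt_coeff_0)
    hence s: "(\<lambda>n. - (sqrt_coeff (Suc n) * x ^ Suc n)) sums (1 - sqrt (1 - x))"
      using sums_minus by fastforce
    have "(\<Sum>n<N. - (sqrt_coeff (Suc n) * x ^ Suc n)) \<le> 1 - sqrt (1 - x)"
      unfolding sums_unique[OF s]
      by (rule sum_le_suminf[OF sums_summable[OF s]])
         (use x sqrt_coeff_nonpos in \<open>auto intro!: mult_nonpos_nonneg\<close>)
    also have "\<dots> \<le> 1" using x by simp
    finally show ?thesis .
  qed
  show ?thesis
  proof (rule tendsto_upperbound)
    show "((\<lambda>x. \<Sum>n<N. - (sqrt_coeff (Suc n) * x ^ Suc n)) \<longlongrightarrow> (\<Sum>n<N. - sqrt_coeff (Suc n))) (at_left 1)"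
      by (rule tendsto_eq_intros refl | simp)+
    show "\<forall>\<^sub>F x in at_left 1. (\<Sum>n<N. - (sqrt_coeff (Suc n) * x ^ Suc n)) \<le> 1"
      using eventually_at_left_real[of 0 "1::real"] by (rule eventually_mono) (use bound in auto)
  qed simp
qed

lemma summable_sqrt_coeff: "summable (\<lambda>n. \<bar>sqrt_coeff n\<bar>)"
  and suminf_sqrt_coeff_le: "(\<Sum>n. \<bar>sqrt_coeff (Suc n)\<bar>) \<le> 1"
proof -
  have eq: "(\<lambda>n. \<bar>sqrt_coeff (Suc n)\<bar>) = (\<lambda>n. - sqrt_coeff (Suc n))"
    using sqrt_coeff_nonpos by (auto simp: abs_of_nonpos)
  have s: "summable (\<lambda>n. \<bar>sqrt_coeff (Suc n)\<bar>)"
    by (rule bounded_imp_summable[where B = 1])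
       (use sum_sqrt_coeff_le[of "Suc _"] in \<open>unfold eq, auto simp: lessThan_Suc_atMost\<close>)
  thus "summable (\<lambda>n. \<bar>sqrt_coeff n\<bar>)" using summable_Suc_iff[of "\<lambda>n. \<bar>sqrt_coeff n\<bar>"] by simp
  show "(\<Sum>n. \<bar>sqrt_coeff (Suc n)\<bar>) \<le> 1"
    by (rule suminf_le_const[OF s], unfold eq) (rule sum_sqrt_coeff_le)
qed

text \<open>The formal square of the power series is \<open>1 - x\<close>.\<close>

lemma sqrt_coeff_convolution:
  "(\<Sum>i\<le>n. sqrt_coeff i * sqrt_coeff (n - i)) = (if n = 0 then 1 else if n = 1 then - 1 else 0)"
proof -
  have "(\<Sum>i\<le>n. sqrt_coeff i * sqrt_coeff (n - i)) =
      (\<Sum>i\<le>n. (-1) ^ n * (((1/2) gchoose i) * ((1/2) gchoose (n - i))))"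
    by (intro sum.cong) (auto simp: sqrt_coeff_def mult_ac simp flip: power_add)
  also have "\<dots> = (-1) ^ n * (1 gchoose n)"
    using gbinomial_Vandermonde[of "1/2::real" "1/2" n]
    by (simp flip: sum_distrib_left add: atMost_atLeast0)
  also have "\<dots> = (if n = 0 then 1 else if n = 1 then - 1 else 0)"
  proof -
    have "(1::real) gchoose n = of_nat (1 choose n)" by (simp add: binomial_gbinomial)
    thus ?thesis by (cases n) (auto simp: binomial_eq_0)
  qed
  finally show ?thesis .
qed

text \<open>A selfadjoint element \<open>1 - x\<close> with \<open>\<parallel>x\<parallel> \<le> 1\<close> has a square root at distance at most 1
  from 1 that commutes with everything that commutes with \<open>x\<close>, namely the sum of the power series.\<close>

lemma sqrt_one_minus_exists:
  fixes x :: "'a::cstar_alg_1"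
  assumes "adj x = x" "norm x \<le> 1"
  obtains s where "adj s = s" "s * s = 1 - x" "\<And>y. y * x = x * y \<Longrightarrow> y * s = s * y"
    "norm (1 - s) \<le> 1"
proof -
  let ?t = "\<lambda>n. sqrt_coeff n *\<^sub>R x ^ n"
  have le: "norm (?t n) \<le> \<bar>sqrt_coeff n\<bar>" for n
    using norm_power_ineq[of x n] power_le_one[OF norm_ge_zero assms(2), of n]
    by (auto intro!: mult_left_le)
  have nsum: "summable (\<lambda>n. norm (?t n))"
    by (rule summable_comparison_test'[OF summable_sqrt_coeff]) (use le in simp)
  have sum: "summable ?t" by (rule summable_norm_cancel[OF nsum])
  define s where "s = suminf ?t"
  have "adj s = (\<Sum>n. adj (?t n))"
    unfolding s_def by (rule bounded_linear.suminf[OF bounded_linear_adj sum])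
  hence "adj s = s" by (simp add: adj_scaleR adj_power assms s_def)
  moreover have "s * s = 1 - x"
  proof -
    have "s * s = (\<Sum>n. \<Sum>i\<le>n. ?t i * ?t (n - i))"
      unfolding s_def by (rule Cauchy_product[OF nsum nsum])
    also have "(\<lambda>n. \<Sum>i\<le>n. ?t i * ?t (n - i)) = (\<lambda>n. (\<Sum>i\<le>n. sqrt_coeff i * sqrt_coeff (n - i)) *\<^sub>R x ^ n)"
      by (auto simp: scaleR_left.sum mult_ac simp flip: power_add intro!: sum.cong)
    also have "\<dots> = (\<lambda>n. (if n = 0 then 1 else if n = 1 then - 1 else 0) *\<^sub>R x ^ n)"
      by (simp add: sqrt_coeff_convolution)
    also have "suminf \<dots> = (\<Sum>n\<in>{0,1}. (if n = 0 then 1 else if n = 1 then - 1 else 0) *\<^sub>R x ^ n)"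
      by (rule suminf_finite) auto
    finally show ?thesis by simp
  qed
  moreover have "y * s = s * y" if "y * x = x * y" for y
  proof -
    have c: "y * x ^ n = x ^ n * y" for n by (metis that power_commuting_commutes)
    have "y * s = (\<Sum>n. y * ?t n)" unfolding s_def by (rule suminf_mult[OF sum, symmetric])
    also have "\<dots> = (\<Sum>n. ?t n * y)" by (simp add: c)
    also have "\<dots> = s * y" unfolding s_def by (rule suminf_mult2[OF sum, symmetric])
    finally show ?thesis .
  qed
  moreover have "norm (1 - s) \<le> 1"
  proof -
    have nsum': "summable (\<lambda>n. norm (?t (Suc n)))"
      using nsum summable_Suc_iff[of "\<lambda>n. norm (?t n)"] by simp
    have "(\<Sum>n. ?t (Suc n)) = s - 1"
      using suminf_split_head[OF sum] by (simp add: s_def sqrt_coeff_0)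
    hence "norm (1 - s) = norm (\<Sum>n. ?t (Suc n))" by (simp add: norm_minus_commute)
    also have "\<dots> \<le> (\<Sum>n. norm (?t (Suc n)))" by (rule summable_norm[OF nsum'])
    also have "\<dots> \<le> (\<Sum>n. \<bar>sqrt_coeff (Suc n)\<bar>)"
      by (rule suminf_le[OF le nsum'])
         (use summable_sqrt_coeff summable_Suc_iff[of "\<lambda>n. \<bar>sqrt_coeff n\<bar>"] in simp)
    also have "\<dots> \<le> 1" by (rule suminf_sqrt_coeff_le)
    finally show ?thesis .
  qed
  ultimately show thesis by (rule that)
qed

section \<open>Positive elements\<close>

text \<open>Positivity without mention of the spectrum: \<open>h\<close> is the square of a selfadjoint element.\<close>

definition pos :: "'a::cstar_alg \<Rightarrow> bool" where
  "pos h \<longleftrightarrow> (\<exists>s. adj s = s \<and> h = s * s)"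

lemma pos_selfadj: "pos h \<Longrightarrow> adj h = h"
  by (auto simp: pos_def adj_mult)

lemma pos_scaleR:
  assumes "pos h" "r \<ge> 0" shows "pos (r *\<^sub>R h)"
proof -
  obtain s where s: "adj s = s" "h = s * s" using assms by (auto simp: pos_def)
  show ?thesis unfolding pos_def
    by (rule exI[of _ "sqrt r *\<^sub>R s"]) (use s assms in \<open>auto simp: adj_scaleR\<close>)
qed

lemma pos_zero [simp]: "pos 0"
  unfolding pos_def by (rule exI[of _ 0]) simp

lemma norm_one_minus_sq:
  fixes s :: "'a::cstar_alg_1"
  assumes s: "adj s = s" "norm s \<le> 1"
  shows "norm (1 - s * s) \<le> 1"
proof -
  have x: "adj (s * s) = s * s" "norm (s * s) \<le> 1"
    using s by (auto simp: adj_mult norm_selfadj_sq power_le_one)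
  obtain k where k: "adj k = k" "k * k = 1 - s * s" "\<And>y. y * (s * s) = (s * s) * y \<Longrightarrow> y * k = k * y"
    by (rule sqrt_one_minus_exists[OF x]) blast
  have comm: "s * k = k * s" by (rule k(3)) (simp add: mult.assoc)
  \<comment> \<open>The element \<open>s + i\<surd>(1 - s\<^sup>2)\<close> is unitary and has \<open>\<surd>(1 - s\<^sup>2)\<close> as imaginary part.\<close>
  define u where "u = s + \<i> *\<^sub>C k"
  have au: "adj u = s - \<i> *\<^sub>C k"
    by (simp add: u_def adj_add adj_scaleC s k scaleC_minus_left)
  have "adj u * u = (s - \<i> *\<^sub>C k) * (s + \<i> *\<^sub>C k)" by (subst au) (simp add: u_def)
  also have "\<dots> = 1"
    by (simp add: algebra_simps scaleC_mult_left scaleC_mult_right scaleC_scaleC comm scaleC_minus_one scaleC_add_right scaleC_diff_right k)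
  finally have "norm u = 1" using norm_adj_mult[of u]
    by (metis norm_ge_zero norm_one one_power2 power2_eq_imp_eq zero_le_one)
  moreover have "(2 * \<i>) *\<^sub>C k = u - adj u"
    by (subst au) (simp add: u_def flip: scaleC_add_left)
  hence "2 * norm k = norm (u - adj u)"
    using norm_scaleC[of "2 * \<i>" k] by (simp add: norm_mult)
  ultimately have "norm k \<le> 1"
    using norm_triangle_ineq4[of u "adj u"] by simp
  hence "norm (k * k) \<le> 1" by (simp add: norm_selfadj_sq k(1) power_le_one)
  thus ?thesis using k(2) by simp
qed

text \<open>Together with its converse \<open>norm_bound_pos\<close> this characterizes the positive elements among the
  selfadjoint ones by the norm, in a form that is visibly stable under addition.\<close>

lemma pos_norm_bound:
  fixes h :: "'a::cstar_alg_1"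
  assumes "pos h" "norm h \<le> t"
  shows "norm (of_real t - h) \<le> t"
proof (cases "t = 0")
  case True
  thus ?thesis using assms by simp
next
  case False
  hence t: "t > 0" using assms norm_ge_zero[of h] by linarith
  obtain s where s: "adj s = s" "h = s * s" using assms by (auto simp: pos_def)
  have "(norm s)\<^sup>2 \<le> t" using assms(2) norm_selfadj_sq[OF s(1)] by (simp add: s(2))
  hence ns: "norm s \<le> sqrt t" by (rule real_le_rsqrt)
  have "norm (1 - (inverse (sqrt t) *\<^sub>R s) * (inverse (sqrt t) *\<^sub>R s)) \<le> 1"
    by (rule norm_one_minus_sq) (use s ns t in \<open>auto simp: adj_scaleR field_simps\<close>)
  also have "(inverse (sqrt t) *\<^sub>R s) * (inverse (sqrt t) *\<^sub>R s) = inverse t *\<^sub>R h"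
    using t by (simp add: s field_simps)
  finally have "t * norm (1 - inverse t *\<^sub>R h) \<le> t" using t by simp
  also have "t * norm (1 - inverse t *\<^sub>R h) = norm (t *\<^sub>R (1 - inverse t *\<^sub>R h))" using t by simp
  also have "t *\<^sub>R (1 - inverse t *\<^sub>R h) = of_real t - h"
    using t by (simp add: scaleR_diff_right of_real_def)
  finally show ?thesis .
qed

lemma norm_bound_sqrt:
  fixes h :: "'a::cstar_alg_1"
  assumes "adj h = h" "norm (of_real t - h) \<le> t"
  obtains s where "adj s = s" "s * s = h" "\<And>y. y * h = h * y \<Longrightarrow> y * s = s * y"
    "norm (of_real (sqrt t) - s) \<le> sqrt t"
proof (cases "t = 0")
  case True
  hence "h = 0" using assms by simp
  thus thesis using True by (intro that[of 0]) auto
next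
  case False
  hence t: "t > 0" using assms norm_ge_zero[of "of_real t - h"] by linarith
  define x where "x = 1 - inverse t *\<^sub>R h"
  have hx: "h = t *\<^sub>R (1 - x)" using t by (simp add: x_def)
  have "of_real t - h = t *\<^sub>R x" using t by (simp add: x_def scaleR_diff_right of_real_def)
  hence "norm x \<le> 1" using assms(2) t by simp
  moreover have "adj x = x" by (simp add: x_def adj_diff adj_scaleR assms)
  ultimately obtain s where s: "adj s = s" "s * s = 1 - x" "\<And>y. y * x = x * y \<Longrightarrow> y * s = s * y"
    "norm (1 - s) \<le> 1"
    using sqrt_one_minus_exists[of x] by blast
  show thesis
  proof (rule that[of "sqrt t *\<^sub>R s"])
    show "(sqrt t *\<^sub>R s) * (sqrt t *\<^sub>R s) = h" using t by (simp add: s hx)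
    fix y assume "y * h = h * y"
    hence "y * x = x * y" by (simp add: x_def algebra_simps)
    thus "y * (sqrt t *\<^sub>R s) = (sqrt t *\<^sub>R s) * y" by (simp add: s)
  next
    have "of_real (sqrt t) - sqrt t *\<^sub>R s = sqrt t *\<^sub>R (1 - s)"
      by (simp add: scaleR_diff_right of_real_def)
    thus "norm (of_real (sqrt t) - sqrt t *\<^sub>R s) \<le> sqrt t" using s(4) t by (simp add: mult_left_le)
  qed (simp add: adj_scaleR s)
qed

lemma norm_bound_pos:
  fixes h :: "'a::cstar_alg_1"
  assumes "adj h = h" "norm (of_real t - h) \<le> t"
  shows "pos h"
proof -
  obtain s where "adj s = s" "s * s = h" by (rule norm_bound_sqrt[OF assms])
  thus ?thesis unfolding pos_def by (intro exI[of _ s]) simp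
qed

lemma pos_iff_norm:
  fixes h :: "'a::cstar_alg_1"
  assumes "norm h \<le> t"
  shows "pos h \<longleftrightarrow> adj h = h \<and> norm (of_real t - h) \<le> t"
proof
  assume "pos h"
  thus "adj h = h \<and> norm (of_real t - h) \<le> t" using pos_norm_bound[OF _ assms] pos_selfadj by simp
qed (rule norm_bound_pos[of _ t], simp_all)

lemma pos_sqrt:
  fixes h :: "'a::cstar_alg_1"
  assumes "pos h"
  obtains s where "pos s" "s * s = h" "\<And>y. y * h = h * y \<Longrightarrow> y * s = s * y"
proof -
  obtain s where s: "adj s = s" "s * s = h" "\<And>y. y * h = h * y \<Longrightarrow> y * s = s * y"
    "norm (of_real (sqrt (norm h)) - s) \<le> sqrt (norm h)"
    by (rule norm_bound_sqrt[OF pos_selfadj[OF assms] pos_norm_bound[OF assms order_refl]])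
      (rule that)
  have "pos s" by (rule norm_bound_pos[OF s(1,4)])
  thus thesis by (rule that[OF _ s(2,3)])
qed

lemma pos_add:
  fixes a b :: "'a::cstar_alg_1"
  assumes "pos a" "pos b"
  shows "pos (a + b)"
proof -
  have "norm (of_real (norm a + norm b) - (a + b)) \<le> norm (of_real (norm a) - a) + norm (of_real (norm b) - b)"
    using norm_triangle_ineq[of "of_real (norm a) - a" "of_real (norm b) - b"] by (simp add: algebra_simps)
  also have "\<dots> \<le> norm a + norm b"
    using pos_norm_bound[OF assms(1) order_refl] pos_norm_bound[OF assms(2) order_refl] by simp
  finally show ?thesis
    using pos_iff_norm[OF norm_triangle_ineq, of a b] assms by (simp add: adj_add pos_selfadj)
qed

lemma pos_sum:
  fixes f :: "'b \<Rightarrow> 'a::cstar_alg_1"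
  shows "(\<And>i. i \<in> I \<Longrightarrow> pos (f i)) \<Longrightarrow> pos (sum f I)"
  by (induction I rule: infinite_finite_induct) (simp_all add: pos_add)

lemma pos_norm_minus:
  fixes h :: "'a::cstar_alg_1"
  assumes "adj h = h"
  shows "pos (of_real (norm h) - h)"
  by (rule norm_bound_pos[of _ "norm h"]) (simp_all add: adj_diff assms)

text \<open>If \<open>0 \<le> a \<le> \<beta>\<close> then \<open>u = \<surd>a + i\<surd>(\<beta> - a)\<close> satisfies \<open>u\<^sup>*u = \<beta>\<close>, and \<open>\<surd>a\<close> is its real part.\<close>

lemma pos_le_norm:
  fixes a :: "'a::cstar_alg_1"
  assumes a: "pos a" and b: "pos (of_real \<beta> - a)" and "\<beta> \<ge> 0"
  shows "norm a \<le> \<beta>"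
proof -
  obtain s where s: "adj s = s" "s * s = a" "\<And>y. y * a = a * y \<Longrightarrow> y * s = s * y"
    by (rule pos_sqrt[OF a]) (rule that[OF pos_selfadj])
  obtain k where k: "adj k = k" "k * k = of_real \<beta> - a"
    "\<And>y. y * (of_real \<beta> - a) = (of_real \<beta> - a) * y \<Longrightarrow> y * k = k * y"
    by (rule pos_sqrt[OF b]) (rule that[OF pos_selfadj])
  have "a * k = k * a" by (rule k(3)) (simp add: algebra_simps of_real_def)
  hence comm: "s * k = k * s" by (metis s(3))
  define u where "u = s + \<i> *\<^sub>C k"
  have au: "adj u = s - \<i> *\<^sub>C k"
    by (simp add: u_def adj_add adj_scaleC s k scaleC_minus_left)
  have "adj u * u = (s - \<i> *\<^sub>C k) * (s + \<i> *\<^sub>C k)" by (subst au) (simp add: u_def)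
  also have "\<dots> = of_real \<beta>"
    by (simp add: algebra_simps scaleC_mult_left scaleC_mult_right scaleC_scaleC comm scaleC_minus_one scaleC_add_right scaleC_diff_right k s)
  finally have nu: "(norm u)\<^sup>2 = \<beta>" using \<open>\<beta> \<ge> 0\<close> norm_adj_mult[of u] by simp
  have "2 *\<^sub>R s = u + adj u" by (subst au) (simp add: u_def scaleR_2)
  moreover have "2 * norm s = norm (2 *\<^sub>R s)" by simp
  ultimately have "2 * norm s = norm (u + adj u)" by simp
  hence "norm s \<le> norm u" using norm_triangle_ineq[of u "adj u"] by simp
  hence "(norm s)\<^sup>2 \<le> (norm u)\<^sup>2" by (simp add: power_mono)
  moreover have "norm a = (norm s)\<^sup>2" using norm_selfadj_sq[OF s(1)] unfolding s(2) .
  ultimately show ?thesis using nu by simp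
qed

lemma pos_norm_mono:
  fixes a b :: "'a::cstar_alg_1"
  assumes a: "pos a" and b: "pos (b - a)"
  shows "norm a \<le> norm b"
proof (rule pos_le_norm[OF a])
  have eq: "a + (b - a) = b" "(of_real (norm b) - b) + (b - a) = of_real (norm b) - a" by simp_all
  have "pos b" using pos_add[OF a b] unfolding eq .
  from pos_add[OF pos_norm_minus[OF pos_selfadj[OF this]] b]
  show "pos (of_real (norm b) - a)" unfolding eq .
qed (rule norm_ge_zero)

lemma pos_antisym:
  fixes a :: "'a::cstar_alg_1"
  assumes "pos a" "pos (- a)" shows "a = 0"
proof -
  have "norm a \<le> 0" by (rule pos_le_norm) (use assms in simp_all)
  thus ?thesis by simp
qed

text \<open>The spectra of \<open>c\<^sup>*c\<close> and \<open>cc\<^sup>*\<close> agree up to zero; the following is the part of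
  this that is needed, proved by comparing the norms of powers of \<open>t + c\<^sup>*c\<close> and \<open>t + cc\<^sup>*\<close>.\<close>

lemma neg_swap:
  fixes c :: "'a::cstar_alg_1"
  assumes "pos (- (adj c * c))"
  shows "pos (- (c * adj c))"
proof (cases "c = 0")
  case False
  define t where "t = (norm c)\<^sup>2"
  have t: "t > 0" using False by (simp add: t_def)
  define A where "A = of_real t + adj c * c"
  define D where "D = of_real t + c * adj c"
  have nA: "norm A \<le> t"
    using pos_norm_bound[OF assms, of t] norm_adj_mult[of c] by (simp add: A_def t_def)
  have DA: "c * A ^ n = D ^ n * c" for n
  proof (induction n)
    case (Suc n)
    have "c * A ^ Suc n = (c * A) * A ^ n" by (simp add: mult.assoc)
    also have "c * A = D * c" by (simp add: A_def D_def algebra_simps of_real_def)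
    also have "D * c * A ^ n = D ^ Suc n * c" by (simp add: mult.assoc Suc)
    finally show ?case .
  qed simp
  \<comment> \<open>\<open>G n = (\<Sum>j<n. t\<^bsup>n-1-j\<^esup> A\<^sup>j)\<close>, so that \<open>D\<^sup>n = t\<^sup>n + c (G n) c\<^sup>*\<close> grows at most like \<open>(n + 1) t\<^sup>n\<close>.\<close>
  define G where "G = rec_nat 0 (\<lambda>n g. t *\<^sub>R g + A ^ n)"
  have G0: "G 0 = 0" and GS: "G (Suc n) = t *\<^sub>R G n + A ^ n" for n by (simp_all add: G_def)
  have DG: "D ^ n = of_real (t ^ n) + c * G n * adj c" for n
  proof (induction n)
    case (Suc n)
    have "D ^ Suc n = D ^ n * D" by (simp add: power_commutes)
    also have "\<dots> = t *\<^sub>R D ^ n + (D ^ n * c) * adj c"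
      unfolding D_def by (simp add: distrib_left of_real_def mult.assoc)
    also have "\<dots> = t *\<^sub>R (of_real (t ^ n) + c * G n * adj c) + (c * A ^ n) * adj c"
      by (simp add: DA Suc)
    also have "\<dots> = of_real (t ^ Suc n) + c * G (Suc n) * adj c"
      by (simp add: GS algebra_simps of_real_def)
    finally show ?case .
  qed (simp add: G0)
  have nG: "t * norm (G n) \<le> n * t ^ n" for n
  proof (induction n)
    case (Suc n)
    have "norm (A ^ n) \<le> t ^ n" using norm_power_ineq[of A n] power_mono[OF nA, of n] by simp
    hence "norm (G (Suc n)) \<le> t * norm (G n) + t ^ n"
      unfolding GS using norm_triangle_ineq[of "t *\<^sub>R G n" "A ^ n"] t by simp
    also have "\<dots> \<le> (n + 1) * t ^ n" using Suc by (simp add: algebra_simps)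
    finally have "t * norm (G (Suc n)) \<le> t * ((n + 1) * t ^ n)" using t by simp
    thus ?case by (simp add: algebra_simps)
  qed (simp add: G0)
  have nD: "norm (D ^ n) \<le> (real n + 1) * t ^ n" for n
  proof -
    have "norm (c * G n * adj c) \<le> norm c * norm (G n) * norm c"
      by (metis norm_adj norm_mult_ineq mult_right_mono norm_ge_zero order_trans)
    also have "\<dots> = t * norm (G n)" by (simp add: t_def power2_eq_square)
    finally have "norm (c * G n * adj c) \<le> n * t ^ n" using nG[of n] by linarith
    moreover have "norm (of_real (t ^ n) :: 'a) = t ^ n" using t by (simp only: norm_of_real) simp
    ultimately show ?thesis
      unfolding DG using norm_triangle_ineq[of "of_real (t ^ n)" "c * G n * adj c"] by (simp add: algebra_simps)
  qed
  have sD: "adj D = D" by (simp add: D_def adj_add adj_mult)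
  have "norm D \<le> t"
  proof (rule ccontr)
    assume "\<not> norm D \<le> t"
    \<comment> \<open>For powers \<open>n\<close> of 2 one has \<open>\<parallel>D\<^sup>n\<parallel> = \<parallel>D\<parallel>\<^sup>n\<close>, which cannot stay below \<open>(n + 1) t\<^sup>n\<close> if \<open>\<parallel>D\<parallel> > t\<close>.\<close>
    define r where "r = norm D / t"
    have r: "r > 1" using \<open>\<not> norm D \<le> t\<close> t by (simp add: r_def)
    have le: "r ^ (2 ^ m) \<le> 2 ^ m + 1" for m :: nat
    proof -
      have "norm D ^ (2 ^ m) \<le> (2 ^ m + 1) * t ^ (2 ^ m)"
        using nD[of "2 ^ m"] norm_selfadj_power[OF sD, of m] by simp
      thus ?thesis using t by (simp add: r_def power_divide divide_le_eq)
    qed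
    obtain k :: nat where k: "3 / (r - 1)\<^sup>2 < real k" using reals_Archimedean2 by blast
    define N :: real where "N = 2 ^ k"
    have N: "N > real k" "N \<ge> 1" by (simp_all add: N_def of_nat_less_two_power)
    have "1 + N * (r - 1) \<le> (1 + (r - 1)) ^ (2 ^ k)"
      using Bernoulli_inequality[of "r - 1" "2 ^ k"] r by (simp add: N_def)
    hence "(N * (r - 1))\<^sup>2 \<le> (r ^ (2 ^ k))\<^sup>2" using r N by (intro power_mono) auto
    also have "\<dots> \<le> 2 * N + 1"
      using le[of "Suc k"] by (simp add: N_def mult.commute flip: power_mult)
    also have "\<dots> \<le> 3 * N" using N by simp
    finally have "N * (r - 1)\<^sup>2 \<le> 3" using N by (simp add: power2_eq_square mult_ac)
    hence "N \<le> 3 / (r - 1)\<^sup>2" using r by (subst pos_le_divide_eq) auto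
    thus False using k N by linarith
  qed
  hence "norm (of_real t - - (c * adj c)) \<le> t" by (simp add: D_def)
  moreover have "adj (- (c * adj c)) = - (c * adj c)" by (simp add: adj_minus adj_mult)
  ultimately show ?thesis by (intro norm_bound_pos[of _ t])
qed simp

text \<open>With \<open>c = x + iy\<close>, where \<open>x\<close> and \<open>y\<close> are selfadjoint, the element is \<open>2x\<^sup>2 + 2y\<^sup>2\<close>.\<close>

lemma pos_adj_mult_add:
  fixes c :: "'a::cstar_alg_1"
  shows "pos (adj c * c + c * adj c)"
proof -
  define x where "x = (1/2) *\<^sub>R (c + adj c)"
  define y where "y = (- \<i> / 2) *\<^sub>C (c - adj c)"
  have sx: "adj x = x" by (simp add: x_def adj_scaleR adj_add add.commute)
  have sy: "adj y = y"
    by (simp add: y_def adj_scaleC adj_diff scaleC_diff_right scaleC_minus_left)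
  have y2: "y * y = (- 1/4) *\<^sub>R ((c - adj c) * (c - adj c))"
  proof -
    have "y * y = (- 1/4) *\<^sub>C ((c - adj c) * (c - adj c))"
      by (simp add: y_def scaleC_mult_left scaleC_mult_right scaleC_scaleC)
    thus ?thesis using scaleC_of_real[of "-1/4" "(c - adj c) * (c - adj c)"] by simp
  qed
  have x2: "x * x = (1/4) *\<^sub>R ((c + adj c) * (c + adj c))" by (simp add: x_def)
  have "(c + adj c) * (c + adj c) - (c - adj c) * (c - adj c) = 2 *\<^sub>R (adj c * c + c * adj c)"
    by (simp add: scaleR_2 distrib_left distrib_right left_diff_distrib right_diff_distrib)
  hence "adj c * c + c * adj c = (1/2) *\<^sub>R ((c + adj c) * (c + adj c) - (c - adj c) * (c - adj c))"
    by simp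
  also have "\<dots> = 2 *\<^sub>R (x * x) + 2 *\<^sub>R (y * y)"
    unfolding x2 y2 by (simp add: scaleR_diff_right)
  finally have "adj c * c + c * adj c = 2 *\<^sub>R (x * x) + 2 *\<^sub>R (y * y)" .
  moreover have "pos (x * x)" "pos (y * y)" unfolding pos_def using sx sy by blast+
  ultimately show ?thesis by (simp add: pos_add pos_scaleR)
qed

text \<open>The theorem of Fukamiya and Kaplansky. With \<open>h = b\<^sup>*b\<close>, \<open>p = \<bar>h\<bar>\<close> and \<open>x = p - h\<close>, the element
  \<open>c = bx\<close> satisfies \<open>c\<^sup>*c = - xpx \<le> 0\<close>, whence \<open>c = 0\<close>.\<close>

theorem pos_adj_mult:
  fixes b :: "'a::cstar_alg_1"
  shows "pos (adj b * b)"
proof -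
  define h where "h = adj b * b"
  have sh: "adj h = h" by (simp add: h_def adj_mult)
  have "pos (h * h)" using sh by (auto simp: pos_def)
  then obtain p where p: "pos p" "p * p = h * h" "\<And>y. y * (h * h) = (h * h) * y \<Longrightarrow> y * p = p * y"
    by (rule pos_sqrt) blast
  have hp: "h * p = p * h" by (rule p(3)) (simp add: mult.assoc)
  obtain r where r: "pos r" "r * r = p" "\<And>y. y * p = p * y \<Longrightarrow> y * r = r * y"
    by (rule pos_sqrt[OF p(1)]) blast
  have hr: "h * r = r * h" by (rule r(3)) (rule hp)
  have pr: "p * r = r * p" by (rule r(3)) simp
  define x where "x = p - h"
  have sx: "adj x = x" by (simp add: x_def adj_diff sh pos_selfadj p)
  have xr: "x * r = r * x" by (simp add: x_def algebra_simps hr pr)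
  have hx: "h * x = - (p * x)" by (simp add: x_def algebra_simps hp p)
  define c where "c = b * x"
  have "adj c * c = x * (h * x)" by (simp add: c_def h_def adj_mult sx mult.assoc)
  also have "\<dots> = - (x * (r * r) * x)" by (simp add: hx r mult.assoc)
  also have "x * (r * r) * x = (r * x) * (r * x)" by (metis xr mult.assoc)
  finally have cc: "adj c * c = - ((r * x) * (r * x))" .
  have srx: "adj (r * x) = r * x" by (simp add: adj_mult sx pos_selfadj r xr)
  have neg: "pos (- (adj c * c))" unfolding cc pos_def using srx by auto
  have "pos (adj c * c)" using pos_add[OF pos_adj_mult_add[of c] neg_swap[OF neg]] by simp
  hence "adj c * c = 0" using neg by (rule pos_antisym)
  hence "r * x = 0" using cc srx by (auto intro: selfadj_sq_zero)
  hence px: "p * x = 0" by (simp add: mult.assoc flip: r(2))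
  hence "x * x = 0" using hx by (simp add: x_def left_diff_distrib)
  hence "x = 0" using sx by (rule selfadj_sq_zero[rotated])
  thus ?thesis using p(1) by (simp add: x_def h_def)
qed

lemma pos_conj:
  fixes a :: "'a::cstar_alg_1"
  assumes "pos a"
  shows "pos (adj c * a * c)"
proof -
  obtain s where s: "adj s = s" "a = s * s" using assms by (auto simp: pos_def)
  have "adj c * a * c = adj (s * c) * (s * c)" by (simp add: s adj_mult mult.assoc)
  thus ?thesis by (simp add: pos_adj_mult)
qed

section \<open>Unitization\<close>

text \<open>\<open>Unz a z\<close> stands for \<open>a + z1\<close>.\<close>

datatype 'a unz = Unz (upart: 'a) (uscal: complex)

text \<open>Left multiplication by \<open>a + z1\<close> as an operator on the algebra, and its operator norm.\<close>

definition mulop :: "'a::cstar_alg \<Rightarrow> complex \<Rightarrow> 'a \<Rightarrow> 'a" where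
  "mulop a z b = a * b + z *\<^sub>C b"

definition opn :: "'a::cstar_alg \<Rightarrow> complex \<Rightarrow> real" where
  "opn a z = (SUP b\<in>{b. norm b \<le> 1}. norm (mulop a z b))"

lemma norm_mulop_le: "norm (mulop a z b) \<le> (norm a + cmod z) * norm b"
  unfolding mulop_def
  by (rule order_trans[OF norm_triangle_ineq]) (use norm_mult_ineq[of a b] in \<open>simp add: norm_scaleC distrib_right\<close>)

lemma mulop_scaleR: "mulop a z (r *\<^sub>R b) = r *\<^sub>R mulop a z b"
  by (simp add: mulop_def scaleC_add_right scaleC_mult_right scaleC_scaleC mult.commute flip: scaleC_of_real)

lemma opn_bdd: "bdd_above ((\<lambda>b. norm (mulop a z b)) ` {b. norm b \<le> 1})"
proof (rule bdd_aboveI2)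
  fix b :: 'a assume "b \<in> {b. norm b \<le> 1}"
  thus "norm (mulop a z b) \<le> norm a + cmod z"
    using norm_mulop_le[of a z b] mult_left_le[of "norm b" "norm a + cmod z"] by simp
qed

lemma norm_mulop: "norm (mulop a z b) \<le> opn a z * norm b"
proof (cases "b = 0")
  case True
  thus ?thesis by (simp add: mulop_def)
next
  case False
  have "norm (mulop a z (inverse (norm b) *\<^sub>R b)) \<le> opn a z"
    unfolding opn_def by (rule cSUP_upper[OF _ opn_bdd]) (use False in auto)
  thus ?thesis using False by (simp add: mulop_scaleR field_simps)
qed

lemma opn_le:
  assumes "\<And>b. norm b \<le> 1 \<Longrightarrow> norm (mulop a z b) \<le> K"
  shows "opn a z \<le> K"
  unfolding opn_def by (rule cSUP_least) (use assms in \<open>auto intro: exI[of _ 0]\<close>)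

lemma opn_nonneg: "opn a z \<ge> 0"
proof -
  have "norm (mulop a z 0) \<le> opn a z"
    unfolding opn_def by (rule cSUP_upper[OF _ opn_bdd]) simp
  thus ?thesis by (simp add: mulop_def)
qed

lemma norm_mulop_le_opn: "norm b \<le> 1 \<Longrightarrow> norm (mulop a z b) \<le> opn a z"
  using norm_mulop[of a z b] mult_left_le[OF _ opn_nonneg, of "norm b" a z] by simp

lemma opn_le_sum: "opn a z \<le> norm a + cmod z"
proof (rule opn_le)
  fix b :: 'a assume "norm b \<le> 1"
  thus "norm (mulop a z b) \<le> norm a + cmod z"
    using norm_mulop_le[of a z b] mult_left_le[of "norm b" "norm a + cmod z"] by simp
qed

lemma opn_triangle: "opn (a + a') (z + z') \<le> opn a z + opn a' z'"
proof (rule opn_le)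
  fix b :: 'a assume b: "norm b \<le> 1"
  have "mulop (a + a') (z + z') b = mulop a z b + mulop a' z' b"
    by (simp add: mulop_def algebra_simps scaleC_add_left)
  thus "norm (mulop (a + a') (z + z') b) \<le> opn a z + opn a' z'"
    using norm_triangle_ineq[of "mulop a z b" "mulop a' z' b"] norm_mulop_le_opn[OF b, of a z]
      norm_mulop_le_opn[OF b, of a' z'] by simp
qed

lemma opn_scaleC_le: "opn (w *\<^sub>C a) (w * z) \<le> cmod w * opn a z"
proof (rule opn_le)
  fix b :: 'a assume b: "norm b \<le> 1"
  have "mulop (w *\<^sub>C a) (w * z) b = w *\<^sub>C mulop a z b"
    by (simp add: mulop_def scaleC_mult_left scaleC_add_right scaleC_scaleC)
  thus "norm (mulop (w *\<^sub>C a) (w * z) b) \<le> cmod w * opn a z"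
    using norm_mulop_le_opn[OF b, of a z] by (simp add: norm_scaleC mult_left_mono)
qed

lemma opn_scaleC: "opn (w *\<^sub>C a) (w * z) = cmod w * opn a z"
proof (cases "w = 0")
  case True
  have "opn (0::'a) 0 \<le> norm (0::'a) + cmod 0" by (rule opn_le_sum)
  thus ?thesis using True opn_nonneg[of "0::'a" 0] by simp
next
  case False
  have "cmod w * opn a z = cmod w * opn (inverse w *\<^sub>C (w *\<^sub>C a)) (inverse w * (w * z))"
    using False by (simp add: scaleC_scaleC flip: mult.assoc)
  also have "\<dots> \<le> cmod w * (cmod (inverse w) * opn (w *\<^sub>C a) (w * z))"
    by (intro mult_left_mono opn_scaleC_le) simp
  also have "\<dots> = opn (w *\<^sub>C a) (w * z)" using False by (simp add: norm_inverse)
  finally show ?thesis using opn_scaleC_le[of w a z] by simp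
qed

lemma opn_mult: "opn (a * a' + z *\<^sub>C a' + z' *\<^sub>C a) (z * z') \<le> opn a z * opn a' z'"
proof (rule opn_le)
  fix b :: 'a assume b: "norm b \<le> 1"
  have "mulop (a * a' + z *\<^sub>C a' + z' *\<^sub>C a) (z * z') b = mulop a z (mulop a' z' b)"
    by (simp add: mulop_def algebra_simps scaleC_mult_left scaleC_mult_right scaleC_add_right scaleC_scaleC)
  also have "norm \<dots> \<le> opn a z * norm (mulop a' z' b)" by (rule norm_mulop)
  also have "\<dots> \<le> opn a z * opn a' z'"
    by (intro mult_left_mono norm_mulop_le_opn opn_nonneg b)
  finally show "norm (mulop (a * a' + z *\<^sub>C a' + z' *\<^sub>C a) (z * z') b) \<le> opn a z * opn a' z'" .
qed

text \<open>The C*-identity for the operator norm, from \<open>\<parallel>xb\<parallel>\<^sup>2 = \<parallel>b\<^sup>*(x\<^sup>*x)b\<parallel>\<close> with \<open>x = a + z1\<close>.\<close>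

lemma opn_adj_mult_ge:
  "(opn a z)\<^sup>2 \<le> opn (adj a * a + cnj z *\<^sub>C a + z *\<^sub>C adj a) (cnj z * z)" (is "_ \<le> ?R")
proof -
  have "opn a z \<le> sqrt ?R"
  proof (rule opn_le)
    fix b :: 'a assume b: "norm b \<le> 1"
    have "adj (mulop a z b) * mulop a z b = adj b * mulop (adj a * a + cnj z *\<^sub>C a + z *\<^sub>C adj a) (cnj z * z) b"
      by (simp add: mulop_def adj_add adj_mult adj_scaleC algebra_simps scaleC_mult_left
          scaleC_mult_right scaleC_add_right scaleC_scaleC)
    hence "(norm (mulop a z b))\<^sup>2 \<le> norm b * norm (mulop (adj a * a + cnj z *\<^sub>C a + z *\<^sub>C adj a) (cnj z * z) b)"
      by (metis norm_adj norm_adj_mult norm_mult_ineq)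
    also have "\<dots> \<le> 1 * ?R"
      by (intro mult_mono norm_mulop_le_opn b) auto
    finally show "norm (mulop a z b) \<le> sqrt ?R" by (simp add: real_le_rsqrt)
  qed
  hence "(opn a z)\<^sup>2 \<le> (sqrt ?R)\<^sup>2" by (intro power_mono opn_nonneg)
  thus ?thesis by (simp add: opn_nonneg)
qed

lemma opn_adj: "opn (adj a) (cnj z) = opn a z"
proof -
  have le: "opn c w \<le> opn (adj c) (cnj w)" for c :: 'a and w
  proof (cases "opn c w = 0")
    case False
    have "(opn c w)\<^sup>2 \<le> opn (adj c) (cnj w) * opn c w"
      using opn_adj_mult_ge[of c w] opn_mult[of "adj c" c "cnj w" w] by simp
    thus ?thesis using False opn_nonneg[of c w] by (simp add: power2_eq_square)
  qed (simp add: opn_nonneg)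
  show ?thesis using le[of a z] le[of "adj a" "cnj z"] by simp
qed

lemma opn_cstar: "opn (adj a * a + cnj z *\<^sub>C a + z *\<^sub>C adj a) (cnj z * z) = (opn a z)\<^sup>2"
  using opn_adj_mult_ge[of a z] opn_mult[of "adj a" a "cnj z" z] by (simp add: opn_adj power2_eq_square)

lemma opn_zero_right: "opn a 0 = norm a"
proof (rule antisym)
  show "opn a 0 \<le> norm a" using opn_le_sum[of a 0] by simp
  have "norm (a * adj a) \<le> opn a 0 * norm a"
    using norm_mulop[of a 0 "adj a"] by (simp add: mulop_def)
  moreover have "norm (a * adj a) = norm a * norm a"
    using norm_adj_mult[of "adj a"] by (simp add: power2_eq_square)
  ultimately show "norm a \<le> opn a 0" by (cases "a = 0") (auto simp: opn_nonneg)
qed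

text \<open>The operator norm alone is only a seminorm if the algebra already has a unit. The maximum with
  the modulus of the scalar part is a C*-norm in every case.\<close>

instantiation unz :: (cstar_alg) real_normed_vector
begin

definition "0 = Unz 0 0"
definition "x + y = Unz (upart x + upart y) (uscal x + uscal y)"
definition "- x = Unz (- upart x) (- uscal x)"
definition "x - y = Unz (upart x - upart y) (uscal x - uscal y)"
definition "r *\<^sub>R x = Unz (r *\<^sub>R upart x) (r *\<^sub>R uscal x)"
definition "norm x = max (cmod (uscal x)) (opn (upart x) (uscal x))"
definition "sgn x = (inverse (norm x) *\<^sub>R x :: 'a unz)"
definition "dist x y = (norm (x - y) :: real)" for x y :: "'a unz"
definition [code del]: "(uniformity :: ('a unz \<times> 'a unz) filter) = (INF e\<in>{0 <..}. principal {(x, y). dist x y < e})"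
definition [code del]: "open U \<longleftrightarrow> (\<forall>x\<in>U. \<forall>\<^sub>F (x', y) in uniformity. x' = x \<longrightarrow> y \<in> U)" for U :: "'a unz set"

lemmas unz_simps = zero_unz_def plus_unz_def uminus_unz_def minus_unz_def scaleR_unz_def

instance
proof
  fix x y :: "'a unz" and r s :: real
  show "(norm x = 0) = (x = 0)"
  proof
    assume n: "norm x = 0"
    have "cmod (uscal x) \<le> norm x" "opn (upart x) (uscal x) \<le> norm x"
      by (auto simp: norm_unz_def)
    hence "uscal x = 0" "opn (upart x) (uscal x) = 0"
      using n opn_nonneg[of "upart x" "uscal x"] by auto
    hence "upart x = 0" using opn_zero_right[of "upart x"] by simp
    thus "x = 0" using \<open>uscal x = 0\<close> by (simp add: unz_simps unz.expand)
  next
    assume "x = 0"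
    thus "norm x = 0" by (simp add: unz_simps norm_unz_def opn_zero_right)
  qed
  show "norm (x + y) \<le> norm x + norm y"
    using norm_triangle_ineq[of "uscal x" "uscal y"] opn_triangle[of "upart x" "upart y" "uscal x" "uscal y"]
    by (auto simp: norm_unz_def unz_simps)
  show "norm (r *\<^sub>R x) = \<bar>r\<bar> * norm x"
    using opn_scaleC[of "of_real r" "upart x" "uscal x"]
    by (simp add: norm_unz_def unz_simps scaleC_of_real scaleR_conv_of_real norm_mult max_mult_distrib_left)
qed (auto simp: unz_simps unz.expand algebra_simps sgn_unz_def dist_unz_def uniformity_unz_def open_unz_def)

end

lemma norm_unz_ge:
  fixes x :: "'a::cstar_alg unz"
  shows "cmod (uscal x) \<le> norm x" "norm (upart x) \<le> 2 * norm x"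
proof -
  show s: "cmod (uscal x) \<le> norm x" by (simp add: norm_unz_def)
  have "norm (upart x) = opn (upart x + 0) (uscal x + (- uscal x))" by (simp add: opn_zero_right)
  also have "\<dots> \<le> opn (upart x) (uscal x) + opn (0::'a) (- uscal x)" by (rule opn_triangle)
  also have "opn (0::'a) (- uscal x) \<le> cmod (uscal x)" using opn_le_sum[of "0::'a" "- uscal x"] by simp
  also have "opn (upart x) (uscal x) \<le> norm x" by (simp add: norm_unz_def)
  finally show "norm (upart x) \<le> 2 * norm x" using s by simp
qed

lemma norm_unz_le: "norm x \<le> norm (upart x) + cmod (uscal x)"
  using opn_le_sum[of "upart x" "uscal x"] by (simp add: norm_unz_def)

instance unz :: (cstar_alg) banach
proof
  fix X :: "nat \<Rightarrow> 'a unz"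
  assume "Cauchy X"
  have "Cauchy (\<lambda>n. uscal (X n))"
  proof (rule metric_CauchyI)
    fix e :: real assume "e > 0"
    then obtain M where M: "\<And>m n. m \<ge> M \<Longrightarrow> n \<ge> M \<Longrightarrow> dist (X m) (X n) < e"
      using metric_CauchyD[OF \<open>Cauchy X\<close>] by metis
    show "\<exists>M. \<forall>m\<ge>M. \<forall>n\<ge>M. dist (uscal (X m)) (uscal (X n)) < e"
    proof (intro exI allI impI)
      fix m n assume "m \<ge> M" "n \<ge> M"
      from M[OF this] norm_unz_ge(1)[of "X m - X n"]
      show "dist (uscal (X m)) (uscal (X n)) < e" by (simp add: dist_norm unz_simps)
    qed
  qed
  moreover have "Cauchy (\<lambda>n. upart (X n))"
  proof (rule metric_CauchyI)
    fix e :: real assume "e > 0"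
    hence "e / 2 > 0" by simp
    then obtain M where M: "\<And>m n. m \<ge> M \<Longrightarrow> n \<ge> M \<Longrightarrow> dist (X m) (X n) < e / 2"
      using metric_CauchyD[OF \<open>Cauchy X\<close>] by metis
    show "\<exists>M. \<forall>m\<ge>M. \<forall>n\<ge>M. dist (upart (X m)) (upart (X n)) < e"
    proof (intro exI allI impI)
      fix m n assume "m \<ge> M" "n \<ge> M"
      from M[OF this] norm_unz_ge(2)[of "X m - X n"]
      show "dist (upart (X m)) (upart (X n)) < e" by (simp add: dist_norm unz_simps)
    qed
  qed
  ultimately obtain a z where a: "(\<lambda>n. upart (X n)) \<longlonglongrightarrow> a" and z: "(\<lambda>n. uscal (X n)) \<longlonglongrightarrow> z"
    by (metis Cauchy_convergent convergent_def)
  have "(\<lambda>n. norm (X n - Unz a z)) \<longlonglongrightarrow> 0"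
  proof (rule real_tendsto_sandwich[where f = "\<lambda>_. 0"])
    show "\<forall>\<^sub>F n in sequentially. norm (X n - Unz a z) \<le> norm (upart (X n) - a) + cmod (uscal (X n) - z)"
    proof (intro always_eventually allI)
      fix n show "norm (X n - Unz a z) \<le> norm (upart (X n) - a) + cmod (uscal (X n) - z)"
        using norm_unz_le[of "X n - Unz a z"] by (simp add: unz_simps)
    qed
    show "(\<lambda>n. norm (upart (X n) - a) + cmod (uscal (X n) - z)) \<longlonglongrightarrow> 0"
      using tendsto_norm_zero[OF LIM_zero[OF a]] tendsto_norm_zero[OF LIM_zero[OF z]]
      by (auto intro: tendsto_add_zero)
  qed auto
  hence "X \<longlonglongrightarrow> Unz a z" by (simp add: tendsto_norm_zero_iff LIM_zero_iff)
  thus "convergent X" by (rule convergentI)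
qed

instantiation unz :: (cstar_alg) cstar_alg_1
begin

definition "1 = Unz 0 1"
definition "x * y = Unz (upart x * upart y + uscal x *\<^sub>C upart y + uscal y *\<^sub>C upart x) (uscal x * uscal y)"
definition "z *\<^sub>C x = Unz (z *\<^sub>C upart x) (z * uscal x)"
definition "adj x = Unz (adj (upart x)) (cnj (uscal x))"

lemmas unz_simps' = unz_simps one_unz_def times_unz_def scaleC_unz_def adj_unz_def

instance
proof
  fix x y :: "'a unz" and z :: complex
  show "norm (x * y) \<le> norm x * norm y"
  proof -
    have "cmod (uscal x * uscal y) \<le> norm x * norm y"
      unfolding norm_mult by (intro mult_mono norm_unz_ge) auto
    moreover have "opn (upart x * upart y + uscal x *\<^sub>C upart y + uscal y *\<^sub>C upart x) (uscal x * uscal y)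
        \<le> opn (upart x) (uscal x) * opn (upart y) (uscal y)" by (rule opn_mult)
    moreover have "\<dots> \<le> norm x * norm y"
      by (intro mult_mono) (auto simp: norm_unz_def opn_nonneg le_max_iff_disj)
    ultimately show ?thesis unfolding norm_unz_def[of "x * y"] by (simp add: unz_simps')
  qed
  show "norm (1 :: 'a unz) = 1"
  proof -
    have "opn (0::'a) 1 \<le> 1" using opn_le_sum[of "0::'a" 1] by simp
    thus ?thesis by (simp add: norm_unz_def unz_simps')
  qed
  show "norm (z *\<^sub>C x) = cmod z * norm x"
    by (simp add: norm_unz_def unz_simps' opn_scaleC norm_mult max_mult_distrib_left)
  show "norm (adj x * x) = (norm x)\<^sup>2"
  proof -
    have "norm (adj x * x) = max ((cmod (uscal x))\<^sup>2) ((opn (upart x) (uscal x))\<^sup>2)"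
      by (simp add: norm_unz_def unz_simps' opn_cstar norm_mult power2_eq_square)
    also have "\<dots> = (norm x)\<^sup>2"
      unfolding norm_unz_def max_def using opn_nonneg[of "upart x" "uscal x"]
      by (auto simp: power_mono_iff)
    finally show ?thesis .
  qed
qed (auto simp: unz_simps' unz.expand algebra_simps scaleC_add_left scaleC_add_right scaleC_scaleC
    scaleC_of_real scaleR_conv_of_real scaleC_mult_left scaleC_mult_right adj_add adj_mult adj_scaleC
    simp flip: scaleC_of_real)

end

section \<open>Elementary facts on *-algebras with a C*-seminorm\<close>

lemma complex_ring_simps [simp]:
  "carrier complex_ring = UNIV" "mult complex_ring = (*)" "one complex_ring = 1"
  "zero complex_ring = 0" "add complex_ring = (+)"
  by (simp_all add: complex_ring_def)

lemma cring_complex_ring: "cring complex_ring"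
proof (rule cringI)
  show "abelian_group complex_ring"
    by (rule abelian_groupI) (auto simp: algebra_simps intro: exI[of _ "- x" for x])
  show "comm_monoid complex_ring" by (rule comm_monoidI) (auto simp: algebra_simps)
qed (auto simp: algebra_simps)

lemma a_inv_complex_ring [simp]: "\<ominus>\<^bsub>complex_ring\<^esub> z = - z"
proof -
  interpret cring complex_ring by (rule cring_complex_ring)
  show ?thesis by (rule minus_equality) simp_all
qed

text \<open>The seminorm may vanish on nonzero elements, and completeness is not required.\<close>

locale seminormed_star_algebra = star_algebra A for A :: "('a, 'm) cstar_scheme" (structure) +
  assumes seminorm: "is_cstar_seminorm A (nrm A)"

sublocale cstar_algebra \<subseteq> seminormed_star_algebra
  by unfold_locales (rule cstar_norm)

context star_algebra
begin

lemma smult_cl [simp, intro]: "a \<in> carrier A \<Longrightarrow> z \<odot> a \<in> carrier A"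
  by (rule smult_closed) simp_all

lemma mult_cl [simp, intro]: "a \<in> carrier A \<Longrightarrow> b \<in> carrier A \<Longrightarrow> a \<otimes> b \<in> carrier A"
  by (rule mult_closed)

lemma star_cl [simp, intro]: "a \<in> carrier A \<Longrightarrow> star A a \<in> carrier A"
  by (rule star_closed)

lemmas zero_cl [simp, intro] = M.zero_closed
lemmas uminus_cl [simp, intro] = M.a_inv_closed

lemma smult_radd: "a \<in> carrier A \<Longrightarrow> b \<in> carrier A \<Longrightarrow> z \<odot> (a \<oplus> b) = z \<odot> a \<oplus> z \<odot> b"
  using smult_r_distr[of z a b] by simp

lemma smult_ladd: "a \<in> carrier A \<Longrightarrow> (z + z') \<odot> a = z \<odot> a \<oplus> z' \<odot> a"
  using smult_l_distr[of z z' a] by simp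

lemma smult_smult: "a \<in> carrier A \<Longrightarrow> z \<odot> (z' \<odot> a) = (z * z') \<odot> a"
  using smult_assoc1[of z z' a] by simp

lemma smult_one' [simp]: "a \<in> carrier A \<Longrightarrow> 1 \<odot> a = a"
  using smult_one[of a] by simp

lemma smult_zero [simp]: "a \<in> carrier A \<Longrightarrow> 0 \<odot> a = \<zero>"
  using smult_l_null[of a] by simp

lemma smult_zero_right [simp]: "z \<odot> \<zero> = \<zero>"
  using smult_r_null[of z] by simp

lemma smult_minus_one: "a \<in> carrier A \<Longrightarrow> (-1) \<odot> a = \<ominus> a"
  using smult_l_minus[of 1 a] by simp

lemma smult_uminus: "a \<in> carrier A \<Longrightarrow> z \<odot> (\<ominus> a) = \<ominus> (z \<odot> a)"
  using smult_r_minus[of z a] by simp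

lemma uminus_mult: "a \<in> carrier A \<Longrightarrow> b \<in> carrier A \<Longrightarrow> (\<ominus> a) \<otimes> b = \<ominus> (a \<otimes> b)"
  using smult_mult[of a b "-1"] by (simp add: smult_minus_one)

lemma mult_uminus: "a \<in> carrier A \<Longrightarrow> b \<in> carrier A \<Longrightarrow> a \<otimes> (\<ominus> b) = \<ominus> (a \<otimes> b)"
  using mult_smult[of a b "-1"] by (simp add: smult_minus_one)

lemma star_uminus: "a \<in> carrier A \<Longrightarrow> star A (\<ominus> a) = \<ominus> star A a"
  using star_smult[of a "-1"] by (simp add: smult_minus_one)

lemma zero_mult [simp]: "a \<in> carrier A \<Longrightarrow> \<zero> \<otimes> a = \<zero>"
  using smult_mult[of "\<zero>" a 0] by simp

lemma mult_zero [simp]: "a \<in> carrier A \<Longrightarrow> a \<otimes> \<zero> = \<zero>"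
  using mult_smult[of a "\<zero>" 0] by simp

lemma star_zero [simp]: "star A \<zero> = \<zero>"
  using star_smult[of "\<zero>" 0] by simp

lemma diff_mult: "a \<in> carrier A \<Longrightarrow> b \<in> carrier A \<Longrightarrow> c \<in> carrier A \<Longrightarrow> (a \<ominus> b) \<otimes> c = a \<otimes> c \<ominus> b \<otimes> c"
  by (simp add: a_minus_def add_mult uminus_mult)

lemma mult_diff: "a \<in> carrier A \<Longrightarrow> b \<in> carrier A \<Longrightarrow> c \<in> carrier A \<Longrightarrow> c \<otimes> (a \<ominus> b) = c \<otimes> a \<ominus> c \<otimes> b"
  by (simp add: a_minus_def mult_add mult_uminus)

lemma star_diff: "a \<in> carrier A \<Longrightarrow> b \<in> carrier A \<Longrightarrow> star A (a \<ominus> b) = star A a \<ominus> star A b"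
  by (simp add: a_minus_def star_add star_uminus)

lemma smult_diff: "a \<in> carrier A \<Longrightarrow> b \<in> carrier A \<Longrightarrow> z \<odot> (a \<ominus> b) = z \<odot> a \<ominus> z \<odot> b"
  by (simp add: a_minus_def smult_radd smult_uminus)

lemma diff_self [simp]: "a \<in> carrier A \<Longrightarrow> a \<ominus> a = \<zero>"
  by (simp add: a_minus_def M.r_neg)

lemma diff_zero [simp]: "a \<in> carrier A \<Longrightarrow> a \<ominus> \<zero> = a"
  by (simp add: a_minus_def)

lemma uminus_diff: "a \<in> carrier A \<Longrightarrow> b \<in> carrier A \<Longrightarrow> \<ominus> (a \<ominus> b) = b \<ominus> a"
  by (simp add: a_minus_def M.minus_add M.a_comm)

lemma diff_eq_zero_iff: "a \<in> carrier A \<Longrightarrow> b \<in> carrier A \<Longrightarrow> a \<ominus> b = \<zero> \<longleftrightarrow> a = b"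
  by (metis M.add.inv_comm M.add.m_lcomm a_minus_def M.minus_equality M.minus_minus uminus_cl diff_self)

lemma diff_add_diff: "a \<in> carrier A \<Longrightarrow> b \<in> carrier A \<Longrightarrow> c \<in> carrier A \<Longrightarrow> (a \<ominus> b) \<oplus> (b \<ominus> c) = a \<ominus> c"
proof -
  assume [simp]: "a \<in> carrier A" "b \<in> carrier A" "c \<in> carrier A"
  have "(a \<ominus> b) \<oplus> (b \<ominus> c) = a \<oplus> ((\<ominus> b \<oplus> b) \<oplus> \<ominus> c)" by (simp add: a_minus_def M.a_assoc)
  also have "\<dots> = a \<ominus> c" by (simp add: M.l_neg a_minus_def)
  finally show ?thesis .
qed

lemma add_diff_add: "a \<in> carrier A \<Longrightarrow> b \<in> carrier A \<Longrightarrow> c \<in> carrier A \<Longrightarrow> d \<in> carrier A \<Longrightarrow>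
    (a \<oplus> b) \<ominus> (c \<oplus> d) = (a \<ominus> c) \<oplus> (b \<ominus> d)"
  by (simp add: a_minus_def M.minus_add M.a_ac)

end

context seminormed_star_algebra
begin

lemma nrm_add: "a \<in> carrier A \<Longrightarrow> b \<in> carrier A \<Longrightarrow> nrm A (a \<oplus> b) \<le> nrm A a + nrm A b"
  and nrm_smult: "a \<in> carrier A \<Longrightarrow> nrm A (z \<odot> a) = cmod z * nrm A a"
  and nrm_mult: "a \<in> carrier A \<Longrightarrow> b \<in> carrier A \<Longrightarrow> nrm A (a \<otimes> b) \<le> nrm A a * nrm A b"
  and nrm_star_mult: "a \<in> carrier A \<Longrightarrow> nrm A (star A a \<otimes> a) = (nrm A a)\<^sup>2"
  using seminorm by (auto simp: is_cstar_seminorm_def)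

lemma nrm_zero [simp]: "nrm A \<zero> = 0"
  using nrm_smult[of "\<zero>" 0] by simp

lemma nrm_uminus: "a \<in> carrier A \<Longrightarrow> nrm A (\<ominus> a) = nrm A a"
  using nrm_smult[of a "-1"] by (simp add: smult_minus_one)

lemma nrm_nonneg: "a \<in> carrier A \<Longrightarrow> nrm A a \<ge> 0"
  using nrm_add[of a "\<ominus> a"] by (simp add: nrm_uminus M.r_neg)

lemma nrm_diff_commute: "a \<in> carrier A \<Longrightarrow> b \<in> carrier A \<Longrightarrow> nrm A (a \<ominus> b) = nrm A (b \<ominus> a)"
  using nrm_uminus[of "a \<ominus> b"] by (simp add: uminus_diff)

lemma nrm_diff_triangle:
  "a \<in> carrier A \<Longrightarrow> b \<in> carrier A \<Longrightarrow> c \<in> carrier A \<Longrightarrow> nrm A (a \<ominus> c) \<le> nrm A (a \<ominus> b) + nrm A (b \<ominus> c)"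
  using nrm_add[of "a \<ominus> b" "b \<ominus> c"] by (simp add: diff_add_diff)

lemma nrm_diff_ge: "a \<in> carrier A \<Longrightarrow> b \<in> carrier A \<Longrightarrow> \<bar>nrm A a - nrm A b\<bar> \<le> nrm A (a \<ominus> b)"
  using nrm_diff_triangle[of a b "\<zero>"] nrm_diff_triangle[of b a "\<zero>"] nrm_diff_commute[of a b] by simp

lemma nrm_star: assumes "a \<in> carrier A" shows "nrm A (star A a) = nrm A a"
proof -
  have le: "nrm A b \<le> nrm A (star A b)" if b: "b \<in> carrier A" for b
  proof (cases "nrm A b = 0")
    case False
    thus ?thesis
      using nrm_mult[of "star A b" b] nrm_star_mult[OF b] b nrm_nonneg[OF b]
      by (simp add: power2_eq_square)
  qed (simp add: nrm_nonneg b)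
  show ?thesis using le[OF assms] le[of "star A a"] assms by (simp add: star_star)
qed

lemma nrm_mult_diff:
  assumes [simp]: "a \<in> carrier A" "b \<in> carrier A" "c \<in> carrier A" "d \<in> carrier A"
  shows "nrm A (a \<otimes> b \<ominus> c \<otimes> d) \<le> nrm A (a \<ominus> c) * nrm A b + nrm A c * nrm A (b \<ominus> d)"
proof -
  have "nrm A (a \<otimes> b \<ominus> c \<otimes> d) \<le> nrm A (a \<otimes> b \<ominus> c \<otimes> b) + nrm A (c \<otimes> b \<ominus> c \<otimes> d)"
    by (rule nrm_diff_triangle) simp_all
  also have "\<dots> = nrm A ((a \<ominus> c) \<otimes> b) + nrm A (c \<otimes> (b \<ominus> d))" by (simp add: diff_mult mult_diff)
  also have "\<dots> \<le> nrm A (a \<ominus> c) * nrm A b + nrm A c * nrm A (b \<ominus> d)"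
    by (intro add_mono nrm_mult) simp_all
  finally show ?thesis .
qed

lemma nrm_add_diff:
  assumes [simp]: "a \<in> carrier A" "b \<in> carrier A" "c \<in> carrier A" "d \<in> carrier A"
  shows "nrm A ((a \<oplus> b) \<ominus> (c \<oplus> d)) \<le> nrm A (a \<ominus> c) + nrm A (b \<ominus> d)"
  by (simp add: add_diff_add nrm_add)

end

locale star_hom =
  fixes A :: "('a, 'm) cstar_scheme" and B :: "('b, 'n) cstar_scheme" and h :: "'a \<Rightarrow> 'b"
  assumes hom_closed: "a \<in> carrier A \<Longrightarrow> h a \<in> carrier B"
    and hom_add: "a \<in> carrier A \<Longrightarrow> b \<in> carrier A \<Longrightarrow> h (a \<oplus>\<^bsub>A\<^esub> b) = h a \<oplus>\<^bsub>B\<^esub> h b"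
    and hom_mult: "a \<in> carrier A \<Longrightarrow> b \<in> carrier A \<Longrightarrow> h (a \<otimes>\<^bsub>A\<^esub> b) = h a \<otimes>\<^bsub>B\<^esub> h b"
    and hom_smult: "a \<in> carrier A \<Longrightarrow> h (z \<odot>\<^bsub>A\<^esub> a) = z \<odot>\<^bsub>B\<^esub> h a"
    and hom_star: "a \<in> carrier A \<Longrightarrow> h (star A a) = star B (h a)"

lemma star_hom_comp: "star_hom A B h \<Longrightarrow> star_hom B C g \<Longrightarrow> star_hom A C (g \<circ> h)"
  by (simp add: star_hom_def)

lemma
  assumes "star_hom A B h" "star_algebra A" "star_algebra B"
  shows star_hom_zero: "h \<zero>\<^bsub>A\<^esub> = \<zero>\<^bsub>B\<^esub>"
    and star_hom_uminus: "a \<in> carrier A \<Longrightarrow> h (\<ominus>\<^bsub>A\<^esub> a) = \<ominus>\<^bsub>B\<^esub> h a"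
    and star_hom_diff: "a \<in> carrier A \<Longrightarrow> b \<in> carrier A \<Longrightarrow> h (a \<ominus>\<^bsub>A\<^esub> b) = h a \<ominus>\<^bsub>B\<^esub> h b"
    and star_hom_finsum: "(\<And>i. i \<in> I \<Longrightarrow> f i \<in> carrier A) \<Longrightarrow> h (finsum A f I) = finsum B (\<lambda>i. h (f i)) I"
proof -
  interpret h: star_hom A B h by fact
  interpret A: star_algebra A by fact
  interpret B: star_algebra B by fact
  show z: "h \<zero>\<^bsub>A\<^esub> = \<zero>\<^bsub>B\<^esub>"
    using h.hom_smult[of "\<zero>\<^bsub>A\<^esub>" 0] by (simp add: h.hom_closed)
  have u: "h (\<ominus>\<^bsub>A\<^esub> a) = \<ominus>\<^bsub>B\<^esub> h a" if "a \<in> carrier A" for a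
    using h.hom_smult[of a "-1"] that by (simp add: A.smult_minus_one B.smult_minus_one h.hom_closed)
  show "a \<in> carrier A \<Longrightarrow> h (\<ominus>\<^bsub>A\<^esub> a) = \<ominus>\<^bsub>B\<^esub> h a" by (rule u)
  show "a \<in> carrier A \<Longrightarrow> b \<in> carrier A \<Longrightarrow> h (a \<ominus>\<^bsub>A\<^esub> b) = h a \<ominus>\<^bsub>B\<^esub> h b"
    by (simp add: a_minus_def h.hom_add u)
  show "(\<And>i. i \<in> I \<Longrightarrow> f i \<in> carrier A) \<Longrightarrow> h (finsum A f I) = finsum B (\<lambda>i. h (f i)) I"
  proof (induction I rule: infinite_finite_induct)
    case (infinite I)
    thus ?case using z by simp
  next
    case empty
    thus ?case using z by simp
  next
    case (insert x F)
    have "finsum A f (insert x F) = f x \<oplus>\<^bsub>A\<^esub> finsum A f F"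
      by (rule A.M.finsum_insert) (use insert in auto)
    moreover have "finsum B (\<lambda>i. h (f i)) (insert x F) = h (f x) \<oplus>\<^bsub>B\<^esub> finsum B (\<lambda>i. h (f i)) F"
      by (rule B.M.finsum_insert) (use insert h.hom_closed in auto)
    moreover have "finsum A f F \<in> carrier A"
      by (rule A.M.finsum_closed) (use insert in auto)
    ultimately show ?case using insert by (simp add: h.hom_add)
  qed
qed

section \<open>Embedding a C*-algebra in a type\<close>

text \<open>The type below is the \<open>\<ell>\<^sup>\<infinity>\<close>-product of all C*-algebras with carrier in a given type: its elements
  are the bounded families that select an element of each of these algebras. One type thus
  contains an isometric copy of each of the algebras. The value \<open>undefined\<close> outside of the
  C*-algebras makes families equal if their components are.\<close>

typedef 'a cprod = "{\<phi> :: 'a cstar \<Rightarrow> 'a.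
    (\<forall>A. if cstar_algebra A then \<phi> A \<in> carrier A else \<phi> A = undefined) \<and>
    (\<exists>K. \<forall>A. cstar_algebra A \<longrightarrow> nrm A (\<phi> A) \<le> K)}"
  morphisms cpt Abs_cprod
proof (rule exI, rule CollectI, intro conjI allI exI impI)
  fix A :: "'a cstar"
  show "if cstar_algebra A then (if cstar_algebra A then \<zero>\<^bsub>A\<^esub> else undefined) \<in> carrier A
    else (if cstar_algebra A then \<zero>\<^bsub>A\<^esub> else undefined) = undefined"
    by (auto simp: star_algebra.zero_cl cstar_algebra.axioms(1))
  assume "cstar_algebra A"
  then interpret cstar_algebra A .
  show "nrm A (if cstar_algebra A then \<zero>\<^bsub>A\<^esub> else undefined) \<le> 0"
    using \<open>cstar_algebra A\<close> by simp
qed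

lemma comp_in [simp, intro]: "cstar_algebra A \<Longrightarrow> cpt x A \<in> carrier A"
  using cpt[of x] by auto

lemma comp_bound: "\<exists>K. \<forall>A. cstar_algebra A \<longrightarrow> nrm A (cpt x A) \<le> K"
  using cpt[of x] by auto

lemma cprod_eqI: "(\<And>A. cstar_algebra A \<Longrightarrow> cpt x A = cpt y A) \<Longrightarrow> x = y"
  by (rule cpt_inject[THEN iffD1], rule ext) (metis (mono_tags, lifting) cpt mem_Collect_eq)

text \<open>The family with given components, which have to be bounded for the result to be meaningful.\<close>

definition mk_cprod :: "('a cstar \<Rightarrow> 'a) \<Rightarrow> 'a cprod" where
  "mk_cprod \<phi> = Abs_cprod (\<lambda>A. if cstar_algebra A then \<phi> A else undefined)"

lemma comp_mk:
  assumes "\<And>A. cstar_algebra A \<Longrightarrow> \<phi> A \<in> carrier A" "\<And>A. cstar_algebra A \<Longrightarrow> nrm A (\<phi> A) \<le> K"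
    and "cstar_algebra A"
  shows "cpt (mk_cprod \<phi>) A = \<phi> A"
proof -
  have "cpt (mk_cprod \<phi>) = (\<lambda>A. if cstar_algebra A then \<phi> A else undefined)"
    unfolding mk_cprod_def by (rule Abs_cprod_inverse) (use assms(1,2) in auto)
  thus ?thesis using assms(3) by simp
qed

instantiation cprod :: (type) real_normed_vector
begin

definition "0 = mk_cprod (\<lambda>A :: 'a cstar. \<zero>\<^bsub>A\<^esub>)"
definition "x + y = mk_cprod (\<lambda>A :: 'a cstar. cpt x A \<oplus>\<^bsub>A\<^esub> cpt y A)"
definition "- x = mk_cprod (\<lambda>A :: 'a cstar. \<ominus>\<^bsub>A\<^esub> cpt x A)"
definition "x - y = mk_cprod (\<lambda>A :: 'a cstar. cpt x A \<ominus>\<^bsub>A\<^esub> cpt y A)"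
definition "r *\<^sub>R x = mk_cprod (\<lambda>A :: 'a cstar. of_real r \<odot>\<^bsub>A\<^esub> cpt x A)"
definition "norm x = (SUP A :: 'a cstar. if cstar_algebra A then nrm A (cpt x A) else 0)"
definition "sgn x = (inverse (norm x) *\<^sub>R x :: 'a cprod)"
definition "dist x y = (norm (x - y) :: real)" for x y :: "'a cprod"
definition [code del]: "(uniformity :: ('a cprod \<times> 'a cprod) filter) = (INF e\<in>{0 <..}. principal {(x, y). dist x y < e})"
definition [code del]: "open U \<longleftrightarrow> (\<forall>x\<in>U. \<forall>\<^sub>F (x', y) in uniformity. x' = x \<longrightarrow> y \<in> U)" for U :: "'a cprod set"

lemma norm_cprod_ge: assumes "cstar_algebra A" shows "nrm A (cpt x A) \<le> norm x"
proof -
  obtain K where K: "\<And>A. cstar_algebra A \<Longrightarrow> nrm A (cpt x A) \<le> K" using comp_bound[of x] by auto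
  have "bdd_above (range (\<lambda>A :: 'a cstar. if cstar_algebra A then nrm A (cpt x A) else 0))"
    by (rule bdd_aboveI2[where M = "max K 0"]) (use K in \<open>auto simp: le_max_iff_disj\<close>)
  from cSUP_upper[OF UNIV_I this, of A] show ?thesis using assms by (simp add: norm_cprod_def)
qed

lemma norm_cprod_le:
  assumes "K \<ge> 0" "\<And>A. cstar_algebra A \<Longrightarrow> nrm A (cpt x A) \<le> K" shows "norm x \<le> K"
  unfolding norm_cprod_def by (rule cSUP_least) (use assms in auto)

lemma norm_cprod_nonneg: "norm (x :: 'a cprod) \<ge> 0"
proof -
  obtain K where K: "\<And>A. cstar_algebra A \<Longrightarrow> nrm A (cpt x A) \<le> K" using comp_bound[of x] by auto
  have bdd: "bdd_above (range (\<lambda>A :: 'a cstar. if cstar_algebra A then nrm A (cpt x A) else 0))"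
    by (rule bdd_aboveI2[where M = "max K 0"]) (use K in \<open>auto simp: le_max_iff_disj\<close>)
  show ?thesis
  proof (cases "\<exists>A :: 'a cstar. cstar_algebra A")
    case True
    then obtain A :: "'a cstar" where A: "cstar_algebra A" by blast
    then interpret cstar_algebra A .
    have "0 \<le> nrm A (cpt x A)" using A by (intro nrm_nonneg) auto
    thus ?thesis using norm_cprod_ge[OF A, of x] by simp
  qed (simp add: norm_cprod_def)
qed

context
  fixes A :: "'a cstar"
  assumes A: "cstar_algebra A"
begin

lemma comp_zero: "cpt 0 A = \<zero>\<^bsub>A\<^esub>"
  unfolding zero_cprod_def
proof (rule comp_mk[where K = 0, OF _ _ A])
  fix A :: "'a cstar" assume "cstar_algebra A"
  then interpret cstar_algebra A .
  show "\<zero>\<^bsub>A\<^esub> \<in> carrier A" "nrm A \<zero>\<^bsub>A\<^esub> \<le> 0" by simp_all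
qed

lemma comp_add: "cpt (x + y) A = cpt x A \<oplus>\<^bsub>A\<^esub> cpt y A"
  unfolding plus_cprod_def
proof (rule comp_mk[where K = "norm x + norm y", OF _ _ A])
  fix A :: "'a cstar" assume A: "cstar_algebra A"
  then interpret cstar_algebra A .
  show "cpt x A \<oplus>\<^bsub>A\<^esub> cpt y A \<in> carrier A" using A by auto
  show "nrm A (cpt x A \<oplus>\<^bsub>A\<^esub> cpt y A) \<le> norm x + norm y"
    using nrm_add[of "cpt x A" "cpt y A"] norm_cprod_ge[OF A, of x] norm_cprod_ge[OF A, of y] A by auto
qed

lemma comp_uminus: "cpt (- x) A = \<ominus>\<^bsub>A\<^esub> cpt x A"
  unfolding uminus_cprod_def
proof (rule comp_mk[where K = "norm x", OF _ _ A])
  fix A :: "'a cstar" assume A: "cstar_algebra A"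
  then interpret cstar_algebra A .
  show "\<ominus>\<^bsub>A\<^esub> cpt x A \<in> carrier A" using A by auto
  show "nrm A (\<ominus>\<^bsub>A\<^esub> cpt x A) \<le> norm x"
    using nrm_uminus[of "cpt x A"] norm_cprod_ge[OF A, of x] A by auto
qed

lemma comp_diff: "cpt (x - y) A = cpt x A \<ominus>\<^bsub>A\<^esub> cpt y A"
  unfolding minus_cprod_def
proof (rule comp_mk[where K = "norm x + norm y", OF _ _ A])
  fix A :: "'a cstar" assume A: "cstar_algebra A"
  then interpret cstar_algebra A .
  show "cpt x A \<ominus>\<^bsub>A\<^esub> cpt y A \<in> carrier A" using A by auto
  show "nrm A (cpt x A \<ominus>\<^bsub>A\<^esub> cpt y A) \<le> norm x + norm y"
    using nrm_add[of "cpt x A" "\<ominus>\<^bsub>A\<^esub> cpt y A"] nrm_uminus[of "cpt y A"]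
      norm_cprod_ge[OF A, of x] norm_cprod_ge[OF A, of y] A by (auto simp: a_minus_def)
qed

lemma comp_scaleR: "cpt (r *\<^sub>R x) A = of_real r \<odot>\<^bsub>A\<^esub> cpt x A"
  unfolding scaleR_cprod_def
proof (rule comp_mk[where K = "\<bar>r\<bar> * norm x", OF _ _ A])
  fix A :: "'a cstar" assume A: "cstar_algebra A"
  then interpret cstar_algebra A .
  show "complex_of_real r \<odot>\<^bsub>A\<^esub> cpt x A \<in> carrier A" using A by auto
  show "nrm A (complex_of_real r \<odot>\<^bsub>A\<^esub> cpt x A) \<le> \<bar>r\<bar> * norm x"
    using nrm_smult[of "cpt x A"] norm_cprod_ge[OF A, of x] A by (auto intro: mult_left_mono)
qed

end

instance
proof
  fix x y z :: "'a cprod" and r s :: real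
  show "x + y + z = x + (y + z)"
  proof (rule cprod_eqI)
    fix A :: "'a cstar" assume A: "cstar_algebra A"
    then interpret cstar_algebra A .
    show "cpt (x + y + z) A = cpt (x + (y + z)) A"
      using A by (simp add: comp_add M.a_assoc)
  qed
  show "x + y = y + x"
  proof (rule cprod_eqI)
    fix A :: "'a cstar" assume A: "cstar_algebra A"
    then interpret cstar_algebra A .
    show "cpt (x + y) A = cpt (y + x) A" using A by (simp add: comp_add M.a_comm)
  qed
  show "0 + x = x"
  proof (rule cprod_eqI)
    fix A :: "'a cstar" assume A: "cstar_algebra A"
    then interpret cstar_algebra A .
    show "cpt (0 + x) A = cpt x A" using A by (simp add: comp_add comp_zero)
  qed
  show "- x + x = 0"
  proof (rule cprod_eqI)
    fix A :: "'a cstar" assume A: "cstar_algebra A"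
    then interpret cstar_algebra A .
    show "cpt (- x + x) A = cpt 0 A" using A by (simp add: comp_add comp_zero comp_uminus M.l_neg)
  qed
  show "x - y = x + - y"
  proof (rule cprod_eqI)
    fix A :: "'a cstar" assume A: "cstar_algebra A"
    show "cpt (x - y) A = cpt (x + - y) A" using A by (simp add: comp_add comp_uminus comp_diff a_minus_def)
  qed
  show "r *\<^sub>R (x + y) = r *\<^sub>R x + r *\<^sub>R y"
  proof (rule cprod_eqI)
    fix A :: "'a cstar" assume A: "cstar_algebra A"
    then interpret cstar_algebra A .
    show "cpt (r *\<^sub>R (x + y)) A = cpt (r *\<^sub>R x + r *\<^sub>R y) A"
      using A by (simp add: comp_add comp_scaleR smult_radd)
  qed
  show "(r + s) *\<^sub>R x = r *\<^sub>R x + s *\<^sub>R x"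
  proof (rule cprod_eqI)
    fix A :: "'a cstar" assume A: "cstar_algebra A"
    then interpret cstar_algebra A .
    show "cpt ((r + s) *\<^sub>R x) A = cpt (r *\<^sub>R x + s *\<^sub>R x) A"
      using A by (simp add: comp_add comp_scaleR smult_ladd)
  qed
  show "r *\<^sub>R s *\<^sub>R x = (r * s) *\<^sub>R x"
  proof (rule cprod_eqI)
    fix A :: "'a cstar" assume A: "cstar_algebra A"
    then interpret cstar_algebra A .
    show "cpt (r *\<^sub>R s *\<^sub>R x) A = cpt ((r * s) *\<^sub>R x) A"
      using A by (simp add: comp_scaleR smult_smult)
  qed
  show "1 *\<^sub>R x = x"
  proof (rule cprod_eqI)
    fix A :: "'a cstar" assume A: "cstar_algebra A"
    then interpret cstar_algebra A .
    show "cpt (1 *\<^sub>R x) A = cpt x A"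
      using A by (simp add: comp_scaleR)
  qed
  show "(norm x = 0) = (x = 0)"
  proof
    assume n: "norm x = 0"
    show "x = 0"
    proof (rule cprod_eqI)
      fix A :: "'a cstar" assume A: "cstar_algebra A"
      then interpret cstar_algebra A .
      have "nrm A (cpt x A) = 0" using norm_cprod_ge[OF A, of x] n nrm_nonneg[of "cpt x A"] A by auto
      thus "cpt x A = cpt 0 A" using A by (simp add: comp_zero norm_eq_zero)
    qed
  next
    assume "x = 0"
    have "norm (0 :: 'a cprod) \<le> 0"
    proof (rule norm_cprod_le)
      fix A :: "'a cstar" assume A: "cstar_algebra A"
      then interpret cstar_algebra A .
      show "nrm A (cpt 0 A) \<le> 0" using A by (simp add: comp_zero)
    qed simp
    thus "norm x = 0" using norm_cprod_nonneg[of "0 :: 'a cprod"] \<open>x = 0\<close> by simp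
  qed
  show "norm (x + y) \<le> norm x + norm y"
  proof (rule norm_cprod_le)
    fix A :: "'a cstar" assume A: "cstar_algebra A"
    then interpret cstar_algebra A .
    show "nrm A (cpt (x + y) A) \<le> norm x + norm y"
      using nrm_add[of "cpt x A" "cpt y A"] norm_cprod_ge[OF A, of x] norm_cprod_ge[OF A, of y] A
      by (auto simp: comp_add)
  qed (simp add: norm_cprod_nonneg)
  have le: "norm (r *\<^sub>R x) \<le> \<bar>r\<bar> * norm x" for r and x :: "'a cprod"
  proof (rule norm_cprod_le)
    fix A :: "'a cstar" assume A: "cstar_algebra A"
    then interpret cstar_algebra A .
    show "nrm A (cpt (r *\<^sub>R x) A) \<le> \<bar>r\<bar> * norm x"
      using nrm_smult[of "cpt x A"] norm_cprod_ge[OF A, of x] A by (auto simp: comp_scaleR intro: mult_left_mono)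
  qed (simp add: norm_cprod_nonneg)
  show "norm (r *\<^sub>R x) = \<bar>r\<bar> * norm x"
  proof (rule antisym[OF le])
    show "\<bar>r\<bar> * norm x \<le> norm (r *\<^sub>R x)"
    proof (cases "r = 0")
      case False
      have "inverse r *\<^sub>R (r *\<^sub>R x) = x"
      proof (rule cprod_eqI)
        fix A :: "'a cstar" assume A: "cstar_algebra A"
        then interpret cstar_algebra A .
        show "cpt (inverse r *\<^sub>R (r *\<^sub>R x)) A = cpt x A"
          using A False by (simp add: comp_scaleR smult_smult)
      qed
      hence "norm x \<le> \<bar>inverse r\<bar> * norm (r *\<^sub>R x)" using le[of "inverse r" "r *\<^sub>R x"] by simp
      thus ?thesis using False by (simp add: field_simps)
    qed (simp add: norm_cprod_nonneg)
  qed
qed (simp_all add: sgn_cprod_def dist_cprod_def uniformity_cprod_def open_cprod_def)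

end

text \<open>The limit in the product is the family of the limits.\<close>

instance cprod :: (type) banach
proof
  fix X :: "nat \<Rightarrow> 'a cprod"
  assume X: "Cauchy X"
  have cau: "(\<lambda>n. cpt (X n) A) \<in> cauchy_seqs A (nrm A)" if A: "cstar_algebra A" for A
    unfolding cauchy_seqs_def
  proof (intro CollectI conjI allI impI)
    show "cpt (X n) A \<in> carrier A" for n using A by simp
    fix e :: real assume "e > 0"
    then obtain M where M: "\<And>m n. m \<ge> M \<Longrightarrow> n \<ge> M \<Longrightarrow> norm (X m - X n) < e"
      using CauchyD[OF X] by metis
    show "\<exists>M. \<forall>m\<ge>M. \<forall>n\<ge>M. nrm A (cpt (X m) A \<ominus>\<^bsub>A\<^esub> cpt (X n) A) < e"
    proof (intro exI allI impI)
      fix m n assume "m \<ge> M" "n \<ge> M"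
      from M[OF this] norm_cprod_ge[OF A, of "X m - X n"]
      show "nrm A (cpt (X m) A \<ominus>\<^bsub>A\<^esub> cpt (X n) A) < e" by (simp add: comp_diff[OF A])
    qed
  qed
  have "\<exists>l\<in>carrier A. (\<lambda>n. nrm A (cpt (X n) A \<ominus>\<^bsub>A\<^esub> l)) \<longlonglongrightarrow> 0" if A: "cstar_algebra A" for A
    using cstar_algebra.norm_complete[OF A] cau[OF A] by (auto simp: is_complete_def)
  then obtain l where l: "\<And>A. cstar_algebra A \<Longrightarrow> l A \<in> carrier A"
    "\<And>A. cstar_algebra A \<Longrightarrow> (\<lambda>n. nrm A (cpt (X n) A \<ominus>\<^bsub>A\<^esub> l A)) \<longlonglongrightarrow> 0"
    by metis
  have close: "nrm A (cpt (X n) A \<ominus>\<^bsub>A\<^esub> l A) \<le> e"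
    if M: "\<And>m n. m \<ge> M \<Longrightarrow> n \<ge> M \<Longrightarrow> norm (X m - X n) < e" and n: "n \<ge> M" and A: "cstar_algebra A"
    for M e n A
  proof -
    interpret cstar_algebra A by fact
    have "(\<lambda>m. e + nrm A (cpt (X m) A \<ominus>\<^bsub>A\<^esub> l A)) \<longlonglongrightarrow> e + 0"
      by (intro tendsto_intros l A)
    moreover have "\<forall>\<^sub>F m in sequentially. nrm A (cpt (X n) A \<ominus>\<^bsub>A\<^esub> l A) \<le> e + nrm A (cpt (X m) A \<ominus>\<^bsub>A\<^esub> l A)"
    proof (rule eventually_sequentiallyI)
      fix m assume "m \<ge> M"
      have "nrm A (cpt (X n) A \<ominus>\<^bsub>A\<^esub> cpt (X m) A) < e"
        using M[OF n \<open>m \<ge> M\<close>] norm_cprod_ge[OF A, of "X n - X m"] by (simp add: comp_diff[OF A])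
      thus "nrm A (cpt (X n) A \<ominus>\<^bsub>A\<^esub> l A) \<le> e + nrm A (cpt (X m) A \<ominus>\<^bsub>A\<^esub> l A)"
        using nrm_diff_triangle[of "cpt (X n) A" "cpt (X m) A" "l A"] A l(1)[OF A] by simp
    qed
    ultimately have "nrm A (cpt (X n) A \<ominus>\<^bsub>A\<^esub> l A) \<le> e + 0"
      by (rule tendsto_lowerbound) simp
    thus ?thesis by simp
  qed
  obtain M0 where M0: "\<And>m n. m \<ge> M0 \<Longrightarrow> n \<ge> M0 \<Longrightarrow> norm (X m - X n) < 1"
    using CauchyD[OF X, of 1] by (metis zero_less_one)
  have comp_l: "cpt (mk_cprod l) A = l A" if A: "cstar_algebra A" for A
  proof (rule comp_mk[OF l(1) _ A, where K = "norm (X M0) + 1"])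
    fix A :: "'a cstar" assume A: "cstar_algebra A"
    then interpret cstar_algebra A .
    show "nrm A (l A) \<le> norm (X M0) + 1"
      using nrm_diff_ge[of "cpt (X M0) A" "l A"] close[of M0 1 M0, OF M0 order_refl A] norm_cprod_ge[OF A, of "X M0"] A l(1)[OF A]
      by auto
  qed
  have "X \<longlonglongrightarrow> mk_cprod l"
  proof (rule LIMSEQ_I)
    fix e :: real assume "e > 0"
    hence "e / 2 > 0" by simp
    then obtain M where M: "\<And>m n. m \<ge> M \<Longrightarrow> n \<ge> M \<Longrightarrow> norm (X m - X n) < e / 2"
      using CauchyD[OF X] by metis
    show "\<exists>M. \<forall>n\<ge>M. norm (X n - mk_cprod l) < e"
    proof (intro exI allI impI)
      fix n assume n: "n \<ge> M"
      have "norm (X n - mk_cprod l) \<le> e / 2"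
        by (rule norm_cprod_le) (use close[OF M n] \<open>e > 0\<close> in \<open>auto simp: comp_diff comp_l\<close>)
      thus "norm (X n - mk_cprod l) < e" using \<open>e > 0\<close> by simp
    qed
  qed
  thus "convergent X" by (rule convergentI)
qed

instantiation cprod :: (type) cstar_alg
begin

definition "x * y = mk_cprod (\<lambda>A :: 'a cstar. cpt x A \<otimes>\<^bsub>A\<^esub> cpt y A)"
definition "z *\<^sub>C x = mk_cprod (\<lambda>A :: 'a cstar. z \<odot>\<^bsub>A\<^esub> cpt x A)"
definition "adj x = mk_cprod (\<lambda>A :: 'a cstar. star A (cpt x A))"

context
  fixes A :: "'a cstar"
  assumes A: "cstar_algebra A"
begin

lemma comp_mult: "cpt (x * y) A = cpt x A \<otimes>\<^bsub>A\<^esub> cpt y A"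
  unfolding times_cprod_def
proof (rule comp_mk[where K = "norm x * norm y", OF _ _ A])
  fix A :: "'a cstar" assume A: "cstar_algebra A"
  then interpret cstar_algebra A .
  show "cpt x A \<otimes>\<^bsub>A\<^esub> cpt y A \<in> carrier A" using A by auto
  show "nrm A (cpt x A \<otimes>\<^bsub>A\<^esub> cpt y A) \<le> norm x * norm y"
    by (rule order_trans[OF nrm_mult mult_mono])
      (use norm_cprod_ge[OF A, of x] norm_cprod_ge[OF A, of y] A in \<open>auto simp: nrm_nonneg\<close>)
qed

lemma comp_scaleC: "cpt (z *\<^sub>C x) A = z \<odot>\<^bsub>A\<^esub> cpt x A"
  unfolding scaleC_cprod_def
proof (rule comp_mk[where K = "cmod z * norm x", OF _ _ A])
  fix A :: "'a cstar" assume A: "cstar_algebra A"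
  then interpret cstar_algebra A .
  show "z \<odot>\<^bsub>A\<^esub> cpt x A \<in> carrier A" using A by auto
  show "nrm A (z \<odot>\<^bsub>A\<^esub> cpt x A) \<le> cmod z * norm x"
    using nrm_smult[of "cpt x A"] norm_cprod_ge[OF A, of x] A by (auto intro: mult_left_mono)
qed

lemma comp_adj: "cpt (adj x) A = star A (cpt x A)"
  unfolding adj_cprod_def
proof (rule comp_mk[where K = "norm x", OF _ _ A])
  fix A :: "'a cstar" assume A: "cstar_algebra A"
  then interpret cstar_algebra A .
  show "star A (cpt x A) \<in> carrier A" using A by auto
  show "nrm A (star A (cpt x A)) \<le> norm x"
    using nrm_star[of "cpt x A"] norm_cprod_ge[OF A, of x] A by auto
qed

end

instance
proof
  fix x y z :: "'a cprod" and r :: real and v w :: complex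
  have eqs: "cpt (x * y * z) A = cpt (x * (y * z)) A"
      "cpt ((x + y) * z) A = cpt (x * z + y * z) A" "cpt (x * (y + z)) A = cpt (x * y + x * z) A"
      "cpt (r *\<^sub>R x * y) A = cpt (r *\<^sub>R (x * y)) A" "cpt (x * r *\<^sub>R y) A = cpt (r *\<^sub>R (x * y)) A"
      "cpt (v *\<^sub>C (x + y)) A = cpt (v *\<^sub>C x + v *\<^sub>C y) A"
      "cpt ((v + w) *\<^sub>C x) A = cpt (v *\<^sub>C x + w *\<^sub>C x) A"
      "cpt (v *\<^sub>C (w *\<^sub>C x)) A = cpt ((v * w) *\<^sub>C x) A"
      "cpt (of_real r *\<^sub>C x) A = cpt (r *\<^sub>R x) A"
      "cpt (v *\<^sub>C x * y) A = cpt (v *\<^sub>C (x * y)) A" "cpt (x * v *\<^sub>C y) A = cpt (v *\<^sub>C (x * y)) A"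
      "cpt (adj (adj x)) A = cpt x A" "cpt (adj (x + y)) A = cpt (adj x + adj y) A"
      "cpt (adj (v *\<^sub>C x)) A = cpt (cnj v *\<^sub>C adj x) A" "cpt (adj (x * y)) A = cpt (adj y * adj x) A"
    if A: "cstar_algebra A" for A
  proof -
    interpret cstar_algebra A by fact
    note s = comp_add[OF A] comp_mult[OF A] comp_scaleR[OF A] comp_scaleC[OF A] comp_adj[OF A] comp_in[OF A]
    show "cpt (x * y * z) A = cpt (x * (y * z)) A"
      "cpt ((x + y) * z) A = cpt (x * z + y * z) A" "cpt (x * (y + z)) A = cpt (x * y + x * z) A"
      "cpt (r *\<^sub>R x * y) A = cpt (r *\<^sub>R (x * y)) A" "cpt (x * r *\<^sub>R y) A = cpt (r *\<^sub>R (x * y)) A"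
      "cpt (v *\<^sub>C (x + y)) A = cpt (v *\<^sub>C x + v *\<^sub>C y) A"
      "cpt ((v + w) *\<^sub>C x) A = cpt (v *\<^sub>C x + w *\<^sub>C x) A"
      "cpt (v *\<^sub>C (w *\<^sub>C x)) A = cpt ((v * w) *\<^sub>C x) A"
      "cpt (of_real r *\<^sub>C x) A = cpt (r *\<^sub>R x) A"
      "cpt (v *\<^sub>C x * y) A = cpt (v *\<^sub>C (x * y)) A" "cpt (x * v *\<^sub>C y) A = cpt (v *\<^sub>C (x * y)) A"
      "cpt (adj (adj x)) A = cpt x A" "cpt (adj (x + y)) A = cpt (adj x + adj y) A"
      "cpt (adj (v *\<^sub>C x)) A = cpt (cnj v *\<^sub>C adj x) A" "cpt (adj (x * y)) A = cpt (adj y * adj x) A"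
      by (simp_all add: s mult_assoc add_mult mult_add smult_mult mult_smult smult_radd smult_ladd
          smult_smult star_star star_add star_smult star_mult)
  qed
  show "x * y * z = x * (y * z)" "(x + y) * z = x * z + y * z" "x * (y + z) = x * y + x * z"
    "r *\<^sub>R x * y = r *\<^sub>R (x * y)" "x * r *\<^sub>R y = r *\<^sub>R (x * y)"
    "v *\<^sub>C (x + y) = v *\<^sub>C x + v *\<^sub>C y" "(v + w) *\<^sub>C x = v *\<^sub>C x + w *\<^sub>C x"
    "v *\<^sub>C (w *\<^sub>C x) = (v * w) *\<^sub>C x" "of_real r *\<^sub>C x = r *\<^sub>R x"
    "v *\<^sub>C x * y = v *\<^sub>C (x * y)" "x * v *\<^sub>C y = v *\<^sub>C (x * y)"
    "adj (adj x) = x" "adj (x + y) = adj x + adj y"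
    "adj (v *\<^sub>C x) = cnj v *\<^sub>C adj x" "adj (x * y) = adj y * adj x"
    by (rule cprod_eqI, erule eqs)+
  show "norm (x * y) \<le> norm x * norm y"
  proof (rule norm_cprod_le)
    fix A :: "'a cstar" assume A: "cstar_algebra A"
    then interpret cstar_algebra A .
    show "nrm A (cpt (x * y) A) \<le> norm x * norm y"
      unfolding comp_mult[OF A]
      by (rule order_trans[OF nrm_mult mult_mono])
        (use norm_cprod_ge[OF A, of x] norm_cprod_ge[OF A, of y] A in \<open>auto simp: nrm_nonneg\<close>)
  qed simp
  have le: "norm (w *\<^sub>C x) \<le> cmod w * norm x" for w and x :: "'a cprod"
  proof (rule norm_cprod_le)
    fix A :: "'a cstar" assume A: "cstar_algebra A"
    then interpret cstar_algebra A .
    show "nrm A (cpt (w *\<^sub>C x) A) \<le> cmod w * norm x"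
      using nrm_smult[of "cpt x A"] norm_cprod_ge[OF A, of x] A by (auto simp: comp_scaleC intro: mult_left_mono)
  qed simp
  show "norm (w *\<^sub>C x) = cmod w * norm x"
  proof (rule antisym[OF le])
    show "cmod w * norm x \<le> norm (w *\<^sub>C x)"
    proof (cases "w = 0")
      case False
      have "inverse w *\<^sub>C (w *\<^sub>C x) = x"
      proof (rule cprod_eqI)
        fix A :: "'a cstar" assume A: "cstar_algebra A"
        then interpret cstar_algebra A .
        show "cpt (inverse w *\<^sub>C (w *\<^sub>C x)) A = cpt x A"
          using A False by (simp add: comp_scaleC smult_smult)
      qed
      hence "norm x \<le> cmod (inverse w) * norm (w *\<^sub>C x)" using le[of "inverse w" "w *\<^sub>C x"] by simp
      from mult_left_mono[OF this, of "cmod w"] False show ?thesis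
        by (simp add: norm_inverse flip: mult.assoc)
    qed simp
  qed
  show "norm (adj x * x) = (norm x)\<^sup>2"
  proof (rule antisym)
    show "norm (adj x * x) \<le> (norm x)\<^sup>2"
    proof (rule norm_cprod_le)
      fix A :: "'a cstar" assume A: "cstar_algebra A"
      then interpret cstar_algebra A .
      show "nrm A (cpt (adj x * x) A) \<le> (norm x)\<^sup>2"
        using norm_cprod_ge[OF A, of x] A by (simp add: comp_mult comp_adj nrm_star_mult power_mono nrm_nonneg)
    qed simp
    have "norm x \<le> sqrt (norm (adj x * x))"
    proof (rule norm_cprod_le)
      fix A :: "'a cstar" assume A: "cstar_algebra A"
      then interpret cstar_algebra A .
      show "nrm A (cpt x A) \<le> sqrt (norm (adj x * x))"
        using norm_cprod_ge[OF A, of "adj x * x"] A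
        by (intro real_le_rsqrt) (simp add: comp_mult comp_adj nrm_star_mult)
    qed simp
    hence "(norm x)\<^sup>2 \<le> (sqrt (norm (adj x * x)))\<^sup>2" by (intro power_mono) auto
    thus "(norm x)\<^sup>2 \<le> norm (adj x * x)" by simp
  qed
qed

end

text \<open>The algebra on all elements of a type of class \<open>cstar_alg\<close>, as a record.\<close>

definition cls :: "'c::cstar_alg cstar" where
  "cls = \<lparr>carrier = UNIV, mult = (*), one = undefined, zero = 0, add = (+), smult = scaleC,
     star = adj, nrm = norm\<rparr>"

lemma cls_simps [simp]:
  "carrier cls = UNIV" "mult cls = (*)" "zero cls = 0" "add cls = (+)" "smult cls = scaleC"
  "star cls = adj" "nrm cls = norm"
  by (simp_all add: cls_def)

lemma star_algebra_cls: "star_algebra (cls :: 'c::cstar_alg cstar)"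
proof (rule star_algebra.intro)
  show "Module.module complex_ring (cls :: 'c cstar)"
  proof (rule moduleI[OF cring_complex_ring])
    show "abelian_group (cls :: 'c cstar)"
    proof (rule abelian_groupI)
      fix x :: 'c
      show "\<exists>y\<in>carrier cls. y \<oplus>\<^bsub>cls\<^esub> x = \<zero>\<^bsub>cls\<^esub>" by (rule bexI[of _ "- x"]) auto
    qed (auto simp: algebra_simps)
  qed (auto simp: scaleC_add_left scaleC_add_right scaleC_scaleC)
qed (unfold_locales, auto simp: algebra_simps scaleC_mult_left scaleC_mult_right adj_add adj_mult adj_scaleC)

lemma seminormed_cls: "seminormed_star_algebra (cls :: 'c::cstar_alg cstar)"
proof -
  interpret star_algebra "cls :: 'c cstar" by (rule star_algebra_cls)
  show ?thesis
    by unfold_locales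
      (auto simp: is_cstar_seminorm_def norm_triangle_ineq norm_scaleC norm_mult_ineq norm_adj_mult)
qed

lemma a_inv_cls [simp]: "\<ominus>\<^bsub>cls\<^esub> x = - x"
proof -
  interpret star_algebra "cls :: 'c::cstar_alg cstar" by (rule star_algebra_cls)
  show ?thesis using smult_minus_one[of x] by (simp add: scaleC_minus_one)
qed

lemma a_minus_cls [simp]: "x \<ominus>\<^bsub>cls\<^esub> y = x - y"
  by (simp add: a_minus_def)

lemma finsum_cls [simp]: "finsum cls f I = sum f I"
proof -
  interpret star_algebra "cls :: 'c::cstar_alg cstar" by (rule star_algebra_cls)
  show ?thesis
  proof (induction I rule: infinite_finite_induct)
    case (insert x F)
    thus ?case using M.finsum_insert[of F x f] by simp
  qed auto
qed

text \<open>The embedding sends \<open>a\<close> to the family that is \<open>a\<close> at the component \<open>A\<close> and 0 elsewhere. It takes values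
  in the unitization of the product, so that results on unital algebras apply; the
  embedding itself does not preserve units.\<close>

definition emb :: "'a cstar \<Rightarrow> 'a \<Rightarrow> 'a cprod unz" where
  "emb A a = Unz (mk_cprod (\<lambda>A'. if A' = A then a else \<zero>\<^bsub>A'\<^esub>)) 0"

lemma comp_emb:
  assumes "cstar_algebra A" "a \<in> carrier A" "cstar_algebra C"
  shows "cpt (upart (emb A a)) C = (if C = A then a else \<zero>\<^bsub>C\<^esub>)"
proof -
  interpret cstar_algebra A by fact
  have "cpt (mk_cprod (\<lambda>A'. if A' = A then a else \<zero>\<^bsub>A'\<^esub>)) C = (if C = A then a else \<zero>\<^bsub>C\<^esub>)"
  proof (rule comp_mk[where K = "nrm A a", OF _ _ assms(3)])
    fix C :: "'a cstar" assume C: "cstar_algebra C"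
    then interpret C: cstar_algebra C .
    show "(if C = A then a else \<zero>\<^bsub>C\<^esub>) \<in> carrier C" using assms by auto
    show "nrm C (if C = A then a else \<zero>\<^bsub>C\<^esub>) \<le> nrm A a" using nrm_nonneg[OF assms(2)] by auto
  qed
  thus ?thesis by (simp add: emb_def)
qed

lemma
  assumes "cstar_algebra A"
  shows star_hom_emb: "star_hom A cls (emb A)"
    and norm_emb: "a \<in> carrier A \<Longrightarrow> norm (emb A a) = nrm A a"
proof -
  interpret cstar_algebra A by fact
  note ce = comp_emb[OF assms]
  have us: "uscal (emb A a) = 0" for a by (simp add: emb_def)
  have eqI: "x = y" if "uscal x = 0" "uscal y = 0"
    "\<And>C. cstar_algebra C \<Longrightarrow> cpt (upart x) C = cpt (upart y) C" for x y :: "'a cprod unz"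
    by (rule unz.expand) (use that cprod_eqI in auto)
  show "star_hom A cls (emb A)"
  proof
    fix a b z assume a[simp]: "a \<in> carrier A" and b[simp]: "b \<in> carrier A"
    show "emb A (a \<oplus>\<^bsub>A\<^esub> b) = emb A a \<oplus>\<^bsub>cls\<^esub> emb A b"
    proof (rule eqI)
      fix C :: "'a cstar" assume C: "cstar_algebra C"
      then interpret C: cstar_algebra C .
      show "cpt (upart (emb A (a \<oplus>\<^bsub>A\<^esub> b))) C = cpt (upart (emb A a \<oplus>\<^bsub>cls\<^esub> emb A b)) C"
        using C by (simp add: ce unz_simps' comp_add)
    qed (simp_all add: us unz_simps')
    show "emb A (a \<otimes>\<^bsub>A\<^esub> b) = emb A a \<otimes>\<^bsub>cls\<^esub> emb A b"
    proof (rule eqI)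
      fix C :: "'a cstar" assume C: "cstar_algebra C"
      then interpret C: cstar_algebra C .
      show "cpt (upart (emb A (a \<otimes>\<^bsub>A\<^esub> b))) C = cpt (upart (emb A a \<otimes>\<^bsub>cls\<^esub> emb A b)) C"
        using C by (simp add: ce unz_simps' comp_mult us)
    qed (simp_all add: us unz_simps')
  next
    fix a z assume a[simp]: "a \<in> carrier A"
    show "emb A (z \<odot>\<^bsub>A\<^esub> a) = z \<odot>\<^bsub>cls\<^esub> emb A a"
    proof (rule eqI)
      fix C :: "'a cstar" assume C: "cstar_algebra C"
      then interpret C: cstar_algebra C .
      show "cpt (upart (emb A (z \<odot>\<^bsub>A\<^esub> a))) C = cpt (upart (z \<odot>\<^bsub>cls\<^esub> emb A a)) C"
        using C by (simp add: ce unz_simps' comp_scaleC)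
    qed (simp_all add: us unz_simps')
    show "emb A (star A a) = star cls (emb A a)"
    proof (rule eqI)
      fix C :: "'a cstar" assume C: "cstar_algebra C"
      then interpret C: cstar_algebra C .
      show "cpt (upart (emb A (star A a))) C = cpt (upart (star cls (emb A a))) C"
        using C by (simp add: ce unz_simps' comp_adj)
    qed (simp_all add: us unz_simps')
  qed simp
  assume a: "a \<in> carrier A"
  have "norm (emb A a) = norm (upart (emb A a))"
    by (simp add: norm_unz_def us opn_zero_right)
  also have "\<dots> = nrm A a"
  proof (rule antisym)
    show "norm (upart (emb A a)) \<le> nrm A a"
    proof (rule norm_cprod_le)
      fix C :: "'a cstar" assume C: "cstar_algebra C"
      then interpret C: cstar_algebra C .
      show "nrm C (cpt (upart (emb A a)) C) \<le> nrm A a" using C a by (simp add: ce nrm_nonneg)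
    qed (simp add: nrm_nonneg a)
    show "nrm A a \<le> norm (upart (emb A a))"
      using norm_cprod_ge[OF assms, of "upart (emb A a)"] assms a by (simp add: ce)
  qed
  finally show "norm (emb A a) = nrm A a" .
qed

lemma emb_inj:
  assumes "cstar_algebra A" "a \<in> carrier A" "b \<in> carrier A" "emb A a = emb A b"
  shows "a = b"
proof -
  have "a = cpt (upart (emb A a)) A" using comp_emb[OF assms(1,2,1)] by simp
  also have "\<dots> = cpt (upart (emb A b)) A" unfolding assms(4) ..
  also have "\<dots> = b" using comp_emb[OF assms(1,3,1)] by simp
  finally show ?thesis .
qed

text \<open>In a C*-algebra, a sum of two elements of the form \<open>b\<^sup>*b\<close> is again of this form.\<close>

lemma cstar_positive_add:
  assumes A: "cstar_algebra (A :: 'a cstar)" and b: "b \<in> carrier A" and c: "c \<in> carrier A"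
  shows "cstar_positive A (star A b \<otimes>\<^bsub>A\<^esub> b \<oplus>\<^bsub>A\<^esub> star A c \<otimes>\<^bsub>A\<^esub> c)"
proof -
  interpret cstar_algebra A by fact
  interpret j: star_hom A cls "emb A" by (rule star_hom_emb[OF A])
  define d where "d = star A b \<otimes>\<^bsub>A\<^esub> b \<oplus>\<^bsub>A\<^esub> star A c \<otimes>\<^bsub>A\<^esub> c"
  have d: "d \<in> carrier A" using b c by (simp add: d_def)
  have "emb A d = adj (emb A b) * emb A b + adj (emb A c) * emb A c"
    using b c by (simp add: d_def j.hom_add j.hom_mult j.hom_star)
  hence "pos (emb A d)" by (simp add: pos_add pos_adj_mult)
  then obtain s where s: "adj s = s" "emb A d = s * s" by (auto simp: pos_def)
  \<comment> \<open>The square root in the unitization has scalar part 0, as its square has, and its component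
    at \<open>A\<close> is the required element.\<close>
  have "uscal (s * s) = 0" unfolding s(2)[symmetric] by (simp add: emb_def)
  hence z: "uscal s = 0" by (simp add: unz_simps')
  have "upart (emb A d) = upart s * upart s" using s(2) z by (simp add: unz_simps')
  moreover have "adj (upart s) = upart s" using arg_cong[OF s(1), of upart] by (simp add: unz_simps')
  ultimately have "upart (emb A d) = adj (upart s) * upart s" by simp
  hence "d = star A (cpt (upart s) A) \<otimes>\<^bsub>A\<^esub> cpt (upart s) A"
    using comp_emb[OF A d A] by (simp add: comp_mult[OF A] comp_adj[OF A])
  thus ?thesis using A by (auto simp: cstar_positive_def d_def)
qed

section \<open>Limits and completions\<close>

context seminormed_star_algebra
begin

text \<open>Convergence of sequences with respect to the seminorm; limits need not be unique.\<close>

definition lims :: "(nat \<Rightarrow> 'a) \<Rightarrow> 'a \<Rightarrow> bool" where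
  "lims x l \<longleftrightarrow> (\<forall>n. x n \<in> carrier A) \<and> l \<in> carrier A \<and> (\<lambda>n. nrm A (x n \<ominus> l)) \<longlonglongrightarrow> 0"

lemma cauchy_in: "x \<in> cauchy_seqs A (nrm A) \<Longrightarrow> x n \<in> carrier A"
  by (simp add: cauchy_seqs_def)

lemma cauchy_nrm:
  assumes x: "x \<in> cauchy_seqs A (nrm A)"
  shows "convergent (\<lambda>n. nrm A (x n))"
proof (rule real_Cauchy_convergent, rule metric_CauchyI)
  fix e :: real assume "e > 0"
  then obtain M where M: "\<And>m n. m \<ge> M \<Longrightarrow> n \<ge> M \<Longrightarrow> nrm A (x m \<ominus> x n) < e"
    using x unfolding cauchy_seqs_def by blast
  show "\<exists>M. \<forall>m\<ge>M. \<forall>n\<ge>M. dist (nrm A (x m)) (nrm A (x n)) < e"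
  proof (intro exI allI impI)
    fix m n assume "m \<ge> M" "n \<ge> M"
    from M[OF this] nrm_diff_ge[OF cauchy_in[OF x] cauchy_in[OF x], of m n]
    show "dist (nrm A (x m)) (nrm A (x n)) < e" by (simp add: dist_real_def)
  qed
qed

lemma cauchy_bounded:
  assumes x: "x \<in> cauchy_seqs A (nrm A)"
  obtains K where "K > 0" "\<And>n. nrm A (x n) \<le> K"
proof -
  have "Bseq (\<lambda>n. nrm A (x n))" using cauchy_nrm[OF x] by (rule convergent_imp_Bseq)
  then obtain K where "K > 0" "\<And>n. norm (nrm A (x n)) \<le> K" by (auto elim: BseqE)
  show thesis
  proof (rule that[OF \<open>K > 0\<close>])
    fix n show "nrm A (x n) \<le> K" using \<open>norm (nrm A (x n)) \<le> K\<close> by (simp add: abs_le_iff)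
  qed
qed

lemma cauchyI:
  assumes "\<And>n. x n \<in> carrier A"
    and "\<And>e. e > 0 \<Longrightarrow> \<exists>M. \<forall>m\<ge>M. \<forall>n\<ge>M. nrm A (x m \<ominus> x n) < e"
  shows "x \<in> cauchy_seqs A (nrm A)"
  using assms by (auto simp: cauchy_seqs_def)

lemma cauchyD:
  assumes "x \<in> cauchy_seqs A (nrm A)" "e > 0"
  shows "\<exists>M. \<forall>m\<ge>M. \<forall>n\<ge>M. nrm A (x m \<ominus> x n) < e"
  using assms by (auto simp: cauchy_seqs_def)

lemma cauchy_const: "a \<in> carrier A \<Longrightarrow> (\<lambda>n. a) \<in> cauchy_seqs A (nrm A)"
  by (rule cauchyI) simp_all

lemma cauchy_add:
  assumes x: "x \<in> cauchy_seqs A (nrm A)" and y: "y \<in> cauchy_seqs A (nrm A)"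
  shows "(\<lambda>n. x n \<oplus> y n) \<in> cauchy_seqs A (nrm A)"
proof (rule cauchyI)
  note [simp] = cauchy_in[OF x] cauchy_in[OF y]
  show "x n \<oplus> y n \<in> carrier A" for n by simp
  fix e :: real assume "e > 0"
  hence e: "e / 2 > 0" by simp
  obtain M where M: "\<And>m n. m \<ge> M \<Longrightarrow> n \<ge> M \<Longrightarrow> nrm A (x m \<ominus> x n) < e / 2" using cauchyD[OF x e] by blast
  obtain N where N: "\<And>m n. m \<ge> N \<Longrightarrow> n \<ge> N \<Longrightarrow> nrm A (y m \<ominus> y n) < e / 2" using cauchyD[OF y e] by blast
  show "\<exists>M. \<forall>m\<ge>M. \<forall>n\<ge>M. nrm A (x m \<oplus> y m \<ominus> (x n \<oplus> y n)) < e"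
  proof (intro exI allI impI)
    fix m n assume mn: "m \<ge> max M N" "n \<ge> max M N"
    have "nrm A (x m \<oplus> y m \<ominus> (x n \<oplus> y n)) \<le> nrm A (x m \<ominus> x n) + nrm A (y m \<ominus> y n)"
      by (rule nrm_add_diff) simp_all
    thus "nrm A (x m \<oplus> y m \<ominus> (x n \<oplus> y n)) < e" using M[of m n] N[of m n] mn by simp
  qed
qed

lemma cauchy_mult:
  assumes x: "x \<in> cauchy_seqs A (nrm A)" and y: "y \<in> cauchy_seqs A (nrm A)"
  shows "(\<lambda>n. x n \<otimes> y n) \<in> cauchy_seqs A (nrm A)"
proof (rule cauchyI)
  note [simp] = cauchy_in[OF x] cauchy_in[OF y]
  show "x n \<otimes> y n \<in> carrier A" for n by simp
  fix e :: real assume "e > 0"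
  obtain K where K: "K > 0" "\<And>n. nrm A (x n) \<le> K" by (rule cauchy_bounded[OF x]) blast
  obtain L where L: "L > 0" "\<And>n. nrm A (y n) \<le> L" by (rule cauchy_bounded[OF y]) blast
  have e1: "e / (2 * L) > 0" and e2: "e / (2 * K) > 0" using \<open>e > 0\<close> K L by auto
  obtain M where M: "\<And>m n. m \<ge> M \<Longrightarrow> n \<ge> M \<Longrightarrow> nrm A (x m \<ominus> x n) < e / (2 * L)" using cauchyD[OF x e1] by blast
  obtain N where N: "\<And>m n. m \<ge> N \<Longrightarrow> n \<ge> N \<Longrightarrow> nrm A (y m \<ominus> y n) < e / (2 * K)" using cauchyD[OF y e2] by blast
  show "\<exists>M. \<forall>m\<ge>M. \<forall>n\<ge>M. nrm A (x m \<otimes> y m \<ominus> x n \<otimes> y n) < e"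
  proof (intro exI allI impI)
    fix m n assume mn: "m \<ge> max M N" "n \<ge> max M N"
    have "nrm A (x m \<otimes> y m \<ominus> x n \<otimes> y n) \<le> nrm A (x m \<ominus> x n) * nrm A (y m) + nrm A (x n) * nrm A (y m \<ominus> y n)"
      by (rule nrm_mult_diff) simp_all
    also have "\<dots> \<le> nrm A (x m \<ominus> x n) * L + K * nrm A (y m \<ominus> y n)"
      by (intro add_mono mult_left_mono mult_right_mono K L nrm_nonneg) simp_all
    also have "\<dots> < e / (2 * L) * L + K * (e / (2 * K))"
      using M[of m n] N[of m n] mn K L by (intro add_strict_mono mult_strict_left_mono mult_strict_right_mono) auto
    also have "\<dots> = e" using K L by simp
    finally show "nrm A (x m \<otimes> y m \<ominus> x n \<otimes> y n) < e" .
  qed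
qed

lemma cauchy_smult:
  assumes x: "x \<in> cauchy_seqs A (nrm A)"
  shows "(\<lambda>n. z \<odot> x n) \<in> cauchy_seqs A (nrm A)"
proof (rule cauchyI)
  note [simp] = cauchy_in[OF x]
  show "z \<odot> x n \<in> carrier A" for n by simp
  fix e :: real assume "e > 0"
  hence e: "e / (cmod z + 1) > 0" by (simp add: add_nonneg_pos)
  obtain M where M: "\<And>m n. m \<ge> M \<Longrightarrow> n \<ge> M \<Longrightarrow> nrm A (x m \<ominus> x n) < e / (cmod z + 1)" using cauchyD[OF x e] by blast
  show "\<exists>M. \<forall>m\<ge>M. \<forall>n\<ge>M. nrm A (z \<odot> x m \<ominus> z \<odot> x n) < e"
  proof (intro exI allI impI)
    fix m n assume mn: "m \<ge> M" "n \<ge> M"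
    have "nrm A (z \<odot> x m \<ominus> z \<odot> x n) = cmod z * nrm A (x m \<ominus> x n)" by (simp add: nrm_smult flip: smult_diff)
    also have "\<dots> \<le> cmod z * (e / (cmod z + 1))" using M[OF mn] by (intro mult_left_mono) auto
    also have "\<dots> < e" using \<open>e > 0\<close> by (simp add: field_simps add_pos_nonneg)
    finally show "nrm A (z \<odot> x m \<ominus> z \<odot> x n) < e" .
  qed
qed

lemma cauchy_uminus: "x \<in> cauchy_seqs A (nrm A) \<Longrightarrow> (\<lambda>n. \<ominus> x n) \<in> cauchy_seqs A (nrm A)"
  using cauchy_smult[of x "-1"] by (simp add: smult_minus_one cauchy_in)

lemma cauchy_star:
  assumes x: "x \<in> cauchy_seqs A (nrm A)"
  shows "(\<lambda>n. star A (x n)) \<in> cauchy_seqs A (nrm A)"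
  using x by (auto simp: cauchy_seqs_def nrm_star simp flip: star_diff)

lemma lims_const: "a \<in> carrier A \<Longrightarrow> lims (\<lambda>n. a) a"
  by (simp add: lims_def)

lemma lims_cauchy:
  assumes "lims x l" shows "x \<in> cauchy_seqs A (nrm A)"
proof (rule cauchyI)
  have [simp]: "x n \<in> carrier A" "l \<in> carrier A" for n using assms by (auto simp: lims_def)
  show "x n \<in> carrier A" for n by simp
  fix e :: real assume "e > 0"
  hence "e / 2 > 0" by simp
  then obtain M where M: "\<And>n. n \<ge> M \<Longrightarrow> norm (nrm A (x n \<ominus> l) - 0) < e / 2"
    using assms LIMSEQ_D[of "\<lambda>n. nrm A (x n \<ominus> l)" 0] unfolding lims_def by metis
  show "\<exists>M. \<forall>m\<ge>M. \<forall>n\<ge>M. nrm A (x m \<ominus> x n) < e"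
  proof (intro exI allI impI)
    fix m n assume mn: "m \<ge> M" "n \<ge> M"
    show "nrm A (x m \<ominus> x n) < e"
      using M[OF mn(1)] M[OF mn(2)] nrm_diff_triangle[of "x m" l "x n"] nrm_diff_commute[of l "x n"] by simp
  qed
qed

lemma lims_le:
  assumes "\<And>n. x n \<in> carrier A" "l \<in> carrier A" "\<And>n. nrm A (x n \<ominus> l) \<le> f n" "f \<longlonglongrightarrow> 0"
  shows "lims x l"
  unfolding lims_def
  by (intro conjI allI assms(1,2) real_tendsto_sandwich[OF _ _ tendsto_const assms(4)] always_eventually)
    (use assms in \<open>auto intro!: nrm_nonneg\<close>)

lemma lims_add: assumes "lims x l" "lims y m" shows "lims (\<lambda>n. x n \<oplus> y n) (l \<oplus> m)"
proof (rule lims_le)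
  show "nrm A (x n \<oplus> y n \<ominus> (l \<oplus> m)) \<le> nrm A (x n \<ominus> l) + nrm A (y n \<ominus> m)" for n
    using assms by (intro nrm_add_diff) (auto simp: lims_def)
  show "(\<lambda>n. nrm A (x n \<ominus> l) + nrm A (y n \<ominus> m)) \<longlonglongrightarrow> 0"
    using assms by (auto simp: lims_def intro: tendsto_add_zero)
qed (use assms in \<open>auto simp: lims_def\<close>)

lemma lims_mult: assumes "lims x l" "lims y m" shows "lims (\<lambda>n. x n \<otimes> y n) (l \<otimes> m)"
proof -
  obtain K where K: "K > 0" "\<And>n. nrm A (y n) \<le> K" by (rule cauchy_bounded[OF lims_cauchy[OF assms(2)]]) blast
  show ?thesis
  proof (rule lims_le)
    show "nrm A (x n \<otimes> y n \<ominus> l \<otimes> m) \<le> nrm A (x n \<ominus> l) * K + nrm A l * nrm A (y n \<ominus> m)" for n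
    proof -
      have "nrm A (x n \<otimes> y n \<ominus> l \<otimes> m) \<le> nrm A (x n \<ominus> l) * nrm A (y n) + nrm A l * nrm A (y n \<ominus> m)"
        using assms by (intro nrm_mult_diff) (auto simp: lims_def)
      also have "nrm A (x n \<ominus> l) * nrm A (y n) \<le> nrm A (x n \<ominus> l) * K"
        using assms by (intro mult_left_mono K nrm_nonneg) (auto simp: lims_def)
      finally show ?thesis by simp
    qed
    have "(\<lambda>n. nrm A (x n \<ominus> l) * K + nrm A l * nrm A (y n \<ominus> m)) \<longlonglongrightarrow> 0 * K + nrm A l * 0"
      using assms by (intro tendsto_intros) (auto simp: lims_def)
    thus "(\<lambda>n. nrm A (x n \<ominus> l) * K + nrm A l * nrm A (y n \<ominus> m)) \<longlonglongrightarrow> 0" by simp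
  qed (use assms in \<open>auto simp: lims_def\<close>)
qed

lemma lims_smult: assumes "lims x l" shows "lims (\<lambda>n. z \<odot> x n) (z \<odot> l)"
proof (rule lims_le)
  show "nrm A (z \<odot> x n \<ominus> z \<odot> l) \<le> cmod z * nrm A (x n \<ominus> l)" for n
    using assms by (simp add: lims_def nrm_smult flip: smult_diff)
  have "(\<lambda>n. cmod z * nrm A (x n \<ominus> l)) \<longlonglongrightarrow> cmod z * 0"
    using assms by (intro tendsto_intros) (auto simp: lims_def)
  thus "(\<lambda>n. cmod z * nrm A (x n \<ominus> l)) \<longlonglongrightarrow> 0" by simp
qed (use assms in \<open>auto simp: lims_def\<close>)

lemma lims_star: assumes "lims x l" shows "lims (\<lambda>n. star A (x n)) (star A l)"
  using assms by (simp add: lims_def nrm_star flip: star_diff)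

lemma lims_nrm: assumes "lims x l" shows "(\<lambda>n. nrm A (x n)) \<longlonglongrightarrow> nrm A l"
proof (rule LIM_zero_cancel, rule Lim_null_comparison)
  show "\<forall>\<^sub>F n in sequentially. norm (nrm A (x n) - nrm A l) \<le> nrm A (x n \<ominus> l)"
    by (intro always_eventually allI) (use assms nrm_diff_ge in \<open>auto simp: lims_def\<close>)
  show "(\<lambda>n. nrm A (x n \<ominus> l)) \<longlonglongrightarrow> 0" using assms by (simp add: lims_def)
qed

lemma lims_unique_nrm: assumes "lims x l" "lims x m" shows "nrm A (l \<ominus> m) = 0"
proof -
  have [simp]: "x n \<in> carrier A" "l \<in> carrier A" "m \<in> carrier A" for n using assms by (auto simp: lims_def)
  have "(\<lambda>n. nrm A (x n \<ominus> l) + nrm A (x n \<ominus> m)) \<longlonglongrightarrow> 0"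
    using assms by (auto simp: lims_def intro: tendsto_add_zero)
  moreover have "nrm A (l \<ominus> m) \<le> nrm A (x n \<ominus> l) + nrm A (x n \<ominus> m)" for n
    using nrm_diff_triangle[of l "x n" m] nrm_diff_commute[of l "x n"] by simp
  ultimately have "nrm A (l \<ominus> m) \<le> 0" by (intro tendsto_lowerbound) (auto intro: always_eventually)
  thus ?thesis using nrm_nonneg[of "l \<ominus> m"] by simp
qed

end

lemma (in cstar_algebra) lims_unique: "lims x l \<Longrightarrow> lims x m \<Longrightarrow> l = m"
  using lims_unique_nrm[of x l m] norm_eq_zero[of "l \<ominus> m"] diff_eq_zero_iff[of l m] by (auto simp: lims_def)

lemma (in cstar_algebra) cauchy_lims: "x \<in> cauchy_seqs A (nrm A) \<Longrightarrow> \<exists>l. lims x l"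
  using norm_complete cauchy_in unfolding is_complete_def lims_def by metis

text \<open>The operations of a completion are defined by images of sets of representatives; all members of
  such a set lie in one class.\<close>

lemma Image_eq_class:
  assumes "equiv S R" "z \<in> S" "T \<noteq> {}" "\<And>t. t \<in> T \<Longrightarrow> (t, z) \<in> R"
  shows "R `` T = R `` {z}"
proof -
  have "R `` {t} = R `` {z}" if "t \<in> T" for t using equiv_class_eq[OF assms(1) assms(4)[OF that]] .
  moreover have "R `` T = (\<Union>t\<in>T. R `` {t})" by auto
  ultimately show ?thesis using assms(3) by auto
qed

context seminormed_star_algebra
begin

abbreviation "CS \<equiv> cauchy_seqs A (nrm A)"
abbreviation "CA \<equiv> completion A"

text \<open>The class of a Cauchy sequence in the completion.\<close>

definition cl :: "(nat \<Rightarrow> 'a) \<Rightarrow> (nat \<Rightarrow> 'a) set" where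
  "cl x = null_equiv A `` {x}"

lemma null_equiv_iff: "(x, y) \<in> null_equiv A \<longleftrightarrow> x \<in> CS \<and> y \<in> CS \<and> (\<lambda>n. nrm A (x n \<ominus> y n)) \<longlonglongrightarrow> 0"
  by (simp add: null_equiv_def)

lemma null_equivI:
  assumes "x \<in> CS" "y \<in> CS" "\<And>n. nrm A (x n \<ominus> y n) \<le> f n" "f \<longlonglongrightarrow> 0"
  shows "(x, y) \<in> null_equiv A"
  unfolding null_equiv_iff
  by (intro conjI assms(1,2) real_tendsto_sandwich[OF _ _ tendsto_const assms(4)] always_eventually allI)
    (use assms cauchy_in in \<open>auto intro!: nrm_nonneg\<close>)

lemma equiv_null: "equiv CS (null_equiv A)"
proof (rule equivI)
  show "null_equiv A \<subseteq> CS \<times> CS" by (auto simp: null_equiv_iff)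
  show "refl_on CS (null_equiv A)" by (auto simp: refl_on_def null_equiv_iff cauchy_in)
  show "sym (null_equiv A)"
    by (auto simp: sym_def null_equiv_iff cauchy_in nrm_diff_commute)
  show "trans (null_equiv A)"
  proof (rule transI)
    fix x y z assume xy: "(x, y) \<in> null_equiv A" and yz: "(y, z) \<in> null_equiv A"
    show "(x, z) \<in> null_equiv A"
    proof (rule null_equivI)
      show "nrm A (x n \<ominus> z n) \<le> nrm A (x n \<ominus> y n) + nrm A (y n \<ominus> z n)" for n
        using xy yz by (intro nrm_diff_triangle) (auto simp: null_equiv_iff cauchy_in)
    qed (use xy yz in \<open>auto simp: null_equiv_iff intro: tendsto_add_zero\<close>)
  qed
qed

lemma cl_eq_iff: "x \<in> CS \<Longrightarrow> y \<in> CS \<Longrightarrow> cl x = cl y \<longleftrightarrow> (\<lambda>n. nrm A (x n \<ominus> y n)) \<longlonglongrightarrow> 0"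
  unfolding cl_def by (simp add: eq_equiv_class_iff[OF equiv_null] null_equiv_iff)

lemma mem_cl: "x' \<in> cl x \<longleftrightarrow> (x, x') \<in> null_equiv A"
  by (simp add: cl_def)

lemma cl_self: "x \<in> CS \<Longrightarrow> x \<in> cl x"
  by (simp add: mem_cl null_equiv_iff cauchy_in)

lemma carrier_CA: "carrier CA = CS // null_equiv A"
  by (simp add: completion_def Let_def)

lemma cl_in [simp, intro]: "x \<in> CS \<Longrightarrow> cl x \<in> carrier CA"
  unfolding carrier_CA cl_def by (rule quotientI)

lemma carrier_CA_E:
  assumes "X \<in> carrier CA" obtains x where "x \<in> CS" "X = cl x"
  using assms unfolding carrier_CA cl_def by (auto elim: quotientE)

lemma CA_add: assumes x: "x \<in> CS" and y: "y \<in> CS" shows "cl x \<oplus>\<^bsub>CA\<^esub> cl y = cl (\<lambda>n. x n \<oplus> y n)"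
proof -
  have "null_equiv A `` {\<lambda>n. x' n \<oplus> y' n | x' y'. x' \<in> cl x \<and> y' \<in> cl y} = cl (\<lambda>n. x n \<oplus> y n)"
    unfolding cl_def[of "\<lambda>n. x n \<oplus> y n"]
  proof (rule Image_eq_class[OF equiv_null])
    fix t assume "t \<in> {\<lambda>n. x' n \<oplus> y' n | x' y'. x' \<in> cl x \<and> y' \<in> cl y}"
    then obtain x' y' where t: "t = (\<lambda>n. x' n \<oplus> y' n)" and x': "x' \<in> cl x" and y': "y' \<in> cl y" by blast
    have nx: "(x', x) \<in> null_equiv A" and ny: "(y', y) \<in> null_equiv A"
      using x' y' equiv_null by (auto simp: mem_cl equiv_def sym_def)
    show "(t, \<lambda>n. x n \<oplus> y n) \<in> null_equiv A"
    proof (rule null_equivI)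
      show "nrm A (t n \<ominus> (x n \<oplus> y n)) \<le> nrm A (x' n \<ominus> x n) + nrm A (y' n \<ominus> y n)" for n
        unfolding t using nx ny by (intro nrm_add_diff) (auto simp: null_equiv_iff cauchy_in)
    qed (use nx ny in \<open>auto simp: t null_equiv_iff intro: tendsto_add_zero cauchy_add\<close>)
  qed (use cl_self[OF x] cl_self[OF y] x y in \<open>auto intro: cauchy_add\<close>)
  thus ?thesis by (simp add: completion_def Let_def)
qed

lemma CA_mult: assumes x: "x \<in> CS" and y: "y \<in> CS" shows "cl x \<otimes>\<^bsub>CA\<^esub> cl y = cl (\<lambda>n. x n \<otimes> y n)"
proof -
  have "null_equiv A `` {\<lambda>n. x' n \<otimes> y' n | x' y'. x' \<in> cl x \<and> y' \<in> cl y} = cl (\<lambda>n. x n \<otimes> y n)"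
    unfolding cl_def[of "\<lambda>n. x n \<otimes> y n"]
  proof (rule Image_eq_class[OF equiv_null])
    fix t assume "t \<in> {\<lambda>n. x' n \<otimes> y' n | x' y'. x' \<in> cl x \<and> y' \<in> cl y}"
    then obtain x' y' where t: "t = (\<lambda>n. x' n \<otimes> y' n)" and x': "x' \<in> cl x" and y': "y' \<in> cl y" by blast
    have nx: "(x', x) \<in> null_equiv A" and ny: "(y', y) \<in> null_equiv A"
      using x' y' equiv_null by (auto simp: mem_cl equiv_def sym_def)
    obtain K where K: "K > 0" "\<And>n. nrm A (x n) \<le> K" by (rule cauchy_bounded[OF x]) blast
    have y'C: "y' \<in> CS" using ny by (simp add: null_equiv_iff)
    obtain L where L: "L > 0" "\<And>n. nrm A (y' n) \<le> L" by (rule cauchy_bounded[OF y'C]) blast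
    show "(t, \<lambda>n. x n \<otimes> y n) \<in> null_equiv A"
    proof (rule null_equivI)
      show "nrm A (t n \<ominus> x n \<otimes> y n) \<le> nrm A (x' n \<ominus> x n) * L + K * nrm A (y' n \<ominus> y n)" for n
      proof -
        have "nrm A (t n \<ominus> x n \<otimes> y n) \<le> nrm A (x' n \<ominus> x n) * nrm A (y' n) + nrm A (x n) * nrm A (y' n \<ominus> y n)"
          unfolding t using nx ny by (intro nrm_mult_diff) (auto simp: null_equiv_iff cauchy_in)
        also have "\<dots> \<le> nrm A (x' n \<ominus> x n) * L + K * nrm A (y' n \<ominus> y n)"
          using nx ny by (intro add_mono mult_left_mono mult_right_mono K L nrm_nonneg)
            (auto simp: null_equiv_iff cauchy_in)
        finally show ?thesis .
      qed
      have "(\<lambda>n. nrm A (x' n \<ominus> x n) * L + K * nrm A (y' n \<ominus> y n)) \<longlonglongrightarrow> 0 * L + K * 0"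
        using nx ny by (intro tendsto_intros) (auto simp: null_equiv_iff)
      thus "(\<lambda>n. nrm A (x' n \<ominus> x n) * L + K * nrm A (y' n \<ominus> y n)) \<longlonglongrightarrow> 0" by simp
    qed (use nx ny in \<open>auto simp: t null_equiv_iff intro: cauchy_mult\<close>)
  qed (use cl_self[OF x] cl_self[OF y] x y in \<open>auto intro: cauchy_mult\<close>)
  thus ?thesis by (simp add: completion_def Let_def)
qed

lemma CA_smult: assumes x: "x \<in> CS" shows "z \<odot>\<^bsub>CA\<^esub> cl x = cl (\<lambda>n. z \<odot> x n)"
proof -
  have "null_equiv A `` {\<lambda>n. z \<odot> x' n | x'. x' \<in> cl x} = cl (\<lambda>n. z \<odot> x n)"
    unfolding cl_def[of "\<lambda>n. z \<odot> x n"]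
  proof (rule Image_eq_class[OF equiv_null])
    fix t assume "t \<in> {\<lambda>n. z \<odot> x' n | x'. x' \<in> cl x}"
    then obtain x' where t: "t = (\<lambda>n. z \<odot> x' n)" and x': "x' \<in> cl x" by blast
    have nx: "(x', x) \<in> null_equiv A" using x' equiv_null by (auto simp: mem_cl equiv_def sym_def)
    show "(t, \<lambda>n. z \<odot> x n) \<in> null_equiv A"
    proof (rule null_equivI)
      show "nrm A (t n \<ominus> z \<odot> x n) \<le> cmod z * nrm A (x' n \<ominus> x n)" for n
        using nx by (simp add: t null_equiv_iff cauchy_in nrm_smult flip: smult_diff)
      have "(\<lambda>n. cmod z * nrm A (x' n \<ominus> x n)) \<longlonglongrightarrow> cmod z * 0"
        using nx by (intro tendsto_intros) (auto simp: null_equiv_iff)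
      thus "(\<lambda>n. cmod z * nrm A (x' n \<ominus> x n)) \<longlonglongrightarrow> 0" by simp
    qed (use nx in \<open>auto simp: t null_equiv_iff intro: cauchy_smult\<close>)
  qed (use cl_self[OF x] x in \<open>auto intro: cauchy_smult\<close>)
  thus ?thesis by (simp add: completion_def Let_def)
qed

lemma CA_star: assumes x: "x \<in> CS" shows "star CA (cl x) = cl (\<lambda>n. star A (x n))"
proof -
  have "null_equiv A `` {\<lambda>n. star A (x' n) | x'. x' \<in> cl x} = cl (\<lambda>n. star A (x n))"
    unfolding cl_def[of "\<lambda>n. star A (x n)"]
  proof (rule Image_eq_class[OF equiv_null])
    fix t assume "t \<in> {\<lambda>n. star A (x' n) | x'. x' \<in> cl x}"
    then obtain x' where t: "t = (\<lambda>n. star A (x' n))" and x': "x' \<in> cl x" by blast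
    have nx: "(x', x) \<in> null_equiv A" using x' equiv_null by (auto simp: mem_cl equiv_def sym_def)
    show "(t, \<lambda>n. star A (x n)) \<in> null_equiv A"
      using nx by (auto simp: t null_equiv_iff cauchy_in nrm_star simp flip: star_diff intro: cauchy_star)
  qed (use cl_self[OF x] x in \<open>auto intro: cauchy_star\<close>)
  thus ?thesis by (simp add: completion_def Let_def)
qed

lemma CA_zero: "\<zero>\<^bsub>CA\<^esub> = cl (\<lambda>n. \<zero>)"
  by (simp add: completion_def Let_def cl_def)

lemma CA_nrm: assumes x: "x \<in> CS" shows "(\<lambda>n. nrm A (x n)) \<longlonglongrightarrow> nrm CA (cl x)"
proof -
  obtain r where r: "(\<lambda>n. nrm A (x n)) \<longlonglongrightarrow> r" using cauchy_nrm[OF x] by (auto simp: convergent_def)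
  have "(\<lambda>n. nrm A (x' n)) \<longlonglongrightarrow> r" if "x' \<in> cl x" for x'
  proof -
    have nx: "(x, x') \<in> null_equiv A" using that by (simp add: mem_cl)
    have "(\<lambda>n. nrm A (x' n) - nrm A (x n)) \<longlonglongrightarrow> 0"
    proof (rule Lim_null_comparison)
      show "\<forall>\<^sub>F n in sequentially. norm (nrm A (x' n) - nrm A (x n)) \<le> nrm A (x n \<ominus> x' n)"
        using nx nrm_diff_ge[of "x _" "x' _"]
        by (intro always_eventually allI) (auto simp: null_equiv_iff cauchy_in abs_minus_commute)
    qed (use nx in \<open>simp add: null_equiv_iff\<close>)
    from tendsto_add[OF this r] show ?thesis by simp
  qed
  hence "(THE r. \<forall>x'\<in>cl x. (\<lambda>n. nrm A (x' n)) \<longlonglongrightarrow> r) = r"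
    using cl_self[OF x] by (intro the_equality) (auto intro: LIMSEQ_unique)
  thus ?thesis using r by (simp add: completion_def Let_def)
qed

lemma star_algebra_CA: "star_algebra CA"
proof (rule star_algebra.intro)
  note cin = cauchy_add cauchy_mult cauchy_smult cauchy_star cauchy_const[OF zero_cl]
  note ops = CA_add CA_mult CA_smult CA_star CA_zero
  note E = carrier_CA_E
  show "Module.module complex_ring CA"
  proof (rule moduleI[OF cring_complex_ring])
    show "abelian_group CA"
    proof (rule abelian_groupI)
      fix X Y Z assume "X \<in> carrier CA" "Y \<in> carrier CA" "Z \<in> carrier CA"
      then obtain x y z where [simp]: "X = cl x" "Y = cl y" "Z = cl z" and [simp]: "x \<in> CS" "y \<in> CS" "z \<in> CS"
        by (metis E)
      show "(X \<oplus>\<^bsub>CA\<^esub> Y) \<oplus>\<^bsub>CA\<^esub> Z = X \<oplus>\<^bsub>CA\<^esub> (Y \<oplus>\<^bsub>CA\<^esub> Z)"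
        by (simp add: ops cin cauchy_in M.a_assoc)
    next
      fix X Y assume "X \<in> carrier CA" "Y \<in> carrier CA"
      then obtain x y where [simp]: "X = cl x" "Y = cl y" and [simp]: "x \<in> CS" "y \<in> CS"
        by (metis E)
      show "X \<oplus>\<^bsub>CA\<^esub> Y \<in> carrier CA" by (simp add: ops cin cl_in)
      show "X \<oplus>\<^bsub>CA\<^esub> Y = Y \<oplus>\<^bsub>CA\<^esub> X" by (simp add: ops cin cauchy_in M.a_comm)
    next
      fix X assume "X \<in> carrier CA"
      then obtain x where [simp]: "X = cl x" and [simp]: "x \<in> CS" by (metis E)
      show "\<zero>\<^bsub>CA\<^esub> \<oplus>\<^bsub>CA\<^esub> X = X" by (simp add: ops cin cauchy_in)
      show "\<exists>Y\<in>carrier CA. Y \<oplus>\<^bsub>CA\<^esub> X = \<zero>\<^bsub>CA\<^esub>"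
        by (rule bexI[of _ "cl (\<lambda>n. (-1) \<odot> x n)"])
          (simp_all add: ops cin cauchy_in cl_in cauchy_uminus smult_minus_one M.l_neg)
    next
      show "\<zero>\<^bsub>CA\<^esub> \<in> carrier CA" by (simp add: CA_zero cl_in cin)
    qed
  next
    fix z X Y assume "X \<in> carrier CA" "Y \<in> carrier CA"
    then obtain x y where [simp]: "X = cl x" "Y = cl y" and [simp]: "x \<in> CS" "y \<in> CS"
      by (metis E)
    show "z \<odot>\<^bsub>CA\<^esub> (X \<oplus>\<^bsub>CA\<^esub> Y) = z \<odot>\<^bsub>CA\<^esub> X \<oplus>\<^bsub>CA\<^esub> z \<odot>\<^bsub>CA\<^esub> Y"
      by (simp add: ops cin cauchy_in smult_radd)
  next
    fix z w X assume "X \<in> carrier CA"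
    then obtain x where [simp]: "X = cl x" and [simp]: "x \<in> CS" by (metis E)
    show "z \<odot>\<^bsub>CA\<^esub> X \<in> carrier CA" by (simp add: ops cin cl_in)
    show "(z \<oplus>\<^bsub>complex_ring\<^esub> w) \<odot>\<^bsub>CA\<^esub> X = z \<odot>\<^bsub>CA\<^esub> X \<oplus>\<^bsub>CA\<^esub> w \<odot>\<^bsub>CA\<^esub> X"
      by (simp add: ops cin cauchy_in smult_ladd)
    show "(z \<otimes>\<^bsub>complex_ring\<^esub> w) \<odot>\<^bsub>CA\<^esub> X = z \<odot>\<^bsub>CA\<^esub> (w \<odot>\<^bsub>CA\<^esub> X)"
      by (simp add: ops cin cauchy_in smult_smult)
    show "\<one>\<^bsub>complex_ring\<^esub> \<odot>\<^bsub>CA\<^esub> X = X" by (simp add: ops cin cauchy_in)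
  qed
  show "star_algebra_axioms CA"
  proof
    fix X Y Z assume "X \<in> carrier CA" "Y \<in> carrier CA" "Z \<in> carrier CA"
    then obtain x y z where [simp]: "X = cl x" "Y = cl y" "Z = cl z" and [simp]: "x \<in> CS" "y \<in> CS" "z \<in> CS"
      by (metis E)
    show "(X \<otimes>\<^bsub>CA\<^esub> Y) \<otimes>\<^bsub>CA\<^esub> Z = X \<otimes>\<^bsub>CA\<^esub> (Y \<otimes>\<^bsub>CA\<^esub> Z)"
      by (simp add: ops cin cauchy_in mult_assoc)
    show "(X \<oplus>\<^bsub>CA\<^esub> Y) \<otimes>\<^bsub>CA\<^esub> Z = X \<otimes>\<^bsub>CA\<^esub> Z \<oplus>\<^bsub>CA\<^esub> Y \<otimes>\<^bsub>CA\<^esub> Z"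
      by (simp add: ops cin cauchy_in add_mult)
    show "X \<otimes>\<^bsub>CA\<^esub> (Y \<oplus>\<^bsub>CA\<^esub> Z) = X \<otimes>\<^bsub>CA\<^esub> Y \<oplus>\<^bsub>CA\<^esub> X \<otimes>\<^bsub>CA\<^esub> Z"
      by (simp add: ops cin cauchy_in mult_add)
  next
    fix X Y z assume "X \<in> carrier CA" "Y \<in> carrier CA"
    then obtain x y where [simp]: "X = cl x" "Y = cl y" and [simp]: "x \<in> CS" "y \<in> CS"
      by (metis E)
    show "X \<otimes>\<^bsub>CA\<^esub> Y \<in> carrier CA" by (simp add: ops cin cl_in)
    show "(z \<odot>\<^bsub>CA\<^esub> X) \<otimes>\<^bsub>CA\<^esub> Y = z \<odot>\<^bsub>CA\<^esub> (X \<otimes>\<^bsub>CA\<^esub> Y)"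
      by (simp add: ops cin cauchy_in smult_mult)
    show "X \<otimes>\<^bsub>CA\<^esub> (z \<odot>\<^bsub>CA\<^esub> Y) = z \<odot>\<^bsub>CA\<^esub> (X \<otimes>\<^bsub>CA\<^esub> Y)"
      by (simp add: ops cin cauchy_in mult_smult)
    show "star CA (X \<oplus>\<^bsub>CA\<^esub> Y) = star CA X \<oplus>\<^bsub>CA\<^esub> star CA Y"
      by (simp add: ops cin cauchy_in star_add)
    show "star CA (X \<otimes>\<^bsub>CA\<^esub> Y) = star CA Y \<otimes>\<^bsub>CA\<^esub> star CA X"
      by (simp add: ops cin cauchy_in star_mult)
  next
    fix X z assume "X \<in> carrier CA"
    then obtain x where [simp]: "X = cl x" and [simp]: "x \<in> CS" by (metis E)
    show "star CA X \<in> carrier CA" by (simp add: ops cin cl_in)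
    show "star CA (star CA X) = X" by (simp add: ops cin cauchy_in star_star)
    show "star CA (z \<odot>\<^bsub>CA\<^esub> X) = cnj z \<odot>\<^bsub>CA\<^esub> star CA X"
      by (simp add: ops cin cauchy_in star_smult)
  qed
qed

lemma cstar_seminorm_CA: "is_cstar_seminorm CA (nrm CA)"
  unfolding is_cstar_seminorm_def
proof (intro conjI ballI allI)
  note cin = cauchy_add cauchy_mult cauchy_smult cauchy_star
  fix X Y z assume "X \<in> carrier CA" "Y \<in> carrier CA"
  then obtain x y where [simp]: "X = cl x" "Y = cl y" and [simp]: "x \<in> CS" "y \<in> CS"
    by (metis carrier_CA_E)
  note x = \<open>x \<in> CS\<close> and y = \<open>y \<in> CS\<close>
  show "nrm CA (X \<oplus>\<^bsub>CA\<^esub> Y) \<le> nrm CA X + nrm CA Y"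
    using LIMSEQ_le[OF CA_nrm[OF cauchy_add[OF x y]] tendsto_add[OF CA_nrm[OF x] CA_nrm[OF y]]]
      nrm_add cauchy_in x y by (simp add: CA_add)
  show "nrm CA (X \<otimes>\<^bsub>CA\<^esub> Y) \<le> nrm CA X * nrm CA Y"
    using LIMSEQ_le[OF CA_nrm[OF cauchy_mult[OF x y]] tendsto_mult[OF CA_nrm[OF x] CA_nrm[OF y]]]
      nrm_mult cauchy_in x y by (simp add: CA_mult)
next
  fix X z assume "X \<in> carrier CA"
  then obtain x where [simp]: "X = cl x" and x[simp]: "x \<in> CS" by (metis carrier_CA_E)
  show "nrm CA (z \<odot>\<^bsub>CA\<^esub> X) = cmod z * nrm CA X"
    using tendsto_mult[OF tendsto_const[of "cmod z"] CA_nrm[OF x]] CA_nrm[OF cauchy_smult[OF x, of z]]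
    by (simp add: CA_smult nrm_smult cauchy_in LIMSEQ_unique)
  show "nrm CA (star CA X \<otimes>\<^bsub>CA\<^esub> X) = (nrm CA X)\<^sup>2"
    using tendsto_power[OF CA_nrm[OF x], of 2] CA_nrm[OF cauchy_mult[OF cauchy_star[OF x] x]]
    by (simp add: CA_mult CA_star cauchy_star nrm_star_mult cauchy_in LIMSEQ_unique)
qed

lemma seminormed_CA: "seminormed_star_algebra CA"
  by (simp add: seminormed_star_algebra_def seminormed_star_algebra_axioms_def star_algebra_CA cstar_seminorm_CA)

abbreviation "toC \<equiv> to_completion A"

lemma toC_cl: "toC a = cl (\<lambda>n. a)"
  by (simp add: to_completion_def cl_def)

lemma star_hom_toC: "star_hom A CA toC"
  by unfold_locales (auto simp: toC_cl CA_add CA_mult CA_smult CA_star cauchy_const)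

lemma nrm_toC: "a \<in> carrier A \<Longrightarrow> nrm CA (toC a) = nrm A a"
  using CA_nrm[OF cauchy_const] LIMSEQ_unique tendsto_const unfolding toC_cl by metis

lemma toC_eq_iff: "a \<in> carrier A \<Longrightarrow> b \<in> carrier A \<Longrightarrow> toC a = toC b \<longleftrightarrow> nrm A (a \<ominus> b) = 0"
  by (simp add: toC_cl cl_eq_iff cauchy_const LIMSEQ_const_iff)

lemma CA_diff: assumes "x \<in> CS" "y \<in> CS" shows "cl x \<ominus>\<^bsub>CA\<^esub> cl y = cl (\<lambda>n. x n \<ominus> y n)"
proof -
  interpret C: star_algebra CA by (rule star_algebra_CA)
  have "cl x \<ominus>\<^bsub>CA\<^esub> cl y = cl x \<oplus>\<^bsub>CA\<^esub> (-1) \<odot>\<^bsub>CA\<^esub> cl y"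
    using assms by (simp add: a_minus_def C.smult_minus_one cl_in)
  also have "\<dots> = cl (\<lambda>n. x n \<ominus> y n)"
    using assms by (simp add: CA_add CA_smult cauchy_uminus smult_minus_one cauchy_in a_minus_def)
  finally show ?thesis .
qed

lemma cauchy_diff: "x \<in> CS \<Longrightarrow> y \<in> CS \<Longrightarrow> (\<lambda>n. x n \<ominus> y n) \<in> CS"
  using cauchy_add[of x "\<lambda>n. (-1) \<odot> y n"] cauchy_smult[of y "-1"]
  by (simp add: a_minus_def smult_minus_one cauchy_in)

lemma nrm_toC_diff_le:
  assumes x: "x \<in> CS" and M: "\<And>m. m \<ge> M \<Longrightarrow> nrm A (x m \<ominus> a) \<le> e" and a: "a \<in> carrier A"
  shows "nrm CA (cl x \<ominus>\<^bsub>CA\<^esub> toC a) \<le> e"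
proof -
  have "(\<lambda>m. nrm A (x m \<ominus> a)) \<longlonglongrightarrow> nrm CA (cl x \<ominus>\<^bsub>CA\<^esub> toC a)"
    using CA_nrm[OF cauchy_diff[OF x cauchy_const[OF a]]] by (simp add: toC_cl CA_diff x a cauchy_const)
  thus ?thesis by (rule tendsto_upperbound) (use M in \<open>auto intro: eventually_sequentiallyI\<close>)
qed

lemma toC_dense:
  assumes X: "X \<in> carrier CA" and e: "e > 0"
  obtains a where "a \<in> carrier A" "nrm CA (X \<ominus>\<^bsub>CA\<^esub> toC a) < e"
proof -
  obtain x where x: "X = cl x" "x \<in> CS" using X by (rule carrier_CA_E)
  have "e / 2 > 0" using e by simp
  then obtain M where M: "\<And>m n. m \<ge> M \<Longrightarrow> n \<ge> M \<Longrightarrow> nrm A (x m \<ominus> x n) < e / 2"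
    using cauchyD[OF x(2)] by blast
  have "nrm CA (cl x \<ominus>\<^bsub>CA\<^esub> toC (x M)) \<le> e / 2"
    by (rule nrm_toC_diff_le[OF x(2)]) (use M[of _ M] x cauchy_in in \<open>auto intro: less_imp_le\<close>)
  thus thesis using that[of "x M"] x e cauchy_in by auto
qed

theorem cstar_algebra_CA: "cstar_algebra CA"
proof -
  interpret C: seminormed_star_algebra CA by (rule seminormed_CA)
  show ?thesis
  proof
    show "is_cstar_seminorm CA (nrm CA)" by (rule cstar_seminorm_CA)
    fix X assume X: "X \<in> carrier CA" "nrm CA X = 0"
    then obtain x where x: "X = cl x" "x \<in> CS" by (metis carrier_CA_E)
    show "X = \<zero>\<^bsub>CA\<^esub>"
      using CA_nrm[OF x(2)] X x by (simp add: CA_zero cl_eq_iff cauchy_const cauchy_in)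
  next
    show "is_complete CA (nrm CA)"
      unfolding is_complete_def
    proof
      fix F assume F: "F \<in> cauchy_seqs CA (nrm CA)"
      have Fin[simp]: "F n \<in> carrier CA" for n using F by (rule C.cauchy_in)
      have "\<exists>a. a \<in> carrier A \<and> nrm CA (F n \<ominus>\<^bsub>CA\<^esub> toC a) < inverse (real (Suc n))" for n
        using toC_dense[OF Fin, of "inverse (real (Suc n))" n] by (metis inverse_positive_iff_positive of_nat_0_less_iff zero_less_Suc)
      then obtain a where a[simp]: "\<And>n. a n \<in> carrier A"
        and aF: "\<And>n. nrm CA (F n \<ominus>\<^bsub>CA\<^esub> toC (a n)) < inverse (real (Suc n))" by metis
      have ta[simp]: "toC (a n) \<in> carrier CA" for n using star_hom.hom_closed[OF star_hom_toC] by simp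
      have aCS: "a \<in> CS"
      proof (rule cauchyI[OF a])
        fix e :: real assume "e > 0"
        hence e: "e / 3 > 0" by simp
        obtain M where M: "\<And>m n. m \<ge> M \<Longrightarrow> n \<ge> M \<Longrightarrow> nrm CA (F m \<ominus>\<^bsub>CA\<^esub> F n) < e / 3"
          using C.cauchyD[OF F e] by blast
        obtain N where N: "inverse (real (Suc N)) < e / 3" using reals_Archimedean[OF e] by blast
        show "\<exists>M. \<forall>m\<ge>M. \<forall>n\<ge>M. nrm A (a m \<ominus> a n) < e"
        proof (intro exI allI impI)
          fix m n assume mn: "m \<ge> max M N" "n \<ge> max M N"
          have inv: "inverse (real (Suc k)) < e / 3" if "k \<ge> max M N" for k
            using that le_imp_inverse_le[of "real (Suc N)" "real (Suc k)"]
            by (intro le_less_trans[OF _ N]) auto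
          have "nrm A (a m \<ominus> a n) = nrm CA (toC (a m) \<ominus>\<^bsub>CA\<^esub> toC (a n))"
            by (simp add: nrm_toC flip: star_hom_diff[OF star_hom_toC star_algebra_axioms star_algebra_CA])
          also have "\<dots> \<le> nrm CA (toC (a m) \<ominus>\<^bsub>CA\<^esub> F m) + (nrm CA (F m \<ominus>\<^bsub>CA\<^esub> F n) + nrm CA (F n \<ominus>\<^bsub>CA\<^esub> toC (a n)))"
            using C.nrm_diff_triangle[of "toC (a m)" "F m" "toC (a n)"] C.nrm_diff_triangle[of "F m" "F n" "toC (a n)"] by simp
          also have "nrm CA (toC (a m) \<ominus>\<^bsub>CA\<^esub> F m) = nrm CA (F m \<ominus>\<^bsub>CA\<^esub> toC (a m))" by (simp add: C.nrm_diff_commute)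
          finally show "nrm A (a m \<ominus> a n) < e"
            using aF[of m] aF[of n] M[of m n] inv[of m] inv[of n] mn by linarith
        qed
      qed
      show "\<exists>L\<in>carrier CA. (\<lambda>n. nrm CA (F n \<ominus>\<^bsub>CA\<^esub> L)) \<longlonglongrightarrow> 0"
      proof (rule bexI[of _ "cl a"])
        show "cl a \<in> carrier CA" using aCS by (rule cl_in)
        show "(\<lambda>n. nrm CA (F n \<ominus>\<^bsub>CA\<^esub> cl a)) \<longlonglongrightarrow> 0"
        proof (rule LIMSEQ_I)
          fix e :: real assume "e > 0"
          hence e: "e / 3 > 0" by simp
          obtain M where M: "\<And>m n. m \<ge> M \<Longrightarrow> n \<ge> M \<Longrightarrow> nrm A (a m \<ominus> a n) < e / 3"
            using cauchyD[OF aCS e] by blast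
          obtain N where N: "inverse (real (Suc N)) < e / 3" using reals_Archimedean[OF e] by blast
          show "\<exists>M. \<forall>n\<ge>M. norm (nrm CA (F n \<ominus>\<^bsub>CA\<^esub> cl a) - 0) < e"
          proof (intro exI allI impI)
            fix n assume n: "n \<ge> max M N"
            have inv: "inverse (real (Suc n)) < e / 3"
              using n le_imp_inverse_le[of "real (Suc N)" "real (Suc n)"]
              by (intro le_less_trans[OF _ N]) auto
            have "nrm CA (cl a \<ominus>\<^bsub>CA\<^esub> toC (a n)) \<le> e / 3"
              by (rule nrm_toC_diff_le[OF aCS]) (use M[of _ n] n in \<open>auto intro: less_imp_le\<close>)
            hence "nrm CA (F n \<ominus>\<^bsub>CA\<^esub> cl a) < e"
              using C.nrm_diff_triangle[of "F n" "toC (a n)" "cl a"] C.nrm_diff_commute[of "cl a" "toC (a n)"]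
                aF[of n] inv aCS \<open>e > 0\<close> by (auto simp: cl_in)
            thus "norm (nrm CA (F n \<ominus>\<^bsub>CA\<^esub> cl a) - 0) < e"
              using C.nrm_nonneg[of "F n \<ominus>\<^bsub>CA\<^esub> cl a"] aCS by (simp add: cl_in)
          qed
        qed
      qed
    qed
  qed
qed

text \<open>An isometric homomorphism extends to the completion.\<close>

lemma extend_isometry:
  assumes B: "cstar_algebra B" and h: "star_hom A B h"
    and iso: "\<And>a. a \<in> carrier A \<Longrightarrow> nrm B (h a) = nrm A a"
  obtains \<psi> where "star_hom CA B \<psi>" "\<And>X. X \<in> carrier CA \<Longrightarrow> nrm B (\<psi> X) = nrm CA X"
    "\<And>a. a \<in> carrier A \<Longrightarrow> \<psi> (toC a) = h a"
proof -
  interpret B: cstar_algebra B by fact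
  interpret h: star_hom A B h by fact
  note hd = star_hom_diff[OF h star_algebra_axioms B.star_algebra_axioms]
  have hc: "(\<lambda>n. h (x n)) \<in> cauchy_seqs B (nrm B)" if "x \<in> CS" for x
    using that by (auto simp: cauchy_seqs_def h.hom_closed iso simp flip: hd)
  define \<psi> where "\<psi> X = (SOME l. \<exists>x\<in>CS. X = cl x \<and> B.lims (\<lambda>n. h (x n)) l)" for X
  have \<psi>: "B.lims (\<lambda>n. h (x n)) (\<psi> (cl x))" if x: "x \<in> CS" for x
  proof -
    have "\<exists>l. \<exists>x'\<in>CS. cl x = cl x' \<and> B.lims (\<lambda>n. h (x' n)) l"
      using B.cauchy_lims[OF hc[OF x]] x by blast
    from someI_ex[OF this, folded \<psi>_def]
    obtain x' where x': "x' \<in> CS" "cl x = cl x'" "B.lims (\<lambda>n. h (x' n)) (\<psi> (cl x))" by blast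
    have "(\<lambda>n. nrm A (x n \<ominus> x' n)) \<longlonglongrightarrow> 0" using x' x by (simp add: cl_eq_iff)
    show ?thesis
    proof (rule B.lims_le)
      show "nrm B (h (x n) \<ominus>\<^bsub>B\<^esub> \<psi> (cl x)) \<le> nrm A (x n \<ominus> x' n) + nrm B (h (x' n) \<ominus>\<^bsub>B\<^esub> \<psi> (cl x))" for n
        using B.nrm_diff_triangle[of "h (x n)" "h (x' n)" "\<psi> (cl x)"] x x' iso[of "x n \<ominus> x' n"]
        by (auto simp: hd cauchy_in h.hom_closed B.lims_def)
      show "(\<lambda>n. nrm A (x n \<ominus> x' n) + nrm B (h (x' n) \<ominus>\<^bsub>B\<^esub> \<psi> (cl x))) \<longlonglongrightarrow> 0"
        using x' \<open>(\<lambda>n. nrm A (x n \<ominus> x' n)) \<longlonglongrightarrow> 0\<close> by (auto simp: B.lims_def intro: tendsto_add_zero)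
    qed (use x x' cauchy_in h.hom_closed in \<open>auto simp: B.lims_def\<close>)
  qed
  show thesis
  proof (rule that)
    show "star_hom CA B \<psi>"
    proof
      fix X Y assume "X \<in> carrier CA" "Y \<in> carrier CA"
      then obtain x y where [simp]: "X = cl x" "Y = cl y" and x[simp]: "x \<in> CS" and y[simp]: "y \<in> CS"
        by (metis carrier_CA_E)
      have "B.lims (\<lambda>n. h (x n \<oplus> y n)) (\<psi> X \<oplus>\<^bsub>B\<^esub> \<psi> Y)"
        using B.lims_add[OF \<psi>[OF x] \<psi>[OF y]] by (simp add: h.hom_add cauchy_in)
      thus "\<psi> (X \<oplus>\<^bsub>CA\<^esub> Y) = \<psi> X \<oplus>\<^bsub>B\<^esub> \<psi> Y"
        using \<psi>[OF cauchy_add[OF x y]] by (simp add: CA_add B.lims_unique)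
      have "B.lims (\<lambda>n. h (x n \<otimes> y n)) (\<psi> X \<otimes>\<^bsub>B\<^esub> \<psi> Y)"
        using B.lims_mult[OF \<psi>[OF x] \<psi>[OF y]] by (simp add: h.hom_mult cauchy_in)
      thus "\<psi> (X \<otimes>\<^bsub>CA\<^esub> Y) = \<psi> X \<otimes>\<^bsub>B\<^esub> \<psi> Y"
        using \<psi>[OF cauchy_mult[OF x y]] by (simp add: CA_mult B.lims_unique)
    next
      fix X z assume "X \<in> carrier CA"
      then obtain x where [simp]: "X = cl x" and x[simp]: "x \<in> CS" by (metis carrier_CA_E)
      show "\<psi> X \<in> carrier B" using \<psi>[OF x] by (simp add: B.lims_def)
      have "B.lims (\<lambda>n. h (z \<odot> x n)) (z \<odot>\<^bsub>B\<^esub> \<psi> X)"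
        using B.lims_smult[OF \<psi>[OF x]] by (simp add: h.hom_smult cauchy_in)
      thus "\<psi> (z \<odot>\<^bsub>CA\<^esub> X) = z \<odot>\<^bsub>B\<^esub> \<psi> X"
        using \<psi>[OF cauchy_smult[OF x, of z]] by (simp add: CA_smult B.lims_unique)
      have "B.lims (\<lambda>n. h (star A (x n))) (star B (\<psi> X))"
        using B.lims_star[OF \<psi>[OF x]] by (simp add: h.hom_star cauchy_in)
      thus "\<psi> (star CA X) = star B (\<psi> X)"
        using \<psi>[OF cauchy_star[OF x]] by (simp add: CA_star B.lims_unique)
    qed
    fix X assume "X \<in> carrier CA"
    then obtain x where X: "X = cl x" and x: "x \<in> CS" by (metis carrier_CA_E)
    have "(\<lambda>n. nrm A (x n)) \<longlonglongrightarrow> nrm B (\<psi> X)"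
      using B.lims_nrm[OF \<psi>[OF x]] by (simp add: iso cauchy_in x X)
    thus "nrm B (\<psi> X) = nrm CA X" using CA_nrm[OF x] X by (simp add: LIMSEQ_unique)
  next
    fix a assume a: "a \<in> carrier A"
    have "B.lims (\<lambda>n. h a) (h a)" by (rule B.lims_const) (simp add: h.hom_closed a)
    thus "\<psi> (toC a) = h a" using \<psi>[OF cauchy_const[OF a]] by (simp add: toC_cl B.lims_unique)
  qed
qed

end

text \<open>The image of an isometric homomorphism defined on a C*-algebra is closed.\<close>

lemma isometry_image_closed:
  fixes g :: "'c::cstar_alg"
  assumes B: "cstar_algebra B" and h: "star_hom B cls \<psi>"
    and iso: "\<And>b. b \<in> carrier B \<Longrightarrow> norm (\<psi> b) = nrm B b"
    and approx: "\<And>e. e > 0 \<Longrightarrow> \<exists>b\<in>carrier B. norm (g - \<psi> b) < e"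
  shows "\<exists>b\<in>carrier B. \<psi> b = g"
proof -
  interpret B: cstar_algebra B by fact
  have hd: "\<psi> (a \<ominus>\<^bsub>B\<^esub> b) = \<psi> a - \<psi> b" if "a \<in> carrier B" "b \<in> carrier B" for a b
    using star_hom_diff[OF h B.star_algebra_axioms star_algebra_cls that] by simp
  have "\<exists>b\<in>carrier B. norm (g - \<psi> b) < inverse (real (Suc n))" for n
    by (rule approx) simp
  then obtain b where b[simp]: "\<And>n. b n \<in> carrier B" and bg: "\<And>n. norm (g - \<psi> (b n)) < inverse (real (Suc n))"
    by metis
  have lim: "(\<lambda>n. \<psi> (b n)) \<longlonglongrightarrow> g"
  proof (rule LIM_zero_cancel, rule Lim_null_comparison)
    show "\<forall>\<^sub>F n in sequentially. norm (\<psi> (b n) - g) \<le> inverse (real (Suc n))"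
      using bg by (intro always_eventually allI) (auto simp: norm_minus_commute intro: less_imp_le)
  qed (rule LIMSEQ_inverse_real_of_nat)
  have "b \<in> cauchy_seqs B (nrm B)"
  proof (rule B.cauchyI[OF b])
    fix e :: real assume "e > 0"
    then obtain M where "\<forall>m\<ge>M. \<forall>n\<ge>M. norm (\<psi> (b m) - \<psi> (b n)) < e"
      using CauchyD[OF LIMSEQ_imp_Cauchy[OF lim]] by blast
    thus "\<exists>M. \<forall>m\<ge>M. \<forall>n\<ge>M. nrm B (b m \<ominus>\<^bsub>B\<^esub> b n) < e" by (auto simp flip: iso hd)
  qed
  then obtain l where l: "B.lims b l" using B.cauchy_lims by blast
  hence lc: "l \<in> carrier B" by (simp add: B.lims_def)
  have "(\<lambda>n. \<psi> (b n) - \<psi> l) \<longlonglongrightarrow> 0"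
  proof (rule tendsto_norm_zero_cancel)
    show "(\<lambda>n. norm (\<psi> (b n) - \<psi> l)) \<longlonglongrightarrow> 0"
      using l lc by (simp add: B.lims_def iso flip: hd)
  qed
  hence "(\<lambda>n. \<psi> (b n)) \<longlonglongrightarrow> \<psi> l" by (rule LIM_zero_cancel)
  thus ?thesis using lim lc LIMSEQ_unique by blast
qed

section \<open>The free *-algebra\<close>

text \<open>The monomial given by a word, and the word that results from a formal adjoint, which reverses the
  order and exchanges \<open>s\<close> and \<open>s\<^sup>*\<close>.\<close>

definition wmono :: "('g \<times> bool) list \<Rightarrow> 'g star_poly" where
  "wmono w = (\<lambda>u. if u = w then 1 else 0)"

definition flip_word :: "('g \<times> bool) list \<Rightarrow> ('g \<times> bool) list" where
  "flip_word w = rev (map (\<lambda>(s, t). (s, \<not> t)) w)"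

lemma flip_flip [simp]: "flip_word (flip_word w) = w"
  by (induction w) (auto simp: flip_word_def rev_map)

lemma flip_word_append: "flip_word (u @ v) = flip_word v @ flip_word u"
  by (simp add: flip_word_def)

lemma flip_word_eq_iff: "flip_word u = w \<longleftrightarrow> u = flip_word w"
  using flip_flip by metis

lemma length_flip [simp]: "length (flip_word w) = length w"
  by (simp add: flip_word_def)

lemma flip_Nil_iff [simp]: "flip_word w = [] \<longleftrightarrow> w = []"
  by (simp add: flip_word_def)

lemma fst_flip: "fst ` set (flip_word w) = fst ` set w"
  by (force simp: flip_word_def image_iff)

text \<open>The words that index the monomials of the free *-algebra on \<open>S\<close>, which has no unit.\<close>

definition words :: "'g set \<Rightarrow> ('g \<times> bool) list set" where
  "words S = {w. w \<noteq> [] \<and> fst ` set w \<subseteq> S}"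

lemma words_append: "u \<in> words S \<Longrightarrow> v \<in> words S \<Longrightarrow> u @ v \<in> words S"
  by (auto simp: words_def)

lemma words_flip: "w \<in> words S \<Longrightarrow> flip_word w \<in> words S"
  by (simp add: words_def fst_flip)

context
  fixes S :: "'g set" and p :: "'g star_poly \<Rightarrow> real"
begin

abbreviation "FA \<equiv> free_star_algebra S p"

lemma FA_simps:
  "carrier FA = {a. finite {w. a w \<noteq> 0} \<and> {w. a w \<noteq> 0} \<subseteq> words S}"
  "a \<otimes>\<^bsub>FA\<^esub> b = (\<lambda>w. \<Sum>i\<le>length w. a (take i w) * b (drop i w))"
  "\<zero>\<^bsub>FA\<^esub> = (\<lambda>w. 0)" "a \<oplus>\<^bsub>FA\<^esub> b = (\<lambda>w. a w + b w)" "z \<odot>\<^bsub>FA\<^esub> a = (\<lambda>w. z * a w)"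
  "star FA a = (\<lambda>w. cnj (a (flip_word w)))" "nrm FA = p"
  by (auto simp: free_star_algebra_def flip_word_def words_def)

lemma FA_mult_closed:
  assumes a: "a \<in> carrier FA" and b: "b \<in> carrier FA"
  shows "a \<otimes>\<^bsub>FA\<^esub> b \<in> carrier FA"
proof -
  let ?U = "{w. a w \<noteq> 0}" and ?V = "{w. b w \<noteq> 0}"
  have "{w. (a \<otimes>\<^bsub>FA\<^esub> b) w \<noteq> 0} \<subseteq> (\<lambda>(u, v). u @ v) ` (?U \<times> ?V)"
  proof
    fix w assume "w \<in> {w. (a \<otimes>\<^bsub>FA\<^esub> b) w \<noteq> 0}"
    hence "(\<Sum>i\<le>length w. a (take i w) * b (drop i w)) \<noteq> 0" by (simp add: FA_simps)
    then obtain i where "a (take i w) * b (drop i w) \<noteq> 0" by (meson sum.not_neutral_contains_not_neutral)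
    thus "w \<in> (\<lambda>(u, v). u @ v) ` (?U \<times> ?V)"
      by (intro image_eqI[of _ _ "(take i w, drop i w)"]) auto
  qed
  moreover have "finite ((\<lambda>(u, v). u @ v) ` (?U \<times> ?V))" using a b by (simp add: FA_simps)
  moreover have "(\<lambda>(u, v). u @ v) ` (?U \<times> ?V) \<subseteq> words S" using a b by (auto simp: FA_simps intro: words_append)
  ultimately show ?thesis unfolding FA_simps(1) by (auto intro: finite_subset)
qed

lemma star_algebra_FA: "star_algebra FA"
proof (rule star_algebra.intro)
  have fin_add: "finite {w. a w + b w \<noteq> 0}" if "finite {w. a w \<noteq> 0}" "finite {w. b w \<noteq> (0::complex)}"
    for a b :: "'g star_poly"
    by (rule finite_subset[OF _ finite_UnI[OF that]]) auto
  have fin_mult: "finite {w. z \<noteq> 0 \<and> a w \<noteq> 0}" if "finite {w. a w \<noteq> (0::complex)}"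
    for a :: "'g star_poly" and z :: complex
    by (rule finite_subset[OF _ that]) auto
  have nz: "x \<noteq> 0 \<or> y \<noteq> 0" if "x + y \<noteq> 0" for x y :: complex
    using that by auto
  show "Module.module complex_ring FA"
  proof (rule moduleI[OF cring_complex_ring])
    show "abelian_group FA"
    proof (rule abelian_groupI)
      fix a assume a: "a \<in> carrier FA"
      show "\<exists>y\<in>carrier FA. y \<oplus>\<^bsub>FA\<^esub> a = \<zero>\<^bsub>FA\<^esub>"
        by (rule bexI[of _ "\<lambda>w. - a w"]) (use a in \<open>auto simp: FA_simps\<close>)
    qed (auto simp: FA_simps fun_eq_iff algebra_simps fin_add subset_iff dest: nz)
  qed (auto simp: FA_simps fun_eq_iff algebra_simps fin_add fin_mult subset_iff dest: nz)
  show "star_algebra_axioms FA"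
  proof
    fix a b c assume abc: "a \<in> carrier FA" "b \<in> carrier FA" "c \<in> carrier FA"
    show "(a \<otimes>\<^bsub>FA\<^esub> b) \<otimes>\<^bsub>FA\<^esub> c = a \<otimes>\<^bsub>FA\<^esub> (b \<otimes>\<^bsub>FA\<^esub> c)"
    proof
      fix w :: "('g \<times> bool) list"
      have "((a \<otimes>\<^bsub>FA\<^esub> b) \<otimes>\<^bsub>FA\<^esub> c) w =
          (\<Sum>j=0..length w. \<Sum>i=0..j. a (take i w) * b (take (j - i) (drop i w)) * c (drop j w))"
        by (auto simp: FA_simps sum_distrib_right atMost_atLeast0 drop_take min_def split: if_splits intro!: sum.cong)
      also have "\<dots> = (\<Sum>j=0..length w. \<Sum>i=0..j. (\<lambda>i m l. a (take i w) * b (take m (drop i w)) * c (drop (i + m) w)) i (j - i) (length w - j))"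
        by (intro sum.cong refl) auto
      also have "\<dots> = (\<Sum>j=0..length w. \<Sum>i=0..length w - j. (\<lambda>i m l. a (take i w) * b (take m (drop i w)) * c (drop (i + m) w)) j i (length w - j - i))"
        by (rule fps_mult_assoc_lemma)
      also have "\<dots> = (a \<otimes>\<^bsub>FA\<^esub> (b \<otimes>\<^bsub>FA\<^esub> c)) w"
        by (auto simp: FA_simps sum_distrib_left atMost_atLeast0 mult.assoc add.commute intro!: sum.cong)
      finally show "((a \<otimes>\<^bsub>FA\<^esub> b) \<otimes>\<^bsub>FA\<^esub> c) w = (a \<otimes>\<^bsub>FA\<^esub> (b \<otimes>\<^bsub>FA\<^esub> c)) w" .
    qed
    show "(a \<oplus>\<^bsub>FA\<^esub> b) \<otimes>\<^bsub>FA\<^esub> c = a \<otimes>\<^bsub>FA\<^esub> c \<oplus>\<^bsub>FA\<^esub> b \<otimes>\<^bsub>FA\<^esub> c"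
      by (simp add: FA_simps distrib_right sum.distrib)
    show "a \<otimes>\<^bsub>FA\<^esub> (b \<oplus>\<^bsub>FA\<^esub> c) = a \<otimes>\<^bsub>FA\<^esub> b \<oplus>\<^bsub>FA\<^esub> a \<otimes>\<^bsub>FA\<^esub> c"
      by (simp add: FA_simps distrib_left sum.distrib)
  next
    fix a b z assume ab: "a \<in> carrier FA" "b \<in> carrier FA"
    show "a \<otimes>\<^bsub>FA\<^esub> b \<in> carrier FA" using ab by (rule FA_mult_closed)
    show "(z \<odot>\<^bsub>FA\<^esub> a) \<otimes>\<^bsub>FA\<^esub> b = z \<odot>\<^bsub>FA\<^esub> (a \<otimes>\<^bsub>FA\<^esub> b)"
      by (simp add: FA_simps sum_distrib_left mult_ac)
    show "a \<otimes>\<^bsub>FA\<^esub> (z \<odot>\<^bsub>FA\<^esub> b) = z \<odot>\<^bsub>FA\<^esub> (a \<otimes>\<^bsub>FA\<^esub> b)"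
      by (simp add: FA_simps sum_distrib_left mult_ac)
    show "star FA (a \<oplus>\<^bsub>FA\<^esub> b) = star FA a \<oplus>\<^bsub>FA\<^esub> star FA b" by (simp add: FA_simps)
    show "star FA (a \<otimes>\<^bsub>FA\<^esub> b) = star FA b \<otimes>\<^bsub>FA\<^esub> star FA a"
    proof
      fix w :: "('g \<times> bool) list"
      have td: "take i (flip_word w) = flip_word (drop (length w - i) w)"
        "drop i (flip_word w) = flip_word (take (length w - i) w)" if "i \<le> length w" for i
        using that by (simp_all add: flip_word_def take_rev drop_rev take_map drop_map)
      have "(star FA (a \<otimes>\<^bsub>FA\<^esub> b)) w = (\<Sum>i\<le>length w. cnj (a (take i (flip_word w))) * cnj (b (drop i (flip_word w))))"
        by (simp add: FA_simps)
      also have "\<dots> = (\<Sum>i\<le>length w. cnj (b (flip_word (take i w))) * cnj (a (flip_word (drop i w))))"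
        by (rule sum.reindex_bij_witness[of _ "\<lambda>i. length w - i" "\<lambda>i. length w - i"]) (auto simp: td)
      also have "\<dots> = (star FA b \<otimes>\<^bsub>FA\<^esub> star FA a) w" by (simp add: FA_simps)
      finally show "(star FA (a \<otimes>\<^bsub>FA\<^esub> b)) w = (star FA b \<otimes>\<^bsub>FA\<^esub> star FA a) w" .
    qed
  next
    fix a z assume a: "a \<in> carrier FA"
    have eq: "{w. a (flip_word w) \<noteq> 0} = flip_word ` {w. a w \<noteq> 0}"
      by (auto simp: image_iff) (metis flip_flip)
    show "star FA a \<in> carrier FA"
      using a by (auto simp: FA_simps eq intro: words_flip)
    show "star FA (star FA a) = a" by (simp add: FA_simps)
    show "star FA (z \<odot>\<^bsub>FA\<^esub> a) = cnj z \<odot>\<^bsub>FA\<^esub> star FA a" by (simp add: FA_simps)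
  qed
qed

lemma mono_in: "w \<in> words S \<Longrightarrow> wmono w \<in> carrier FA"
  by (simp add: FA_simps wmono_def)

lemma star_mono: "star FA (wmono w) = wmono (flip_word w)"
  by (auto simp: FA_simps wmono_def flip_word_eq_iff fun_eq_iff)

lemma mono_mult: "wmono u \<otimes>\<^bsub>FA\<^esub> wmono v = wmono (u @ v)"
proof
  fix w
  have "(wmono u \<otimes>\<^bsub>FA\<^esub> wmono v) w = (\<Sum>i\<le>length w. if i = length u then (if w = u @ v then 1 else 0) else 0)"
    unfolding FA_simps
  proof (intro sum.cong refl)
    fix i assume "i \<in> {..length w}"
    hence i: "i \<le> length w" by simp
    have eq: "(take i w = u \<and> drop i w = v) \<longleftrightarrow> (i = length u \<and> w = u @ v)"
    proof
      assume a: "take i w = u \<and> drop i w = v"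
      have "length (take i w) = i" using i by simp
      moreover have "w = take i w @ drop i w" by simp
      ultimately show "i = length u \<and> w = u @ v" using a by metis
    qed simp
    have "wmono u (take i w) * wmono v (drop i w) = (if take i w = u \<and> drop i w = v then 1 else 0)"
      by (simp add: wmono_def)
    thus "wmono u (take i w) * wmono v (drop i w) = (if i = length u then if w = u @ v then 1 else 0 else 0)"
      unfolding eq by simp
  qed
  also have "\<dots> = wmono (u @ v) w" by (auto simp: wmono_def)
  finally show "(wmono u \<otimes>\<^bsub>FA\<^esub> wmono v) w = wmono (u @ v) w" .
qed

lemma gen_mono: "gen s = wmono [(s, False)]"
  by (simp add: gen_def wmono_def)

lemma gen_in: "s \<in> S \<Longrightarrow> gen s \<in> carrier FA"
  by (simp add: gen_mono mono_in words_def)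

lemma free_linear_induct [consumes 1, case_names zero wmono add]:
  assumes a: "a \<in> carrier FA"
    and zero: "P \<zero>\<^bsub>FA\<^esub>"
    and wmono: "\<And>z w. w \<in> words S \<Longrightarrow> P (z \<odot>\<^bsub>FA\<^esub> wmono w)"
    and add: "\<And>a b. a \<in> carrier FA \<Longrightarrow> b \<in> carrier FA \<Longrightarrow> P a \<Longrightarrow> P b \<Longrightarrow> P (a \<oplus>\<^bsub>FA\<^esub> b)"
  shows "P a"
proof -
  have "\<forall>a. {w. a w \<noteq> 0} = W \<longrightarrow> a \<in> carrier FA \<longrightarrow> P a" if "finite W" for W
    using that
  proof (induction W rule: finite_induct)
    case empty
    show ?case
    proof (intro allI impI)
      fix a :: "'g star_poly" assume "{w. a w \<noteq> 0} = {}"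
      hence "a = \<zero>\<^bsub>FA\<^esub>" by (auto simp: FA_simps)
      thus "P a" using zero by simp
    qed
  next
    case (insert u W)
    show ?case
    proof (intro allI impI)
      fix a :: "'g star_poly" assume a: "{w. a w \<noteq> 0} = insert u W" "a \<in> carrier FA"
      define b where "b = (\<lambda>w. if w = u then 0 else a w)"
      have b: "{w. b w \<noteq> 0} = W" using a insert.hyps by (auto simp: b_def)
      have W: "W \<subseteq> words S" "u \<in> words S" using a by (auto simp: FA_simps)
      have bc: "b \<in> carrier FA" using b insert.hyps W by (simp add: FA_simps)
      have "a u \<odot>\<^bsub>FA\<^esub> wmono u \<in> carrier FA"
        using star_algebra.smult_cl[OF star_algebra_FA] mono_in W by simp
      hence "P (a u \<odot>\<^bsub>FA\<^esub> wmono u \<oplus>\<^bsub>FA\<^esub> b)"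
        using insert.IH b bc wmono W by (intro add) auto
      also have "a u \<odot>\<^bsub>FA\<^esub> wmono u \<oplus>\<^bsub>FA\<^esub> b = a" by (auto simp: FA_simps b_def wmono_def)
      finally show "P a" .
    qed
  qed
  thus ?thesis using a by (auto simp: FA_simps)
qed

lemma mono_induct [consumes 1, case_names letter Cons]:
  assumes w: "w \<in> words S"
    and letter: "\<And>s t. s \<in> S \<Longrightarrow> P (wmono [(s, t)])"
    and Cons: "\<And>s t u. s \<in> S \<Longrightarrow> u \<in> words S \<Longrightarrow> P (wmono u) \<Longrightarrow> P (wmono [(s, t)] \<otimes>\<^bsub>FA\<^esub> wmono u)"
  shows "P (wmono w)"
  using w
proof (induction w)
  case (Cons l w)
  obtain s t where l: "l = (s, t)" by (cases l)
  show ?case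
  proof (cases "w = []")
    case True
    thus ?thesis using Cons l letter by (simp add: words_def)
  next
    case False
    hence w: "w \<in> words S" "s \<in> S" using Cons.prems l by (auto simp: words_def)
    from assms(3)[OF w(2,1) Cons.IH[OF w(1)], of t] show ?thesis by (simp add: mono_mult l)
  qed
qed (simp add: words_def)

lemma letter_cases: "wmono [(s, t)] = (if t then star FA (gen s) else gen s)"
  by (auto simp: gen_mono star_mono flip_word_def)

lemma free_induct [consumes 1, case_names zero add smult mult star gen]:
  assumes a: "a \<in> carrier FA"
    and zero: "P \<zero>\<^bsub>FA\<^esub>"
    and add: "\<And>a b. a \<in> carrier FA \<Longrightarrow> b \<in> carrier FA \<Longrightarrow> P a \<Longrightarrow> P b \<Longrightarrow> P (a \<oplus>\<^bsub>FA\<^esub> b)"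
    and smult: "\<And>z a. a \<in> carrier FA \<Longrightarrow> P a \<Longrightarrow> P (z \<odot>\<^bsub>FA\<^esub> a)"
    and mult: "\<And>a b. a \<in> carrier FA \<Longrightarrow> b \<in> carrier FA \<Longrightarrow> P a \<Longrightarrow> P b \<Longrightarrow> P (a \<otimes>\<^bsub>FA\<^esub> b)"
    and star: "\<And>a. a \<in> carrier FA \<Longrightarrow> P a \<Longrightarrow> P (star FA a)"
    and gen: "\<And>s. s \<in> S \<Longrightarrow> P (gen s)"
  shows "P a"
proof -
  have letter: "P (wmono [(s, t)])" if "s \<in> S" for s t
    using that by (simp add: letter_cases gen star gen_in)
  have "P (wmono w)" if "w \<in> words S" for w
    using that
  proof (induction w rule: mono_induct)
    case (letter s t)
    thus ?case by (rule \<open>\<And>s t. s \<in> S \<Longrightarrow> P (wmono [(s, t)])\<close>)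
  next
    case (Cons s t u)
    thus ?case by (intro mult letter mono_in) (auto simp: words_def)
  qed
  with a show ?thesis
    by (induction a rule: free_linear_induct) (auto intro: zero smult add mono_in)
qed

text \<open>The universal property of the free *-algebra.\<close>

lemma free_hom_exists:
  assumes B: "star_algebra B" and \<theta>: "\<And>s. s \<in> S \<Longrightarrow> \<theta> s \<in> carrier B"
  obtains h where "star_hom FA B h" "\<And>s. s \<in> S \<Longrightarrow> h (gen s) = \<theta> s"
proof -
  interpret B: star_algebra B by fact
  interpret F: star_algebra FA by (rule star_algebra_FA)
  \<comment> \<open>The value of a word, by recursion from the left. The value \<open>\<zero>\<close> at the empty word is never used.\<close>
  define letter where "letter = (\<lambda>(s, t). if t then star B (\<theta> s) else \<theta> s)"
  define wval where "wval = rec_list \<zero>\<^bsub>B\<^esub> (\<lambda>l w r. if w = [] then letter l else letter l \<otimes>\<^bsub>B\<^esub> r)"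
  have wval_Cons: "wval (l # w) = (if w = [] then letter l else letter l \<otimes>\<^bsub>B\<^esub> wval w)" for l w
    by (simp add: wval_def)
  have letter_in[simp]: "letter l \<in> carrier B" if "fst l \<in> S" for l
    using that \<theta> by (auto simp: letter_def split: prod.splits)
  have wval_in: "wval w \<in> carrier B" if "w \<in> words S" for w
    using that by (induction w) (auto simp: words_def wval_Cons)
  have wval_append: "wval (u @ v) = wval u \<otimes>\<^bsub>B\<^esub> wval v" if "u \<in> words S" "v \<in> words S" for u v
    using that(1)
  proof (induction u)
    case (Cons l u)
    have v: "v \<noteq> []" using that(2) by (simp add: words_def)
    show ?case
    proof (cases "u = []")
      case True
      thus ?thesis using v by (simp add: wval_Cons)
    next
      case False
      hence u: "u \<in> words S" "fst l \<in> S" using Cons.prems by (auto simp: words_def)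
      show ?thesis using Cons.IH[OF u(1)] u False that(2) by (simp add: wval_Cons wval_in B.mult_assoc)
    qed
  qed (simp add: words_def)
  have wval_flip: "wval (flip_word w) = star B (wval w)" if "w \<in> words S" for w
    using that
  proof (induction w)
    case (Cons l w)
    have l: "fst l \<in> S" using Cons.prems by (auto simp: words_def)
    have fl: "wval (flip_word [l]) = star B (letter l)"
      using l \<theta> by (auto simp: flip_word_def wval_Cons letter_def B.star_star split: prod.splits)
    show ?case
    proof (cases "w = []")
      case True
      thus ?thesis using fl by (simp add: wval_Cons)
    next
      case False
      hence w: "w \<in> words S" using Cons.prems by (auto simp: words_def)
      have l': "[l] \<in> words S" using l by (simp add: words_def)
      have "wval (flip_word (l # w)) = wval (flip_word w) \<otimes>\<^bsub>B\<^esub> wval (flip_word [l])"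
        using wval_append[OF words_flip[OF w] words_flip[OF l']] flip_word_append[of "[l]" w] by simp
      thus ?thesis using False Cons.IH[OF w] fl w l by (simp add: wval_Cons B.star_mult wval_in)
    qed
  qed (simp add: words_def)
  \<comment> \<open>Extension by linearity.\<close>
  define ev where "ev a = finsum B (\<lambda>w. a w \<odot>\<^bsub>B\<^esub> wval w) {w. a w \<noteq> 0}" for a
  have ev_sup: "ev a = finsum B (\<lambda>w. a w \<odot>\<^bsub>B\<^esub> wval w) W"
    if "finite W" "{w. a w \<noteq> 0} \<subseteq> W" "W \<subseteq> words S" for a W
    unfolding ev_def
    by (rule B.M.add.finprod_mono_neutral_cong_left) (use that wval_in in auto)
  have ev_in: "ev a \<in> carrier B" if "a \<in> carrier FA" for a
    unfolding ev_def by (rule B.M.finsum_closed) (use that wval_in in \<open>auto simp: FA_simps\<close>)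
  have ev_add: "ev (a \<oplus>\<^bsub>FA\<^esub> b) = ev a \<oplus>\<^bsub>B\<^esub> ev b" if "a \<in> carrier FA" "b \<in> carrier FA" for a b
  proof -
    let ?W = "{w. a w \<noteq> 0} \<union> {w. b w \<noteq> 0}"
    have W: "finite ?W" "?W \<subseteq> words S" using that by (auto simp: FA_simps)
    have "ev (a \<oplus>\<^bsub>FA\<^esub> b) = finsum B (\<lambda>w. (a \<oplus>\<^bsub>FA\<^esub> b) w \<odot>\<^bsub>B\<^esub> wval w) ?W"
      by (rule ev_sup) (use W in \<open>auto simp: FA_simps\<close>)
    also have "\<dots> = finsum B (\<lambda>w. a w \<odot>\<^bsub>B\<^esub> wval w \<oplus>\<^bsub>B\<^esub> b w \<odot>\<^bsub>B\<^esub> wval w) ?W"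
      using W wval_in by (intro B.M.finsum_cong') (auto simp: FA_simps B.smult_ladd)
    also have "\<dots> = finsum B (\<lambda>w. a w \<odot>\<^bsub>B\<^esub> wval w) ?W \<oplus>\<^bsub>B\<^esub> finsum B (\<lambda>w. b w \<odot>\<^bsub>B\<^esub> wval w) ?W"
      using W wval_in by (intro B.M.finsum_addf) auto
    also have "\<dots> = ev a \<oplus>\<^bsub>B\<^esub> ev b" using W by (simp add: ev_sup[of ?W])
    finally show ?thesis .
  qed
  have ev_zero: "ev \<zero>\<^bsub>FA\<^esub> = \<zero>\<^bsub>B\<^esub>" by (simp add: ev_def FA_simps)
  have ev_mono: "ev (z \<odot>\<^bsub>FA\<^esub> wmono w) = z \<odot>\<^bsub>B\<^esub> wval w" if "w \<in> words S" for z w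
  proof -
    have "ev (z \<odot>\<^bsub>FA\<^esub> wmono w) = finsum B (\<lambda>u. (z \<odot>\<^bsub>FA\<^esub> wmono w) u \<odot>\<^bsub>B\<^esub> wval u) {w}"
      by (rule ev_sup) (use that in \<open>auto simp: FA_simps wmono_def split: if_splits\<close>)
    also have "\<dots> = z \<odot>\<^bsub>B\<^esub> wval w"
      using that wval_in by (simp add: FA_simps wmono_def)
    finally show ?thesis .
  qed
  have ev_smult: "ev (z \<odot>\<^bsub>FA\<^esub> a) = z \<odot>\<^bsub>B\<^esub> ev a" if "a \<in> carrier FA" for z a
    using that
  proof (induction a rule: free_linear_induct)
    case zero
    show ?case by (simp add: ev_zero)
  next
    case (wmono y w)
    thus ?case by (simp add: F.smult_smult mono_in ev_mono B.smult_smult wval_in)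
  next
    case (add a b)
    thus ?case by (simp add: F.smult_radd ev_add ev_in B.smult_radd)
  qed
  have ev_mult_mono: "ev ((z \<odot>\<^bsub>FA\<^esub> wmono u) \<otimes>\<^bsub>FA\<^esub> b) = (z \<odot>\<^bsub>B\<^esub> wval u) \<otimes>\<^bsub>B\<^esub> ev b"
    if u: "u \<in> words S" and b: "b \<in> carrier FA" for z u b
    using b
  proof (induction b rule: free_linear_induct)
    case zero
    show ?case using u by (simp add: ev_zero mono_in wval_in)
  next
    case (wmono y w)
    have "(z \<odot>\<^bsub>FA\<^esub> wmono u) \<otimes>\<^bsub>FA\<^esub> (y \<odot>\<^bsub>FA\<^esub> wmono w) = (z * y) \<odot>\<^bsub>FA\<^esub> wmono (u @ w)"
      using u wmono by (simp add: mono_in F.smult_mult F.mult_smult F.smult_smult mono_mult words_append mult.commute)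
    thus ?case
      using u wmono by (simp add: ev_mono words_append wval_append B.smult_mult B.mult_smult B.smult_smult wval_in mult.commute)
  next
    case (add a b)
    thus ?case using u by (simp add: F.mult_add mono_in ev_add B.mult_add wval_in ev_in)
  qed
  have ev_mult: "ev (a \<otimes>\<^bsub>FA\<^esub> b) = ev a \<otimes>\<^bsub>B\<^esub> ev b" if a: "a \<in> carrier FA" and b: "b \<in> carrier FA" for a b
    using a
  proof (induction a rule: free_linear_induct)
    case zero
    show ?case using b by (simp add: ev_zero ev_in)
  next
    case (wmono z w)
    thus ?case using b by (simp add: ev_mult_mono ev_mono)
  next
    case (add a c)
    thus ?case using b by (simp add: F.add_mult ev_add B.add_mult ev_in)
  qed
  have ev_star: "ev (star FA a) = star B (ev a)" if "a \<in> carrier FA" for a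
    using that
  proof (induction a rule: free_linear_induct)
    case zero
    show ?case by (simp add: ev_zero)
  next
    case (wmono z w)
    thus ?case by (simp add: F.star_smult mono_in star_mono words_flip ev_mono wval_flip B.star_smult wval_in)
  next
    case (add a b)
    thus ?case by (simp add: F.star_add ev_add B.star_add ev_in)
  qed
  show thesis
  proof (rule that)
    show "star_hom FA B ev"
      by unfold_locales (auto simp: ev_in ev_add ev_mult ev_smult ev_star)
    fix s assume "s \<in> S"
    thus "ev (gen s) = \<theta> s"
      using ev_mono[of "[(s, False)]" 1] \<theta> mono_in[of "[(s, False)]"]
      by (simp add: gen_mono wval_Cons letter_def words_def)
  qed
qed

lemma free_hom_eq:
  assumes B: "star_algebra B" and g: "star_hom FA B g" and h: "star_hom FA B h"
    and eq: "\<And>s. s \<in> S \<Longrightarrow> g (gen s) = h (gen s)" and a: "a \<in> carrier FA"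
  shows "g a = h a"
proof -
  interpret g: star_hom FA B g by fact
  interpret h: star_hom FA B h by fact
  show ?thesis using a
  proof (induction a rule: free_induct)
    case zero
    show ?case using star_hom_zero[OF g star_algebra_FA B] star_hom_zero[OF h star_algebra_FA B] by simp
  qed (simp_all add: g.hom_add h.hom_add g.hom_mult h.hom_mult g.hom_smult h.hom_smult g.hom_star h.hom_star eq)
qed

end

section \<open>Cuntz--Krieger families and seminorms\<close>

text \<open>The Cuntz--Krieger relations as a set of elements that have to vanish.\<close>

definition ck_rels :: "('a, 'k::finite) kgraph \<Rightarrow> ('b, 'm) cstar_scheme \<Rightarrow> ('a \<Rightarrow> 'b) \<Rightarrow> ('a \<Rightarrow> 'b) \<Rightarrow> 'b set" where
  "ck_rels \<Lambda> A P T =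
     (\<lambda>v. star A (P v) \<ominus>\<^bsub>A\<^esub> P v) ` verts_of \<Lambda> \<union>
     (\<lambda>v. P v \<otimes>\<^bsub>A\<^esub> P v \<ominus>\<^bsub>A\<^esub> P v) ` verts_of \<Lambda> \<union>
     (\<lambda>f. T f \<otimes>\<^bsub>A\<^esub> (star A (T f) \<otimes>\<^bsub>A\<^esub> T f) \<ominus>\<^bsub>A\<^esub> T f) ` edges_of \<Lambda> \<union>
     (\<lambda>(v, w). P v \<otimes>\<^bsub>A\<^esub> P w) ` {(v, w). v \<in> verts_of \<Lambda> \<and> w \<in> verts_of \<Lambda> \<and> v \<noteq> w} \<union>
     (\<lambda>(a, f, g, b). T a \<otimes>\<^bsub>A\<^esub> T f \<ominus>\<^bsub>A\<^esub> T g \<otimes>\<^bsub>A\<^esub> T b) ` {(a, f, g, b). a \<in> edges_of \<Lambda> \<and>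
        b \<in> edges_of \<Lambda> \<and> f \<in> edges_of \<Lambda> \<and> g \<in> edges_of \<Lambda> \<and> edges_commute \<Lambda> a f g b} \<union>
     (\<lambda>f. star A (T f) \<otimes>\<^bsub>A\<^esub> T f \<ominus>\<^bsub>A\<^esub> P (src \<Lambda> f)) ` edges_of \<Lambda> \<union>
     (\<lambda>(v, i). P v \<ominus>\<^bsub>A\<^esub> (\<Oplus>\<^bsub>A\<^esub>f\<in>edges_into_col \<Lambda> v i. T f \<otimes>\<^bsub>A\<^esub> star A (T f))) ` (verts_of \<Lambda> \<times> UNIV)"

lemma sum_axis: "(\<Sum>j\<in>UNIV. axis i (1::nat) $ j) = 1"
  by (simp add: axis_def)

lemma edges_into_col_edges: "e \<in> edges_into_col \<Lambda> v i \<Longrightarrow> e \<in> edges_of \<Lambda>"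
  using sum_axis[of i]
  by (auto simp: edges_into_col_def edges_of_def)

text \<open>A choice of elements for the vertices and edges, subject to no relations.\<close>

locale ck_closed =
  fixes \<Lambda> :: "('a, 'k::finite) kgraph" and A :: "('b, 'm) cstar_scheme" (structure)
    and P T :: "'a \<Rightarrow> 'b"
  assumes src_verts: "f \<in> edges_of \<Lambda> \<Longrightarrow> src \<Lambda> f \<in> verts_of \<Lambda>"
    and P_in [simp]: "v \<in> verts_of \<Lambda> \<Longrightarrow> P v \<in> carrier A"
    and T_in [simp]: "f \<in> edges_of \<Lambda> \<Longrightarrow> T f \<in> carrier A"
    and star_alg: "star_algebra A"
begin

interpretation star_algebra A by (rule star_alg)

lemma range_sum_in [simp]: "(\<Oplus>f\<in>edges_into_col \<Lambda> v i. T f \<otimes> star A (T f)) \<in> carrier A"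
  by (rule M.finsum_closed) (auto dest: edges_into_col_edges)

lemma ck_rels_in: "\<rho> \<in> ck_rels \<Lambda> A P T \<Longrightarrow> \<rho> \<in> carrier A"
  by (auto simp: ck_rels_def src_verts)

lemma ck_family_iff: "ck_family \<Lambda> A P T \<longleftrightarrow> (\<forall>\<rho>\<in>ck_rels \<Lambda> A P T. \<rho> = \<zero>)"
proof
  assume "ck_family \<Lambda> A P T"
  then interpret ck_family \<Lambda> A P T .
  show "\<forall>\<rho>\<in>ck_rels \<Lambda> A P T. \<rho> = \<zero>"
    unfolding ck_rels_def ball_Un
  proof (intro conjI)
    show "\<forall>x\<in>(\<lambda>(a, f, g, b). T a \<otimes> T f \<ominus> T g \<otimes> T b) ` {(a, f, g, b). a \<in> edges_of \<Lambda> \<and>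
        b \<in> edges_of \<Lambda> \<and> f \<in> edges_of \<Lambda> \<and> g \<in> edges_of \<Lambda> \<and> edges_commute \<Lambda> a f g b}. x = \<zero>"
      using CK2 by (auto simp: diff_eq_zero_iff)
    show "\<forall>x\<in>(\<lambda>(v, i). P v \<ominus> (\<Oplus>f\<in>edges_into_col \<Lambda> v i. T f \<otimes> star A (T f))) ` (verts_of \<Lambda> \<times> UNIV). x = \<zero>"
      using CK4 by (auto simp: diff_eq_zero_iff)
  qed (use P_projection T_partial_isometry CK1 CK3 src_verts in \<open>auto simp: diff_eq_zero_iff\<close>)
next
  assume r: "\<forall>\<rho>\<in>ck_rels \<Lambda> A P T. \<rho> = \<zero>"
  note r = r[unfolded ck_rels_def ball_Un]
  show "ck_family \<Lambda> A P T"
  proof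
    fix v assume v: "v \<in> verts_of \<Lambda>"
    show "star A (P v) = P v \<and> P v \<otimes> P v = P v" using r v by (auto simp: diff_eq_zero_iff)
    show "P v = (\<Oplus>f\<in>edges_into_col \<Lambda> v i. T f \<otimes> star A (T f))" for i
    proof -
      have "P v \<ominus> (\<Oplus>f\<in>edges_into_col \<Lambda> v i. T f \<otimes> star A (T f)) = \<zero>"
        using r v by auto
      thus ?thesis using v by (simp add: diff_eq_zero_iff)
    qed
  next
    fix f assume f: "f \<in> edges_of \<Lambda>"
    show "T f \<otimes> (star A (T f) \<otimes> T f) = T f" using r f by (auto simp: diff_eq_zero_iff)
    show "star A (T f) \<otimes> T f = P (src \<Lambda> f)" using r f src_verts[OF f] by (auto simp: diff_eq_zero_iff)
  next
    fix v w assume "v \<in> verts_of \<Lambda>" "w \<in> verts_of \<Lambda>" "v \<noteq> w"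
    thus "P v \<otimes> P w = \<zero>" using r by auto
  next
    fix a b f g assume ed: "a \<in> edges_of \<Lambda>" "b \<in> edges_of \<Lambda>" "f \<in> edges_of \<Lambda>" "g \<in> edges_of \<Lambda>"
      "edges_commute \<Lambda> a f g b"
    hence "T a \<otimes> T f \<ominus> T g \<otimes> T b = \<zero>" using r by auto
    thus "T a \<otimes> T f = T g \<otimes> T b" using ed by (simp add: diff_eq_zero_iff)
  qed simp_all
qed

text \<open>Homomorphisms map relations to relations.\<close>

lemma ck_rels_hom:
  assumes h: "star_hom A B h" and B: "star_algebra B"
  shows "ck_rels \<Lambda> B (\<lambda>v. h (P v)) (\<lambda>f. h (T f)) = h ` ck_rels \<Lambda> A P T"
proof -
  interpret h: star_hom A B h by fact
  note hs = star_hom_diff[OF h star_algebra_axioms B, symmetric] h.hom_mult[symmetric] h.hom_star[symmetric]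
  have fs: "(\<Oplus>\<^bsub>B\<^esub>f\<in>edges_into_col \<Lambda> v i. h (T f) \<otimes>\<^bsub>B\<^esub> star B (h (T f))) =
      h (\<Oplus>f\<in>edges_into_col \<Lambda> v i. T f \<otimes> star A (T f))" for v i
  proof -
    interpret B: star_algebra B by fact
    have "h (\<Oplus>f\<in>edges_into_col \<Lambda> v i. T f \<otimes> star A (T f)) =
        (\<Oplus>\<^bsub>B\<^esub>f\<in>edges_into_col \<Lambda> v i. h (T f \<otimes> star A (T f)))"
      by (rule star_hom_finsum[OF h star_algebra_axioms B]) (auto dest: edges_into_col_edges)
    also have "\<dots> = (\<Oplus>\<^bsub>B\<^esub>f\<in>edges_into_col \<Lambda> v i. h (T f) \<otimes>\<^bsub>B\<^esub> star B (h (T f)))"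
      by (rule B.M.finsum_cong')
        (auto dest!: edges_into_col_edges simp: h.hom_mult h.hom_star h.hom_closed)
    finally show ?thesis by simp
  qed
  show ?thesis
    unfolding ck_rels_def image_Un image_image fs
    by (intro arg_cong2[where f = "(\<union>)"] image_cong refl)
      (auto simp: hs src_verts)
qed

end

lemma ck_family_completion_iff:
  assumes A: "seminormed_star_algebra A" and c: "ck_closed \<Lambda> A P T"
  shows "ck_family \<Lambda> (completion A) (\<lambda>v. to_completion A (P v)) (\<lambda>f. to_completion A (T f)) \<longleftrightarrow>
     (\<forall>\<rho>\<in>ck_rels \<Lambda> A P T. nrm A \<rho> = 0)"
proof -
  interpret seminormed_star_algebra A by fact
  interpret ck_closed \<Lambda> A P T by fact
  interpret C: star_algebra CA by (rule star_algebra_CA)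
  interpret h: star_hom A CA toC by (rule star_hom_toC)
  have "ck_closed \<Lambda> CA (\<lambda>v. toC (P v)) (\<lambda>f. toC (T f))"
    by unfold_locales (auto simp: src_verts h.hom_closed)
  then interpret cC: ck_closed \<Lambda> CA "\<lambda>v. toC (P v)" "\<lambda>f. toC (T f)" .
  have z: "toC \<rho> = \<zero>\<^bsub>CA\<^esub> \<longleftrightarrow> nrm A \<rho> = 0" if "\<rho> \<in> carrier A" for \<rho>
    using toC_eq_iff[OF that zero_cl] star_hom_zero[OF star_hom_toC star_algebra_axioms star_algebra_CA] that
    by simp
  show ?thesis
    unfolding cC.ck_family_iff ck_rels_hom[OF star_hom_toC star_algebra_CA]
    using z ck_rels_in by auto
qed

subsection \<open>Seminorms of Cuntz--Krieger families\<close>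

lemma star_algebra_ck_free: "star_algebra (ck_free \<Lambda> p)"
  unfolding ck_free_def by (rule star_algebra_FA)

lemma nrm_ck_free [simp]: "nrm (ck_free \<Lambda> p) = p"
  unfolding ck_free_def by (rule FA_simps)

lemmas ck_free_induct [consumes 1, case_names zero add smult mult star gen] =
  free_induct[of _ "Proj ` verts_of \<Lambda> \<union> Iso ` edges_of \<Lambda>" for \<Lambda>, folded ck_free_def]

lemma seminormed_ck_free: "is_cstar_seminorm (ck_free \<Lambda> p) p \<Longrightarrow> seminormed_star_algebra (ck_free \<Lambda> p)"
  by (simp add: seminormed_star_algebra_def seminormed_star_algebra_axioms_def star_algebra_ck_free)

text \<open>The seminorm is a field of the record of the free *-algebra, so changing it changes the algebra. The
  operations do not depend on it.\<close>

lemma add_monoid_indep: "add_monoid (ck_free \<Lambda> p) = add_monoid (ck_free \<Lambda> q)"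
  by (simp add: ck_free_def free_star_algebra_def)

lemma ck_free_indep:
  "carrier (ck_free \<Lambda> p) = carrier (ck_free \<Lambda> q)"
  "mult (ck_free \<Lambda> p) = mult (ck_free \<Lambda> q)"
  "zero (ck_free \<Lambda> p) = zero (ck_free \<Lambda> q)"
  "add (ck_free \<Lambda> p) = add (ck_free \<Lambda> q)"
  "smult (ck_free \<Lambda> p) = smult (ck_free \<Lambda> q)"
  "star (ck_free \<Lambda> p) = star (ck_free \<Lambda> q)"
  "a_minus (ck_free \<Lambda> p) = a_minus (ck_free \<Lambda> q)"
  "finsum (ck_free \<Lambda> p) = finsum (ck_free \<Lambda> q)"
proof -
  show "a_minus (ck_free \<Lambda> p) = a_minus (ck_free \<Lambda> q)"
    unfolding fun_eq_iff a_minus_def a_inv_def add_monoid_indep[of \<Lambda> p q]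
    by (simp add: ck_free_def free_star_algebra_def)
  show "finsum (ck_free \<Lambda> p) = finsum (ck_free \<Lambda> q)"
    unfolding fun_eq_iff finsum_def add_monoid_indep[of \<Lambda> p q] by simp
qed (simp_all add: ck_free_def free_star_algebra_def)

lemma ck_rels_indep: "ck_rels \<Lambda> (ck_free \<Lambda> p) P T = ck_rels \<Lambda> (ck_free \<Lambda> q) P T"
  unfolding ck_rels_def ck_free_indep[of \<Lambda> p q] ..

lemma star_hom_ck_free_indep: "star_hom (ck_free \<Lambda> p) B h = star_hom (ck_free \<Lambda> q) B h"
  unfolding star_hom_def ck_free_indep[of \<Lambda> p q] ..

lemma cstar_seminorm_indep: "is_cstar_seminorm (ck_free \<Lambda> p) r = is_cstar_seminorm (ck_free \<Lambda> q) r"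
  unfolding is_cstar_seminorm_def ck_free_indep[of \<Lambda> p q] ..

lemma gen_Proj_in [simp]: "v \<in> verts_of \<Lambda> \<Longrightarrow> gen (Proj v) \<in> carrier (ck_free \<Lambda> p)"
  and gen_Iso_in [simp]: "f \<in> edges_of \<Lambda> \<Longrightarrow> gen (Iso f) \<in> carrier (ck_free \<Lambda> p)"
  unfolding ck_free_def by (auto intro: gen_in)

text \<open>Edges start at vertices. The universal algebra can be constructed under this assumption alone.\<close>

definition "src_ok \<Lambda> \<longleftrightarrow> (\<forall>f\<in>edges_of \<Lambda>. src \<Lambda> f \<in> verts_of \<Lambda>)"

lemma ck_closed_gen:
  "src_ok \<Lambda> \<Longrightarrow> ck_closed \<Lambda> (ck_free \<Lambda> p) (\<lambda>v. gen (Proj v)) (\<lambda>f. gen (Iso f))"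
  by (simp add: ck_closed_def star_algebra_ck_free src_ok_def)

lemma ck_seminorm_iff:
  assumes "src_ok \<Lambda>"
  shows "ck_seminorm \<Lambda> p \<longleftrightarrow> is_cstar_seminorm (ck_free \<Lambda> p) p \<and>
    (\<forall>\<rho>\<in>ck_rels \<Lambda> (ck_free \<Lambda> p) (\<lambda>v. gen (Proj v)) (\<lambda>f. gen (Iso f)). p \<rho> = 0)"
  unfolding ck_seminorm_def
  using ck_family_completion_iff[OF seminormed_ck_free ck_closed_gen[OF assms], of p] by auto

text \<open>A family in any *-algebra with a C*-seminorm pulls the seminorm back to one of those
  whose supremum is the universal seminorm; neither completeness nor definiteness is needed.\<close>

theorem ck_seminorm_pullback:
  assumes ok: "src_ok \<Lambda>" and A: "seminormed_star_algebra A" and h: "star_hom (ck_free \<Lambda> q) A h"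
    and ck: "ck_family \<Lambda> A (\<lambda>v. h (gen (Proj v))) (\<lambda>f. h (gen (Iso f)))"
  shows "ck_seminorm \<Lambda> (\<lambda>a. nrm A (h a))"
proof -
  interpret A: seminormed_star_algebra A by fact
  let ?p = "\<lambda>a. nrm A (h a)"
  have hp: "star_hom (ck_free \<Lambda> ?p) A h" using h star_hom_ck_free_indep by blast
  interpret h: star_hom "ck_free \<Lambda> ?p" A h by (rule hp)
  interpret F: star_algebra "ck_free \<Lambda> ?p" by (rule star_algebra_ck_free)
  have c: "ck_closed \<Lambda> A (\<lambda>v. h (gen (Proj v))) (\<lambda>f. h (gen (Iso f)))"
    by unfold_locales (use ok h.hom_closed in \<open>auto simp: src_ok_def\<close>)
  have "\<forall>\<rho>\<in>ck_rels \<Lambda> A (\<lambda>v. h (gen (Proj v))) (\<lambda>f. h (gen (Iso f))). \<rho> = \<zero>\<^bsub>A\<^esub>"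
    using ck ck_closed.ck_family_iff[OF c] by blast
  hence "\<forall>\<rho>\<in>ck_rels \<Lambda> (ck_free \<Lambda> ?p) (\<lambda>v. gen (Proj v)) (\<lambda>f. gen (Iso f)). ?p \<rho> = 0"
    unfolding ck_closed.ck_rels_hom[OF ck_closed_gen[OF ok] hp A.star_algebra_axioms] by simp
  moreover have "is_cstar_seminorm (ck_free \<Lambda> ?p) ?p"
    unfolding is_cstar_seminorm_def
    by (auto simp: h.hom_add h.hom_mult h.hom_smult h.hom_star h.hom_closed A.nrm_add A.nrm_mult
        A.nrm_smult A.nrm_star_mult)
  ultimately show ?thesis using ck_seminorm_iff[OF ok] by blast
qed

lemma ck_seminorm_zero: assumes "src_ok \<Lambda>" shows "ck_seminorm \<Lambda> (\<lambda>a. 0)"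
  using ck_seminorm_iff[OF assms, of "\<lambda>a. 0"] by (simp add: is_cstar_seminorm_def)

lemma ck_family_norm_le:
  assumes A: "cstar_algebra A" and ck: "ck_family \<Lambda> A P T" and ok: "src_ok \<Lambda>"
  shows "v \<in> verts_of \<Lambda> \<Longrightarrow> nrm A (P v) \<le> 1" "f \<in> edges_of \<Lambda> \<Longrightarrow> nrm A (T f) \<le> 1"
proof -
  interpret cstar_algebra A by fact
  interpret ck_family \<Lambda> A P T by fact
  have v: "nrm A (P v) \<le> 1" if "v \<in> verts_of \<Lambda>" for v
  proof -
    have "(nrm A (P v))\<^sup>2 = nrm A (P v)"
      using nrm_star_mult[OF P_closed[OF that]] P_projection[OF that] by simp
    hence "nrm A (P v) = 0 \<or> nrm A (P v) = 1" by (simp add: power2_eq_square)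
    thus ?thesis by auto
  qed
  show "v \<in> verts_of \<Lambda> \<Longrightarrow> nrm A (P v) \<le> 1" by (rule v)
  assume f: "f \<in> edges_of \<Lambda>"
  have "(nrm A (T f))\<^sup>2 = nrm A (P (src \<Lambda> f))"
    using nrm_star_mult[OF T_closed[OF f]] CK3[OF f] by simp
  also have "\<dots> \<le> 1" using ok f by (intro v) (simp add: src_ok_def)
  finally show "nrm A (T f) \<le> 1" by (simp add: power_le_one_iff nrm_nonneg T_closed f abs_square_le_1)
qed

text \<open>The supremum that defines the universal seminorm is finite, because generators have norm at most 1
  in every C*-algebra.\<close>

lemma ck_seminorm_bounded:
  assumes ok: "src_ok \<Lambda>" and a: "a \<in> carrier (ck_free \<Lambda> q)"
  shows "\<exists>K. \<forall>p. ck_seminorm \<Lambda> p \<longrightarrow> p a \<le> K"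
proof -
  have sn: "seminormed_star_algebra (ck_free \<Lambda> p)" if "ck_seminorm \<Lambda> p" for p
    using that by (simp add: ck_seminorm_def seminormed_ck_free)
  have nn: "p a \<ge> 0" if "ck_seminorm \<Lambda> p" "a \<in> carrier (ck_free \<Lambda> q)" for p a
    using seminormed_star_algebra.nrm_nonneg[OF sn[OF that(1)]] that(2) ck_free_indep(1)[of \<Lambda> p q] by simp
  show ?thesis using a
  proof (induction a rule: ck_free_induct)
    case zero
    show ?case
    proof (intro exI[of _ 0] allI impI)
      fix p assume p: "ck_seminorm \<Lambda> p"
      interpret seminormed_star_algebra "ck_free \<Lambda> p" by (rule sn[OF p])
      show "p \<zero>\<^bsub>ck_free \<Lambda> q\<^esub> \<le> 0"
        using nrm_zero ck_free_indep(3)[of \<Lambda> p q] by simp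
    qed
  next
    case (add a b)
    then obtain K L where K: "\<And>p. ck_seminorm \<Lambda> p \<Longrightarrow> p a \<le> K" and L: "\<And>p. ck_seminorm \<Lambda> p \<Longrightarrow> p b \<le> L" by blast
    show ?case
    proof (intro exI[of _ "K + L"] allI impI)
      fix p assume p: "ck_seminorm \<Lambda> p"
      interpret seminormed_star_algebra "ck_free \<Lambda> p" by (rule sn[OF p])
      have "p (a \<oplus>\<^bsub>ck_free \<Lambda> p\<^esub> b) \<le> p a + p b"
        using nrm_add[of a b] add.hyps ck_free_indep(1)[of \<Lambda> p q] by simp
      thus "p (a \<oplus>\<^bsub>ck_free \<Lambda> q\<^esub> b) \<le> K + L"
        using K[OF p] L[OF p] ck_free_indep(4)[of \<Lambda> p q] by simp
    qed
  next
    case (smult z a)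
    then obtain K where K: "\<And>p. ck_seminorm \<Lambda> p \<Longrightarrow> p a \<le> K" by blast
    show ?case
    proof (intro exI[of _ "cmod z * K"] allI impI)
      fix p assume p: "ck_seminorm \<Lambda> p"
      interpret seminormed_star_algebra "ck_free \<Lambda> p" by (rule sn[OF p])
      have "p (z \<odot>\<^bsub>ck_free \<Lambda> p\<^esub> a) = cmod z * p a"
        using nrm_smult[of a z] smult.hyps ck_free_indep(1)[of \<Lambda> p q] by simp
      thus "p (z \<odot>\<^bsub>ck_free \<Lambda> q\<^esub> a) \<le> cmod z * K"
        using mult_left_mono[OF K[OF p], of "cmod z"] ck_free_indep(5)[of \<Lambda> p q] by simp
    qed
  next
    case (mult a b)
    then obtain K L where K: "\<And>p. ck_seminorm \<Lambda> p \<Longrightarrow> p a \<le> K" and L: "\<And>p. ck_seminorm \<Lambda> p \<Longrightarrow> p b \<le> L" by blast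
    show ?case
    proof (intro exI[of _ "K * L"] allI impI)
      fix p assume p: "ck_seminorm \<Lambda> p"
      interpret seminormed_star_algebra "ck_free \<Lambda> p" by (rule sn[OF p])
      have "p (a \<otimes>\<^bsub>ck_free \<Lambda> p\<^esub> b) \<le> p a * p b"
        using nrm_mult[of a b] mult.hyps ck_free_indep(1)[of \<Lambda> p q] by simp
      also have "\<dots> \<le> K * L"
        using nn[OF p, of a] nn[OF p, of b] K[OF p] L[OF p] mult.hyps
        by (intro mult_mono) auto
      finally show "p (a \<otimes>\<^bsub>ck_free \<Lambda> q\<^esub> b) \<le> K * L"
        using ck_free_indep(2)[of \<Lambda> p q] by simp
    qed
  next
    case (star a)
    then obtain K where K: "\<And>p. ck_seminorm \<Lambda> p \<Longrightarrow> p a \<le> K" by blast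
    show ?case
    proof (intro exI[of _ K] allI impI)
      fix p assume p: "ck_seminorm \<Lambda> p"
      interpret seminormed_star_algebra "ck_free \<Lambda> p" by (rule sn[OF p])
      have "p (star (ck_free \<Lambda> p) a) = p a"
        using nrm_star[of a] star.hyps ck_free_indep(1)[of \<Lambda> p q] by simp
      thus "p (star (ck_free \<Lambda> q) a) \<le> K"
        using K[OF p] ck_free_indep(6)[of \<Lambda> p q] by simp
    qed
  next
    case (gen s)
    show ?case
    proof (intro exI[of _ 1] allI impI)
      fix p assume p: "ck_seminorm \<Lambda> p"
      interpret seminormed_star_algebra "ck_free \<Lambda> p" by (rule sn[OF p])
      have ck: "ck_family \<Lambda> CA (\<lambda>v. toC (gen (Proj v))) (\<lambda>f. toC (gen (Iso f)))"
        using p by (simp add: ck_seminorm_def)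
      show "p (gen s) \<le> 1"
        using gen ck_family_norm_le[OF cstar_algebra_CA ck ok] nrm_toC by auto
    qed
  qed
qed

lemma ck_seminorm_le_universal:
  assumes ok: "src_ok \<Lambda>" and a: "a \<in> carrier (ck_free \<Lambda> q)" and p: "ck_seminorm \<Lambda> p"
  shows "p a \<le> ck_universal_seminorm \<Lambda> a"
proof -
  obtain K where "\<And>p. ck_seminorm \<Lambda> p \<Longrightarrow> p a \<le> K" using ck_seminorm_bounded[OF ok a] by blast
  hence "bdd_above ((\<lambda>p. p a) ` {p. ck_seminorm \<Lambda> p})" by (intro bdd_aboveI2) auto
  thus ?thesis unfolding ck_universal_seminorm_def using p by (intro cSUP_upper) auto
qed

lemma universal_le:
  assumes ok: "src_ok \<Lambda>" and "\<And>p. ck_seminorm \<Lambda> p \<Longrightarrow> p a \<le> K"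
  shows "ck_universal_seminorm \<Lambda> a \<le> K"
  unfolding ck_universal_seminorm_def by (rule cSUP_least) (use assms ck_seminorm_zero in auto)

theorem ck_seminorm_universal:
  assumes ok: "src_ok \<Lambda>"
  shows "ck_seminorm \<Lambda> (ck_universal_seminorm \<Lambda>)" (is "ck_seminorm \<Lambda> ?U")
proof -
  let ?F = "ck_free \<Lambda> ?U"
  interpret F: star_algebra ?F by (rule star_algebra_ck_free)
  note le = ck_seminorm_le_universal[OF ok, where q = ?U]
  have sn: "is_cstar_seminorm ?F p" if "ck_seminorm \<Lambda> p" for p
    using that cstar_seminorm_indep by (auto simp: ck_seminorm_def)
  have nn: "?U a \<ge> 0" if "a \<in> carrier ?F" for a
    using le[OF that ck_seminorm_zero[OF ok]] .
  have pnn: "p a \<ge> 0" if "ck_seminorm \<Lambda> p" "a \<in> carrier ?F" for p a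
  proof -
    interpret seminormed_star_algebra "ck_free \<Lambda> p"
      using that by (simp add: ck_seminorm_def seminormed_ck_free)
    show ?thesis using nrm_nonneg[of a] that ck_free_indep(1)[of \<Lambda> p ?U] by simp
  qed
  have smult_le: "?U (z \<odot>\<^bsub>?F\<^esub> a) \<le> cmod z * ?U a" if "a \<in> carrier ?F" for z a
  proof (rule universal_le[OF ok])
    fix p assume p: "ck_seminorm \<Lambda> p"
    have "p (z \<odot>\<^bsub>?F\<^esub> a) = cmod z * p a" using sn[OF p] that by (simp add: is_cstar_seminorm_def)
    thus "p (z \<odot>\<^bsub>?F\<^esub> a) \<le> cmod z * ?U a" using le[OF that p] by (simp add: mult_left_mono)
  qed
  have "is_cstar_seminorm ?F ?U"
    unfolding is_cstar_seminorm_def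
  proof (intro conjI ballI allI)
    fix a b assume a: "a \<in> carrier ?F" and b: "b \<in> carrier ?F"
    show "?U (a \<oplus>\<^bsub>?F\<^esub> b) \<le> ?U a + ?U b"
    proof (rule universal_le[OF ok])
      fix p assume p: "ck_seminorm \<Lambda> p"
      have "p (a \<oplus>\<^bsub>?F\<^esub> b) \<le> p a + p b" using sn[OF p] a b by (simp add: is_cstar_seminorm_def)
      thus "p (a \<oplus>\<^bsub>?F\<^esub> b) \<le> ?U a + ?U b" using le[OF a p] le[OF b p] by simp
    qed
    show "?U (a \<otimes>\<^bsub>?F\<^esub> b) \<le> ?U a * ?U b"
    proof (rule universal_le[OF ok])
      fix p assume p: "ck_seminorm \<Lambda> p"
      have "p (a \<otimes>\<^bsub>?F\<^esub> b) \<le> p a * p b" using sn[OF p] a b by (simp add: is_cstar_seminorm_def)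
      also have "\<dots> \<le> ?U a * ?U b" by (intro mult_mono le p a b nn pnn)
      finally show "p (a \<otimes>\<^bsub>?F\<^esub> b) \<le> ?U a * ?U b" .
    qed
  next
    fix a z assume a: "a \<in> carrier ?F"
    show "?U (z \<odot>\<^bsub>?F\<^esub> a) = cmod z * ?U a"
    proof (rule antisym[OF smult_le[OF a]])
      show "cmod z * ?U a \<le> ?U (z \<odot>\<^bsub>?F\<^esub> a)"
      proof (cases "z = 0")
        case True
        thus ?thesis using nn a by simp
      next
        case False
        have "?U a = ?U (inverse z \<odot>\<^bsub>?F\<^esub> (z \<odot>\<^bsub>?F\<^esub> a))" using False a by (simp add: F.smult_smult)
        also have "\<dots> \<le> cmod (inverse z) * ?U (z \<odot>\<^bsub>?F\<^esub> a)" by (rule smult_le) (simp add: a)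
        finally have "cmod z * ?U a \<le> cmod z * (cmod (inverse z) * ?U (z \<odot>\<^bsub>?F\<^esub> a))"
          by (rule mult_left_mono) simp
        thus ?thesis using False by (simp add: norm_inverse flip: mult.assoc)
      qed
    qed
    show "?U (star ?F a \<otimes>\<^bsub>?F\<^esub> a) = (?U a)\<^sup>2"
    proof (rule antisym)
      have eq: "p (star ?F a \<otimes>\<^bsub>?F\<^esub> a) = (p a)\<^sup>2" if "ck_seminorm \<Lambda> p" for p
        using sn[OF that] a by (simp add: is_cstar_seminorm_def)
      show "?U (star ?F a \<otimes>\<^bsub>?F\<^esub> a) \<le> (?U a)\<^sup>2"
        by (rule universal_le[OF ok]) (simp add: eq power_mono[OF le[OF a]] pnn a)
      have "?U a \<le> sqrt (?U (star ?F a \<otimes>\<^bsub>?F\<^esub> a))"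
      proof (rule universal_le[OF ok])
        fix p assume p: "ck_seminorm \<Lambda> p"
        have "(p a)\<^sup>2 \<le> ?U (star ?F a \<otimes>\<^bsub>?F\<^esub> a)"
          using le[OF _ p, of "star ?F a \<otimes>\<^bsub>?F\<^esub> a"] eq[OF p] a by simp
        thus "p a \<le> sqrt (?U (star ?F a \<otimes>\<^bsub>?F\<^esub> a))" by (rule real_le_rsqrt)
      qed
      hence "(?U a)\<^sup>2 \<le> (sqrt (?U (star ?F a \<otimes>\<^bsub>?F\<^esub> a)))\<^sup>2" by (intro power_mono nn a)
      thus "(?U a)\<^sup>2 \<le> ?U (star ?F a \<otimes>\<^bsub>?F\<^esub> a)" using nn a by simp
    qed
  qed
  moreover have "?U \<rho> = 0" if \<rho>: "\<rho> \<in> ck_rels \<Lambda> ?F (\<lambda>v. gen (Proj v)) (\<lambda>f. gen (Iso f))" for \<rho>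
  proof (rule antisym)
    show "?U \<rho> \<le> 0"
    proof (rule universal_le[OF ok])
      fix p assume p: "ck_seminorm \<Lambda> p"
      have "\<rho> \<in> ck_rels \<Lambda> (ck_free \<Lambda> p) (\<lambda>v. gen (Proj v)) (\<lambda>f. gen (Iso f))"
        using \<rho> ck_rels_indep by metis
      thus "p \<rho> \<le> 0" using p unfolding ck_seminorm_iff[OF ok] by auto
    qed
    show "0 \<le> ?U \<rho>" by (rule nn) (rule ck_closed.ck_rels_in[OF ck_closed_gen[OF ok] \<rho>])
  qed
  ultimately show ?thesis unfolding ck_seminorm_iff[OF ok] by blast
qed

text \<open>The free *-algebra with the universal seminorm, whose completion is \<open>C\<^sup>*(\<Lambda>)\<close>.\<close>

abbreviation ck_poly :: "('a, 'k::finite) kgraph \<Rightarrow> 'a ck_gen star_poly cstar" where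
  "ck_poly \<Lambda> \<equiv> ck_free \<Lambda> (ck_universal_seminorm \<Lambda>)"

lemma
  assumes ok: "src_ok \<Lambda>"
  shows seminormed_ck_poly: "seminormed_star_algebra (ck_poly \<Lambda>)"
    and cstar_algebra_ck: "cstar_algebra (ck_algebra \<Lambda>)"
    and ck_family_ck: "ck_family \<Lambda> (ck_algebra \<Lambda>) (\<lambda>v. to_completion (ck_poly \<Lambda>) (gen (Proj v)))
        (\<lambda>f. to_completion (ck_poly \<Lambda>) (gen (Iso f)))"
proof -
  show s: "seminormed_star_algebra (ck_poly \<Lambda>)"
    using ck_seminorm_universal[OF ok] by (simp add: ck_seminorm_def seminormed_ck_free)
  show "cstar_algebra (ck_algebra \<Lambda>)"
    unfolding ck_algebra_def by (rule seminormed_star_algebra.cstar_algebra_CA[OF s])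
  show "ck_family \<Lambda> (ck_algebra \<Lambda>) (\<lambda>v. to_completion (ck_poly \<Lambda>) (gen (Proj v)))
        (\<lambda>f. to_completion (ck_poly \<Lambda>) (gen (Iso f)))"
    using ck_seminorm_universal[OF ok] by (simp add: ck_seminorm_def ck_algebra_def)
qed

text \<open>Products are dense because every generator is a product of elements: \<open>P = PP\<close> and
  \<open>T = T(T\<^sup>*T)\<close>.\<close>

lemma dense_span_products:
  assumes ok: "src_ok \<Lambda>"
  defines "A \<equiv> ck_algebra \<Lambda>"
  shows "dense_span A {a \<otimes>\<^bsub>A\<^esub> b | a b. a \<in> carrier A \<and> b \<in> carrier A}"
proof -
  let ?F = "ck_poly \<Lambda>" and ?Pr = "{a \<otimes>\<^bsub>A\<^esub> b | a b. a \<in> carrier A \<and> b \<in> carrier A}"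
  interpret F: seminormed_star_algebra ?F by (rule seminormed_ck_poly[OF ok])
  have CA: "completion ?F = A" by (simp add: A_def ck_algebra_def)
  interpret A: cstar_algebra A unfolding A_def by (rule cstar_algebra_ck[OF ok])
  interpret ck: ck_family \<Lambda> A "\<lambda>v. F.toC (gen (Proj v))" "\<lambda>f. F.toC (gen (Iso f))"
    unfolding A_def by (rule ck_family_ck[OF ok])
  have h: "star_hom ?F A F.toC" using F.star_hom_toC by (simp add: CA)
  interpret h: star_hom ?F A F.toC by (rule h)
  have prod: "x \<otimes>\<^bsub>A\<^esub> y \<in> lin_span A ?Pr" if "x \<in> carrier A" "y \<in> carrier A" for x y
    using that by (intro lin_span.base) blast
  have "F.toC a \<in> lin_span A ?Pr \<and> star A (F.toC a) \<in> lin_span A ?Pr" if "a \<in> carrier ?F" for a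
    using that
  proof (induction a rule: ck_free_induct)
    case zero
    show ?case using star_hom_zero[OF h F.star_algebra_axioms A.star_algebra_axioms] lin_span.zero[of A] by simp
  next
    case (add a b)
    thus ?case by (auto simp: h.hom_add A.star_add h.hom_closed intro: lin_span.add)
  next
    case (smult z a)
    thus ?case by (auto simp: h.hom_smult A.star_smult h.hom_closed intro: lin_span.smult)
  next
    case (mult a b)
    thus ?case by (auto simp: h.hom_mult A.star_mult h.hom_closed intro: prod)
  next
    case (star a)
    thus ?case by (auto simp: h.hom_star A.star_star h.hom_closed)
  next
    case (gen s)
    show ?case
    proof (cases s)
      case (Proj v)
      hence v: "v \<in> verts_of \<Lambda>" using gen by auto
      show ?thesis
        using prod[OF ck.P_closed[OF v] ck.P_closed[OF v]] ck.P_projection[OF v] Proj by simp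
    next
      case (Iso f)
      hence f: "f \<in> edges_of \<Lambda>" using gen by auto
      let ?T = "F.toC (gen (Iso f))"
      have T[simp]: "?T \<in> carrier A" by (rule ck.T_closed[OF f])
      have t: "?T = ?T \<otimes>\<^bsub>A\<^esub> (star A ?T \<otimes>\<^bsub>A\<^esub> ?T)" using ck.T_partial_isometry[OF f] by simp
      have "star A ?T = star A (?T \<otimes>\<^bsub>A\<^esub> (star A ?T \<otimes>\<^bsub>A\<^esub> ?T))" using t by simp
      also have "\<dots> = star A (star A ?T \<otimes>\<^bsub>A\<^esub> ?T) \<otimes>\<^bsub>A\<^esub> star A ?T" by (rule A.star_mult) simp_all
      finally have "star A ?T \<in> lin_span A ?Pr" using prod[of "star A (star A ?T \<otimes>\<^bsub>A\<^esub> ?T)" "star A ?T"] by simp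
      moreover have "?T \<in> lin_span A ?Pr" using prod[of ?T "star A ?T \<otimes>\<^bsub>A\<^esub> ?T"] t by simp
      ultimately show ?thesis using Iso by simp
    qed
  qed
  note span = this
  show ?thesis
    unfolding dense_span_def
  proof (intro ballI allI impI)
    fix a and e :: real assume "a \<in> carrier A" "e > 0"
    then obtain b where b: "b \<in> carrier ?F" "nrm A (a \<ominus>\<^bsub>A\<^esub> F.toC b) < e"
      using F.toC_dense[unfolded CA] by blast
    show "\<exists>b\<in>lin_span A ?Pr. nrm A (a \<ominus>\<^bsub>A\<^esub> b) < e"
      by (rule bexI[of _ "F.toC b"]) (use b span in auto)
  qed
qed

section \<open>Morita equivalence with a corner\<close>

lemma lin_span_subset: "S \<subseteq> lin_span A T \<Longrightarrow> lin_span A S \<subseteq> lin_span A T"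
proof
  fix x assume S: "S \<subseteq> lin_span A T" and "x \<in> lin_span A S"
  from this(2) show "x \<in> lin_span A T"
    by induction (use S in \<open>auto intro: lin_span.intros\<close>)
qed

lemma dense_span_subset: "dense_span A S \<Longrightarrow> S \<subseteq> lin_span A T \<Longrightarrow> dense_span A T"
  unfolding dense_span_def using lin_span_subset[of S A T] by blast

text \<open>The algebra \<open>B\<close> is identified by \<open>\<psi>\<close> with the corner of \<open>A\<close> complementary to the projection \<open>q\<close>. The
  partial isometry \<open>h\<close> shows that this corner generates \<open>A\<close> as an ideal: its range projection
  is \<open>q\<close> while its initial projection is orthogonal to \<open>q\<close>.\<close>

theorem morita_corner:
  fixes A :: "'a cstar" and B :: "'b cstar"
  assumes cA: "cstar_algebra A" and cB: "cstar_algebra B"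
    and hom: "star_hom B A \<psi>" and iso: "\<And>b. b \<in> carrier B \<Longrightarrow> nrm A (\<psi> b) = nrm B b"
    and q: "q \<in> carrier A" "star A q = q" "q \<otimes>\<^bsub>A\<^esub> q = q"
    and h: "h \<in> carrier A" "h \<otimes>\<^bsub>A\<^esub> star A h = q" "h \<otimes>\<^bsub>A\<^esub> q = \<zero>\<^bsub>A\<^esub>"
    and corner: "\<And>b. b \<in> carrier B \<Longrightarrow> q \<otimes>\<^bsub>A\<^esub> \<psi> b = \<zero>\<^bsub>A\<^esub> \<and> \<psi> b \<otimes>\<^bsub>A\<^esub> q = \<zero>\<^bsub>A\<^esub>"
    and onto: "\<And>a. a \<in> carrier A \<Longrightarrow> q \<otimes>\<^bsub>A\<^esub> a = \<zero>\<^bsub>A\<^esub> \<Longrightarrow> a \<otimes>\<^bsub>A\<^esub> q = \<zero>\<^bsub>A\<^esub> \<Longrightarrow> a \<in> \<psi> ` carrier B"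
    and dA: "dense_span A {a \<otimes>\<^bsub>A\<^esub> b | a b. a \<in> carrier A \<and> b \<in> carrier A}"
    and dB: "dense_span B {a \<otimes>\<^bsub>B\<^esub> b | a b. a \<in> carrier B \<and> b \<in> carrier B}"
  shows "morita_equivalent A B"
proof -
  interpret A: cstar_algebra A by fact
  interpret B: cstar_algebra B by fact
  interpret \<psi>: star_hom B A \<psi> by fact
  note [simp] = q(1) h(1) \<psi>.hom_closed
  have inj: "b = c" if "b \<in> carrier B" "c \<in> carrier B" "\<psi> b = \<psi> c" for b c
  proof -
    have "nrm B (b \<ominus>\<^bsub>B\<^esub> c) = nrm A (\<psi> b \<ominus>\<^bsub>A\<^esub> \<psi> c)"
      using that by (simp add: star_hom_diff[OF hom B.star_algebra_axioms A.star_algebra_axioms] flip: iso)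
    also have "\<dots> = 0" using that by simp
    finally show ?thesis using that B.norm_eq_zero[of "b \<ominus>\<^bsub>B\<^esub> c"] by (simp add: B.diff_eq_zero_iff)
  qed
  define \<phi> where "\<phi> a = inv_into (carrier B) \<psi> a" for a
  have \<phi>: "\<phi> a \<in> carrier B" "\<psi> (\<phi> a) = a"
    if "a \<in> carrier A" "q \<otimes>\<^bsub>A\<^esub> a = \<zero>\<^bsub>A\<^esub>" "a \<otimes>\<^bsub>A\<^esub> q = \<zero>\<^bsub>A\<^esub>" for a
    unfolding \<phi>_def using onto[OF that] by (auto intro: inv_into_into f_inv_into_f)
  define C where "C = {x \<in> carrier A. x \<otimes>\<^bsub>A\<^esub> q = \<zero>\<^bsub>A\<^esub>}"
  have C[simp]: "x \<in> carrier A" "x \<otimes>\<^bsub>A\<^esub> q = \<zero>\<^bsub>A\<^esub>" if "x \<in> C" for x using that by (auto simp: C_def)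
  have CI: "x \<in> C" if "x \<in> carrier A" "x \<otimes>\<^bsub>A\<^esub> q = \<zero>\<^bsub>A\<^esub>" for x using that unfolding C_def by blast
  have Cstar: "q \<otimes>\<^bsub>A\<^esub> star A x = \<zero>\<^bsub>A\<^esub>" if "x \<in> C" for x
    using A.star_mult[of x q] that q by simp
  have Cip: "q \<otimes>\<^bsub>A\<^esub> (star A x \<otimes>\<^bsub>A\<^esub> y) = \<zero>\<^bsub>A\<^esub>" "(star A x \<otimes>\<^bsub>A\<^esub> y) \<otimes>\<^bsub>A\<^esub> q = \<zero>\<^bsub>A\<^esub>"
    if "x \<in> C" "y \<in> C" for x y
    using that Cstar[OF that(1)] by (simp_all add: A.mult_assoc flip: A.mult_assoc[of q])
  have \<phi>ip: "\<phi> (star A x \<otimes>\<^bsub>A\<^esub> y) \<in> carrier B" "\<psi> (\<phi> (star A x \<otimes>\<^bsub>A\<^esub> y)) = star A x \<otimes>\<^bsub>A\<^esub> y"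
    if "x \<in> C" "y \<in> C" for x y
    using \<phi>[OF _ Cip[OF that]] that by simp_all
  have C_add: "x \<oplus>\<^bsub>A\<^esub> y \<in> C" if "x \<in> C" "y \<in> C" for x y
    by (rule CI) (use that in \<open>simp_all add: A.add_mult\<close>)
  have C_smult: "z \<odot>\<^bsub>A\<^esub> x \<in> C" if "x \<in> C" for x z
    by (rule CI) (use that in \<open>simp_all add: A.smult_mult\<close>)
  have C_diff: "x \<ominus>\<^bsub>A\<^esub> y \<in> C" if "x \<in> C" "y \<in> C" for x y
    by (rule CI) (use that in \<open>simp_all add: A.diff_mult\<close>)
  have C_lact: "a \<otimes>\<^bsub>A\<^esub> x \<in> C" if "x \<in> C" "a \<in> carrier A" for x a
    by (rule CI) (use that in \<open>simp_all add: A.mult_assoc\<close>)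
  have C_ract: "x \<otimes>\<^bsub>A\<^esub> \<psi> b \<in> C" if "x \<in> C" "b \<in> carrier B" for x b
    by (rule CI) (use that corner[OF that(2)] in \<open>simp_all add: A.mult_assoc\<close>)
  have C_zero: "\<zero>\<^bsub>A\<^esub> \<in> C" by (rule CI) simp_all

  \<comment> \<open>The bimodule \<open>C\<close>, with a dummy second component.\<close>
  define X :: "('a, 'b, 'a \<times> 'b) bimodule" where
    "X = \<lparr>carrier = {x. fst x \<in> C \<and> snd x = undefined}, mult = undefined, one = undefined,
      zero = (\<zero>\<^bsub>A\<^esub>, undefined), add = (\<lambda>x y. (fst x \<oplus>\<^bsub>A\<^esub> fst y, undefined)),
      smult = (\<lambda>z x. (z \<odot>\<^bsub>A\<^esub> fst x, undefined)),
      lact = (\<lambda>a x. (a \<otimes>\<^bsub>A\<^esub> fst x, undefined)), ract = (\<lambda>x b. (fst x \<otimes>\<^bsub>A\<^esub> \<psi> b, undefined)),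
      lip = (\<lambda>x y. fst x \<otimes>\<^bsub>A\<^esub> star A (fst y)), rip = (\<lambda>x y. \<phi> (star A (fst x) \<otimes>\<^bsub>A\<^esub> fst y))\<rparr>"
  have X[simp]: "carrier X = {x. fst x \<in> C \<and> snd x = undefined}"
    "zero X = (\<zero>\<^bsub>A\<^esub>, undefined)" "add X = (\<lambda>x y. (fst x \<oplus>\<^bsub>A\<^esub> fst y, undefined))"
    "smult X = (\<lambda>z x. (z \<odot>\<^bsub>A\<^esub> fst x, undefined))"
    "lact X = (\<lambda>a x. (a \<otimes>\<^bsub>A\<^esub> fst x, undefined))" "ract X = (\<lambda>x b. (fst x \<otimes>\<^bsub>A\<^esub> \<psi> b, undefined))"
    "lip X = (\<lambda>x y. fst x \<otimes>\<^bsub>A\<^esub> star A (fst y))" "rip X = (\<lambda>x y. \<phi> (star A (fst x) \<otimes>\<^bsub>A\<^esub> fst y))"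
    by (simp_all add: X_def)

  have modX: "Module.module complex_ring X"
  proof (rule moduleI[OF cring_complex_ring])
    show "abelian_group X"
    proof (rule abelian_groupI)
      fix x assume x: "x \<in> carrier X"
      show "\<exists>y\<in>carrier X. y \<oplus>\<^bsub>X\<^esub> x = \<zero>\<^bsub>X\<^esub>"
        by (rule bexI[of _ "((-1) \<odot>\<^bsub>A\<^esub> fst x, undefined)"])
          (use x C_smult[of "fst x" "-1"] in \<open>auto simp: A.smult_minus_one A.M.l_neg\<close>)
    qed (auto simp: C_add C_zero A.M.a_ac prod_eq_iff)
  qed (auto simp: C_smult A.smult_ladd A.smult_radd A.smult_smult prod_eq_iff)
  then interpret X: Module.module complex_ring X .
  have Xminus: "x \<ominus>\<^bsub>X\<^esub> y = (fst x \<ominus>\<^bsub>A\<^esub> fst y, undefined)" if "x \<in> carrier X" "y \<in> carrier X" for x y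
  proof -
    have "\<ominus>\<^bsub>X\<^esub> y = ((-1) \<odot>\<^bsub>A\<^esub> fst y, undefined)"
      by (rule X.M.minus_equality)
        (use that C_smult[of "fst y" "-1"] in \<open>auto simp: A.smult_minus_one A.M.l_neg\<close>)
    thus ?thesis using that by (simp add: a_minus_def A.smult_minus_one)
  qed
  have complete: "is_complete X p" if p: "\<And>x. x \<in> carrier X \<Longrightarrow> p x = nrm A (fst x)" for p
    unfolding is_complete_def
  proof
    fix x assume x: "x \<in> cauchy_seqs X p"
    have xX: "x n \<in> carrier X" for n using x unfolding cauchy_seqs_def by blast
    hence xC: "fst (x n) \<in> C" for n by simp
    have pm: "p (x m \<ominus>\<^bsub>X\<^esub> y) = nrm A (fst (x m) \<ominus>\<^bsub>A\<^esub> fst y)" if "y \<in> carrier X" for m y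
      unfolding Xminus[OF xX that] by (subst p) (use xC[of m] that in \<open>auto simp: C_diff\<close>)
    have "(\<lambda>n. fst (x n)) \<in> cauchy_seqs A (nrm A)"
      using x xC unfolding cauchy_seqs_def by (simp add: pm xX del: X)
    then obtain l where l: "A.lims (\<lambda>n. fst (x n)) l" using A.cauchy_lims by blast
    have "A.lims (\<lambda>n. fst (x n) \<otimes>\<^bsub>A\<^esub> q) (l \<otimes>\<^bsub>A\<^esub> q)" by (rule A.lims_mult[OF l A.lims_const]) simp
    hence "A.lims (\<lambda>n. \<zero>\<^bsub>A\<^esub>) (l \<otimes>\<^bsub>A\<^esub> q)" using xC by simp
    hence "l \<otimes>\<^bsub>A\<^esub> q = \<zero>\<^bsub>A\<^esub>" using A.lims_unique[OF _ A.lims_const[of "\<zero>\<^bsub>A\<^esub>"]] by simp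
    hence lC: "l \<in> C" using l by (intro CI) (auto simp: A.lims_def)
    show "\<exists>l\<in>carrier X. (\<lambda>n. p (x n \<ominus>\<^bsub>X\<^esub> l)) \<longlonglongrightarrow> 0"
    proof (rule bexI[of _ "(l, undefined)"])
      show lX: "(l, undefined) \<in> carrier X" using lC by simp
      show "(\<lambda>n. p (x n \<ominus>\<^bsub>X\<^esub> (l, undefined))) \<longlonglongrightarrow> 0"
        using l by (simp add: pm[OF lX] A.lims_def del: X)
    qed
  qed
  have cancel: "(a \<ominus>\<^bsub>A\<^esub> b) \<oplus>\<^bsub>A\<^esub> b = a" if "a \<in> carrier A" "b \<in> carrier A" for a b
    using that by (simp add: a_minus_def A.M.a_assoc A.M.l_neg)

  have left: "full_left_hilbert_module A X"
  proof (intro full_left_hilbert_module.intro cA modX full_left_hilbert_module_axioms.intro)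
    show "is_complete X (\<lambda>x. sqrt (nrm A (lip X x x)))"
    proof (rule complete)
      fix x assume "x \<in> carrier X"
      hence x: "fst x \<in> carrier A" by simp
      thus "sqrt (nrm A (lip X x x)) = nrm A (fst x)"
        using A.nrm_star_mult[of "star A (fst x)"] by (simp add: A.star_star A.nrm_star A.nrm_nonneg)
    qed
    show "dense_span A {lip X x y |x y. x \<in> carrier X \<and> y \<in> carrier X}"
    proof (rule dense_span_subset[OF dA], safe)
      fix a b assume [simp]: "a \<in> carrier A" "b \<in> carrier A"
      let ?S = "{lip X x y |x y. x \<in> carrier X \<and> y \<in> carrier X}"
      have base: "x \<otimes>\<^bsub>A\<^esub> star A y \<in> lin_span A ?S" if "x \<in> C" "y \<in> C" for x y
      proof (rule lin_span.base)
        show "x \<otimes>\<^bsub>A\<^esub> star A y \<in> ?S"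
          by (rule CollectI, rule exI[of _ "(x, undefined)"], rule exI[of _ "(y, undefined)"]) (simp add: that)
      qed
      have c1: "x \<ominus>\<^bsub>A\<^esub> x \<otimes>\<^bsub>A\<^esub> q \<in> C" if "x \<in> carrier A" for x
        by (rule CI) (use that q in \<open>simp_all add: A.diff_mult A.mult_assoc\<close>)
      have c2: "x \<otimes>\<^bsub>A\<^esub> h \<in> C" if "x \<in> carrier A" for x
        by (rule CI) (use that h in \<open>simp_all add: A.mult_assoc\<close>)
      let ?b = "b \<ominus>\<^bsub>A\<^esub> q \<otimes>\<^bsub>A\<^esub> b"
      have sb: "star A (star A b \<ominus>\<^bsub>A\<^esub> star A b \<otimes>\<^bsub>A\<^esub> q) = ?b"
        by (simp add: A.star_diff A.star_mult A.star_star q)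
      have qb: "q \<otimes>\<^bsub>A\<^esub> ?b = \<zero>\<^bsub>A\<^esub>" by (simp add: A.mult_diff q flip: A.mult_assoc)
      have "(a \<ominus>\<^bsub>A\<^esub> a \<otimes>\<^bsub>A\<^esub> q) \<otimes>\<^bsub>A\<^esub> ?b = a \<otimes>\<^bsub>A\<^esub> ?b"
        using qb by (simp add: A.diff_mult A.mult_assoc)
      also have "\<dots> = a \<otimes>\<^bsub>A\<^esub> b \<ominus>\<^bsub>A\<^esub> a \<otimes>\<^bsub>A\<^esub> (q \<otimes>\<^bsub>A\<^esub> b)" by (simp add: A.mult_diff)
      finally have e1: "(a \<ominus>\<^bsub>A\<^esub> a \<otimes>\<^bsub>A\<^esub> q) \<otimes>\<^bsub>A\<^esub> star A (star A b \<ominus>\<^bsub>A\<^esub> star A b \<otimes>\<^bsub>A\<^esub> q) =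
          a \<otimes>\<^bsub>A\<^esub> b \<ominus>\<^bsub>A\<^esub> a \<otimes>\<^bsub>A\<^esub> (q \<otimes>\<^bsub>A\<^esub> b)" unfolding sb .
      have "(a \<otimes>\<^bsub>A\<^esub> h) \<otimes>\<^bsub>A\<^esub> star A (star A b \<otimes>\<^bsub>A\<^esub> h) = a \<otimes>\<^bsub>A\<^esub> ((h \<otimes>\<^bsub>A\<^esub> star A h) \<otimes>\<^bsub>A\<^esub> b)"
        by (simp add: A.star_mult A.star_star A.mult_assoc)
      hence e2: "(a \<otimes>\<^bsub>A\<^esub> h) \<otimes>\<^bsub>A\<^esub> star A (star A b \<otimes>\<^bsub>A\<^esub> h) = a \<otimes>\<^bsub>A\<^esub> (q \<otimes>\<^bsub>A\<^esub> b)" unfolding h(2) .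
      \<comment> \<open>\<open>ab = (a - aq)(b - qb) + (ah)(h\<^sup>*b)\<close>, and both summands are left inner products.\<close>
      have "a \<otimes>\<^bsub>A\<^esub> b = (a \<otimes>\<^bsub>A\<^esub> b \<ominus>\<^bsub>A\<^esub> a \<otimes>\<^bsub>A\<^esub> (q \<otimes>\<^bsub>A\<^esub> b)) \<oplus>\<^bsub>A\<^esub> a \<otimes>\<^bsub>A\<^esub> (q \<otimes>\<^bsub>A\<^esub> b)"
        by (rule cancel[symmetric]) simp_all
      also have "\<dots> \<in> lin_span A ?S"
      proof (rule lin_span.add)
        show "a \<otimes>\<^bsub>A\<^esub> b \<ominus>\<^bsub>A\<^esub> a \<otimes>\<^bsub>A\<^esub> (q \<otimes>\<^bsub>A\<^esub> b) \<in> lin_span A ?S"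
          unfolding e1[symmetric] by (intro base c1) simp_all
        show "a \<otimes>\<^bsub>A\<^esub> (q \<otimes>\<^bsub>A\<^esub> b) \<in> lin_span A ?S"
          unfolding e2[symmetric] by (intro base c2) simp_all
      qed
      finally show "a \<otimes>\<^bsub>A\<^esub> b \<in> lin_span A ?S" .
    qed
    fix x assume x: "x \<in> carrier X"
    show "cstar_positive A (lip X x x)"
      unfolding cstar_positive_def
      by (rule bexI[of _ "star A (fst x)"]) (use x in \<open>auto simp: A.star_star\<close>)
    show "lip X x x = \<zero>\<^bsub>A\<^esub> \<Longrightarrow> x = \<zero>\<^bsub>X\<^esub>"
      using x A.nrm_star_mult[of "star A (fst x)"] A.norm_eq_zero[of "fst x"]
      by (simp add: A.star_star A.nrm_star prod_eq_iff)
  qed (auto simp: C_lact A.mult_add A.add_mult A.mult_assoc A.mult_smult A.smult_mult A.star_mult A.star_star prod_eq_iff)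

  have right: "full_right_hilbert_module B X"
  proof (intro full_right_hilbert_module.intro cB modX full_right_hilbert_module_axioms.intro)
    show "is_complete X (\<lambda>x. sqrt (nrm B (rip X x x)))"
    proof (rule complete)
      fix x assume "x \<in> carrier X"
      hence x: "fst x \<in> C" by simp
      have "nrm B (rip X x x) = nrm A (star A (fst x) \<otimes>\<^bsub>A\<^esub> fst x)"
        using iso[OF \<phi>ip(1)[OF x x]] \<phi>ip(2)[OF x x] by simp
      thus "sqrt (nrm B (rip X x x)) = nrm A (fst x)"
        using A.nrm_star_mult[of "fst x"] x by (simp add: A.nrm_nonneg del: X)
    qed
    show "dense_span B {rip X x y |x y. x \<in> carrier X \<and> y \<in> carrier X}"
    proof (rule dense_span_subset[OF dB], safe, rule lin_span.base)
      fix b c assume b: "b \<in> carrier B" and c: "c \<in> carrier B"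
      have bC: "\<psi> (star B b) \<in> C" "\<psi> c \<in> C" using b c corner by (auto intro!: CI)
      have "rip X (\<psi> (star B b), undefined) (\<psi> c, undefined) = b \<otimes>\<^bsub>B\<^esub> c"
        by (rule inj) (use \<phi>ip[OF bC] b c in \<open>simp_all add: \<psi>.hom_star \<psi>.hom_mult A.star_star\<close>)
      thus "b \<otimes>\<^bsub>B\<^esub> c \<in> {rip X x y |x y. x \<in> carrier X \<and> y \<in> carrier X}"
        using bC by (intro CollectI exI[of _ "(\<psi> (star B b), undefined)"] exI[of _ "(\<psi> c, undefined)"])
          (simp del: X(8))
    qed
    fix x assume "x \<in> carrier X"
    hence x: "fst x \<in> C" and sx: "snd x = undefined" by auto
    note [simp] = C(1)[OF x]
    show "cstar_positive B (rip X x x)"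
    proof -
      \<comment> \<open>\<open>x\<^sup>*x = b\<^sup>*b + c\<^sup>*c\<close> with \<open>b = x - qx\<close> and \<open>c = h\<^sup>*x\<close> in the corner.\<close>
      let ?b = "fst x \<ominus>\<^bsub>A\<^esub> q \<otimes>\<^bsub>A\<^esub> fst x" and ?c = "star A h \<otimes>\<^bsub>A\<^esub> fst x"
      have qb: "q \<otimes>\<^bsub>A\<^esub> ?b = \<zero>\<^bsub>A\<^esub>" by (simp add: A.mult_diff q flip: A.mult_assoc)
      have bq: "?b \<otimes>\<^bsub>A\<^esub> q = \<zero>\<^bsub>A\<^esub>" using x by (simp add: A.diff_mult A.mult_assoc)
      have cq: "?c \<otimes>\<^bsub>A\<^esub> q = \<zero>\<^bsub>A\<^esub>" using x by (simp add: A.mult_assoc)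
      have "q \<otimes>\<^bsub>A\<^esub> star A h = \<zero>\<^bsub>A\<^esub>" using A.star_mult[of h q] q h by simp
      hence qc: "q \<otimes>\<^bsub>A\<^esub> ?c = \<zero>\<^bsub>A\<^esub>" by (simp flip: A.mult_assoc)
      note b = \<phi>[OF _ qb bq, simplified] and c = \<phi>[OF _ qc cq, simplified]
      have sb: "star A ?b = star A (fst x) \<ominus>\<^bsub>A\<^esub> star A (fst x) \<otimes>\<^bsub>A\<^esub> q"
        by (simp add: A.star_diff A.star_mult q)
      have "star A ?b \<otimes>\<^bsub>A\<^esub> ?b = star A (fst x) \<otimes>\<^bsub>A\<^esub> ?b"
        unfolding sb using qb by (simp add: A.diff_mult A.mult_assoc)
      also have "\<dots> = star A (fst x) \<otimes>\<^bsub>A\<^esub> fst x \<ominus>\<^bsub>A\<^esub> star A (fst x) \<otimes>\<^bsub>A\<^esub> (q \<otimes>\<^bsub>A\<^esub> fst x)"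
        by (simp add: A.mult_diff)
      finally have bb: "star A ?b \<otimes>\<^bsub>A\<^esub> ?b = star A (fst x) \<otimes>\<^bsub>A\<^esub> fst x \<ominus>\<^bsub>A\<^esub> star A (fst x) \<otimes>\<^bsub>A\<^esub> (q \<otimes>\<^bsub>A\<^esub> fst x)" .
      have "star A ?c \<otimes>\<^bsub>A\<^esub> ?c = star A (fst x) \<otimes>\<^bsub>A\<^esub> ((h \<otimes>\<^bsub>A\<^esub> star A h) \<otimes>\<^bsub>A\<^esub> fst x)"
        by (simp add: A.star_mult A.star_star A.mult_assoc)
      hence cc: "star A ?c \<otimes>\<^bsub>A\<^esub> ?c = star A (fst x) \<otimes>\<^bsub>A\<^esub> (q \<otimes>\<^bsub>A\<^esub> fst x)" unfolding h(2) .
      have "star A ?b \<otimes>\<^bsub>A\<^esub> ?b \<oplus>\<^bsub>A\<^esub> star A ?c \<otimes>\<^bsub>A\<^esub> ?c = star A (fst x) \<otimes>\<^bsub>A\<^esub> fst x"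
        unfolding bb cc by (rule cancel) simp_all
      hence "star B (\<phi> ?b) \<otimes>\<^bsub>B\<^esub> \<phi> ?b \<oplus>\<^bsub>B\<^esub> star B (\<phi> ?c) \<otimes>\<^bsub>B\<^esub> \<phi> ?c = rip X x x"
        using b c \<phi>ip[OF x x] by (intro inj) (simp_all add: \<psi>.hom_add \<psi>.hom_mult \<psi>.hom_star)
      thus ?thesis using cstar_positive_add[OF cB b(1) c(1)] by simp
    qed
    show "rip X x x = \<zero>\<^bsub>B\<^esub> \<Longrightarrow> x = \<zero>\<^bsub>X\<^esub>"
    proof -
      assume "rip X x x = \<zero>\<^bsub>B\<^esub>"
      hence "star A (fst x) \<otimes>\<^bsub>A\<^esub> fst x = \<zero>\<^bsub>A\<^esub>"
        using \<phi>ip(2)[OF x x] star_hom_zero[OF hom B.star_algebra_axioms A.star_algebra_axioms] by simp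
      thus "x = \<zero>\<^bsub>X\<^esub>"
        using A.nrm_star_mult[of "fst x"] A.norm_eq_zero[of "fst x"] sx by (simp add: prod_eq_iff)
    qed
  next
    fix x y assume "x \<in> carrier X" "y \<in> carrier X"
    hence x: "fst x \<in> C" and y: "fst y \<in> C" by auto
    note [simp] = C(1)[OF x] C(1)[OF y]
    show "rip X x y \<in> carrier B" using \<phi>ip[OF x y] by simp
    show "star B (rip X x y) = rip X y x"
      by (rule inj) (use \<phi>ip[OF x y] \<phi>ip[OF y x] in \<open>simp_all add: \<psi>.hom_star A.star_mult A.star_star\<close>)
    show "rip X x (z \<odot>\<^bsub>X\<^esub> y) = z \<odot>\<^bsub>B\<^esub> rip X x y" for z
      by (rule inj)
        (use \<phi>ip[OF x y] \<phi>ip[OF x C_smult[OF y]] in \<open>simp_all add: \<psi>.hom_smult A.mult_smult\<close>)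
    show "rip X x (ract X y b) = rip X x y \<otimes>\<^bsub>B\<^esub> b" if b: "b \<in> carrier B" for b
      by (rule inj)
        (use \<phi>ip[OF x y] \<phi>ip[OF x C_ract[OF y b]] b in \<open>simp_all add: \<psi>.hom_mult A.mult_assoc\<close>)
    show "rip X x (y \<oplus>\<^bsub>X\<^esub> y') = rip X x y \<oplus>\<^bsub>B\<^esub> rip X x y'" if "y' \<in> carrier X" for y'
    proof -
      have y': "fst y' \<in> C" using that by simp
      show ?thesis
        by (rule inj) (use \<phi>ip[OF x y] \<phi>ip[OF x y'] \<phi>ip[OF x C_add[OF y y']] y' in
          \<open>simp_all add: \<psi>.hom_add A.mult_add\<close>)
    qed
  qed (auto simp: C_ract \<psi>.hom_add \<psi>.hom_mult \<psi>.hom_smult A.mult_add A.add_mult A.mult_assoc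
      A.mult_smult A.smult_mult prod_eq_iff)

  have "imprimitivity_bimodule A B X"
  proof (intro imprimitivity_bimodule.intro left right imprimitivity_bimodule_axioms.intro)
    fix x y z a b assume "x \<in> carrier X" "y \<in> carrier X"
    hence x: "fst x \<in> C" and y: "fst y \<in> C" by auto
    note [simp] = C(1)[OF x] C(1)[OF y]
    show "rip X (lact X a x) y = rip X x (lact X (star A a) y)" if "a \<in> carrier A"
      using that by (simp add: A.star_mult A.mult_assoc)
    show "lip X (ract X x b) y = lip X x (ract X y (star B b))" if "b \<in> carrier B"
      using that by (simp add: A.star_mult A.mult_assoc \<psi>.hom_star A.star_star)
    show "lact X (lip X x y) z = ract X x (rip X y z)" if "z \<in> carrier X"
      using that \<phi>ip[OF y] by (simp add: A.mult_assoc)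
  qed (auto simp: A.mult_assoc)
  thus ?thesis unfolding morita_equivalent_def by blast
qed

section \<open>Two by two matrices over a unital C*-algebra\<close>

text \<open>Matrices act on the Hilbert module of pairs with the inner product \<open>ip2\<close> and the norm \<open>hn\<close>. Their
  norm \<open>mn\<close> is the operator norm.\<close>

datatype 'c mat2 = Mat (m11: 'c) (m12: 'c) (m21: 'c) (m22: 'c)

definition ip2 :: "'c::cstar_alg_1 \<times> 'c \<Rightarrow> 'c \<times> 'c \<Rightarrow> 'c" where
  "ip2 \<xi> \<eta> = adj (fst \<xi>) * fst \<eta> + adj (snd \<xi>) * snd \<eta>"

definition hn :: "'c::cstar_alg_1 \<times> 'c \<Rightarrow> real" where
  "hn \<xi> = sqrt (norm (ip2 \<xi> \<xi>))"

definition app2 :: "'c::cstar_alg_1 mat2 \<Rightarrow> 'c \<times> 'c \<Rightarrow> 'c \<times> 'c" where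
  "app2 M \<xi> = (m11 M * fst \<xi> + m12 M * snd \<xi>, m21 M * fst \<xi> + m22 M * snd \<xi>)"

definition mn :: "'c::cstar_alg_1 mat2 \<Rightarrow> real" where
  "mn M = (SUP \<xi>\<in>{\<xi>. hn \<xi> \<le> 1}. hn (app2 M \<xi>))"

definition M2 :: "'c::cstar_alg_1 mat2 cstar" where
  "M2 = \<lparr>carrier = UNIV,
     mult = (\<lambda>X Y. Mat (m11 X * m11 Y + m12 X * m21 Y) (m11 X * m12 Y + m12 X * m22 Y)
       (m21 X * m11 Y + m22 X * m21 Y) (m21 X * m12 Y + m22 X * m22 Y)),
     one = undefined, zero = Mat 0 0 0 0,
     add = (\<lambda>X Y. Mat (m11 X + m11 Y) (m12 X + m12 Y) (m21 X + m21 Y) (m22 X + m22 Y)),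
     smult = (\<lambda>z X. Mat (z *\<^sub>C m11 X) (z *\<^sub>C m12 X) (z *\<^sub>C m21 X) (z *\<^sub>C m22 X)),
     star = (\<lambda>X. Mat (adj (m11 X)) (adj (m21 X)) (adj (m12 X)) (adj (m22 X))),
     nrm = mn\<rparr>"

lemma M2_simps [simp]:
  "carrier M2 = UNIV"
  "X \<otimes>\<^bsub>M2\<^esub> Y = Mat (m11 X * m11 Y + m12 X * m21 Y) (m11 X * m12 Y + m12 X * m22 Y)
       (m21 X * m11 Y + m22 X * m21 Y) (m21 X * m12 Y + m22 X * m22 Y)"
  "\<zero>\<^bsub>M2\<^esub> = Mat 0 0 0 0"
  "X \<oplus>\<^bsub>M2\<^esub> Y = Mat (m11 X + m11 Y) (m12 X + m12 Y) (m21 X + m21 Y) (m22 X + m22 Y)"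
  "z \<odot>\<^bsub>M2\<^esub> X = Mat (z *\<^sub>C m11 X) (z *\<^sub>C m12 X) (z *\<^sub>C m21 X) (z *\<^sub>C m22 X)"
  "star M2 X = Mat (adj (m11 X)) (adj (m21 X)) (adj (m12 X)) (adj (m22 X))"
  "nrm M2 = mn"
  by (simp_all add: M2_def)

lemma pos_ip2: "pos (ip2 \<xi> \<xi>)"
  by (simp add: ip2_def pos_add pos_adj_mult)

lemma hn_nonneg [simp]: "hn \<xi> \<ge> 0"
  by (simp add: hn_def)

lemma hn_sq: "(hn \<xi>)\<^sup>2 = norm (ip2 \<xi> \<xi>)"
  by (simp add: hn_def)

lemma norm_fst_le_hn: "norm (fst \<xi>) \<le> hn \<xi>" and norm_snd_le_hn: "norm (snd \<xi>) \<le> hn \<xi>"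
proof -
  have "norm (adj (fst \<xi>) * fst \<xi>) \<le> norm (ip2 \<xi> \<xi>)"
    by (rule pos_norm_mono) (simp_all add: ip2_def pos_adj_mult)
  thus "norm (fst \<xi>) \<le> hn \<xi>" unfolding hn_def norm_adj_mult by (rule real_le_rsqrt)
  have "norm (adj (snd \<xi>) * snd \<xi>) \<le> norm (ip2 \<xi> \<xi>)"
    by (rule pos_norm_mono) (simp_all add: ip2_def pos_adj_mult)
  thus "norm (snd \<xi>) \<le> hn \<xi>" unfolding hn_def norm_adj_mult by (rule real_le_rsqrt)
qed

lemma hn_le: "hn \<xi> \<le> norm (fst \<xi>) + norm (snd \<xi>)"
proof -
  have "norm (ip2 \<xi> \<xi>) \<le> (norm (fst \<xi>))\<^sup>2 + (norm (snd \<xi>))\<^sup>2"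
    unfolding ip2_def by (rule order_trans[OF norm_triangle_ineq]) (simp add: norm_adj_mult)
  also have "\<dots> \<le> (norm (fst \<xi>) + norm (snd \<xi>))\<^sup>2" by (simp add: power2_sum)
  finally show ?thesis unfolding hn_def by (intro real_le_lsqrt) auto
qed

text \<open>As for scalars, by positivity of \<open>\<langle>\<zeta>,\<zeta>\<rangle>\<close> for \<open>\<zeta> = \<eta> - t\<xi>a\<close>, where \<open>a = \<langle>\<xi>,\<eta>\<rangle>\<close> and \<open>t = 1 / \<parallel>\<langle>\<xi>,\<xi>\<rangle>\<parallel>\<close>.\<close>

lemma ip2_cauchy_schwarz: "norm (ip2 \<xi> \<eta>) \<le> hn \<xi> * hn \<eta>"
proof (cases "hn \<xi> = 0")
  case True
  hence "fst \<xi> = 0" "snd \<xi> = 0" using norm_fst_le_hn[of \<xi>] norm_snd_le_hn[of \<xi>] by auto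
  thus ?thesis using True by (simp add: ip2_def)
next
  case False
  define s where "s = norm (ip2 \<xi> \<xi>)"
  have s: "s > 0" using False by (simp add: s_def hn_def)
  define a where "a = ip2 \<xi> \<eta>"
  define t where "t = 1 / s"
  have t: "t > 0" "t * s = 1" using s by (simp_all add: t_def)
  define \<zeta> where "\<zeta> = (fst \<eta> - t *\<^sub>R (fst \<xi> * a), snd \<eta> - t *\<^sub>R (snd \<xi> * a))"
  have ad: "adj a = ip2 \<eta> \<xi>" by (simp add: a_def ip2_def adj_add adj_mult)
  have "ip2 \<zeta> \<zeta> = ip2 \<eta> \<eta> - t *\<^sub>R (ip2 \<eta> \<xi> * a) - t *\<^sub>R (adj a * ip2 \<xi> \<eta>) + (t * t) *\<^sub>R (adj a * ip2 \<xi> \<xi> * a)"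
    by (simp add: \<zeta>_def ip2_def adj_diff adj_scaleR adj_mult algebra_simps)
  also have "\<dots> = ip2 \<eta> \<eta> - t *\<^sub>R (adj a * a) - t *\<^sub>R (adj a * a) + (t * t) *\<^sub>R (adj a * ip2 \<xi> \<xi> * a)"
    unfolding ad[symmetric] a_def[symmetric] ..
  finally have z: "ip2 \<zeta> \<zeta> = ip2 \<eta> \<eta> - t *\<^sub>R (adj a * a) - t *\<^sub>R (adj a * a) + (t * t) *\<^sub>R (adj a * ip2 \<xi> \<xi> * a)" .
  have "pos (of_real s - ip2 \<xi> \<xi>)" unfolding s_def by (rule pos_norm_minus) (rule pos_selfadj[OF pos_ip2])
  hence "pos ((t * t) *\<^sub>R (adj a * (of_real s - ip2 \<xi> \<xi>) * a))" using t by (intro pos_scaleR pos_conj) auto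
  also have "(t * t) *\<^sub>R (adj a * (of_real s - ip2 \<xi> \<xi>) * a) = (t * (t * s)) *\<^sub>R (adj a * a) - (t * t) *\<^sub>R (adj a * ip2 \<xi> \<xi> * a)"
    by (simp add: left_diff_distrib right_diff_distrib scaleR_diff_right of_real_def mult.assoc)
  finally have "pos (t *\<^sub>R (adj a * a) - (t * t) *\<^sub>R (adj a * ip2 \<xi> \<xi> * a))" using t by simp
  from pos_add[OF pos_ip2[of \<zeta>] this] have "pos (ip2 \<eta> \<eta> - t *\<^sub>R (adj a * a))"
    unfolding z by simp
  hence "norm (t *\<^sub>R (adj a * a)) \<le> norm (ip2 \<eta> \<eta>)"
    using t by (intro pos_norm_mono pos_scaleR pos_adj_mult) auto
  hence "t * (norm a)\<^sup>2 \<le> (hn \<eta>)\<^sup>2" using t by (simp add: norm_adj_mult hn_sq)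
  hence "s * (t * (norm a)\<^sup>2) \<le> s * (hn \<eta>)\<^sup>2" using s by (intro mult_left_mono) auto
  also have "s * (t * (norm a)\<^sup>2) = (norm a)\<^sup>2" using t by (simp add: mult.commute flip: mult.assoc)
  also have "s * (hn \<eta>)\<^sup>2 = (hn \<xi> * hn \<eta>)\<^sup>2" by (simp add: s_def power_mult_distrib hn_sq)
  finally show ?thesis unfolding a_def by (rule power2_le_imp_le) simp
qed

lemma hn_triangle: "hn (\<xi> + \<eta>) \<le> hn \<xi> + hn \<eta>"
proof -
  have "ip2 (\<xi> + \<eta>) (\<xi> + \<eta>) = ip2 \<xi> \<xi> + ip2 \<xi> \<eta> + (ip2 \<eta> \<xi> + ip2 \<eta> \<eta>)"
    by (simp add: ip2_def adj_add algebra_simps)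
  hence "norm (ip2 (\<xi> + \<eta>) (\<xi> + \<eta>)) \<le> norm (ip2 \<xi> \<xi>) + norm (ip2 \<xi> \<eta>) + (norm (ip2 \<eta> \<xi>) + norm (ip2 \<eta> \<eta>))"
    by (metis norm_triangle_mono norm_triangle_ineq)
  also have "\<dots> \<le> (hn \<xi>)\<^sup>2 + hn \<xi> * hn \<eta> + (hn \<eta> * hn \<xi> + (hn \<eta>)\<^sup>2)"
    unfolding hn_sq by (intro add_mono ip2_cauchy_schwarz order_refl)
  also have "\<dots> = (hn \<xi> + hn \<eta>)\<^sup>2" by (simp add: power2_sum)
  finally show ?thesis unfolding hn_def[of "\<xi> + \<eta>"] by (intro real_le_lsqrt) auto
qed

lemma hn_scaleC: "hn (z *\<^sub>C fst \<xi>, z *\<^sub>C snd \<xi>) = cmod z * hn \<xi>"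
proof -
  have "ip2 (z *\<^sub>C fst \<xi>, z *\<^sub>C snd \<xi>) (z *\<^sub>C fst \<xi>, z *\<^sub>C snd \<xi>) = (cnj z * z) *\<^sub>C ip2 \<xi> \<xi>"
    by (simp add: ip2_def adj_scaleC scaleC_mult_left scaleC_mult_right scaleC_scaleC scaleC_add_right mult.commute)
  thus ?thesis by (simp add: hn_def norm_scaleC norm_mult real_sqrt_mult)
qed

lemma app2_scaleC: "app2 M (z *\<^sub>C fst \<xi>, z *\<^sub>C snd \<xi>) = (z *\<^sub>C fst (app2 M \<xi>), z *\<^sub>C snd (app2 M \<xi>))"
  by (simp add: app2_def scaleC_mult_right scaleC_add_right)

lemma hn_app2_le: "hn (app2 M \<xi>) \<le> (norm (m11 M) + norm (m12 M) + norm (m21 M) + norm (m22 M)) * hn \<xi>"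
proof -
  have m: "norm (a * fst \<xi> + b * snd \<xi>) \<le> (norm a + norm b) * hn \<xi>" for a b
  proof -
    have "norm (a * fst \<xi> + b * snd \<xi>) \<le> norm a * norm (fst \<xi>) + norm b * norm (snd \<xi>)"
      by (rule order_trans[OF norm_triangle_ineq]) (intro add_mono norm_mult_ineq)
    also have "\<dots> \<le> norm a * hn \<xi> + norm b * hn \<xi>"
      by (intro add_mono mult_left_mono norm_fst_le_hn norm_snd_le_hn norm_ge_zero)
    finally show ?thesis by (simp add: distrib_right)
  qed
  show ?thesis
    using hn_le[of "app2 M \<xi>"] m[of "m11 M" "m12 M"] m[of "m21 M" "m22 M"]
    by (simp add: app2_def algebra_simps)
qed

lemma mn_upper: assumes "hn \<xi> \<le> 1" shows "hn (app2 M \<xi>) \<le> mn M"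
  unfolding mn_def
proof (rule cSUP_upper)
  let ?K = "norm (m11 M) + norm (m12 M) + norm (m21 M) + norm (m22 M)"
  show "bdd_above ((\<lambda>\<xi>. hn (app2 M \<xi>)) ` {\<xi>. hn \<xi> \<le> 1})"
  proof (rule bdd_aboveI2)
    fix \<xi> :: "'a \<times> 'a" assume "\<xi> \<in> {\<xi>. hn \<xi> \<le> 1}"
    thus "hn (app2 M \<xi>) \<le> ?K"
      using hn_app2_le[of M \<xi>] mult_left_le[of "hn \<xi>" ?K] by simp
  qed
qed (simp add: assms)

lemma mn_nonneg: "mn M \<ge> 0"
proof -
  have "hn (0::'a \<times> 'a) \<le> 1" by (simp add: hn_def ip2_def)
  from mn_upper[OF this, of M] show ?thesis using hn_nonneg[of "app2 M 0"] by linarith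
qed

lemma mn_le: assumes "\<And>\<xi>. hn \<xi> \<le> 1 \<Longrightarrow> hn (app2 M \<xi>) \<le> K" shows "mn M \<le> K"
proof -
  have "hn (0::'a \<times> 'a) \<le> 1" by (simp add: hn_def ip2_def)
  thus ?thesis unfolding mn_def using assms by (intro cSUP_least) blast+
qed

lemma hn_app2: "hn (app2 M \<xi>) \<le> mn M * hn \<xi>"
proof (cases "hn \<xi> = 0")
  case True
  thus ?thesis using hn_app2_le[of M \<xi>] by simp
next
  case False
  define z where "z = complex_of_real (inverse (hn \<xi>))"
  have z: "cmod z = inverse (hn \<xi>)" by (simp add: z_def norm_inverse)
  have "hn (app2 M (z *\<^sub>C fst \<xi>, z *\<^sub>C snd \<xi>)) \<le> mn M"
    by (rule mn_upper) (simp only: hn_scaleC z, use False in simp)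
  hence "inverse (hn \<xi>) * hn (app2 M \<xi>) \<le> mn M" unfolding app2_scaleC hn_scaleC z .
  hence "hn \<xi> * (inverse (hn \<xi>) * hn (app2 M \<xi>)) \<le> hn \<xi> * mn M" by (rule mult_left_mono) simp
  thus ?thesis using False by (simp add: mult.commute flip: mult.assoc)
qed

lemma app2_mult: "app2 (X \<otimes>\<^bsub>M2\<^esub> Y) \<xi> = app2 X (app2 Y \<xi>)"
  by (simp add: app2_def algebra_simps)

lemma ip2_app2: "ip2 (app2 X \<xi>) \<eta> = ip2 \<xi> (app2 (star M2 X) \<eta>)"
  by (simp add: ip2_def app2_def adj_add adj_mult algebra_simps)

lemma mn_mult: "mn (X \<otimes>\<^bsub>M2\<^esub> Y) \<le> mn X * mn Y"
proof (rule mn_le)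
  fix \<xi> :: "'a \<times> 'a" assume "hn \<xi> \<le> 1"
  have "hn (app2 X (app2 Y \<xi>)) \<le> mn X * hn (app2 Y \<xi>)" by (rule hn_app2)
  also have "\<dots> \<le> mn X * mn Y" by (intro mult_left_mono mn_upper mn_nonneg \<open>hn \<xi> \<le> 1\<close>)
  finally show "hn (app2 (X \<otimes>\<^bsub>M2\<^esub> Y) \<xi>) \<le> mn X * mn Y" unfolding app2_mult .
qed

lemma mn_star_mult_ge: "(mn X)\<^sup>2 \<le> mn (star M2 X \<otimes>\<^bsub>M2\<^esub> X)"
proof -
  have "mn X \<le> sqrt (mn (star M2 X \<otimes>\<^bsub>M2\<^esub> X))"
  proof (rule mn_le, rule real_le_rsqrt)
    fix \<xi> :: "'a \<times> 'a" assume \<xi>: "hn \<xi> \<le> 1"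
    have "(hn (app2 X \<xi>))\<^sup>2 = norm (ip2 \<xi> (app2 (star M2 X \<otimes>\<^bsub>M2\<^esub> X) \<xi>))"
      unfolding hn_sq ip2_app2 app2_mult ..
    also have "\<dots> \<le> hn \<xi> * hn (app2 (star M2 X \<otimes>\<^bsub>M2\<^esub> X) \<xi>)" by (rule ip2_cauchy_schwarz)
    also have "\<dots> \<le> 1 * mn (star M2 X \<otimes>\<^bsub>M2\<^esub> X)" by (intro mult_mono mn_upper \<xi>) auto
    finally show "(hn (app2 X \<xi>))\<^sup>2 \<le> mn (star M2 X \<otimes>\<^bsub>M2\<^esub> X)" by simp
  qed
  hence "(mn X)\<^sup>2 \<le> (sqrt (mn (star M2 X \<otimes>\<^bsub>M2\<^esub> X)))\<^sup>2" by (intro power_mono mn_nonneg)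
  thus ?thesis using mn_nonneg[of "star M2 X \<otimes>\<^bsub>M2\<^esub> X"] by (simp del: M2_simps)
qed

lemma mn_star: "mn (star M2 X) = mn X"
proof -
  have le: "mn Y \<le> mn (star M2 Y)" for Y :: "'a mat2"
  proof (cases "mn Y = 0")
    case False
    have "(mn Y)\<^sup>2 \<le> mn (star M2 Y) * mn Y"
      using mn_star_mult_ge[of Y] mn_mult[of "star M2 Y" Y] by linarith
    thus ?thesis using False mn_nonneg[of Y] by (simp add: power2_eq_square del: M2_simps)
  qed (simp add: mn_nonneg del: M2_simps)
  have "star M2 (star M2 X) = X" by simp
  thus ?thesis using le[of X] le[of "star M2 X"] by (simp del: M2_simps)
qed

lemma star_algebra_M2: "star_algebra (M2 :: 'c::cstar_alg_1 mat2 cstar)"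
proof (rule star_algebra.intro)
  show "Module.module complex_ring (M2 :: 'c mat2 cstar)"
  proof (rule moduleI[OF cring_complex_ring])
    show "abelian_group (M2 :: 'c mat2 cstar)"
    proof (rule abelian_groupI)
      fix x :: "'c mat2"
      show "\<exists>y\<in>carrier M2. y \<oplus>\<^bsub>M2\<^esub> x = \<zero>\<^bsub>M2\<^esub>"
        by (rule bexI[of _ "Mat (- m11 x) (- m12 x) (- m21 x) (- m22 x)"]) auto
    qed (auto simp: algebra_simps)
  qed (auto simp: scaleC_add_left scaleC_add_right scaleC_scaleC)
qed (unfold_locales, auto simp: algebra_simps scaleC_mult_left scaleC_mult_right scaleC_add_right adj_add adj_mult adj_scaleC)

lemma seminormed_M2: "seminormed_star_algebra (M2 :: 'c::cstar_alg_1 mat2 cstar)"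
proof -
  have add: "mn (X \<oplus>\<^bsub>M2\<^esub> Y) \<le> mn X + mn Y" for X Y :: "'c mat2"
  proof (rule mn_le)
    fix \<xi> :: "'c \<times> 'c" assume \<xi>: "hn \<xi> \<le> 1"
    have "app2 (X \<oplus>\<^bsub>M2\<^esub> Y) \<xi> = app2 X \<xi> + app2 Y \<xi>" by (simp add: app2_def algebra_simps)
    thus "hn (app2 (X \<oplus>\<^bsub>M2\<^esub> Y) \<xi>) \<le> mn X + mn Y"
      using hn_triangle[of "app2 X \<xi>" "app2 Y \<xi>"] mn_upper[OF \<xi>, of X] mn_upper[OF \<xi>, of Y] by simp
  qed
  have smult_le: "mn (z \<odot>\<^bsub>M2\<^esub> X) \<le> cmod z * mn X" for X :: "'c mat2" and z
  proof (rule mn_le)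
    fix \<xi> :: "'c \<times> 'c" assume \<xi>: "hn \<xi> \<le> 1"
    have "app2 (z \<odot>\<^bsub>M2\<^esub> X) \<xi> = (z *\<^sub>C fst (app2 X \<xi>), z *\<^sub>C snd (app2 X \<xi>))"
      by (simp add: app2_def scaleC_add_right scaleC_mult_left)
    thus "hn (app2 (z \<odot>\<^bsub>M2\<^esub> X) \<xi>) \<le> cmod z * mn X"
      using mn_upper[OF \<xi>, of X] by (simp only: hn_scaleC mult_left_mono norm_ge_zero)
  qed
  have smult: "mn (z \<odot>\<^bsub>M2\<^esub> X) = cmod z * mn X" for X :: "'c mat2" and z
  proof (rule antisym[OF smult_le])
    show "cmod z * mn X \<le> mn (z \<odot>\<^bsub>M2\<^esub> X)"
    proof (cases "z = 0")
      case True
      thus ?thesis using mn_nonneg[of "z \<odot>\<^bsub>M2\<^esub> X"] by simp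
    next
      case False
      have "X = inverse z \<odot>\<^bsub>M2\<^esub> (z \<odot>\<^bsub>M2\<^esub> X)" using False by (simp add: scaleC_scaleC)
      hence "mn X \<le> cmod (inverse z) * mn (z \<odot>\<^bsub>M2\<^esub> X)" using smult_le[of "inverse z" "z \<odot>\<^bsub>M2\<^esub> X"] by (simp del: M2_simps)
      from mult_left_mono[OF this, of "cmod z"] False show ?thesis
        by (simp add: norm_inverse del: M2_simps flip: mult.assoc)
    qed
  qed
  have cs: "mn (star M2 X \<otimes>\<^bsub>M2\<^esub> X) = (mn X)\<^sup>2" for X :: "'c mat2"
    using mn_star_mult_ge[of X] mn_mult[of "star M2 X" X] unfolding mn_star by (simp add: power2_eq_square del: M2_simps)
  interpret star_algebra "M2 :: 'c mat2 cstar" by (rule star_algebra_M2)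
  show ?thesis
    by unfold_locales (simp add: is_cstar_seminorm_def add smult cs mn_mult del: M2_simps(2-6))
qed

lemma mn_corner: "mn (Mat b 0 0 0) = norm b"
proof (rule antisym)
  show "mn (Mat b 0 0 0) \<le> norm b"
  proof (rule mn_le)
    fix \<xi> :: "'a \<times> 'a" assume \<xi>: "hn \<xi> \<le> 1"
    have "hn (app2 (Mat b 0 0 0) \<xi>) \<le> norm (b * fst \<xi>)"
      using hn_le[of "app2 (Mat b 0 0 0) \<xi>"] by (simp add: app2_def)
    also have "\<dots> \<le> norm b * norm (fst \<xi>)" by (rule norm_mult_ineq)
    also have "\<dots> \<le> norm b * 1" using norm_fst_le_hn[of \<xi>] \<xi> by (intro mult_left_mono) auto
    finally show "hn (app2 (Mat b 0 0 0) \<xi>) \<le> norm b" by simp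
  qed
  have "hn (1::'a, 0) \<le> 1" using hn_le[of "(1::'a, 0)"] by simp
  from mn_upper[OF this, of "Mat b 0 0 0"] show "norm b \<le> mn (Mat b 0 0 0)"
    using norm_fst_le_hn[of "app2 (Mat b 0 0 0) (1, 0)"] by (simp add: app2_def)
qed

lemma finsum_M2: "finsum M2 f I = Mat (\<Sum>i\<in>I. m11 (f i)) (\<Sum>i\<in>I. m12 (f i)) (\<Sum>i\<in>I. m21 (f i)) (\<Sum>i\<in>I. m22 (f i))"
proof -
  interpret star_algebra "M2 :: 'a mat2 cstar" by (rule star_algebra_M2)
  show ?thesis
  proof (induction I rule: infinite_finite_induct)
    case (insert x F)
    thus ?case using M.finsum_insert[of F x f] by simp
  qed auto
qed

section \<open>Paths in higher-rank graphs\<close>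

text \<open>The equations are stated below for the skeleton (\<open>W_simps\<close>) and for the reduced skeleton
  (\<open>WR_simps\<close>), with the vertices and edges of these graphs made explicit.\<close>

declare is_walk.simps [simp del]

lemma axis_one_eq_iff [simp]: "axis i (Suc 0) = axis j (Suc 0) \<longleftrightarrow> i = j"
  by (auto simp: axis_eq_axis)

lemma axis_one_add_eq:
  assumes "axis i (1::nat) + axis j 1 = axis i' 1 + axis j' 1"
  shows "i' = i \<and> j' = j \<or> i' = j \<and> j' = i"
proof -
  have c: "(axis i (1::nat) + axis j 1) $ k = (axis i' 1 + axis j' 1) $ k" for k using assms by simp
  show ?thesis
    using c[of i] c[of j] c[of i'] c[of j'] by (auto simp: axis_def split: if_splits)
qed

context k_graph
begin

abbreviation "Vs \<equiv> verts_of \<Lambda>"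
abbreviation "Es \<equiv> edges_of \<Lambda>"

lemma edge_Mor: "e \<in> Es \<Longrightarrow> e \<in> Mor \<Lambda>" and vert_Mor: "x \<in> Vs \<Longrightarrow> x \<in> Mor \<Lambda>"
  by (simp_all add: edges_of_def verts_of_def)

lemma rng_vert: "x \<in> Mor \<Lambda> \<Longrightarrow> rng \<Lambda> x \<in> Vs" and src_vert: "x \<in> Mor \<Lambda> \<Longrightarrow> src \<Lambda> x \<in> Vs"
  by (simp_all add: verts_of_def rng_closed src_closed deg_rng deg_src)

lemma factorization_unique:
  assumes "a \<in> Mor \<Lambda>" "b \<in> Mor \<Lambda>" "c \<in> Mor \<Lambda>" "d \<in> Mor \<Lambda>" "src \<Lambda> a = rng \<Lambda> b" "src \<Lambda> c = rng \<Lambda> d"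
    and "deg \<Lambda> a = deg \<Lambda> c" "deg \<Lambda> b = deg \<Lambda> d" "cmp \<Lambda> a b = cmp \<Lambda> c d"
  shows "a = c" "b = d"
proof -
  have "cmp \<Lambda> a b \<in> Mor \<Lambda>" "deg \<Lambda> (cmp \<Lambda> a b) = deg \<Lambda> b + deg \<Lambda> a"
    using assms by (simp_all add: cmp_closed deg_cmp add.commute)
  from ex1_implies_ex[OF factorization[OF this]] factorization[OF this]
  have "(a, b) = (c, d)" using assms by (elim ex1E) (metis (mono_tags, lifting) case_prodI)
  thus "a = c" "b = d" by auto
qed

lemma factorization_exists:
  assumes "x \<in> Mor \<Lambda>" "deg \<Lambda> x = m + n"
  obtains a b where "a \<in> Mor \<Lambda>" "b \<in> Mor \<Lambda>" "src \<Lambda> a = rng \<Lambda> b" "deg \<Lambda> a = m" "deg \<Lambda> b = n" "x = cmp \<Lambda> a b"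
  using ex1_implies_ex[OF factorization[OF assms(1), of n m]] assms(2) by (auto simp: add.commute)

lemma left_cancel:
  assumes "a \<in> Mor \<Lambda>" "b \<in> Mor \<Lambda>" "d \<in> Mor \<Lambda>" "src \<Lambda> a = rng \<Lambda> b" "src \<Lambda> a = rng \<Lambda> d" "cmp \<Lambda> a b = cmp \<Lambda> a d"
  shows "b = d"
proof -
  have "deg \<Lambda> a + deg \<Lambda> b = deg \<Lambda> a + deg \<Lambda> d" using assms deg_cmp by metis
  hence "deg \<Lambda> b = deg \<Lambda> d" by (simp add: vec_eq_iff)
  thus ?thesis using factorization_unique[of a b a d] assms by auto
qed

lemma vert_ids: assumes "x \<in> Vs" shows "rng \<Lambda> x = x" "src \<Lambda> x = x"
proof -
  have x: "x \<in> Mor \<Lambda>" "deg \<Lambda> x = 0" using assms by (auto simp: verts_of_def)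
  show "rng \<Lambda> x = x"
    by (rule factorization_unique(1)[of _ x x "src \<Lambda> x"])
      (simp_all add: x rng_closed src_closed src_rng rng_src deg_rng deg_src cmp_rng cmp_src)
  show "src \<Lambda> x = x"
    by (rule factorization_unique(2)[of "rng \<Lambda> x" x x "src \<Lambda> x", symmetric])
      (simp_all add: x rng_closed src_closed src_rng rng_src deg_rng deg_src cmp_rng cmp_src)
qed

text \<open>The colour of an edge, as an index.\<close>

definition col :: "'a \<Rightarrow> 'k" where "col e = (THE i. deg \<Lambda> e = axis i 1)"

lemma deg_edge: assumes "e \<in> Es" shows "deg \<Lambda> e = axis (col e) 1"
proof -
  have s: "(\<Sum>i\<in>UNIV. deg \<Lambda> e $ i) = 1" using assms by (simp add: edges_of_def)
  then obtain i where i: "deg \<Lambda> e $ i \<noteq> 0" by (metis sum.neutral zero_neq_one)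
  have "(\<Sum>j\<in>UNIV. deg \<Lambda> e $ j) = deg \<Lambda> e $ i + (\<Sum>j\<in>UNIV - {i}. deg \<Lambda> e $ j)"
    by (rule sum.remove) auto
  hence "deg \<Lambda> e $ i = 1" "(\<Sum>j\<in>UNIV - {i}. deg \<Lambda> e $ j) = 0" using s i by linarith+
  hence "deg \<Lambda> e = axis i 1" by (auto simp: vec_eq_iff axis_def)
  moreover from this have "col e = i" unfolding col_def by (intro the_equality) auto
  ultimately show ?thesis by simp
qed

lemma edgeI: "e \<in> Mor \<Lambda> \<Longrightarrow> deg \<Lambda> e = axis i 1 \<Longrightarrow> e \<in> Es"
  using sum_axis[of i] by (simp add: edges_of_def)

lemma col_eqI: "e \<in> Es \<Longrightarrow> deg \<Lambda> e = axis i 1 \<Longrightarrow> col e = i"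
  using deg_edge[of e] by simp

lemma edges_commute_iff:
  "edges_commute \<Lambda> a b c d \<longleftrightarrow> a \<in> Es \<and> b \<in> Es \<and> c \<in> Es \<and> d \<in> Es \<and> src \<Lambda> a = rng \<Lambda> b \<and>
     src \<Lambda> c = rng \<Lambda> d \<and> cmp \<Lambda> a b = cmp \<Lambda> c d"
  by (auto simp: edges_commute_def path_equiv_def paths_def skeleton_def path_mor_def edge_Mor rng_vert src_vert is_walk.simps)

text \<open>The composition of two edges also factors with their colours in the opposite order.\<close>

lemma swap_exists:
  assumes "a \<in> Es" "b \<in> Es" "src \<Lambda> a = rng \<Lambda> b"
  obtains c d where "edges_commute \<Lambda> a b c d" "deg \<Lambda> c = deg \<Lambda> b" "deg \<Lambda> d = deg \<Lambda> a"
proof -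
  have "deg \<Lambda> (cmp \<Lambda> a b) = deg \<Lambda> b + deg \<Lambda> a" using assms by (simp add: deg_cmp edge_Mor add.commute)
  then obtain c d where cd: "c \<in> Mor \<Lambda>" "d \<in> Mor \<Lambda>" "src \<Lambda> c = rng \<Lambda> d" "deg \<Lambda> c = deg \<Lambda> b"
    "deg \<Lambda> d = deg \<Lambda> a" "cmp \<Lambda> a b = cmp \<Lambda> c d"
    using factorization_exists[of "cmp \<Lambda> a b" "deg \<Lambda> b" "deg \<Lambda> a"] assms by (metis cmp_closed edge_Mor)
  have "c \<in> Es" "d \<in> Es" using cd assms deg_edge edgeI by metis+
  thus thesis using that cd assms by (simp add: edges_commute_iff)
qed

lemma edges_commute_cases:
  assumes "edges_commute \<Lambda> a b c d"
  obtains "c = a" "d = b" | "col c = col b" "col d = col a"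
proof -
  have e: "a \<in> Es" "b \<in> Es" "c \<in> Es" "d \<in> Es" "src \<Lambda> a = rng \<Lambda> b" "src \<Lambda> c = rng \<Lambda> d" "cmp \<Lambda> a b = cmp \<Lambda> c d"
    using assms by (auto simp: edges_commute_iff)
  have "axis (col a) (1::nat) + axis (col b) 1 = axis (col c) 1 + axis (col d) 1"
    using e deg_cmp[of a b] deg_cmp[of c d] by (simp add: edge_Mor deg_edge)
  from axis_one_add_eq[OF this] show thesis
  proof
    assume "col c = col a \<and> col d = col b"
    hence dd: "deg \<Lambda> a = deg \<Lambda> c" "deg \<Lambda> b = deg \<Lambda> d" using deg_edge[OF e(1)] deg_edge[OF e(2)]
      deg_edge[OF e(3)] deg_edge[OF e(4)] by simp_all
    note fu = factorization_unique[OF e(1-4)[THEN edge_Mor] e(5,6) dd e(7)]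
    show thesis by (rule that(1)) (simp_all add: fu)
  qed (auto intro: that(2))
qed

text \<open>\<open>W x es\<close>: the edges \<open>es\<close> form a path with range \<open>x\<close>; its morphism is \<open>M x es\<close>.\<close>

abbreviation "W \<equiv> is_walk (skeleton \<Lambda>)"
abbreviation "M x es \<equiv> path_mor \<Lambda> (x, es)"

lemma W_simps [simp]: "W x [] \<longleftrightarrow> x \<in> Vs"
  "W x (e # es) \<longleftrightarrow> e \<in> Es \<and> rng \<Lambda> e = x \<and> W (src \<Lambda> e) es"
  by (auto simp: is_walk.simps skeleton_def edge_Mor rng_vert)

lemma M_Nil [simp]: "M x [] = x" by (simp add: path_mor_def)

lemma M_Cons: "e \<in> Es \<Longrightarrow> M x (e # es) = cmp \<Lambda> e (M (src \<Lambda> e) es)"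
  by (auto simp: path_mor_def cmp_src edge_Mor)

lemma walk_mor: "W x es \<Longrightarrow> M x es \<in> Mor \<Lambda> \<and> rng \<Lambda> (M x es) = x \<and> deg \<Lambda> (M x es) = sum_list (map (deg \<Lambda>) es)"
proof (induction es arbitrary: x)
  case Nil
  thus ?case by (auto simp: vert_ids vert_Mor) (simp add: verts_of_def)
next
  case (Cons e es)
  hence IH: "M (src \<Lambda> e) es \<in> Mor \<Lambda> \<and> rng \<Lambda> (M (src \<Lambda> e) es) = src \<Lambda> e \<and>
    deg \<Lambda> (M (src \<Lambda> e) es) = sum_list (map (deg \<Lambda>) es)" by auto
  thus ?case using Cons.prems by (simp add: M_Cons cmp_closed rng_cmp deg_cmp edge_Mor)
qed

lemma deg_total_add: "(\<Sum>i\<in>UNIV. (m + n :: nat ^ 'k) $ i) = (\<Sum>i\<in>UNIV. m $ i) + (\<Sum>i\<in>UNIV. n $ i)"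
  by (simp add: sum.distrib)

lemma deg_total_edges:
  assumes "\<And>e. e \<in> set es \<Longrightarrow> e \<in> Es"
  shows "(\<Sum>i\<in>UNIV. sum_list (map (deg \<Lambda>) es) $ i) = length es"
  using assms
proof (induction es)
  case (Cons e es)
  hence "(\<Sum>i\<in>UNIV. deg \<Lambda> e $ i) = 1" by (simp add: edges_of_def)
  thus ?case using Cons by (simp add: sum.distrib)
qed simp

lemma walk_edges: "W x es \<Longrightarrow> e \<in> set es \<Longrightarrow> e \<in> Es"
  by (induction es arbitrary: x) auto

lemma walk_length: "W x es \<Longrightarrow> (\<Sum>i\<in>UNIV. deg \<Lambda> (M x es) $ i) = length es"
  using walk_mor[of x es] deg_total_edges[of es] walk_edges[of x es] by auto

lemma walk_exists:
  assumes "y \<in> Mor \<Lambda>"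
  obtains es where "W (rng \<Lambda> y) es" "M (rng \<Lambda> y) es = y"
proof -
  have "\<exists>es. W (rng \<Lambda> y) es \<and> M (rng \<Lambda> y) es = y" if "(\<Sum>i\<in>UNIV. deg \<Lambda> y $ i) = n" "y \<in> Mor \<Lambda>" for n y
    using that
  proof (induction n arbitrary: y)
    case 0
    hence "y \<in> Vs" by (simp add: verts_of_def vec_eq_iff)
    thus ?case by (intro exI[of _ "[]"]) (simp add: vert_ids)
  next
    case (Suc n)
    then obtain i where i: "deg \<Lambda> y $ i \<noteq> 0" by (metis sum.neutral nat.distinct(1))
    have dec: "deg \<Lambda> y = axis i 1 + (deg \<Lambda> y - axis i 1)" using i by (auto simp: vec_eq_iff axis_def)
    then obtain e z where e: "e \<in> Mor \<Lambda>" "z \<in> Mor \<Lambda>" "src \<Lambda> e = rng \<Lambda> z" "deg \<Lambda> e = axis i 1"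
      "deg \<Lambda> z = deg \<Lambda> y - axis i 1" "y = cmp \<Lambda> e z"
      using factorization_exists[OF Suc.prems(2)] by metis
    have "(\<Sum>j\<in>UNIV. deg \<Lambda> y $ j) = (\<Sum>j\<in>UNIV. axis i 1 $ j) + (\<Sum>j\<in>UNIV. deg \<Lambda> z $ j)"
      unfolding e(5) by (subst dec) (rule deg_total_add)
    hence "(\<Sum>j\<in>UNIV. deg \<Lambda> z $ j) = n" using Suc.prems(1) sum_axis[of i] by simp
    from Suc.IH[OF this e(2)] obtain es where "W (rng \<Lambda> z) es" "M (rng \<Lambda> z) es = z" by blast
    hence "W (rng \<Lambda> y) (e # es) \<and> M (rng \<Lambda> y) (e # es) = y"
      using e edgeI[OF e(1,4)] by (simp add: M_Cons rng_cmp)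
    thus ?case by blast
  qed
  thus thesis using assms that by blast
qed

text \<open>Paths with the same morphism are related by exchanging consecutive edges. Accordingly a
  multiplicative function of paths that is invariant under these exchanges depends only on the
  morphism.\<close>

theorem walk_prod_eq:
  fixes t :: "'a \<Rightarrow> 'm::monoid_mult"
  assumes t: "\<And>a b c d. edges_commute \<Lambda> a b c d \<Longrightarrow> t a * t b = t c * t d"
    and "W x es" "W y fs" "M x es = M y fs"
  shows "prod_list (map t es) = prod_list (map t fs)"
proof -
  have "length es = n \<Longrightarrow> ?thesis" for n
    using assms(2-4)
  proof (induction n arbitrary: x y es fs)
    case 0
    hence "length fs = 0" using walk_length[of x es] walk_length[of y fs] by simp
    thus ?case using 0 by simp
  next
    case (Suc n)
    have "length fs = Suc n" using Suc.prems walk_length[of x es] walk_length[of y fs] by simp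
    then obtain e p g q where es: "es = e # p" and fs: "fs = g # q" and len: "length p = n" "length q = n"
      using Suc.prems(1) by (auto simp: length_Suc_conv)
    define P where "P = M (src \<Lambda> e) p"
    define Q where "Q = M (src \<Lambda> g) q"
    have e: "e \<in> Es" "W (src \<Lambda> e) p" "rng \<Lambda> e = x" and g: "g \<in> Es" "W (src \<Lambda> g) q" "rng \<Lambda> g = y"
      using Suc.prems es fs by auto
    have P: "P \<in> Mor \<Lambda>" "rng \<Lambda> P = src \<Lambda> e" and Q: "Q \<in> Mor \<Lambda>" "rng \<Lambda> Q = src \<Lambda> g"
      using walk_mor[OF e(2)] walk_mor[OF g(2)] by (auto simp: P_def Q_def)
    have eq: "cmp \<Lambda> e P = cmp \<Lambda> g Q" using Suc.prems(4) e g by (simp add: es fs M_Cons P_def Q_def)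
    hence deq: "deg \<Lambda> e + deg \<Lambda> P = deg \<Lambda> g + deg \<Lambda> Q"
      using deg_cmp[of e P] deg_cmp[of g Q] e g P Q by (simp add: edge_Mor)
    show ?case
    proof (cases "col e = col g")
      case True
      hence "deg \<Lambda> e = deg \<Lambda> g" using e g by (simp add: deg_edge)
      moreover from this have "deg \<Lambda> P = deg \<Lambda> Q" using deq by (simp add: vec_eq_iff)
      ultimately have "e = g" "P = Q"
        using factorization_unique[OF edge_Mor[OF e(1)] P(1) edge_Mor[OF g(1)] Q(1) P(2)[symmetric] Q(2)[symmetric]] eq
        by blast+
      thus ?thesis
        using Suc.IH[OF len(1) e(2) g(2)] by (simp add: es fs P_def Q_def)
    next
      case False
      let ?i = "col e" and ?j = "col g"
      have de: "deg \<Lambda> e = axis ?i 1" and dg: "deg \<Lambda> g = axis ?j 1" using e g deg_edge by auto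
      have c: "axis ?i 1 $ k + deg \<Lambda> P $ k = axis ?j 1 $ k + deg \<Lambda> Q $ k" for k
        using arg_cong[OF deq, of "\<lambda>z. z $ k"] by (simp add: de dg)
      \<comment> \<open>The common morphism of degree at least \<open>axis ?i 1 + axis ?j 1\<close> factors as \<open>ea\<rho> = gb\<rho>'\<close>, and then
        \<open>\<rho> = \<rho>'\<close> and \<open>ea = gb\<close> by unique factorization.\<close>
      define r where "r = deg \<Lambda> P - axis ?j 1"
      have pk: "deg \<Lambda> P $ k = (axis ?j 1 + r) $ k \<and> deg \<Lambda> Q $ k = (axis ?i 1 + r) $ k" for k
        using c[of k] False by (cases "k = ?i"; cases "k = ?j") (auto simp: r_def axis_def)
      hence dP: "deg \<Lambda> P = axis ?j 1 + r" and dQ: "deg \<Lambda> Q = axis ?i 1 + r"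
        unfolding vec_eq_iff by blast+
      obtain a \<rho> where a: "a \<in> Mor \<Lambda>" "\<rho> \<in> Mor \<Lambda>" "src \<Lambda> a = rng \<Lambda> \<rho>" "deg \<Lambda> a = axis ?j 1" "deg \<Lambda> \<rho> = r" "P = cmp \<Lambda> a \<rho>"
        using factorization_exists[OF P(1) dP] by blast
      obtain b \<rho>' where b: "b \<in> Mor \<Lambda>" "\<rho>' \<in> Mor \<Lambda>" "src \<Lambda> b = rng \<Lambda> \<rho>'" "deg \<Lambda> b = axis ?i 1" "deg \<Lambda> \<rho>' = r" "Q = cmp \<Lambda> b \<rho>'"
        using factorization_exists[OF Q(1) dQ] by blast
      have aE: "a \<in> Es" "b \<in> Es" using a b edgeI by auto
      have ra: "rng \<Lambda> a = src \<Lambda> e" "rng \<Lambda> b = src \<Lambda> g" using a b P Q rng_cmp by metis+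
      have eq3: "cmp \<Lambda> (cmp \<Lambda> e a) \<rho> = cmp \<Lambda> (cmp \<Lambda> g b) \<rho>'"
        using eq a b e g ra by (simp add: cmp_assoc edge_Mor)
      have deg3: "deg \<Lambda> (cmp \<Lambda> e a) = deg \<Lambda> (cmp \<Lambda> g b)"
        using a b e g ra by (simp add: deg_cmp edge_Mor de dg add.commute)
      have A: "cmp \<Lambda> e a \<in> Mor \<Lambda>" "src \<Lambda> (cmp \<Lambda> e a) = rng \<Lambda> \<rho>"
        using a(1,3) e(1) ra by (simp_all add: cmp_closed src_cmp edge_Mor)
      have B: "cmp \<Lambda> g b \<in> Mor \<Lambda>" "src \<Lambda> (cmp \<Lambda> g b) = rng \<Lambda> \<rho>'"
        using b(1,3) g(1) ra by (simp_all add: cmp_closed src_cmp edge_Mor)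
      have "deg \<Lambda> \<rho> = deg \<Lambda> \<rho>'" using a(5) b(5) by simp
      note fu = factorization_unique[OF A(1) a(2) B(1) b(2) A(2) B(2) deg3 this eq3]
      have rho: "\<rho> = \<rho>'" by (rule fu(2))
      have "cmp \<Lambda> e a = cmp \<Lambda> g b" by (rule fu(1))
      hence "edges_commute \<Lambda> e a g b" using e g aE ra by (simp add: edges_commute_iff)
      hence tt: "t e * t a = t g * t b" by (rule t)
      obtain rs where rs: "W (rng \<Lambda> \<rho>) rs" "M (rng \<Lambda> \<rho>) rs = \<rho>" using walk_exists[OF a(2)] by blast
      have "prod_list (map t p) = prod_list (map t (a # rs))"
        by (rule Suc.IH[OF len(1) e(2), of "src \<Lambda> e"]) (use a rs aE ra in \<open>simp_all add: M_Cons flip: P_def\<close>)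
      moreover have "prod_list (map t q) = prod_list (map t (b # rs))"
        by (rule Suc.IH[OF len(2) g(2), of "src \<Lambda> g"]) (use b rs aE ra rho in \<open>simp_all add: M_Cons flip: Q_def\<close>)
      ultimately show ?thesis using tt by (simp add: es fs flip: mult.assoc)
    qed
  qed
  thus ?thesis by blast
qed

end

section \<open>The reduced graph\<close>

lemma ex1_unique: "\<exists>!x. P x \<Longrightarrow> P a \<Longrightarrow> P b \<Longrightarrow> a = b"
  by blast

lemma complete_edge_endpoints:
  "complete_edge \<Lambda> E \<Longrightarrow> e \<in> E \<Longrightarrow> e' \<in> E \<Longrightarrow> src \<Lambda> e = src \<Lambda> e' \<and> rng \<Lambda> e = rng \<Lambda> e'"
  unfolding complete_edge_def by (elim conjE) blast

lemma complete_edge_color: "complete_edge \<Lambda> E \<Longrightarrow> \<exists>!e. e \<in> E \<and> deg \<Lambda> e = axis i 1"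
  unfolding complete_edge_def by (elim conjE) (erule spec)

lemma complete_edge_swap:
  "complete_edge \<Lambda> E \<Longrightarrow> e \<in> E \<Longrightarrow> a \<in> edges_of \<Lambda> \<Longrightarrow> b \<in> edges_of \<Lambda> \<Longrightarrow> e' \<in> edges_of \<Lambda> \<Longrightarrow>
    edges_commute \<Lambda> e a e' b \<Longrightarrow> e' \<in> E"
  unfolding complete_edge_def by (elim conjE) blast

text \<open>A vertex \<open>v\<close> at which the graph can be reduced, and the chosen edge \<open>f\<close> from \<open>v\<close>.\<close>

locale reducible = k_graph \<Lambda> for \<Lambda> :: "('a, 'k::finite) kgraph" +
  fixes v f :: 'a
  assumes row_fin: "row_finite \<Lambda>"
    and v_vert: "v \<in> verts_of \<Lambda>"
    and ce_from: "complete_edge \<Lambda> (edges_from \<Lambda> v)"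
    and ce_into: "complete_edge \<Lambda> (edges_into \<Lambda> v)"
    and v_neq: "v \<noteq> common_rng \<Lambda> (edges_from \<Lambda> v)"
    and f_from: "f \<in> edges_from \<Lambda> v"
begin

text \<open>\<open>w\<close> is the common range of the edges \<open>g i\<close> from \<open>v\<close>, and \<open>u\<close> the common source of the edges \<open>h i\<close> into
  \<open>v\<close>, where \<open>i\<close> is the colour; \<open>f = g i0\<close>.\<close>

definition "w = common_rng \<Lambda> (edges_from \<Lambda> v)"
definition "i0 = col f"
definition h :: "'k \<Rightarrow> 'a" where "h i = (THE e. e \<in> edges_into \<Lambda> v \<and> deg \<Lambda> e = axis i 1)"
definition g :: "'k \<Rightarrow> 'a" where "g i = (THE e. e \<in> edges_from \<Lambda> v \<and> deg \<Lambda> e = axis i 1)"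
definition "u = src \<Lambda> (h i0)"

lemma f_edge: "f \<in> Es" "src \<Lambda> f = v"
  using f_from by (auto simp: edges_from_def)

lemma from_rng: assumes "e \<in> Es" "src \<Lambda> e = v" shows "rng \<Lambda> e = w"
proof -
  have *: "rng \<Lambda> e' = rng \<Lambda> f" if "e' \<in> edges_from \<Lambda> v" for e'
    using complete_edge_endpoints[OF ce_from that f_from] by simp
  have "w = rng \<Lambda> f"
    unfolding w_def common_rng_def
  proof (rule the_equality)
    show "\<forall>e\<in>edges_from \<Lambda> v. rng \<Lambda> e = rng \<Lambda> f" using * by blast
    fix x assume "\<forall>e\<in>edges_from \<Lambda> v. rng \<Lambda> e = x"
    from bspec[OF this f_from] show "x = rng \<Lambda> f" by simp
  qed
  moreover have "e \<in> edges_from \<Lambda> v" using assms by (simp add: edges_from_def)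
  ultimately show ?thesis using *[of e] by simp
qed

lemma w_vert: "w \<in> Vs" and w_neq: "w \<noteq> v"
  using from_rng[OF f_edge] rng_vert[OF edge_Mor[OF f_edge(1)]] v_neq by (auto simp: w_def)

lemma g_props: "g i \<in> Es" "src \<Lambda> (g i) = v" "rng \<Lambda> (g i) = w" "deg \<Lambda> (g i) = axis i 1" "col (g i) = i"
  and g_unique: "e \<in> Es \<Longrightarrow> src \<Lambda> e = v \<Longrightarrow> g (col e) = e"
proof -
  have ex1: "\<exists>!e. e \<in> edges_from \<Lambda> v \<and> deg \<Lambda> e = axis i 1" for i
    by (rule complete_edge_color[OF ce_from])
  have gi: "g i \<in> edges_from \<Lambda> v \<and> deg \<Lambda> (g i) = axis i 1" for i
    unfolding g_def by (rule theI'[OF ex1])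
  show "g i \<in> Es" "src \<Lambda> (g i) = v" "deg \<Lambda> (g i) = axis i 1" using gi[of i] by (auto simp: edges_from_def)
  thus "rng \<Lambda> (g i) = w" "col (g i) = i" by (auto intro: from_rng col_eqI)
  show "e \<in> Es \<Longrightarrow> src \<Lambda> e = v \<Longrightarrow> g (col e) = e"
    using gi[of "col e"] deg_edge[of e] by (intro ex1_unique[OF ex1[of "col e"]]) (simp_all add: edges_from_def)
qed

lemma f_eq: "f = g i0"
  using g_unique[OF f_edge] by (simp add: i0_def)

lemma h_props: "h i \<in> Es" "rng \<Lambda> (h i) = v" "deg \<Lambda> (h i) = axis i 1" "col (h i) = i" "src \<Lambda> (h i) = u"
  and h_unique: "e \<in> Es \<Longrightarrow> rng \<Lambda> e = v \<Longrightarrow> h (col e) = e"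
proof -
  have ex1: "\<exists>!e. e \<in> edges_into \<Lambda> v \<and> deg \<Lambda> e = axis i 1" for i
    by (rule complete_edge_color[OF ce_into])
  have hi: "h i \<in> edges_into \<Lambda> v \<and> deg \<Lambda> (h i) = axis i 1" for i
    unfolding h_def by (rule theI'[OF ex1])
  show "h i \<in> Es" "rng \<Lambda> (h i) = v" "deg \<Lambda> (h i) = axis i 1" using hi[of i] by (auto simp: edges_into_def)
  thus "col (h i) = i" by (auto intro: col_eqI)
  show "src \<Lambda> (h i) = u"
    using complete_edge_endpoints[OF ce_into, of "h i" "h i0"] hi unfolding u_def by blast
  show "e \<in> Es \<Longrightarrow> rng \<Lambda> e = v \<Longrightarrow> h (col e) = e"
    using hi[of "col e"] deg_edge[of e] by (intro ex1_unique[OF ex1[of "col e"]]) (simp_all add: edges_into_def)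
qed

lemma u_vert: "u \<in> Vs" using h_props[of i0] src_vert edge_Mor by metis

lemma u_neq: "u \<noteq> v"
  using from_rng[of "h i0"] h_props[of i0] w_neq by auto

lemma swap_src: assumes "edges_commute \<Lambda> a b c d" shows "src \<Lambda> a = v \<longleftrightarrow> src \<Lambda> c = v"
proof -
  have "src \<Lambda> c = v" if "edges_commute \<Lambda> a b c d" "src \<Lambda> a = v" for a b c d
  proof -
    have e: "a \<in> Es" "b \<in> Es" "c \<in> Es" "d \<in> Es" using that by (auto simp: edges_commute_iff)
    hence "a \<in> edges_from \<Lambda> v" using that by (simp add: edges_from_def)
    hence "c \<in> edges_from \<Lambda> v" using complete_edge_swap[OF ce_from _ e(2,4,3) that(1)] by simp
    thus ?thesis by (simp add: edges_from_def)
  qed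
  moreover have "edges_commute \<Lambda> c d a b" using assms by (auto simp: edges_commute_iff)
  ultimately show ?thesis using assms by blast
qed

text \<open>The morphism of a path of two edges through \<open>v\<close> depends only on the unordered pair of colours.\<close>

lemma gh_swap: "cmp \<Lambda> (g i) (h j) = cmp \<Lambda> (g j) (h i)"
proof -
  obtain c d where cd: "edges_commute \<Lambda> (g i) (h j) c d" "deg \<Lambda> c = axis j 1" "deg \<Lambda> d = axis i 1"
    using swap_exists[of "g i" "h j"] g_props h_props by metis
  have e: "c \<in> Es" "d \<in> Es" "src \<Lambda> c = rng \<Lambda> d" using cd by (auto simp: edges_commute_iff)
  have "src \<Lambda> c = v" using swap_src[OF cd(1)] g_props by simp
  hence "c = g j" "d = h i"
    using g_unique[of c] h_unique[of d] e cd col_eqI by auto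
  thus ?thesis using cd(1) by (simp add: edges_commute_iff)
qed

text \<open>An edge into \<open>v\<close> can be moved past an edge into \<open>u\<close>.\<close>

lemma h_swap:
  assumes "a \<in> Es" "rng \<Lambda> a = u"
  obtains b where "b \<in> Es" "rng \<Lambda> b = u" "col b = i" "src \<Lambda> b = src \<Lambda> a" "cmp \<Lambda> (h i) a = cmp \<Lambda> (h (col a)) b"
proof -
  obtain c d where cd: "edges_commute \<Lambda> (h i) a c d" "deg \<Lambda> c = deg \<Lambda> a" "deg \<Lambda> d = axis i 1"
    using swap_exists[of "h i" a] h_props assms by metis
  have e: "c \<in> Es" "d \<in> Es" "src \<Lambda> c = rng \<Lambda> d" "cmp \<Lambda> (h i) a = cmp \<Lambda> c d" using cd by (auto simp: edges_commute_iff)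
  have "rng \<Lambda> c = v"
    using rng_cmp[of "h i" a] rng_cmp[of c d] e assms h_props by (simp add: edge_Mor)
  moreover have "col c = col a" using cd deg_edge[OF assms(1)] e by (intro col_eqI) auto
  ultimately have c: "c = h (col a)" using h_unique[of c] e by simp
  have "src \<Lambda> d = src \<Lambda> a"
    using src_cmp[of "h i" a] src_cmp[of c d] e assms h_props by (simp add: edge_Mor)
  thus thesis using that[of d] c e cd h_props col_eqI by auto
qed

text \<open>\<open>ER\<close>, \<open>rR e\<close> and \<open>m e\<close> are the edges of the reduced graph, their ranges and the morphisms of
  \<open>\<Lambda>\<close> which they represent, and \<open>ERi x i\<close> consists of the edges into \<open>x\<close> of colour \<open>i\<close>. The relation
  \<open>comR a b c d\<close> is the relation \<open>ab \<sim>\<^sub>R cd\<close> between paths of length 2 in the reduced graph.\<close>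

definition "ER = {e \<in> Es. src \<Lambda> e \<noteq> v}"
definition "rR e = (if rng \<Lambda> e = v then w else rng \<Lambda> e)"
definition "m e = (if rng \<Lambda> e = v then cmp \<Lambda> f e else e)"
definition "ERi x i = {e \<in> ER. deg \<Lambda> e = axis i 1 \<and> rR e = x}"
definition "comR a b c d \<longleftrightarrow> a \<in> ER \<and> b \<in> ER \<and> c \<in> ER \<and> d \<in> ER \<and> src \<Lambda> a = rR b \<and> src \<Lambda> c = rR d \<and>
  cmp \<Lambda> (m a) (m b) = cmp \<Lambda> (m c) (m d)"

lemma ER_edge: "e \<in> ER \<Longrightarrow> e \<in> Es" "e \<in> ER \<Longrightarrow> src \<Lambda> e \<noteq> v"
  by (auto simp: ER_def)

lemma h_ER: "h i \<in> ER" using h_props u_neq by (simp add: ER_def)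

lemma rR_h: "rR (h i) = w" using h_props by (simp add: rR_def)

lemma m_h: "m (h i) = cmp \<Lambda> f (h i)" using h_props by (simp add: m_def)

lemma m_h_g: "m (h i) = cmp \<Lambda> (g i0) (h i)"
  using m_h[of i] by (simp only: f_eq[symmetric])

lemma m_props: assumes "e \<in> ER" shows "m e \<in> Mor \<Lambda>" "rng \<Lambda> (m e) = rR e" "src \<Lambda> (m e) = src \<Lambda> e"
  using assms f_edge from_rng[OF f_edge]
  by (auto simp: m_def rR_def ER_edge edge_Mor cmp_closed rng_cmp src_cmp)

lemma rR_vert: "e \<in> ER \<Longrightarrow> rR e \<in> Vs - {v}"
  using w_vert w_neq rng_vert by (auto simp: rR_def ER_edge edge_Mor)

text \<open>In the reduced graph, too, the edges \<open>h i\<close> and \<open>h j\<close> can be exchanged with the help of edges into \<open>u\<close>: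
  for an edge \<open>a\<close> of colour \<open>j\<close> into \<open>u\<close> there is \<open>b\<close> of colour \<open>i\<close> with \<open>h\<^sub>i a \<sim>\<^sub>R h\<^sub>j b\<close>. If \<open>u = w\<close> then
  \<open>a\<close> may be the edge \<open>h j\<close> itself.\<close>

lemma h_comR_exists:
  assumes "a \<in> ER" "rR a = u"
  obtains b where "b \<in> ER" "rR b = u" "col b = i" "comR (h i) a (h (col a)) b"
    "cmp \<Lambda> (h i) (m a) = cmp \<Lambda> (h (col a)) (m b)"
proof -
  have a: "a \<in> Es" "src \<Lambda> a \<noteq> v" using assms by (auto simp: ER_edge)
  have lift: "comR (h i) a (h (col a)) b"
    if b: "b \<in> ER" "rR b = u" and eq: "cmp \<Lambda> (h i) (m a) = cmp \<Lambda> (h (col a)) (m b)" for b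
  proof -
    have "cmp \<Lambda> (m (h i)) (m a) = cmp \<Lambda> f (cmp \<Lambda> (h i) (m a))"
      unfolding m_h using f_edge h_props m_props[OF assms(1)] assms by (simp add: cmp_assoc edge_Mor)
    also have "\<dots> = cmp \<Lambda> (m (h (col a))) (m b)"
      unfolding m_h eq using f_edge h_props m_props[OF b(1)] b by (simp add: cmp_assoc edge_Mor)
    finally show ?thesis using assms b h_ER h_props by (simp add: comR_def)
  qed
  show thesis
  proof (cases "rng \<Lambda> a = v")
    case False
    hence ra: "rng \<Lambda> a = u" "m a = a" using assms by (auto simp: rR_def m_def)
    obtain b where b: "b \<in> Es" "rng \<Lambda> b = u" "col b = i" "src \<Lambda> b = src \<Lambda> a" "cmp \<Lambda> (h i) a = cmp \<Lambda> (h (col a)) b"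
      by (rule h_swap[OF a(1) ra(1)])
    have "b \<in> ER" "rR b = u" "m b = b" using b a u_neq by (auto simp: ER_def rR_def m_def)
    thus thesis using that[of b] lift[of b] b ra by simp
  next
    case True
    hence uw: "u = w" and aj: "a = h (col a)" using assms h_unique[OF a(1)] by (auto simp: rR_def)
    define j where "j = col a"
    have gu: "rng \<Lambda> (g k) = u" for k using g_props uw by simp
    obtain b where b: "b \<in> Es" "rng \<Lambda> b = u" "col b = i" "src \<Lambda> b = src \<Lambda> (g j)"
      "cmp \<Lambda> (h i) (g j) = cmp \<Lambda> (h (col (g j))) b"
      by (rule h_swap[OF g_props(1) gu])
    have "b = g i" using g_unique[of b] b(1,3,4) g_props(2)[of j] by simp
    hence hg: "cmp \<Lambda> (h i) (g j) = cmp \<Lambda> (h j) (g i)" using b(5) g_props(5)[of j] by simp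
    note [simp] = g_props h_props uw[symmetric] edge_Mor[OF g_props(1)] edge_Mor[OF h_props(1)]
    have "cmp \<Lambda> (h i) (m (h j)) = cmp \<Lambda> (h i) (cmp \<Lambda> (g j) (h i0))"
      unfolding m_h_g by (simp add: gh_swap[of i0 j])
    also have "\<dots> = cmp \<Lambda> (cmp \<Lambda> (h i) (g j)) (h i0)" by (simp add: cmp_assoc)
    also have "\<dots> = cmp \<Lambda> (h j) (cmp \<Lambda> (g i) (h i0))" unfolding hg by (simp add: cmp_assoc)
    also have "\<dots> = cmp \<Lambda> (h j) (m (h i))" unfolding m_h_g by (simp add: gh_swap[of i0 i])
    finally have "cmp \<Lambda> (h i) (m a) = cmp \<Lambda> (h (col a)) (m (h i))" using aj by (simp add: j_def)
    thus thesis using that[of "h i"] lift[of "h i"] h_ER rR_h by simp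
  qed
qed

lemma h_comR_h:
  assumes a: "a \<in> ER" "rR a = u" and b: "b \<in> ER" "rR b = u" and b': "b' \<in> ER" "rR b' = u"
    and eq: "cmp \<Lambda> (h j) (m a) = cmp \<Lambda> (h i0) (m b)" and eq': "cmp \<Lambda> (h i) (m a) = cmp \<Lambda> (h i0) (m b')"
  shows "comR (h i) b (h j) b'"
proof -
  note [simp] = g_props h_props edge_Mor[OF g_props(1)] edge_Mor[OF h_props(1)]
    m_props[OF a(1)] m_props[OF b(1)] m_props[OF b'(1)] a b b' cmp_assoc
  have gh: "cmp \<Lambda> (g k) (cmp \<Lambda> (h l) x) = cmp \<Lambda> (g l) (cmp \<Lambda> (h k) x)"
    if "x \<in> Mor \<Lambda>" "rng \<Lambda> x = u" for k l x
  proof -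
    have "cmp \<Lambda> (cmp \<Lambda> (g k) (h l)) x = cmp \<Lambda> (cmp \<Lambda> (g l) (h k)) x" by (simp only: gh_swap)
    thus ?thesis using that by simp
  qed
  have "cmp \<Lambda> (m (h i)) (m b) = cmp \<Lambda> (g i0) (cmp \<Lambda> (h i) (m b))" unfolding m_h_g by simp
  also have "\<dots> = cmp \<Lambda> (g i) (cmp \<Lambda> (h j) (m a))" unfolding eq by (rule gh) simp_all
  also have "\<dots> = cmp \<Lambda> (g j) (cmp \<Lambda> (h i) (m a))" by (rule gh) simp_all
  also have "\<dots> = cmp \<Lambda> (g i0) (cmp \<Lambda> (h j) (m b'))" unfolding eq' by (rule gh) simp_all
  also have "\<dots> = cmp \<Lambda> (m (h j)) (m b')" unfolding m_h_g by simp
  finally show ?thesis using h_ER by (simp add: comR_def del: cmp_assoc)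
qed

text \<open>Relations of \<open>\<Lambda>\<close> between paths of length 2 whose middle vertex is not \<open>v\<close> hold in the reduced graph. If
  the paths have source \<open>v\<close>, their last edges are to be replaced by edges into \<open>v\<close>.\<close>

lemma comR_edges:
  assumes c: "edges_commute \<Lambda> a b c d" and src: "src \<Lambda> a \<noteq> v"
  shows "src \<Lambda> b \<noteq> v \<Longrightarrow> comR a b c d"
    and "src \<Lambda> b = v \<Longrightarrow> comR a (h (col b)) c (h (col d))"
    and "src \<Lambda> c \<noteq> v" and "src \<Lambda> d = src \<Lambda> b" and "rng \<Lambda> c = rng \<Lambda> a"
proof -
  have e: "a \<in> Es" "b \<in> Es" "c \<in> Es" "d \<in> Es" "src \<Lambda> a = rng \<Lambda> b" "src \<Lambda> c = rng \<Lambda> d" "cmp \<Lambda> a b = cmp \<Lambda> c d"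
    using c by (auto simp: edges_commute_iff)
  note [simp] = edge_Mor[OF e(1)] edge_Mor[OF e(2)] edge_Mor[OF e(3)] edge_Mor[OF e(4)]
    edge_Mor[OF g_props(1)] edge_Mor[OF h_props(1)] g_props h_props
  show sc: "src \<Lambda> c \<noteq> v" using swap_src[OF c] src by simp
  show sd: "src \<Lambda> d = src \<Lambda> b" using e src_cmp[of a b] src_cmp[of c d] by simp
  show rc: "rng \<Lambda> c = rng \<Lambda> a" using e rng_cmp[of a b] rng_cmp[of c d] by simp
  have ER: "a \<in> ER" "c \<in> ER" using e src sc by (auto simp: ER_def)
  have mm: "cmp \<Lambda> (m a) b = cmp \<Lambda> (m c) d"
  proof (cases "rng \<Lambda> a = v")
    case True
    thus ?thesis using e f_edge rc by (simp add: m_def cmp_assoc edge_Mor)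
  next
    case False
    thus ?thesis using e rc by (simp add: m_def)
  qed
  show "comR a b c d" if "src \<Lambda> b \<noteq> v"
  proof -
    have "m b = b" "m d = d" "rR b = rng \<Lambda> b" "rR d = rng \<Lambda> d" using e src sc by (auto simp: m_def rR_def)
    thus ?thesis using ER e that sd mm by (simp add: comR_def ER_def)
  qed
  show "comR a (h (col b)) c (h (col d))" if "src \<Lambda> b = v"
  proof -
    have bg: "g (col b) = b" "g (col d) = d" using g_unique e that sd by auto
    have sa: "src \<Lambda> a = w" "src \<Lambda> c = w" using from_rng[OF e(2) that] from_rng[OF e(4)] sd that e by auto
    have fm: "cmp \<Lambda> (m x) (m (h (col y))) = cmp \<Lambda> (cmp \<Lambda> (m x) y) (h i0)"
      if "g (col y) = y" "x \<in> ER" "src \<Lambda> x = w" for x y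
    proof -
      have "m (h (col y)) = cmp \<Lambda> (g (col y)) (h i0)" unfolding m_h_g by (rule gh_swap)
      thus ?thesis using that m_props[OF that(2)] g_props[of "col y"] by (simp add: cmp_assoc edge_Mor)
    qed
    show ?thesis
      using fm[OF bg(1) ER(1) sa(1)] fm[OF bg(2) ER(2) sa(2)] mm ER sa h_ER rR_h by (simp add: comR_def)
  qed
qed

lemma finite_into: "x \<in> Vs \<Longrightarrow> finite (edges_into_col \<Lambda> x i)"
  using row_fin by (simp add: row_finite_def)

text \<open>For a vertex other than \<open>v\<close>, its edges in \<open>\<Lambda>\<close> and in the reduced graph correspond to each other; an
  edge into it with source \<open>v\<close> corresponds to the edge with range \<open>v\<close> of the same colour.\<close>

definition "\<sigma> e = (if src \<Lambda> e = v then h (col e) else e)"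

lemma bij_sigma: assumes x: "x \<in> Vs" "x \<noteq> v" shows "bij_betw \<sigma> (edges_into_col \<Lambda> x i) (ERi x i)"
proof -
  have E: "e \<in> Es" "deg \<Lambda> e = axis i 1" "rng \<Lambda> e = x" "col e = i" if "e \<in> edges_into_col \<Lambda> x i" for e
    using that edges_into_col_edges[OF that] by (auto simp: edges_into_col_def intro: col_eqI)
  show ?thesis
    unfolding bij_betw_def
  proof
    show "inj_on \<sigma> (edges_into_col \<Lambda> x i)"
    proof (rule inj_onI)
      fix a b assume a: "a \<in> edges_into_col \<Lambda> x i" and b: "b \<in> edges_into_col \<Lambda> x i" and eq: "\<sigma> a = \<sigma> b"
      show "a = b"
        using eq E[OF a] E[OF b] g_unique[of a] g_unique[of b] h_props(2)[of i] x
        by (auto simp: \<sigma>_def split: if_splits)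
    qed
    show "\<sigma> ` edges_into_col \<Lambda> x i = ERi x i"
    proof
      show "\<sigma> ` edges_into_col \<Lambda> x i \<subseteq> ERi x i"
      proof
        fix e assume "e \<in> \<sigma> ` edges_into_col \<Lambda> x i"
        then obtain a where a: "a \<in> edges_into_col \<Lambda> x i" "e = \<sigma> a" by blast
        show "e \<in> ERi x i"
          using E[OF a(1)] a(2) from_rng[of a] h_ER h_props rR_h x
          by (auto simp: \<sigma>_def ERi_def ER_def rR_def)
      qed
      show "ERi x i \<subseteq> \<sigma> ` edges_into_col \<Lambda> x i"
      proof
        fix e assume "e \<in> ERi x i"
        hence e: "e \<in> Es" "src \<Lambda> e \<noteq> v" "deg \<Lambda> e = axis i 1" "rR e = x" "col e = i"
          by (auto simp: ERi_def ER_def intro: col_eqI)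
        show "e \<in> \<sigma> ` edges_into_col \<Lambda> x i"
        proof (cases "rng \<Lambda> e = v")
          case True
          have "e = \<sigma> (g i)" using h_unique[OF e(1) True] e g_props by (simp add: \<sigma>_def)
          moreover have "g i \<in> edges_into_col \<Lambda> x i"
            using True e g_props edge_Mor by (simp add: edges_into_col_def rR_def)
          ultimately show ?thesis by blast
        next
          case False
          hence "e \<in> edges_into_col \<Lambda> x i" "\<sigma> e = e" using e edge_Mor by (auto simp: edges_into_col_def rR_def \<sigma>_def)
          thus ?thesis by (metis image_eqI)
        qed
      qed
    qed
  qed
qed

subsection \<open>Vertices and edges of the reduction\<close>

text \<open>\<open>WR\<close> describes the paths of the reduced graph. \<open>px\<close> is the map \<open>par\<close> on lists of edges, and \<open>\<mu> p\<close> is the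
  morphism of \<open>\<Lambda>\<close> which the path \<open>p\<close> of the reduced graph represents.\<close>

abbreviation "\<Lambda>R \<equiv> reduction \<Lambda> v f"
abbreviation "WR \<equiv> is_walk (reduced_skeleton \<Lambda> v)"
abbreviation "RE \<equiv> reduced_equiv \<Lambda> v f"
definition "px es = concat (map (\<lambda>e. if rng \<Lambda> e = v then [f, e] else [e]) es)"
definition "\<mu> p = M (fst p) (px (snd p))"

lemma RS_simps:
  "verts (reduced_skeleton \<Lambda> v) = Vs - {v}" "edges (reduced_skeleton \<Lambda> v) = ER"
  "grng (reduced_skeleton \<Lambda> v) = rR" "gsrc (reduced_skeleton \<Lambda> v) = src \<Lambda>"
  by (auto simp: reduced_skeleton_def ER_def edges_from_def rR_def w_def)

lemma WR_simps [simp]: "WR x [] \<longleftrightarrow> x \<in> Vs - {v}"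
  "WR x (e # es) \<longleftrightarrow> e \<in> ER \<and> rR e = x \<and> WR (src \<Lambda> e) es"
  using rR_vert[of e] by (auto simp: is_walk.simps RS_simps)

lemma px_simps [simp]: "px [] = []" "px (e # es) = (if rng \<Lambda> e = v then [f, e] else [e]) @ px es"
  by (auto simp: px_def)

lemma WR_walk: "WR x es \<Longrightarrow> W x (px es)"
proof (induction es arbitrary: x)
  case (Cons e es)
  thus ?case using f_edge from_rng[OF f_edge] by (auto simp: rR_def ER_edge)
qed auto

lemma mu_Cons: assumes "WR x (e # es)" shows "\<mu> (x, e # es) = cmp \<Lambda> (m e) (\<mu> (src \<Lambda> e, es))"
proof -
  have e: "e \<in> ER" "rR e = x" "WR (src \<Lambda> e) es" using assms by auto
  have "W (src \<Lambda> e) (px es)" by (rule WR_walk[OF e(3)])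
  from walk_mor[OF this] show ?thesis
    using e f_edge by (simp add: \<mu>_def m_def M_Cons ER_edge cmp_assoc edge_Mor)
qed

lemma WR_edges: "WR x es \<Longrightarrow> e \<in> set es \<Longrightarrow> e \<in> ER"
  by (induction es arbitrary: x) auto

lemma paths_R: "p \<in> paths (reduced_skeleton \<Lambda> v) \<longleftrightarrow> WR (fst p) (snd p)"
  by (cases p) (simp add: paths_def)

lemma RE_iff: "(p, q) \<in> RE \<longleftrightarrow> WR (fst p) (snd p) \<and> WR (fst q) (snd q) \<and> \<mu> p = \<mu> q"
  using WR_walk by (auto simp: reduced_equiv_def paths_R path_equiv_def par_def paths_def \<mu>_def px_def)

lemma equiv_RE: "equiv (paths (reduced_skeleton \<Lambda> v)) RE"
  by (rule equivI) (auto simp: refl_on_def sym_def trans_def RE_iff paths_R)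

text \<open>The number of edges with source \<open>v\<close> depends only on the morphism of a path in \<open>\<Lambda>\<close>, and together
  with the degree it determines the degree in the reduced graph. It appears as an exponent of 2
  because \<open>walk_prod_eq\<close> is about products.\<close>

lemma px_prod: "WR x es \<Longrightarrow> prod_list (map (\<lambda>e. if src \<Lambda> e = v then 2 else 1::nat) (px es)) =
    2 ^ length (filter (\<lambda>e. rng \<Lambda> e = v) es)"
  by (induction es arbitrary: x) (use f_edge in \<open>auto simp: ER_edge\<close>)

lemma px_deg: "sum_list (map (deg \<Lambda>) (px es)) =
    sum_list (map (deg \<Lambda>) es) + sum_list (replicate (length (filter (\<lambda>e. rng \<Lambda> e = v) es)) (deg \<Lambda> f))"
  by (induction es) (auto simp: add_ac)

lemma RE_deg:
  assumes "(p, q) \<in> RE" shows "sum_list (map (deg \<Lambda>) (snd p)) = sum_list (map (deg \<Lambda>) (snd q))"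
proof -
  have W: "WR (fst p) (snd p)" "WR (fst q) (snd q)" and eq: "\<mu> p = \<mu> q" using assms by (auto simp: RE_iff)
  have "prod_list (map (\<lambda>e. if src \<Lambda> e = v then 2 else 1::nat) (px (snd p))) =
      prod_list (map (\<lambda>e. if src \<Lambda> e = v then 2 else 1) (px (snd q)))"
  proof (rule walk_prod_eq[OF _ WR_walk[OF W(1)] WR_walk[OF W(2)]])
    show "M (fst p) (px (snd p)) = M (fst q) (px (snd q))" using eq by (simp add: \<mu>_def)
    fix a b c d assume c: "edges_commute \<Lambda> a b c d"
    hence "src \<Lambda> d = src \<Lambda> b"
      using src_cmp[of a b] src_cmp[of c d] by (auto simp: edges_commute_iff edge_Mor)
    thus "(if src \<Lambda> a = v then 2 else 1) * (if src \<Lambda> b = v then 2 else 1) =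
        (if src \<Lambda> c = v then 2 else 1) * (if src \<Lambda> d = v then 2 else 1::nat)"
      using swap_src[OF c] by simp
  qed
  hence "length (filter (\<lambda>e. rng \<Lambda> e = v) (snd p)) = length (filter (\<lambda>e. rng \<Lambda> e = v) (snd q))"
    unfolding px_prod[OF W(1)] px_prod[OF W(2)] by simp
  moreover have "sum_list (map (deg \<Lambda>) (px (snd p))) = sum_list (map (deg \<Lambda>) (px (snd q)))"
    using walk_mor[OF WR_walk[OF W(1)]] walk_mor[OF WR_walk[OF W(2)]] eq by (simp add: \<mu>_def)
  ultimately show ?thesis unfolding px_deg by (simp add: vec_eq_iff)
qed

lemma R_simps:
  "Mor \<Lambda>R = paths (reduced_skeleton \<Lambda> v) // RE"
  "rng \<Lambda>R X = RE `` {(fst p, []) | p. p \<in> X}"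
  "src \<Lambda>R X = RE `` {(if snd p = [] then fst p else src \<Lambda> (last (snd p)), []) | p. p \<in> X}"
  "cmp \<Lambda>R X Y = RE `` {(fst p, snd p @ snd q) | p q. p \<in> X \<and> q \<in> Y}"
  "deg \<Lambda>R X = (THE n. \<forall>p\<in>X. sum_list (map (deg \<Lambda>) (snd p)) = n)"
  by (simp_all add: reduction_def Let_def path_rng_def path_src_def path_cat_def path_deg_def reduced_skeleton_def)

lemma deg_R: assumes "WR (fst p) (snd p)" shows "deg \<Lambda>R (RE `` {p}) = sum_list (map (deg \<Lambda>) (snd p))"
proof -
  have "(p, p) \<in> RE" using assms by (simp add: RE_iff)
  thus ?thesis unfolding R_simps by (intro the_equality) (auto dest: RE_deg)
qed

lemma WR_total: "WR x es \<Longrightarrow> (\<Sum>i\<in>UNIV. sum_list (map (deg \<Lambda>) es) $ i) = length es"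
  by (rule deg_total_edges) (auto dest: WR_edges ER_edge)

text \<open>The vertices and edges of the reduction, as equivalence classes of paths. All these classes are
  singletons (\<open>class_vx\<close>, \<open>class_ed\<close>).\<close>

definition "vx x = {(x, [] :: 'a list)}"
definition "ed e = {(rR e, [e])}"

lemma class_vx: assumes "x \<in> Vs - {v}" shows "RE `` {(x, [])} = vx x"
proof -
  have "q = (x, [])" if q: "((x, []), q) \<in> RE" for q
  proof -
    have W: "WR (fst q) (snd q)" and eq: "\<mu> q = x" using q by (auto simp: RE_iff \<mu>_def)
    have "snd q = []" using RE_deg[OF q] WR_total[OF W] by simp
    thus ?thesis using eq by (cases q) (simp add: \<mu>_def)
  qed
  moreover have "((x, []), (x, [])) \<in> RE" using assms by (simp add: RE_iff)
  ultimately show ?thesis by (auto simp: vx_def)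
qed

lemma class_ed: assumes "e \<in> ER" shows "RE `` {(rR e, [e])} = ed e"
proof -
  have se: "src \<Lambda> e \<in> Vs - {v}" using assms src_vert by (auto simp: ER_edge edge_Mor)
  have We: "WR (rR e) [e]" using assms se by simp
  have mu: "\<mu> (rR e', [e']) = m e'" if "e' \<in> ER" for e'
  proof -
    have "WR (rR e') [e']" using that src_vert by (auto simp: ER_edge edge_Mor)
    from mu_Cons[OF this] show ?thesis using m_props[OF that] by (simp add: \<mu>_def) (metis cmp_src)
  qed
  have "q = (rR e, [e])" if q: "((rR e, [e]), q) \<in> RE" for q
  proof -
    have W: "WR (fst q) (snd q)" and eq: "\<mu> (rR e, [e]) = \<mu> q" using q by (auto simp: RE_iff)
    have d: "deg \<Lambda> e = sum_list (map (deg \<Lambda>) (snd q))" using RE_deg[OF q] by simp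
    have "length (snd q) = 1" using d WR_total[OF W] WR_total[OF We] by simp
    then obtain e' where e': "snd q = [e']" by (auto simp: length_Suc_conv)
    hence E': "e' \<in> ER" "fst q = rR e'" using W by auto
    hence q': "q = (rR e', [e'])" using e' by (cases q) simp
    have dd: "deg \<Lambda> e = deg \<Lambda> e'" using d e' by simp
    have mm: "m e = m e'" using eq unfolding q' mu[OF assms] mu[OF E'(1)] .
    have total: "(\<Sum>i\<in>UNIV. deg \<Lambda> x $ i) = 1" if "x \<in> Es" for x using that by (simp add: edges_of_def)
    have mdeg: "deg \<Lambda> (m x) = (if rng \<Lambda> x = v then deg \<Lambda> f + deg \<Lambda> x else deg \<Lambda> x)" if "x \<in> ER" for x
      using that f_edge by (simp add: m_def deg_cmp ER_edge edge_Mor)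
    have "rng \<Lambda> e = v \<longleftrightarrow> rng \<Lambda> e' = v"
    proof (rule ccontr)
      assume "\<not> ?thesis"
      hence "deg \<Lambda> f + deg \<Lambda> e = deg \<Lambda> e" using mdeg[OF assms] mdeg[OF E'(1)] mm dd by (auto split: if_splits)
      hence "deg \<Lambda> f = 0" by (simp add: vec_eq_iff)
      thus False using total[OF f_edge(1)] by simp
    qed
    hence "e = e'"
      using mm left_cancel[of f e e'] f_edge assms E' by (auto simp: m_def ER_edge edge_Mor split: if_splits)
    thus ?thesis using q' by simp
  qed
  moreover have "((rR e, [e]), (rR e, [e])) \<in> RE" using We by (simp add: RE_iff)
  ultimately show ?thesis by (auto simp: ed_def)
qed

lemma Mor_R_E:
  assumes "X \<in> Mor \<Lambda>R" obtains p where "WR (fst p) (snd p)" "X = RE `` {p}"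
  using assms unfolding R_simps by (auto elim!: quotientE simp: paths_R)

lemma Mor_R_I: "WR (fst p) (snd p) \<Longrightarrow> RE `` {p} \<in> Mor \<Lambda>R"
  unfolding R_simps by (rule quotientI) (simp add: paths_R)

lemma ER_walk: "e \<in> ER \<Longrightarrow> WR (rR e) [e]"
  using src_vert by (auto simp: ER_edge edge_Mor)

lemma vx_Mor: "x \<in> Vs - {v} \<Longrightarrow> vx x \<in> Mor \<Lambda>R \<and> deg \<Lambda>R (vx x) = 0"
  using Mor_R_I[of "(x, [])"] deg_R[of "(x, [])"] by (simp add: class_vx)

lemma ed_Mor: "e \<in> ER \<Longrightarrow> ed e \<in> Mor \<Lambda>R \<and> deg \<Lambda>R (ed e) = deg \<Lambda> e"
  using Mor_R_I[of "(rR e, [e])"] deg_R[of "(rR e, [e])"] ER_walk[of e] by (simp add: class_ed)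

lemma verts_R: "verts_of \<Lambda>R = vx ` (Vs - {v})"
proof
  show "vx ` (Vs - {v}) \<subseteq> verts_of \<Lambda>R" using vx_Mor by (auto simp: verts_of_def)
  show "verts_of \<Lambda>R \<subseteq> vx ` (Vs - {v})"
  proof
    fix X assume "X \<in> verts_of \<Lambda>R"
    then obtain p where p: "WR (fst p) (snd p)" "X = RE `` {p}" "deg \<Lambda>R X = 0"
      by (auto simp: verts_of_def elim: Mor_R_E)
    hence "snd p = []" using deg_R[OF p(1)] WR_total[OF p(1)] by simp
    hence "p = (fst p, [])" by (cases p) simp
    thus "X \<in> vx ` (Vs - {v})" using p class_vx[of "fst p"] by (metis WR_simps(1) image_eqI snd_conv)
  qed
qed

lemma edges_R: "edges_of \<Lambda>R = ed ` ER"
proof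
  show "ed ` ER \<subseteq> edges_of \<Lambda>R"
  proof
    fix X assume "X \<in> ed ` ER"
    then obtain e where e: "e \<in> ER" "X = ed e" by blast
    have "(\<Sum>i\<in>UNIV. deg \<Lambda> e $ i) = 1" using ER_edge(1)[OF e(1)] by (simp add: edges_of_def)
    thus "X \<in> edges_of \<Lambda>R" using ed_Mor[OF e(1)] e by (simp add: edges_of_def)
  qed
  show "edges_of \<Lambda>R \<subseteq> ed ` ER"
  proof
    fix X assume "X \<in> edges_of \<Lambda>R"
    then obtain p where p: "WR (fst p) (snd p)" "X = RE `` {p}" "(\<Sum>i\<in>UNIV. deg \<Lambda>R X $ i) = 1"
      by (auto simp: edges_of_def elim: Mor_R_E)
    hence "length (snd p) = 1" using deg_R[OF p(1)] WR_total[OF p(1)] by simp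
    then obtain e where e: "snd p = [e]" by (auto simp: length_Suc_conv)
    hence "e \<in> ER" "p = (rR e, [e])" using p(1) by (cases p, auto)+
    thus "X \<in> ed ` ER" using p class_ed by auto
  qed
qed

lemma rng_ed: "e \<in> ER \<Longrightarrow> rng \<Lambda>R (ed e) = vx (rR e)"
  using class_vx[OF rR_vert, of e] by (simp add: R_simps ed_def)

lemma src_ed: "e \<in> ER \<Longrightarrow> src \<Lambda>R (ed e) = vx (src \<Lambda> e)"
  using class_vx[of "src \<Lambda> e"] src_vert by (simp add: R_simps ed_def ER_edge edge_Mor)

lemma vx_inj [simp]: "vx x = vx y \<longleftrightarrow> x = y" by (simp add: vx_def)

lemma ed_inj [simp]: "ed e = ed e' \<longleftrightarrow> e = e'" by (auto simp: ed_def)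

lemma src_ok_R: "src_ok \<Lambda>R"
  using src_vert by (auto simp: src_ok_def edges_R verts_R src_ed ER_edge edge_Mor)

lemma src_ok: "src_ok \<Lambda>"
  using src_vert by (auto simp: src_ok_def edge_Mor)

lemma edges_into_col_R:
  assumes "x \<in> Vs - {v}" shows "edges_into_col \<Lambda>R (vx x) i = ed ` ERi x i"
proof
  show "edges_into_col \<Lambda>R (vx x) i \<subseteq> ed ` ERi x i"
  proof
    fix X assume X: "X \<in> edges_into_col \<Lambda>R (vx x) i"
    then obtain e where e: "e \<in> ER" "X = ed e" using edges_into_col_edges[OF X] by (auto simp: edges_R)
    thus "X \<in> ed ` ERi x i" using X ed_Mor[OF e(1)] rng_ed[OF e(1)] by (simp add: edges_into_col_def ERi_def)
  qed
  show "ed ` ERi x i \<subseteq> edges_into_col \<Lambda>R (vx x) i"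
    using ed_Mor rng_ed by (auto simp: edges_into_col_def ERi_def)
qed

lemma mu_pair:
  assumes "x \<in> ER" "y \<in> ER" "src \<Lambda> x = rR y"
  shows "WR (rR x) [x, y]" "\<mu> (rR x, [x, y]) = cmp \<Lambda> (m x) (m y)"
proof -
  show W: "WR (rR x) [x, y]" using assms ER_walk[of y] by simp
  have "\<mu> (rR y, [y]) = m y"
    using mu_Cons[OF ER_walk[OF assms(2)]] m_props[OF assms(2)] by (simp add: \<mu>_def) (metis cmp_src)
  thus "\<mu> (rR x, [x, y]) = cmp \<Lambda> (m x) (m y)" using mu_Cons[OF W] assms by simp
qed

lemma edges_commute_R:
  assumes "a \<in> ER" "b \<in> ER" "c \<in> ER" "d \<in> ER"
  shows "edges_commute \<Lambda>R (ed a) (ed b) (ed c) (ed d) \<longleftrightarrow> comR a b c d"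
proof -
  have cmpR: "cmp \<Lambda>R (ed x) (ed y) = RE `` {(rR x, [x, y])}" for x y
    by (simp add: R_simps ed_def)
  have inP: "(rng \<Lambda>R (ed x), [ed x, ed y]) \<in> paths (skeleton \<Lambda>R) \<longleftrightarrow> src \<Lambda> x = rR y"
    if "x \<in> ER" "y \<in> ER" for x y
    using that rR_vert src_vert
    by (auto simp: is_walk.simps paths_def skeleton_def rng_ed src_ed verts_R edges_R ER_edge edge_Mor)
  have "RE `` {(rR a, [a, b])} = RE `` {(rR c, [c, d])} \<longleftrightarrow> cmp \<Lambda> (m a) (m b) = cmp \<Lambda> (m c) (m d)"
    if "src \<Lambda> a = rR b" "src \<Lambda> c = rR d"
    using mu_pair[OF assms(1,2) that(1)] mu_pair[OF assms(3,4) that(2)]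
      eq_equiv_class_iff[OF equiv_RE, of "(rR a, [a, b])" "(rR c, [c, d])"]
    by (simp add: paths_R RE_iff del: WR_simps)
  thus ?thesis
    using assms by (auto simp: edges_commute_def path_equiv_def inP path_mor_def cmpR comR_def)
qed

end

section \<open>Families for a graph and for its reduction\<close>

lemma pos_sum_eq_zero:
  fixes x :: "'i \<Rightarrow> 'c::cstar_alg_1"
  assumes "finite I" "\<And>i. i \<in> I \<Longrightarrow> pos (x i)" "sum x I = 0" "i \<in> I"
  shows "x i = 0"
proof (rule pos_antisym)
  show "pos (x i)" using assms by blast
  have "sum x I = x i + sum x (I - {i})" using assms by (intro sum.remove) auto
  hence "- x i = sum x (I - {i})" using assms by (simp add: eq_neg_iff_add_eq_0 neg_eq_iff_add_eq_0)
  moreover have "pos (sum x (I - {i}))" by (rule pos_sum) (use assms(2) in blast)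
  ultimately show "pos (- x i)" by simp
qed

text \<open>Families in a type of unital C*-algebras, for a graph of which only those properties are assumed that
  the reduction is known to share: it is not necessary to prove that it is a \<open>k\<close>-graph.\<close>

locale cls_family =
  fixes \<Lambda> :: "('a, 'k::finite) kgraph" and P T :: "'a \<Rightarrow> 'c::cstar_alg_1"
  assumes ck: "ck_family \<Lambda> cls P T" and ok: "src_ok \<Lambda>"
    and edge_into: "e \<in> edges_of \<Lambda> \<Longrightarrow> rng \<Lambda> e \<in> verts_of \<Lambda> \<and> (\<exists>i. e \<in> edges_into_col \<Lambda> (rng \<Lambda> e) i)"
    and fin: "x \<in> verts_of \<Lambda> \<Longrightarrow> finite (edges_into_col \<Lambda> x i)"
begin

interpretation ck_family \<Lambda> cls P T by (rule ck)

lemma P_proj: "x \<in> verts_of \<Lambda> \<Longrightarrow> adj (P x) = P x" "x \<in> verts_of \<Lambda> \<Longrightarrow> P x * P x = P x"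
  using P_projection[of x] by simp_all

lemma P_orth: "x \<in> verts_of \<Lambda> \<Longrightarrow> y \<in> verts_of \<Lambda> \<Longrightarrow> x \<noteq> y \<Longrightarrow> P x * P y = 0"
  using CK1[of x y] by simp

lemma TT: "e \<in> edges_of \<Lambda> \<Longrightarrow> adj (T e) * T e = P (src \<Lambda> e)"
  using CK3[of e] by simp

lemma TP: "e \<in> edges_of \<Lambda> \<Longrightarrow> T e * P (src \<Lambda> e) = T e"
  using T_partial_isometry[of e] CK3[of e] by simp

lemma P_sum: "x \<in> verts_of \<Lambda> \<Longrightarrow> P x = (\<Sum>e\<in>edges_into_col \<Lambda> x i. T e * adj (T e))"
  using CK4[of x i] by simp

lemma T_commute: "edges_commute \<Lambda> a b c d \<Longrightarrow> a \<in> edges_of \<Lambda> \<Longrightarrow> b \<in> edges_of \<Lambda> \<Longrightarrow> c \<in> edges_of \<Lambda> \<Longrightarrow>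
    d \<in> edges_of \<Lambda> \<Longrightarrow> T a * T b = T c * T d"
  using CK2[of a d b c] by simp

text \<open>The projection \<open>P\<^sub>x\<close> is a sum of projections, hence dominates each of them.\<close>

lemma PT: assumes "e \<in> edges_of \<Lambda>" shows "P (rng \<Lambda> e) * T e = T e"
proof -
  define x where "x = rng \<Lambda> e"
  have x: "x \<in> verts_of \<Lambda>" using edge_into[OF assms] by (simp add: x_def)
  obtain i where i: "e \<in> edges_into_col \<Lambda> x i" using edge_into[OF assms] by (auto simp: x_def)
  define r where "r = 1 - P x"
  have r: "adj r = r" "r * P x = 0" using P_proj[OF x] by (simp_all add: r_def adj_diff algebra_simps)
  define y where "y d = adj (T d) * r" for d
  have "(\<Sum>d\<in>edges_into_col \<Lambda> x i. adj (y d) * y d) = r * (\<Sum>d\<in>edges_into_col \<Lambda> x i. T d * adj (T d)) * r"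
    by (simp add: y_def adj_mult r sum_distrib_left sum_distrib_right mult.assoc)
  also have "\<dots> = r * P x * r" using P_sum[OF x, of i] by simp
  finally have "(\<Sum>d\<in>edges_into_col \<Lambda> x i. adj (y d) * y d) = 0" using r by simp
  hence "adj (y e) * y e = 0"
    by (intro pos_sum_eq_zero[OF fin[OF x] _ _ i, of "\<lambda>d. adj (y d) * y d"]) (simp_all add: pos_adj_mult)
  hence "y e = 0" using norm_adj_mult[of "y e"] by simp
  hence "adj (y e) = 0" by simp
  hence "r * T e = 0" by (simp add: y_def adj_mult r)
  thus ?thesis by (simp add: r_def x_def left_diff_distrib)
qed

end

lemma ck_family_hom:
  assumes ok: "src_ok \<Lambda>" and A: "star_algebra A" and B: "star_algebra B" and h: "star_hom A B h"
    and ck: "ck_family \<Lambda> A P T"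
  shows "ck_family \<Lambda> B (\<lambda>v. h (P v)) (\<lambda>f. h (T f))"
proof -
  interpret ck_family \<Lambda> A P T by fact
  interpret h: star_hom A B h by fact
  have cA: "ck_closed \<Lambda> A P T"
    using ok P_closed T_closed A by (simp add: ck_closed_def src_ok_def)
  have cB: "ck_closed \<Lambda> B (\<lambda>v. h (P v)) (\<lambda>f. h (T f))"
    using ok P_closed T_closed h.hom_closed B by (simp add: ck_closed_def src_ok_def)
  show ?thesis
    using ck star_hom_zero[OF h A B]
    unfolding ck_closed.ck_family_iff[OF cA] ck_closed.ck_family_iff[OF cB] ck_closed.ck_rels_hom[OF cA h B]
    by auto
qed

context reducible
begin

lemma into_v: "edges_into_col \<Lambda> v i = {h i}"
proof -
  have "e = h i" if "e \<in> edges_into_col \<Lambda> v i" for e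
    using h_unique[of e] edges_into_col_edges[OF that] that col_eqI[of e i] by (simp add: edges_into_col_def)
  moreover have "h i \<in> edges_into_col \<Lambda> v i" using h_props edge_Mor by (simp add: edges_into_col_def)
  ultimately show ?thesis by blast
qed

lemma cls_family_Lambda: assumes "ck_family \<Lambda> cls P T" shows "cls_family \<Lambda> P T"
proof (rule cls_family.intro[OF assms src_ok])
  fix e assume e: "e \<in> Es"
  hence "e \<in> edges_into_col \<Lambda> (rng \<Lambda> e) (col e)" using deg_edge[OF e] edge_Mor[OF e] by (simp add: edges_into_col_def)
  thus "rng \<Lambda> e \<in> Vs \<and> (\<exists>i. e \<in> edges_into_col \<Lambda> (rng \<Lambda> e) i)"
    using rng_vert[OF edge_Mor[OF e]] by blast
qed (rule finite_into)

lemma ERi_col: assumes "e \<in> ER" shows "e \<in> ERi (rR e) (col e)"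
  using assms deg_edge[OF ER_edge(1)[OF assms]] by (simp add: ERi_def)

lemma cls_family_R: assumes "ck_family \<Lambda>R cls P T" shows "cls_family \<Lambda>R P T"
proof (rule cls_family.intro[OF assms src_ok_R])
  fix X assume "X \<in> edges_of \<Lambda>R"
  then obtain e where e: "e \<in> ER" "X = ed e" by (auto simp: edges_R)
  have "X \<in> edges_into_col \<Lambda>R (rng \<Lambda>R X) (col e)"
    using ERi_col[OF e(1)] e rng_ed[OF e(1)] edges_into_col_R[OF rR_vert[OF e(1)]] by auto
  thus "rng \<Lambda>R X \<in> verts_of \<Lambda>R \<and> (\<exists>i. X \<in> edges_into_col \<Lambda>R (rng \<Lambda>R X) i)"
    using rng_ed[OF e(1)] rR_vert[OF e(1)] e by (auto simp: verts_R)
next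
  fix X i assume "X \<in> verts_of \<Lambda>R"
  then obtain x where x: "x \<in> Vs" "x \<noteq> v" "X = vx x" by (auto simp: verts_R)
  have "finite (ERi x i)" using bij_betw_finite[OF bij_sigma[OF x(1,2)]] finite_into[OF x(1)] by blast
  thus "finite (edges_into_col \<Lambda>R X i)" using edges_into_col_R[of x i] x by simp
qed

text \<open>A family for \<open>\<Lambda>\<close> yields one for the reduction, an edge \<open>e\<close> with range \<open>v\<close> being represented
  by \<open>T\<^sub>f T\<^sub>e\<close>.\<close>

theorem reduced_family:
  fixes P T :: "'a \<Rightarrow> 'c::cstar_alg_1"
  assumes ck: "ck_family \<Lambda> cls P T"
    and P': "\<And>x. x \<in> Vs - {v} \<Longrightarrow> P' (vx x) = P x"
    and T': "\<And>e. e \<in> ER \<Longrightarrow> T' (ed e) = (if rng \<Lambda> e = v then T f * T e else T e)"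
  shows "ck_family \<Lambda>R cls P' T'"
proof -
  interpret c: cls_family \<Lambda> P T by (rule cls_family_Lambda[OF ck])
  define \<tau> where "\<tau> e = (if rng \<Lambda> e = v then T f * T e else T e)" for e
  have T'\<tau>: "T' (ed e) = \<tau> e" if "e \<in> ER" for e using T'[OF that] by (simp add: \<tau>_def)
  have TfP: "T f * P v = T f" "adj (T f) * T f = P v" using c.TP[OF f_edge(1)] c.TT[OF f_edge(1)] f_edge(2) by simp_all
  have tt: "adj (\<tau> e) * \<tau> e = P (src \<Lambda> e)" if "e \<in> ER" for e
  proof (cases "rng \<Lambda> e = v")
    case True
    have "adj (\<tau> e) * \<tau> e = adj (T e) * ((adj (T f) * T f) * T e)"
      using True by (simp add: \<tau>_def adj_mult mult.assoc)
    also have "\<dots> = adj (T e) * (P (rng \<Lambda> e) * T e)" unfolding TfP True ..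
    also have "\<dots> = P (src \<Lambda> e)" using c.PT c.TT ER_edge[OF that] by simp
    finally show ?thesis .
  qed (use that in \<open>simp add: \<tau>_def c.TT ER_edge\<close>)
  have tp: "\<tau> e * P (src \<Lambda> e) = \<tau> e" if "e \<in> ER" for e
    using c.TP[OF ER_edge(1)[OF that]] by (simp add: \<tau>_def mult.assoc)
  \<comment> \<open>The two sides are products along paths of \<open>\<Lambda>\<close> with the same morphism.\<close>
  have comm: "\<tau> a * \<tau> b = \<tau> c * \<tau> d" if com: "comR a b c d" for a b c d
  proof -
    have ab: "a \<in> ER" "b \<in> ER" "src \<Lambda> a = rR b" and cd: "c \<in> ER" "d \<in> ER" "src \<Lambda> c = rR d"
      and eq: "cmp \<Lambda> (m a) (m b) = cmp \<Lambda> (m c) (m d)" using com by (auto simp: comR_def)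
    have pr: "prod_list (map T (px [x, y])) = \<tau> x * \<tau> y" for x y by (simp add: \<tau>_def mult.assoc)
    have "prod_list (map T (px [a, b])) = prod_list (map T (px [c, d]))"
    proof (rule walk_prod_eq)
      show "W (rR a) (px [a, b])" "W (rR c) (px [c, d])"
        using WR_walk mu_pair(1)[OF ab] mu_pair(1)[OF cd] by blast+
      show "M (rR a) (px [a, b]) = M (rR c) (px [c, d])"
        using mu_pair(2)[OF ab] mu_pair(2)[OF cd] eq by (simp add: \<mu>_def del: px_simps)
    qed (auto simp: edges_commute_iff intro: c.T_commute)
    thus ?thesis unfolding pr .
  qed
  have Pv: "P v = T (h i) * adj (T (h i))" for i
    using c.P_sum[OF v_vert, of i] by (simp add: into_v)
  \<comment> \<open>\<open>T\<^sub>g T\<^sub>g\<^sup>* = T\<^sub>g P\<^sub>v T\<^sub>g\<^sup>*\<close> with \<open>P\<^sub>v = T\<^sub>h T\<^sub>h\<^sup>*\<close>, where \<open>g = g i\<close> and \<open>h = h i0\<close>; then \<open>T\<^sub>g T\<^sub>h = \<tau> (h i)\<close>. Thus the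
    range projections of \<open>e\<close> and \<open>\<sigma> e\<close> agree.\<close>
  have Tg: "T (g i) * adj (T (g i)) = \<tau> (h i) * adj (\<tau> (h i))" for i
  proof -
    have gp: "T (g i) * P v = T (g i)" using c.TP[OF g_props(1)] g_props(2) by simp
    have "edges_commute \<Lambda> (g i) (h i0) (g i0) (h i)"
      using g_props h_props gh_swap by (simp add: edges_commute_iff)
    hence "T (g i) * T (h i0) = T (g i0) * T (h i)" by (rule c.T_commute) (simp_all add: g_props h_props)
    hence gh: "T (g i) * T (h i0) = \<tau> (h i)" using h_props by (simp add: \<tau>_def f_eq[symmetric])
    have "T (g i) * adj (T (g i)) = (T (g i) * P v) * adj (T (g i))" by (simp add: gp)
    also have "\<dots> = (T (g i) * T (h i0)) * adj (T (g i) * T (h i0))"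
      by (simp add: Pv[of i0] adj_mult mult.assoc)
    finally show ?thesis unfolding gh .
  qed
  have sum: "P x = (\<Sum>e\<in>ERi x i. \<tau> e * adj (\<tau> e))" if x: "x \<in> Vs" "x \<noteq> v" for x i
  proof -
    have "P x = (\<Sum>e\<in>edges_into_col \<Lambda> x i. T e * adj (T e))" by (rule c.P_sum[OF x(1)])
    also have "\<dots> = (\<Sum>e\<in>edges_into_col \<Lambda> x i. \<tau> (\<sigma> e) * adj (\<tau> (\<sigma> e)))"
    proof (rule sum.cong[OF refl])
      fix e assume e: "e \<in> edges_into_col \<Lambda> x i"
      show "T e * adj (T e) = \<tau> (\<sigma> e) * adj (\<tau> (\<sigma> e))"
      proof (cases "src \<Lambda> e = v")
        case True
        have "g (col e) = e" using g_unique[OF edges_into_col_edges[OF e] True] .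
        thus ?thesis using Tg[of "col e"] True by (simp add: \<sigma>_def)
      next
        case False
        have "rng \<Lambda> e = x" using e by (simp add: edges_into_col_def)
        thus ?thesis using False x by (simp add: \<sigma>_def \<tau>_def)
      qed
    qed
    also have "\<dots> = (\<Sum>e\<in>ERi x i. \<tau> e * adj (\<tau> e))"
      by (rule sum.reindex_bij_betw[OF bij_sigma[OF x]])
    finally show ?thesis .
  qed
  show ?thesis
  proof
    fix X assume "X \<in> verts_of \<Lambda>R"
    then obtain x where x: "x \<in> Vs - {v}" "X = vx x" by (auto simp: verts_R)
    show "star cls (P' X) = P' X \<and> P' X \<otimes>\<^bsub>cls\<^esub> P' X = P' X" using x P'[OF x(1)] c.P_proj by simp
    show "P' X = (\<Oplus>\<^bsub>cls\<^esub>F\<in>edges_into_col \<Lambda>R X i. T' F \<otimes>\<^bsub>cls\<^esub> star cls (T' F))" for i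
    proof -
      have "(\<Sum>F\<in>ed ` ERi x i. T' F * adj (T' F)) = (\<Sum>e\<in>ERi x i. T' (ed e) * adj (T' (ed e)))"
        by (rule sum.reindex_cong[of ed]) (auto simp: inj_on_def)
      also have "\<dots> = P x" using sum[of x i] x by (simp add: T'\<tau> ERi_def)
      finally show ?thesis using x P'[OF x(1)] edges_into_col_R[OF x(1), of i] by simp
    qed
  next
    fix X Y assume "X \<in> verts_of \<Lambda>R" "Y \<in> verts_of \<Lambda>R" "X \<noteq> Y"
    then obtain x y where x: "x \<in> Vs - {v}" "X = vx x" and y: "y \<in> Vs - {v}" "Y = vx y" by (auto simp: verts_R)
    thus "P' X \<otimes>\<^bsub>cls\<^esub> P' Y = \<zero>\<^bsub>cls\<^esub>" using P' \<open>X \<noteq> Y\<close> c.P_orth by auto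
  next
    fix F assume "F \<in> edges_of \<Lambda>R"
    then obtain e where e: "e \<in> ER" "F = ed e" by (auto simp: edges_R)
    have s: "src \<Lambda> e \<in> Vs - {v}" using e src_vert by (simp add: ER_edge edge_Mor)
    show "T' F \<otimes>\<^bsub>cls\<^esub> (star cls (T' F) \<otimes>\<^bsub>cls\<^esub> T' F) = T' F"
      using e by (simp add: T'\<tau> tt tp)
    show "star cls (T' F) \<otimes>\<^bsub>cls\<^esub> T' F = P' (src \<Lambda>R F)"
      using e P'[OF s] by (simp add: T'\<tau> tt src_ed)
  next
    fix X Y F G assume com: "edges_commute \<Lambda>R X F G Y" and ed: "X \<in> edges_of \<Lambda>R" "Y \<in> edges_of \<Lambda>R"
      "F \<in> edges_of \<Lambda>R" "G \<in> edges_of \<Lambda>R"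
    then obtain a b c d where *: "a \<in> ER" "b \<in> ER" "c \<in> ER" "d \<in> ER" "X = ed a" "F = ed b" "G = ed c" "Y = ed d"
      by (auto simp: edges_R)
    hence "comR a b c d" using com edges_commute_R[of a b c d] by simp
    thus "T' X \<otimes>\<^bsub>cls\<^esub> T' F = T' G \<otimes>\<^bsub>cls\<^esub> T' Y" using comm * by (simp add: T'\<tau>)
  qed simp_all
qed

text \<open>Conversely, a family for the reduction is compressed from a family of matrices for \<open>\<Lambda>\<close>: the
  missing projection \<open>P\<^sub>v\<close> is a copy, in the second diagonal entry, of the range projection common to
  the edges which had range \<open>v\<close>.\<close>

lemma M2_family:
  fixes P' T' :: "('a, 'a) path set \<Rightarrow> 'c::cstar_alg_1"
  assumes ck: "ck_family \<Lambda>R cls P' T'"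
  obtains PM TM :: "'a \<Rightarrow> 'c mat2" where "ck_family \<Lambda> M2 PM TM"
    "\<And>x. x \<in> Vs - {v} \<Longrightarrow> PM x = Mat (P' (vx x)) 0 0 0"
    "\<And>e. e \<in> ER \<Longrightarrow> (if rng \<Lambda> e = v then TM f \<otimes>\<^bsub>M2\<^esub> TM e else TM e) = Mat (T' (ed e)) 0 0 0"
proof -
  interpret c: cls_family \<Lambda>R P' T' by (rule cls_family_R[OF ck])
  define Q where "Q x = P' (vx x)" for x
  define S where "S e = T' (ed e)" for e
  have vR: "vx x \<in> verts_of \<Lambda>R" if "x \<in> Vs" "x \<noteq> v" for x using that by (auto simp: verts_R)
  have eR: "ed e \<in> edges_of \<Lambda>R" if "e \<in> ER" for e using that by (auto simp: edges_R)
  have Q: "adj (Q x) = Q x" "Q x * Q x = Q x" if "x \<in> Vs" "x \<noteq> v" for x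
    using c.P_proj[OF vR[OF that]] by (simp_all add: Q_def)
  have Qo: "Q x * Q y = 0" if "x \<in> Vs" "x \<noteq> v" "y \<in> Vs" "y \<noteq> v" "x \<noteq> y" for x y
    using c.P_orth[OF vR[OF that(1,2)] vR[OF that(3,4)]] that by (simp add: Q_def)
  have SS: "adj (S e) * S e = Q (src \<Lambda> e)" and SQ: "S e * Q (src \<Lambda> e) = S e" and QS: "Q (rR e) * S e = S e"
    if "e \<in> ER" for e
    using c.TT[OF eR[OF that]] c.TP[OF eR[OF that]] c.PT[OF eR[OF that]] that
    by (simp_all add: Q_def S_def src_ed rng_ed)
  have Qsum: "Q x = (\<Sum>e\<in>ERi x i. S e * adj (S e))" if "x \<in> Vs" "x \<noteq> v" for x i
  proof -
    have "Q x = (\<Sum>F\<in>ed ` ERi x i. T' F * adj (T' F))"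
      using c.P_sum[OF vR[OF that], of i] edges_into_col_R[of x i] that by (simp add: Q_def)
    also have "\<dots> = (\<Sum>e\<in>ERi x i. S e * adj (S e))"
      unfolding S_def by (rule sum.reindex_cong[of ed]) (auto simp: inj_on_def)
    finally show ?thesis .
  qed
  have comm: "S a * S b = S c * S d" if "comR a b c d" for a b c d
  proof -
    have e: "a \<in> ER" "b \<in> ER" "c \<in> ER" "d \<in> ER" using that by (auto simp: comR_def)
    thus ?thesis
      unfolding S_def using edges_commute_R[OF e] that by (intro c.T_commute eR) auto
  qed
  have uv: "u \<in> Vs" "u \<noteq> v" using u_vert u_neq .
  \<comment> \<open>Equations between elements with initial projection \<open>Q u\<close> may be tested on the edges into \<open>u\<close> of
    one colour.\<close>
  have sep: "X * Q u = Y * Q u" if "\<And>a. a \<in> ERi u i \<Longrightarrow> X * S a = Y * S a" for X Y i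
    using that by (simp add: Qsum[OF uv, of i] sum_distrib_left flip: mult.assoc)
  have hS: "S (h i) * Q u = S (h i)" "adj (S (h i)) * S (h i) = Q u" "Q w * S (h i) = S (h i)" for i
    using SQ[OF h_ER] SS[OF h_ER] QS[OF h_ER] h_props rR_h by simp_all
  \<comment> \<open>The range projection of \<open>S (h j)\<close> dominates that of \<open>S (h i)\<close>, since \<open>S (h i) S a = S (h j) S b\<close> for
    every edge \<open>a\<close> of colour \<open>j\<close> into \<open>u\<close>.\<close>
  have absorb: "S (h j) * adj (S (h j)) * S (h i) = S (h i)" for i j
  proof -
    have "S (h j) * adj (S (h j)) * S (h i) * Q u = S (h i) * Q u"
    proof (rule sep[of j])
      fix a assume "a \<in> ERi u j"
      hence a: "a \<in> ER" "rR a = u" "col a = j" by (auto simp: ERi_def intro: col_eqI ER_edge)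
      obtain b where b: "b \<in> ER" "rR b = u" "comR (h i) a (h j) b"
        using h_comR_exists[OF a(1,2), of i] a(3) by metis
      have "S (h j) * adj (S (h j)) * S (h i) * S a = S (h j) * adj (S (h j)) * (S (h j) * S b)"
        using comm[OF b(3)] by (simp add: mult.assoc)
      also have "\<dots> = S (h j) * (Q u * S b)" by (simp add: mult.assoc flip: hS(2)[of j])
      also have "\<dots> = S (h i) * S a" using QS[OF b(1)] b(2) comm[OF b(3)] by simp
      finally show "S (h j) * adj (S (h j)) * S (h i) * S a = S (h i) * S a" .
    qed
    thus ?thesis by (simp add: hS mult.assoc)
  qed
  define q where "q = S (h i0) * adj (S (h i0))"
  have qeq: "S (h i) * adj (S (h i)) = q" for i
  proof -
    let ?p = "S (h i) * adj (S (h i))"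
    have "q * ?p = ?p" unfolding q_def by (simp add: absorb flip: mult.assoc)
    moreover have "?p * q = q" unfolding q_def by (simp add: absorb flip: mult.assoc)
    moreover have "adj (q * ?p) = ?p * q" by (simp add: q_def adj_mult mult.assoc)
    moreover have "adj ?p = ?p" by (simp add: adj_mult)
    ultimately show ?thesis by simp
  qed
  have qS: "q * S (h i) = S (h i)" for i unfolding q_def by (rule absorb)
  have q: "adj q = q" "q * q = q" by (simp_all add: q_def adj_mult absorb flip: mult.assoc)
  \<comment> \<open>The edge \<open>g i\<close> is to satisfy \<open>T\<^sub>g T\<^sub>h = S (h i)\<close> for \<open>h = h i0\<close>, which dictates \<open>V i\<close>.\<close>
  define V where "V i = S (h i) * adj (S (h i0))" for i
  have V0: "V i0 = q" by (simp add: V_def q_def)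
  have VV: "adj (V i) * V i = q" "V i * adj (V i) = q" for i
  proof -
    have "adj (V i) * V i = S (h i0) * (adj (S (h i)) * S (h i)) * adj (S (h i0))"
      by (simp add: V_def adj_mult mult.assoc)
    also have "\<dots> = q" by (simp add: hS q_def)
    finally show "adj (V i) * V i = q" .
    have "V i * adj (V i) = S (h i) * (adj (S (h i0)) * S (h i0)) * adj (S (h i))"
      by (simp add: V_def adj_mult mult.assoc)
    also have "\<dots> = q" by (simp add: hS qeq)
    finally show "V i * adj (V i) = q" .
  qed
  have Vq: "V i * q = V i" for i
  proof -
    have "adj (q * S (h i0)) = adj (S (h i0))" by (simp only: qS)
    thus ?thesis by (simp add: V_def adj_mult q mult.assoc)
  qed
  have VS: "V i * S (h j) = V j * S (h i)" for i j
  proof -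
    have "V i * S (h j) * Q u = V j * S (h i) * Q u"
    proof (rule sep[of i0])
      fix a assume "a \<in> ERi u i0"
      hence a: "a \<in> ER" "rR a = u" "col a = i0" by (auto simp: ERi_def intro: col_eqI ER_edge)
      have ex: "\<exists>b. b \<in> ER \<and> rR b = u \<and> comR (h k) a (h i0) b \<and> cmp \<Lambda> (h k) (m a) = cmp \<Lambda> (h i0) (m b)" for k
        using h_comR_exists[OF a(1,2), of k] a(3) by metis
      obtain b where b: "b \<in> ER" "rR b = u" "comR (h j) a (h i0) b" "cmp \<Lambda> (h j) (m a) = cmp \<Lambda> (h i0) (m b)"
        using ex by blast
      obtain b' where b': "b' \<in> ER" "rR b' = u" "comR (h i) a (h i0) b'" "cmp \<Lambda> (h i) (m a) = cmp \<Lambda> (h i0) (m b')"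
        using ex by blast
      have VSa: "V k * S (h l) * S a = S (h k) * S c" if "comR (h l) a (h i0) c" "c \<in> ER" "rR c = u" for k l c
      proof -
        have "V k * S (h l) * S a = S (h k) * (adj (S (h i0)) * S (h i0)) * S c"
          using comm[OF that(1)] by (simp add: V_def mult.assoc)
        thus ?thesis using QS[OF that(2)] that(3) by (simp add: hS mult.assoc)
      qed
      show "V i * S (h j) * S a = V j * S (h i) * S a"
        using VSa[OF b(3,1,2), of i] VSa[OF b'(3,1,2), of j]
          comm[OF h_comR_h[OF a(1,2) b(1,2) b'(1,2) b(4) b'(4)]] by simp
    qed
    thus ?thesis by (simp add: hS mult.assoc)
  qed
  \<comment> \<open>The second diagonal entry belongs to \<open>v\<close>: edges from \<open>v\<close> and edges into \<open>v\<close> are off-diagonal.\<close>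
  define PM where "PM x = (if x = v then Mat 0 0 0 q else Mat (Q x) 0 0 0)" for x
  define TM where "TM e = (if src \<Lambda> e = v then Mat 0 (V (col e)) 0 0
      else if rng \<Lambda> e = v then Mat 0 0 (S e) 0 else Mat (S e) 0 0 0)" for e
  have srcv: "src \<Lambda> e \<noteq> v" if "e \<in> Es" "rng \<Lambda> e = v" for e
    using h_unique[OF that] h_props(5)[of "col e"] u_neq by metis
  have famM: "ck_family \<Lambda> M2 PM TM"
  proof
    fix x assume x: "x \<in> Vs"
    show "star M2 (PM x) = PM x \<and> PM x \<otimes>\<^bsub>M2\<^esub> PM x = PM x"
      using x Q q by (simp add: PM_def)
    show "PM x = (\<Oplus>\<^bsub>M2\<^esub>e\<in>edges_into_col \<Lambda> x i. TM e \<otimes>\<^bsub>M2\<^esub> star M2 (TM e))" for i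
    proof (cases "x = v")
      case True
      have "h i \<in> Es" "src \<Lambda> (h i) \<noteq> v" "rng \<Lambda> (h i) = v" using h_props u_neq by simp_all
      thus ?thesis using True by (simp add: into_v finsum_M2 PM_def TM_def qeq)
    next
      case False
      have t: "TM e \<otimes>\<^bsub>M2\<^esub> star M2 (TM e) = Mat (S (\<sigma> e) * adj (S (\<sigma> e))) 0 0 0"
        if e: "e \<in> edges_into_col \<Lambda> x i" for e
      proof -
        have "rng \<Lambda> e = x" using e by (simp add: edges_into_col_def)
        thus ?thesis using False by (simp add: TM_def \<sigma>_def VV qeq)
      qed
      have "(\<Sum>e\<in>edges_into_col \<Lambda> x i. S (\<sigma> e) * adj (S (\<sigma> e))) = Q x"
        using sum.reindex_bij_betw[OF bij_sigma[OF x False], of "\<lambda>e. S e * adj (S e)" i] Qsum[OF x False, of i]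
        by simp
      moreover have "(\<Oplus>\<^bsub>M2\<^esub>e\<in>edges_into_col \<Lambda> x i. TM e \<otimes>\<^bsub>M2\<^esub> star M2 (TM e)) =
          Mat (\<Sum>e\<in>edges_into_col \<Lambda> x i. S (\<sigma> e) * adj (S (\<sigma> e))) 0 0 0"
        unfolding finsum_M2 mat2.inject by (intro conjI sum.cong sum.neutral ballI refl) (simp_all only: t mat2.sel)
      ultimately show ?thesis using False by (simp only: PM_def if_False)
    qed
  next
    fix x y assume "x \<in> Vs" "y \<in> Vs" "x \<noteq> y"
    thus "PM x \<otimes>\<^bsub>M2\<^esub> PM y = \<zero>\<^bsub>M2\<^esub>"
      using Qo[of x y] by (cases "x = v"; cases "y = v") (auto simp: PM_def)
  next
    fix e assume e: "e \<in> Es"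
    have st: "star M2 (TM e) \<otimes>\<^bsub>M2\<^esub> TM e = PM (src \<Lambda> e)"
      using e srcv[OF e] SS[of e] by (simp add: TM_def PM_def VV ER_def)
    show "star M2 (TM e) \<otimes>\<^bsub>M2\<^esub> TM e = PM (src \<Lambda> e)" by (rule st)
    show "TM e \<otimes>\<^bsub>M2\<^esub> (star M2 (TM e) \<otimes>\<^bsub>M2\<^esub> TM e) = TM e"
      unfolding st using e SQ[of e] by (simp add: TM_def PM_def Vq ER_def)
  next
    fix a d b c assume "a \<in> Es" "d \<in> Es" "b \<in> Es" "c \<in> Es" and com: "edges_commute \<Lambda> a b c d"
    hence e: "a \<in> Es" "b \<in> Es" "c \<in> Es" "d \<in> Es" "src \<Lambda> a = rng \<Lambda> b" "src \<Lambda> c = rng \<Lambda> d"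
      by (auto simp: edges_commute_iff)
    show "TM a \<otimes>\<^bsub>M2\<^esub> TM b = TM c \<otimes>\<^bsub>M2\<^esub> TM d"
    proof (cases "src \<Lambda> a = v")
      case True
      hence c: "src \<Lambda> c = v" using swap_src[OF com] by simp
      have bh: "h (col b) = b" "h (col d) = d" using h_unique e True c by auto
      have s: "src \<Lambda> b \<noteq> v" "src \<Lambda> d \<noteq> v" using srcv e True c by auto
      from com show ?thesis
      proof (cases rule: edges_commute_cases)
        case 2
        have "V (col a) * S b = V (col c) * S d" using VS[of "col a" "col b"] 2 bh by simp
        thus ?thesis using True c s e by (simp add: TM_def)
      qed simp
    next
      case False
      note r = comR_edges[OF com False]
      show ?thesis
      proof (cases "src \<Lambda> b = v")
        case True
        have "S a * S (h (col b)) = S c * S (h (col d))" by (rule comm[OF r(2)[OF True]])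
        hence "S a * V (col b) = S c * V (col d)" by (simp add: V_def flip: mult.assoc)
        thus ?thesis using True False r(3-5) by (simp add: TM_def)
      next
        case sb: False
        have "S a * S b = S c * S d" by (rule comm[OF r(1)[OF sb]])
        moreover have "rng \<Lambda> b \<noteq> v" "rng \<Lambda> d \<noteq> v" using e False r(3) by auto
        ultimately show ?thesis using sb False r(3-5) by (simp add: TM_def)
      qed
    qed
  qed simp_all
  show thesis
  proof (rule that[OF famM])
    show "PM x = Mat (P' (vx x)) 0 0 0" if "x \<in> Vs - {v}" for x
      using that by (simp add: PM_def Q_def)
    fix e assume e: "e \<in> ER"
    have "h (col e) = e" if "rng \<Lambda> e = v" using h_unique[of e] that e by (simp add: ER_edge)
    hence qe: "q * S e = S e" if "rng \<Lambda> e = v" using qS[of "col e"] that by simp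
    have "TM f = Mat 0 q 0 0" using f_edge V0 by (simp add: TM_def i0_def)
    thus "(if rng \<Lambda> e = v then TM f \<otimes>\<^bsub>M2\<^esub> TM e else TM e) = Mat (T' (ed e)) 0 0 0"
      using e qe by (simp add: TM_def ER_edge flip: S_def)
  qed
qed

end

section \<open>The algebras of a graph and of its reduction\<close>

lemmas ck_free_hom_exists =
  free_hom_exists[where S = "Proj ` verts_of \<Lambda> \<union> Iso ` edges_of \<Lambda>" for \<Lambda>, folded ck_free_def]
lemmas ck_free_hom_eq =
  free_hom_eq[where S = "Proj ` verts_of \<Lambda> \<union> Iso ` edges_of \<Lambda>" for \<Lambda>, folded ck_free_def]

text \<open>The embedding into the first diagonal entry is isometric by \<open>mn_corner\<close>.\<close>

lemma star_hom_corner: "star_hom cls M2 (\<lambda>b. Mat b 0 0 0)"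
  by unfold_locales simp_all

lemma ck_generator_cases:
  assumes "s \<in> Proj ` verts_of \<Lambda> \<union> Iso ` edges_of \<Lambda>"
  obtains x where "x \<in> verts_of \<Lambda>" "s = Proj x" | e where "e \<in> edges_of \<Lambda>" "s = Iso e"
  using assms by blast

context reducible
begin

abbreviation "F\<Lambda> \<equiv> ck_poly \<Lambda>"
abbreviation "FR \<equiv> ck_poly \<Lambda>R"

lemma reduction_hom_exists:
  obtains \<phi> where "star_hom FR F\<Lambda> \<phi>" "\<And>x. x \<in> Vs - {v} \<Longrightarrow> \<phi> (gen (Proj (vx x))) = gen (Proj x)"
    "\<And>e. e \<in> ER \<Longrightarrow> \<phi> (gen (Iso (ed e))) =
        (if rng \<Lambda> e = v then gen (Iso f) \<otimes>\<^bsub>F\<Lambda>\<^esub> gen (Iso e) else gen (Iso e))"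
proof -
  interpret F: star_algebra F\<Lambda> by (rule star_algebra_ck_free)
  \<comment> \<open>The vertex or edge is recovered from the singleton class.\<close>
  define \<theta> where "\<theta> s = (case s of Proj X \<Rightarrow> gen (Proj (fst (the_elem X)))
    | Iso X \<Rightarrow> let e = hd (snd (the_elem X)) in
        if rng \<Lambda> e = v then gen (Iso f) \<otimes>\<^bsub>F\<Lambda>\<^esub> gen (Iso e) else gen (Iso e))" for s
  have th: "\<theta> (Proj (vx x)) = gen (Proj x)"
    "\<theta> (Iso (ed e)) = (if rng \<Lambda> e = v then gen (Iso f) \<otimes>\<^bsub>F\<Lambda>\<^esub> gen (Iso e) else gen (Iso e))" for x e
    by (simp_all add: \<theta>_def vx_def ed_def Let_def)
  have \<theta>_carrier: "\<theta> s \<in> carrier F\<Lambda>" if "s \<in> Proj ` verts_of \<Lambda>R \<union> Iso ` edges_of \<Lambda>R" for s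
    using that
  proof (cases rule: ck_generator_cases)
    case (1 X)
    then obtain x where "x \<in> Vs - {v}" "X = vx x" by (auto simp: verts_R)
    thus ?thesis using 1 by (simp add: th)
  next
    case (2 X)
    then obtain e where "e \<in> ER" "X = ed e" by (auto simp: edges_R)
    thus ?thesis using 2 f_edge(1) by (simp add: th ER_edge F.mult_closed)
  qed
  show thesis
  proof (rule ck_free_hom_exists[where \<Lambda> = \<Lambda>R and \<theta> = \<theta> and p = "ck_universal_seminorm \<Lambda>R",
        OF F.star_algebra_axioms])
    fix \<phi> assume \<phi>: "star_hom FR F\<Lambda> \<phi>"
      "\<And>s. s \<in> Proj ` verts_of \<Lambda>R \<union> Iso ` edges_of \<Lambda>R \<Longrightarrow> \<phi> (gen s) = \<theta> s"
    show thesis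
      by (rule that[OF \<phi>(1)]) (simp_all add: \<phi>(2) verts_R edges_R th)
  qed (rule \<theta>_carrier)
qed

theorem morita: "morita_equivalent (ck_algebra \<Lambda>) (ck_algebra \<Lambda>R)"
proof -
  define A where "A = ck_algebra \<Lambda>"
  define B where "B = ck_algebra \<Lambda>R"
  interpret FL: seminormed_star_algebra F\<Lambda> by (rule seminormed_ck_poly[OF src_ok])
  interpret FR: seminormed_star_algebra FR by (rule seminormed_ck_poly[OF src_ok_R])
  have cFL: "completion F\<Lambda> = A" and cFR: "completion FR = B" by (simp_all add: A_def B_def ck_algebra_def)
  have cA: "cstar_algebra A" and cB: "cstar_algebra B"
    unfolding A_def B_def by (rule cstar_algebra_ck[OF src_ok], rule cstar_algebra_ck[OF src_ok_R])
  interpret A: cstar_algebra A by (rule cA)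
  interpret B: cstar_algebra B by (rule cB)
  interpret ckA: ck_family \<Lambda> A "\<lambda>x. FL.toC (gen (Proj x))" "\<lambda>e. FL.toC (gen (Iso e))"
    unfolding A_def by (rule ck_family_ck[OF src_ok])
  have tL: "star_hom F\<Lambda> A FL.toC" using FL.star_hom_toC by (simp add: cFL)
  have tR: "star_hom FR B FR.toC" using FR.star_hom_toC by (simp add: cFR)
  interpret tL: star_hom F\<Lambda> A FL.toC by (rule tL)
  interpret tR: star_hom FR B FR.toC by (rule tR)
  have jA: "star_hom A cls (emb A)" and jB: "star_hom B cls (emb B)" by (rule star_hom_emb[OF cA], rule star_hom_emb[OF cB])
  interpret jA: star_hom A cls "emb A" by (rule jA)
  interpret jB: star_hom B cls "emb B" by (rule jB)
  obtain \<phi> where \<phi>: "star_hom FR F\<Lambda> \<phi>" and \<phi>P: "\<And>x. x \<in> Vs - {v} \<Longrightarrow> \<phi> (gen (Proj (vx x))) = gen (Proj x)"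
    and \<phi>T: "\<And>e. e \<in> ER \<Longrightarrow> \<phi> (gen (Iso (ed e))) =
        (if rng \<Lambda> e = v then gen (Iso f) \<otimes>\<^bsub>F\<Lambda>\<^esub> gen (Iso e) else gen (Iso e))"
    by (rule reduction_hom_exists) blast
  interpret \<phi>: star_hom FR F\<Lambda> \<phi> by (rule \<phi>)
  \<comment> \<open>Everything takes place in the ambient type of \<open>emb A\<close>: \<open>P\<close> and \<open>T\<close> are the generators of \<open>C\<^sup>*(\<Lambda>)\<close>.\<close>
  define jl where "jl = emb A \<circ> FL.toC"
  have jl: "star_hom F\<Lambda> cls jl" unfolding jl_def by (rule star_hom_comp[OF tL jA])
  interpret jl: star_hom F\<Lambda> cls jl by (rule jl)
  define P where "P x = jl (gen (Proj x))" for x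
  define T where "T e = jl (gen (Iso e))" for e
  have famL: "ck_family \<Lambda> cls P T"
    unfolding P_def T_def jl_def o_def
    by (rule ck_family_hom[OF src_ok A.star_algebra_axioms star_algebra_cls jA]) (rule ckA.ck_family_axioms)
  interpret c: cls_family \<Lambda> P T by (rule cls_family_Lambda[OF famL])
  define J where "J = jl \<circ> \<phi>"
  have J: "star_hom FR cls J" unfolding J_def by (rule star_hom_comp[OF \<phi> jl])
  interpret J: star_hom FR cls J by (rule J)
  have JP: "J (gen (Proj (vx x))) = P x" if "x \<in> Vs - {v}" for x
    using \<phi>P[OF that] by (simp add: J_def P_def)
  have JT: "J (gen (Iso (ed e))) = (if rng \<Lambda> e = v then T f * T e else T e)" if "e \<in> ER" for e
    using \<phi>T[OF that] jl.hom_mult[of "gen (Iso f)" "gen (Iso e)"] f_edge ER_edge[OF that]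
    by (simp add: J_def T_def)

  \<comment> \<open>The homomorphism \<open>\<phi>\<close> preserves the universal seminorms.\<close>
  have norm_J: "norm (J a) = ck_universal_seminorm \<Lambda> (\<phi> a)" if "a \<in> carrier FR" for a
    using that FL.nrm_toC[of "\<phi> a"] norm_emb[OF cA, of "FL.toC (\<phi> a)"]
    by (simp add: J_def jl_def \<phi>.hom_closed tL.hom_closed cFL)
  have le1: "ck_universal_seminorm \<Lambda> (\<phi> a) \<le> ck_universal_seminorm \<Lambda>R a" if a: "a \<in> carrier FR" for a
  proof -
    have "ck_family \<Lambda>R cls (\<lambda>X. J (gen (Proj X))) (\<lambda>X. J (gen (Iso X)))"
      by (rule reduced_family[OF famL]) (use JP JT in auto)
    from ck_seminorm_pullback[OF src_ok_R seminormed_cls J this]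
    have "ck_seminorm \<Lambda>R (\<lambda>a. norm (J a))" by simp
    from ck_seminorm_le_universal[OF src_ok_R a this] show ?thesis using norm_J[OF a] by simp
  qed
  have le2: "ck_universal_seminorm \<Lambda>R a \<le> ck_universal_seminorm \<Lambda> (\<phi> a)" if a: "a \<in> carrier FR" for a
  proof -
    define jr where "jr = emb B \<circ> FR.toC"
    have jr: "star_hom FR cls jr" unfolding jr_def by (rule star_hom_comp[OF tR jB])
    have "ck_family \<Lambda>R cls (\<lambda>X. jr (gen (Proj X))) (\<lambda>X. jr (gen (Iso X)))"
      unfolding jr_def o_def
      by (rule ck_family_hom[OF src_ok_R B.star_algebra_axioms star_algebra_cls jB])
        (unfold B_def, rule ck_family_ck[OF src_ok_R])
    then obtain PM TM where fam: "ck_family \<Lambda> M2 PM TM"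
      and PM: "\<And>x. x \<in> Vs - {v} \<Longrightarrow> PM x = Mat (jr (gen (Proj (vx x)))) 0 0 0"
      and TM: "\<And>e. e \<in> ER \<Longrightarrow> (if rng \<Lambda> e = v then TM f \<otimes>\<^bsub>M2\<^esub> TM e else TM e) = Mat (jr (gen (Iso (ed e)))) 0 0 0"
      by (rule M2_family) blast
    define \<theta>0 where "\<theta>0 s = (case s of Proj x \<Rightarrow> PM x | Iso e \<Rightarrow> TM e)" for s
    obtain \<theta> where \<theta>: "star_hom F\<Lambda> M2 \<theta>" and \<theta>g: "\<And>s. s \<in> Proj ` Vs \<union> Iso ` Es \<Longrightarrow> \<theta> (gen s) = \<theta>0 s"
      using ck_free_hom_exists[OF star_algebra_M2, of \<Lambda> \<theta>0 "ck_universal_seminorm \<Lambda>"] by auto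
    interpret \<theta>: star_hom F\<Lambda> M2 \<theta> by (rule \<theta>)
    have \<theta>P: "\<theta> (gen (Proj x)) = PM x" if "x \<in> Vs" for x using \<theta>g[of "Proj x"] that by (simp add: \<theta>0_def)
    have \<theta>T: "\<theta> (gen (Iso e)) = TM e" if "e \<in> Es" for e using \<theta>g[of "Iso e"] that by (simp add: \<theta>0_def)
    have cM: "ck_closed \<Lambda> M2 (\<lambda>x. \<theta> (gen (Proj x))) (\<lambda>e. \<theta> (gen (Iso e)))" and cM': "ck_closed \<Lambda> M2 PM TM"
      using src_ok star_algebra_M2 by (simp_all add: ck_closed_def src_ok_def)
    have "ck_rels \<Lambda> M2 (\<lambda>x. \<theta> (gen (Proj x))) (\<lambda>e. \<theta> (gen (Iso e))) = ck_rels \<Lambda> M2 PM TM"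
    proof -
      interpret M2: star_algebra M2 by (rule star_algebra_M2)
      have fs: "finsum M2 (\<lambda>e. \<theta> (gen (Iso e)) \<otimes>\<^bsub>M2\<^esub> star M2 (\<theta> (gen (Iso e)))) (edges_into_col \<Lambda> x i) =
          finsum M2 (\<lambda>e. TM e \<otimes>\<^bsub>M2\<^esub> star M2 (TM e)) (edges_into_col \<Lambda> x i)" for x i
        by (rule M2.M.finsum_cong') (auto dest: edges_into_col_edges simp: \<theta>T simp del: M2_simps(2-6))
      show ?thesis
        unfolding ck_rels_def fs
        by (intro arg_cong2[where f = "(\<union>)"] image_cong refl)
          (use src_vert in \<open>auto simp: \<theta>P \<theta>T edge_Mor simp del: M2_simps\<close>)
    qed
    hence "ck_family \<Lambda> M2 (\<lambda>x. \<theta> (gen (Proj x))) (\<lambda>e. \<theta> (gen (Iso e)))"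
      using fam ck_closed.ck_family_iff[OF cM] ck_closed.ck_family_iff[OF cM'] by simp
    from ck_seminorm_pullback[OF src_ok seminormed_M2 \<theta> this]
    have sn: "ck_seminorm \<Lambda> (\<lambda>a. mn (\<theta> a))" by simp
    have "(\<theta> \<circ> \<phi>) a = ((\<lambda>b. Mat b 0 0 0) \<circ> jr) a"
    proof (rule ck_free_hom_eq[OF star_algebra_M2 star_hom_comp[OF \<phi> \<theta>] star_hom_comp[OF jr star_hom_corner] _ a])
      fix s assume "s \<in> Proj ` verts_of \<Lambda>R \<union> Iso ` edges_of \<Lambda>R"
      thus "(\<theta> \<circ> \<phi>) (gen s) = ((\<lambda>b. Mat b 0 0 0) \<circ> jr) (gen s)"
      proof (cases rule: ck_generator_cases)
        case (1 X)
        then obtain x where "x \<in> Vs - {v}" "X = vx x" by (auto simp: verts_R)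
        thus ?thesis using 1 by (simp add: \<phi>P \<theta>P PM)
      next
        case (2 X)
        then obtain e where e: "e \<in> ER" "X = ed e" by (auto simp: edges_R)
        have "\<theta> (\<phi> (gen (Iso (ed e)))) = (if rng \<Lambda> e = v then TM f \<otimes>\<^bsub>M2\<^esub> TM e else TM e)"
          using e f_edge by (simp add: \<phi>T \<theta>.hom_mult \<theta>T ER_edge del: M2_simps)
        also have "\<dots> = Mat (jr (gen (Iso (ed e)))) 0 0 0" by (rule TM[OF e(1)])
        finally show ?thesis using 2 e by simp
      qed
    qed
    hence "mn (\<theta> (\<phi> a)) = norm (jr a)" by (simp add: mn_corner)
    also have "\<dots> = ck_universal_seminorm \<Lambda>R a"
      using a FR.nrm_toC[of a] norm_emb[OF cB, of "FR.toC a"] by (simp add: jr_def tR.hom_closed cFR)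
    finally show ?thesis
      using ck_seminorm_le_universal[OF src_ok \<phi>.hom_closed[OF a] sn] by simp
  qed
  have iso0: "nrm A ((FL.toC \<circ> \<phi>) a) = nrm FR a" if "a \<in> carrier FR" for a
    using le1[OF that] le2[OF that] FL.nrm_toC[of "\<phi> a"] that by (simp add: \<phi>.hom_closed cFL)
  obtain \<psi> where \<psi>: "star_hom B A \<psi>" and iso: "\<And>b. b \<in> carrier B \<Longrightarrow> nrm A (\<psi> b) = nrm B b"
    and \<psi>t: "\<And>a. a \<in> carrier FR \<Longrightarrow> \<psi> (FR.toC a) = FL.toC (\<phi> a)"
    using FR.extend_isometry[OF cA star_hom_comp[OF \<phi> tL] iso0] unfolding cFR o_def by blast
  interpret \<psi>: star_hom B A \<psi> by (rule \<psi>)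

  \<comment> \<open>The image of \<open>\<psi>\<close> in the ambient type, a closed *-subalgebra.\<close>
  define \<Gamma> where "\<Gamma> = emb A \<circ> \<psi>"
  have \<Gamma>: "star_hom B cls \<Gamma>" unfolding \<Gamma>_def by (rule star_hom_comp[OF \<psi> jA])
  interpret \<Gamma>: star_hom B cls \<Gamma> by (rule \<Gamma>)
  have norm_\<Gamma>: "norm (\<Gamma> b) = nrm B b" if "b \<in> carrier B" for b
    using iso[OF that] norm_emb[OF cA \<psi>.hom_closed[OF that]] by (simp add: \<Gamma>_def)
  define IM where "IM = \<Gamma> ` carrier B"
  have IM_E: thesis if "x \<in> IM" "\<And>b. b \<in> carrier B \<Longrightarrow> x = \<Gamma> b \<Longrightarrow> thesis" for x thesis
    using that(1) unfolding IM_def by (rule imageE) (rule that(2))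
  have IM_I: "\<Gamma> b \<in> IM" if "b \<in> carrier B" for b unfolding IM_def using that by (rule imageI)
  have IM_add: "x + y \<in> IM" and IM_mult: "x * y \<in> IM" if xy: "x \<in> IM" "y \<in> IM" for x y
  proof -
    obtain b where b: "b \<in> carrier B" "x = \<Gamma> b" using xy(1) by (rule IM_E)
    obtain c where c: "c \<in> carrier B" "y = \<Gamma> c" using xy(2) by (rule IM_E)
    show "x + y \<in> IM" using IM_I[OF B.a_closed[OF b(1) c(1)]] \<Gamma>.hom_add[OF b(1) c(1)] by (simp add: b(2) c(2))
    show "x * y \<in> IM" using IM_I[OF B.mult_closed[OF b(1) c(1)]] \<Gamma>.hom_mult[OF b(1) c(1)] by (simp add: b(2) c(2))
  qed
  have IM_scaleC: "z *\<^sub>C x \<in> IM" and IM_adj: "adj x \<in> IM" if x: "x \<in> IM" for x z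
  proof -
    obtain b where b: "b \<in> carrier B" "x = \<Gamma> b" using x by (rule IM_E)
    show "z *\<^sub>C x \<in> IM" using IM_I[OF B.smult_closed[OF _ b(1), of z]] \<Gamma>.hom_smult[OF b(1), of z] by (simp add: b(2) complex_ring_def)
    show "adj x \<in> IM" using IM_I[OF B.star_closed[OF b(1)]] \<Gamma>.hom_star[OF b(1)] by (simp add: b(2))
  qed
  have IM_zero: "0 \<in> IM"
    using star_hom_zero[OF \<Gamma> B.star_algebra_axioms star_algebra_cls] unfolding IM_def by force
  have IM_J: "J a \<in> IM" if "a \<in> carrier FR" for a
    using \<psi>t[OF that] tR.hom_closed[OF that] by (auto simp: IM_def \<Gamma>_def J_def jl_def intro!: image_eqI[of _ _ "FR.toC a"])
  have IM_P: "P x \<in> IM" if "x \<in> Vs - {v}" for x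
    using IM_J[of "gen (Proj (vx x))"] JP[OF that] that by (simp add: verts_R)
  have IM_T: "(if rng \<Lambda> e = v then T f * T e else T e) \<in> IM" if "e \<in> ER" for e
    using IM_J[of "gen (Iso (ed e))"] that unfolding JT[OF that] by (simp add: edges_R)

  \<comment> \<open>The projection \<open>k\<close> is \<open>1 - P\<^sub>v\<close>. The partial isometry \<open>\<eta>\<close> of an edge into \<open>v\<close> has range
    projection \<open>P\<^sub>v\<close>, whence \<open>k\<^sup>2 + \<eta>\<eta>\<^sup>* = 1\<close>.\<close>
  define q where "q = FL.toC (gen (Proj v))"
  define hh where "hh = FL.toC (gen (Iso (h i0)))"
  define k where "k = 1 - P v"
  define \<eta> where "\<eta> = T (h i0)"
  have jq: "emb A q = P v" and jh: "emb A hh = \<eta>" by (simp_all add: q_def hh_def P_def T_def jl_def \<eta>_def)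
  have Pv: "adj (P v) = P v" "P v * P v = P v" by (rule c.P_proj[OF v_vert])+
  have \<eta>\<eta>: "\<eta> * adj \<eta> = P v" using c.P_sum[OF v_vert, of i0] by (simp add: into_v \<eta>_def)
  have Pvh: "P v * \<eta> = \<eta>" using c.PT[OF h_props(1), of i0] h_props by (simp add: \<eta>_def)
  have hPu: "\<eta> * P u = \<eta>" "adj \<eta> * \<eta> = P u"
    using c.TP[OF h_props(1), of i0] c.TT[OF h_props(1), of i0] h_props by (simp_all add: \<eta>_def)
  have PP: "P x * P y = 0" if "x \<in> Vs" "y \<in> Vs" "x \<noteq> y" for x y by (rule c.P_orth[OF that])
  have hPv: "\<eta> * P v = 0"
  proof -
    have "\<eta> * P v = \<eta> * (P u * P v)" using hPu by (simp flip: mult.assoc)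
    thus ?thesis using PP[OF u_vert v_vert u_neq] by simp
  qed
  have k: "adj k = k" "k * k = k" "k * k + \<eta> * adj \<eta> = 1" "k * P v = 0" "P v * k = 0"
    using Pv by (simp_all add: k_def adj_diff algebra_simps \<eta>\<eta>)
  have kh: "k * \<eta> = 0" by (simp add: k_def left_diff_distrib Pvh)
  have kP: "k * P x = P x" "P x * k = P x" "adj \<eta> * P x = 0" "P x * \<eta> = 0" if "x \<in> Vs" "x \<noteq> v" for x
  proof -
    have o: "P v * P x = 0" "P x * P v = 0" using PP that v_vert by auto
    show "k * P x = P x" "P x * k = P x" by (simp_all add: k_def algebra_simps o)
    have "P x * \<eta> = P x * P v * \<eta>" using Pvh by (simp add: mult.assoc)
    thus "P x * \<eta> = 0" using o by simp
    hence "adj (P x * \<eta>) = 0" by simp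
    thus "adj \<eta> * P x = 0" using c.P_proj[OF that(1)] by (simp add: adj_mult)
  qed
  have PT: "P (rng \<Lambda> e) * T e = T e" "T e * P (src \<Lambda> e) = T e" if "e \<in> Es" for e
    using c.PT[OF that] c.TP[OF that] .

  \<comment> \<open>The row \<open>(k, \<eta>)\<close> is a coisometry, so compression by it is multiplicative with values in 2 by 2
    matrices. All entries of the compressions of polynomials in the generators lie in the image.\<close>
  define good where "good c \<longleftrightarrow> k * c * k \<in> IM \<and> k * c * \<eta> \<in> IM \<and> adj \<eta> * c * k \<in> IM \<and> adj \<eta> * c * \<eta> \<in> IM" for c
  have good_mult: "good (c * d)" if "good c" "good d" for c d
  proof -
    have split: "x * (c * d) * y = (x * c * k) * (k * d * y) + (x * c * \<eta>) * (adj \<eta> * d * y)" for x y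
    proof -
      have "x * (c * d) * y = x * c * (k * k + \<eta> * adj \<eta>) * d * y" unfolding k(3) by (simp add: mult.assoc)
      thus ?thesis by (simp add: distrib_left distrib_right mult.assoc)
    qed
    show ?thesis using that unfolding good_def split by (auto intro!: IM_add IM_mult)
  qed
  have good_adj: "good (adj c)" if "good c" for c
  proof -
    have "adj (k * c * k) = k * adj c * k" "adj (k * c * \<eta>) = adj \<eta> * adj c * k"
      "adj (adj \<eta> * c * k) = k * adj c * \<eta>" "adj (adj \<eta> * c * \<eta>) = adj \<eta> * adj c * \<eta>"
      by (simp_all add: adj_mult k mult.assoc)
    thus ?thesis using that IM_adj unfolding good_def by metis
  qed
  have good_P: "good (P x)" if x: "x \<in> Vs" for x
  proof (cases "x = v")
    case True
    have "adj \<eta> * P v = adj \<eta>" using arg_cong[OF Pvh, of adj] by (simp add: adj_mult Pv)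
    hence "adj \<eta> * P v * \<eta> = P u" using hPu by simp
    thus ?thesis using True IM_zero IM_P u_vert u_neq by (simp add: good_def k kh mult.assoc Pvh hPu)
  next
    case False
    thus ?thesis using kP[OF x False] IM_P[of x] x IM_zero by (simp add: good_def mult.assoc)
  qed
  have good_T: "good (T e)" if e: "e \<in> Es" for e
  proof -
    have r: "rng \<Lambda> e \<in> Vs" and s: "src \<Lambda> e \<in> Vs" using rng_vert src_vert edge_Mor[OF e] by auto
    have left: "x * T e = (x * P (rng \<Lambda> e)) * T e" for x using PT(1)[OF e] by (simp add: mult.assoc)
    have right: "T e * y = T e * (P (src \<Lambda> e) * y)" for y using PT(2)[OF e] by (simp flip: mult.assoc)
    show ?thesis
    proof (cases "src \<Lambda> e = v")
      case True
      have rv: "rng \<Lambda> e = w" using from_rng[OF e True] .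
      have l: "k * T e = T e" "adj \<eta> * T e = 0" using left[of k] left[of "adj \<eta>"] kP[OF w_vert w_neq] rv PT(1)[OF e] by simp_all
      have "T e * k = 0" using right[of k] True k by simp
      moreover have "T e * \<eta> = T f * T (h (col e))"
      proof -
        have "edges_commute \<Lambda> e (h i0) (g i0) (h (col e))"
          using gh_swap[of "col e" i0] g_unique[OF e True] g_props h_props e True by (simp add: edges_commute_iff)
        hence "T e * T (h i0) = T (g i0) * T (h (col e))" using e g_props h_props by (intro c.T_commute) auto
        thus ?thesis by (simp add: \<eta>_def f_eq[symmetric])
      qed
      moreover have "T f * T (h (col e)) \<in> IM" using IM_T[OF h_ER, of "col e"] h_props by simp
      ultimately show ?thesis using l IM_zero by (simp add: good_def mult.assoc)
    next
      case sv: False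
      have rr: "T e * k = T e" "T e * \<eta> = 0" using right[of k] right[of \<eta>] kP[OF s sv] PT(2)[OF e] by simp_all
      have eER: "e \<in> ER" using e sv by (simp add: ER_def)
      show ?thesis
      proof (cases "rng \<Lambda> e = v")
        case True
        have "k * T e = 0" using left[of k] True k by simp
        moreover have "adj \<eta> * T e \<in> IM"
        proof -
          have fP: "adj (T f) * T f = P v" using c.TT[OF f_edge(1)] f_edge(2) by simp
          have "adj \<eta> * T e = adj \<eta> * (P v * T e)" using PT(1)[OF e] True by simp
          also have "\<dots> = adj (T f * T (h i0)) * (T f * T e)" by (simp add: \<eta>_def adj_mult mult.assoc flip: fP)
          finally show ?thesis
            using IM_mult[OF IM_adj[OF IM_T[OF h_ER, of i0]] IM_T[OF eER]] True h_props by simp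
        qed
        ultimately show ?thesis using rr IM_zero by (simp add: good_def mult.assoc)
      next
        case False
        have "k * T e = T e" "adj \<eta> * T e = 0" using left[of k] left[of "adj \<eta>"] kP[OF r False] PT(1)[OF e] by simp_all
        thus ?thesis using rr IM_zero IM_T[OF eER] False by (simp add: good_def mult.assoc)
      qed
    qed
  qed
  have good_jl: "good (jl a)" if "a \<in> carrier F\<Lambda>" for a
    using that
  proof (induction a rule: ck_free_induct)
    case zero
    have "jl \<zero>\<^bsub>F\<Lambda>\<^esub> = 0" using star_hom_zero[OF jl FL.star_algebra_axioms star_algebra_cls] by simp
    thus ?case using IM_zero by (simp add: good_def)
  next
    case (add a b)
    thus ?case by (simp add: jl.hom_add good_def distrib_left distrib_right IM_add)
  next
    case (smult z a)
    thus ?case by (simp add: jl.hom_smult good_def scaleC_mult_left scaleC_mult_right IM_scaleC)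
  next
    case (mult a b)
    thus ?case by (simp add: jl.hom_mult good_mult)
  next
    case (star a)
    thus ?case by (simp add: jl.hom_star good_adj)
  next
    case (gen s)
    thus ?case
    proof (cases rule: ck_generator_cases)
      case (1 x)
      thus ?thesis using good_P by (simp add: P_def)
    next
      case (2 e)
      thus ?thesis using good_T by (simp add: T_def)
    qed
  qed
  have norm_k: "norm k \<le> 1"
  proof -
    have "(norm k)\<^sup>2 = norm k" using norm_adj_mult[of k] k by simp
    hence "norm k = 0 \<or> norm k = 1" by (simp add: power2_eq_square)
    thus ?thesis by auto
  qed

  have qA: "q \<in> carrier A" and hA: "hh \<in> carrier A"
    using v_vert h_props(1)[of i0] by (simp_all add: q_def hh_def tL.hom_closed)
  have jzero: "emb A \<zero>\<^bsub>A\<^esub> = 0" using star_hom_zero[OF jA A.star_algebra_axioms star_algebra_cls] by simp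
  have eqA: "a = b" if "a \<in> carrier A" "b \<in> carrier A" "emb A a = emb A b" for a b
    by (rule emb_inj[OF cA that])
  show ?thesis
    unfolding A_def[symmetric] B_def[symmetric]
  proof (rule morita_corner[OF cA cB \<psi> iso qA _ _ hA])
    show "star A q = q" by (rule eqA) (simp_all add: qA jA.hom_star jq Pv)
    show "q \<otimes>\<^bsub>A\<^esub> q = q" by (rule eqA) (simp_all add: qA jA.hom_mult jq Pv)
    show "hh \<otimes>\<^bsub>A\<^esub> star A hh = q" by (rule eqA) (simp_all add: qA hA jA.hom_mult jA.hom_star jq jh \<eta>\<eta>)
    show "hh \<otimes>\<^bsub>A\<^esub> q = \<zero>\<^bsub>A\<^esub>" by (rule eqA) (simp_all add: qA hA jA.hom_mult jq jh hPv jzero)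
    show "dense_span A {a \<otimes>\<^bsub>A\<^esub> b |a b. a \<in> carrier A \<and> b \<in> carrier A}"
      unfolding A_def by (rule dense_span_products[OF src_ok])
    show "dense_span B {a \<otimes>\<^bsub>B\<^esub> b |a b. a \<in> carrier B \<and> b \<in> carrier B}"
      unfolding B_def by (rule dense_span_products[OF src_ok_R])
  next
    fix b assume b: "b \<in> carrier B"
    \<comment> \<open>The generators of the image, hence all its elements, are fixed by \<open>k\<close>.\<close>
    have fixed: "k * J a = J a \<and> J a * k = J a" if "a \<in> carrier FR" for a
      using that
    proof (induction a rule: ck_free_induct)
      case zero
      have "J \<zero>\<^bsub>FR\<^esub> = 0" using star_hom_zero[OF J FR.star_algebra_axioms star_algebra_cls] by simp
      thus ?case by simp
    next
      case (add a b)
      thus ?case by (simp add: J.hom_add distrib_left distrib_right)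
    next
      case (smult z a)
      thus ?case by (simp add: J.hom_smult scaleC_mult_left scaleC_mult_right)
    next
      case (mult a b)
      thus ?case by (simp add: J.hom_mult mult.assoc) (simp flip: mult.assoc)
    next
      case (star a)
      hence e: "k * J a = J a" "J a * k = J a" by auto
      have "adj (J a) * adj k = adj (J a)" "adj k * adj (J a) = adj (J a)"
        by (simp_all only: adj_mult[symmetric] e)
      thus ?case using star by (simp add: J.hom_star k)
    next
      case (gen s)
      thus ?case
      proof (cases rule: ck_generator_cases)
        case (1 X)
        then obtain x where "x \<in> Vs - {v}" "X = vx x" by (auto simp: verts_R)
        thus ?thesis using 1 JP kP by simp
      next
        case (2 X)
        then obtain e where e: "e \<in> ER" "X = ed e" by (auto simp: edges_R)
        have eE: "e \<in> Es" "src \<Lambda> e \<noteq> v" using e by (auto simp: ER_edge)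
        have s: "src \<Lambda> e \<in> Vs" "rng \<Lambda> e \<in> Vs" using src_vert rng_vert edge_Mor[OF eE(1)] by auto
        have "T e * k = T e * (P (src \<Lambda> e) * k)" using PT(2)[OF eE(1)] by (simp flip: mult.assoc)
        hence r: "T e * k = T e" using kP(2)[OF s(1) eE(2)] PT(2)[OF eE(1)] by simp
        have kl: "k * T d = T d" if "d \<in> Es" "rng \<Lambda> d \<noteq> v" for d
        proof -
          have "k * T d = (k * P (rng \<Lambda> d)) * T d" using PT(1)[OF that(1)] by (simp add: mult.assoc)
          thus ?thesis using kP(1)[of "rng \<Lambda> d"] that rng_vert[OF edge_Mor[OF that(1)]] PT(1)[OF that(1)] by simp
        qed
        have kf: "k * T f = T f" using kl[OF f_edge(1)] from_rng[OF f_edge] w_neq by simp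
        have "k * (T f * T e) = T f * T e" using kf by (simp flip: mult.assoc)
        thus ?thesis using 2 e JT[OF e(1)] r kl[OF eE(1)] by (simp add: mult.assoc)
      qed
    qed
    have "norm (k * \<Gamma> b - \<Gamma> b) \<le> 2 * \<epsilon> \<and> norm (\<Gamma> b * k - \<Gamma> b) \<le> 2 * \<epsilon>" if \<epsilon>: "\<epsilon> > 0" for \<epsilon>
    proof -
      obtain a where a: "a \<in> carrier FR" "nrm B (b \<ominus>\<^bsub>B\<^esub> FR.toC a) < \<epsilon>"
        using FR.toC_dense[unfolded cFR, OF b \<epsilon>] by blast
      have Ja: "\<Gamma> (FR.toC a) = J a" using \<psi>t[OF a(1)] by (simp add: \<Gamma>_def J_def jl_def)
      have d: "norm (\<Gamma> b - J a) < \<epsilon>"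
        using a b norm_\<Gamma>[of "b \<ominus>\<^bsub>B\<^esub> FR.toC a"] tR.hom_closed[OF a(1)]
          star_hom_diff[OF \<Gamma> B.star_algebra_axioms star_algebra_cls b tR.hom_closed[OF a(1)]]
        by (simp add: Ja)
      have bd: "norm (k * (\<Gamma> b - J a)) \<le> \<epsilon>" "norm ((\<Gamma> b - J a) * k) \<le> \<epsilon>"
        using d norm_k norm_mult_ineq[of k "\<Gamma> b - J a"] norm_mult_ineq[of "\<Gamma> b - J a" k]
          mult_right_mono[OF norm_k, of "norm (\<Gamma> b - J a)"] mult_left_mono[OF norm_k, of "norm (\<Gamma> b - J a)"]
        by simp_all
      have e: "k * \<Gamma> b - \<Gamma> b = k * (\<Gamma> b - J a) - (\<Gamma> b - J a)" "\<Gamma> b * k - \<Gamma> b = (\<Gamma> b - J a) * k - (\<Gamma> b - J a)"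
        using fixed[OF a(1)] by (simp_all add: algebra_simps)
      show ?thesis unfolding e
        using norm_triangle_ineq4[of "k * (\<Gamma> b - J a)" "\<Gamma> b - J a"]
          norm_triangle_ineq4[of "(\<Gamma> b - J a) * k" "\<Gamma> b - J a"] bd d by simp
    qed
    from this[of "\<epsilon> / 2" for \<epsilon>]
    have small: "norm (k * \<Gamma> b - \<Gamma> b) \<le> \<epsilon>" "norm (\<Gamma> b * k - \<Gamma> b) \<le> \<epsilon>" if "\<epsilon> > 0" for \<epsilon>
      using that by simp_all
    have "norm (k * \<Gamma> b - \<Gamma> b) \<le> 0" "norm (\<Gamma> b * k - \<Gamma> b) \<le> 0"
      by (rule field_le_epsilon, simp add: small)+
    hence "P v * \<Gamma> b = 0" "\<Gamma> b * P v = 0" by (simp_all add: k_def algebra_simps)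
    thus "q \<otimes>\<^bsub>A\<^esub> \<psi> b = \<zero>\<^bsub>A\<^esub> \<and> \<psi> b \<otimes>\<^bsub>A\<^esub> q = \<zero>\<^bsub>A\<^esub>"
      using b qA by (intro conjI eqA) (simp_all add: jA.hom_mult \<psi>.hom_closed jq jzero \<Gamma>_def)
  next
    fix a assume a: "a \<in> carrier A" and qa: "q \<otimes>\<^bsub>A\<^esub> a = \<zero>\<^bsub>A\<^esub>" and aq: "a \<otimes>\<^bsub>A\<^esub> q = \<zero>\<^bsub>A\<^esub>"
    have "P v * emb A a = 0" "emb A a * P v = 0"
      using jA.hom_mult[OF qA a] jA.hom_mult[OF a qA] by (simp_all add: qa aq jq jzero)
    hence ka: "k * emb A a * k = emb A a" by (simp add: k_def algebra_simps)
    \<comment> \<open>An element \<open>a = kak\<close> is approximated by \<open>kck\<close> with \<open>c\<close> a polynomial in the generators.\<close>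
    have "\<exists>b\<in>carrier B. \<Gamma> b = emb A a"
    proof (rule isometry_image_closed[OF cB \<Gamma> norm_\<Gamma>])
      fix \<epsilon> :: real assume "\<epsilon> > 0"
      then obtain c where c: "c \<in> carrier F\<Lambda>" "nrm A (a \<ominus>\<^bsub>A\<^esub> FL.toC c) < \<epsilon>"
        using FL.toC_dense[unfolded cFL, OF a] by blast
      have tc: "FL.toC c \<in> carrier A" by (rule tL.hom_closed[OF c(1)])
      obtain b where b: "b \<in> carrier B" "\<Gamma> b = k * jl c * k"
        using good_jl[OF c(1)] unfolding good_def IM_def by force
      have d: "norm (emb A a - jl c) < \<epsilon>"
        using c norm_emb[OF cA, of "a \<ominus>\<^bsub>A\<^esub> FL.toC c"] a tc star_hom_diff[OF jA A.star_algebra_axioms star_algebra_cls a tc]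
        by (simp add: jl_def)
      have "emb A a - \<Gamma> b = k * (emb A a - jl c) * k"
        unfolding b right_diff_distrib left_diff_distrib ka ..
      hence "norm (emb A a - \<Gamma> b) \<le> norm k * norm (emb A a - jl c) * norm k"
        using order_trans[OF norm_mult_ineq[of "k * (emb A a - jl c)" k]
            mult_right_mono[OF norm_mult_ineq[of k "emb A a - jl c"] norm_ge_zero]] by simp
      also have "\<dots> \<le> 1 * norm (emb A a - jl c) * 1"
        by (intro mult_mono norm_k) auto
      finally show "\<exists>b\<in>carrier B. norm (emb A a - \<Gamma> b) < \<epsilon>" using b d by (intro bexI[of _ b]) auto
    qed
    then obtain b where b: "b \<in> carrier B" "\<Gamma> b = emb A a" by blast
    hence "\<psi> b = a" by (intro eqA) (simp_all add: \<Gamma>_def \<psi>.hom_closed a)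
    thus "a \<in> \<psi> ` carrier B" using b by blast
  qed
qed

end

theorem theorem6p6:
  fixes \<Lambda> :: "('a, 'k::finite) kgraph" and v f :: 'a
  assumes "k_graph \<Lambda>" and "row_finite \<Lambda>" and "source_free \<Lambda>"
    and "v \<in> verts_of \<Lambda>"
    and "complete_edge \<Lambda> (edges_from \<Lambda> v)" and "complete_edge \<Lambda> (edges_into \<Lambda> v)"
    and "v \<noteq> common_rng \<Lambda> (edges_from \<Lambda> v)"
    and "f \<in> edges_from \<Lambda> v"
  shows "morita_equivalent (ck_algebra \<Lambda>) (ck_algebra (reduction \<Lambda> v f))"
proof -
  interpret reducible \<Lambda> v f
    by (rule reducible.intro, rule assms(1), rule reducible_axioms.intro) (rule assms)+
  show ?thesis by (rule morita)
qed

end
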